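(* Let $(F,B,V,\langle\ ,\ \rangle,*,\mathcal{O}_B,\{\mu\},\mathcal{L})$ be a local PEL datum over $\mathbb{Q}_p$ with reflex field $E$, and let $2n=\dim_{\mathbb{Q}_p}V$. Let $R$ be an $\mathcal{O}_E$-algebra and let $(\mathcal{F}_\Lambda\subset\Lambda\otimes_{\mathbb{Z}_p}R)_{\Lambda\in\mathcal{L}}$ be a family satisfying conditions (1)–(3) in the definition of the naive local model, with each $\mathcal{F}_\Lambda$ of rank $n$ over $R$. If the family satisfies condition $(\mathrm{K}_n)$, then it satisfies the Kottwitz condition: for all $\Lambda\in\mathcal{L}$ there is an equality of polynomial functions over $R$ $$\det(b\mid\mathcal{F}_\Lambda)=\det(b\mid V_1),\qquad b\in\mathcal{O}_B.$$
   Context: Local PEL datum. For a $\mathbb{Q}_p$-algebra $R'$ write $V_{R'}=V\otimes_{\mathbb{Q}_p}R'$. $F$ is a finite product of finite field extensions of $\mathbb{Q}_p$; $B$ is a finite semisimple $\mathbb{Q}_p$-algebra with center $F$; $V$ is a finite-dimensional left $B$-module; $\langle\ ,\ \rangle$ is a nondegenerate alternating $\mathbb{Q}_p$-bilinear form on $V$; $b\mapsto b^*$ is an involution of $B$ with $\langle bv,w\rangle=\langle v,b^*w\rangle$; $\mathcal{O}_B$ is a $*$-invariant maximal order of $B$; $G$ is the algebraic group over $\mathbb{Q}_p$ with $G(R')=\{g\in GL_B(V_{R'}):\exists\,c(g)\in R'^\times,\ \langle gv,gw\rangle=c(g)\langle v,w\rangle\ \forall v,w\}$; $\{\mu\}$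 is a geometric conjugacy class of cocharacters of $G$ such that for a representative $\mu$ the weights on $V_{\overline{\mathbb{Q}}_p}$ are $0$ and $1$ and $c\circ\mu=\mathrm{id}_{\mathbb{G}_m}$; $\mathcal{L}$ is a self-dual multichain of $\mathcal{O}_B$-lattices in $V$ in the sense of Rapoport–Zink (writing $B=\prod B_i$ with $B_i$ simple and $V=\prod V_i$ correspondingly, there are chains $\mathcal{L}_i$ of $\mathcal{O}_{B_i}$-lattices in $V_i$, i.e. nonempty sets of lattices totally ordered by inclusion and stable under every $b\in B_i^\times$ normalizing $\mathcal{O}_{B_i}$, such that $\mathcal{L}$ consists of the $\prod\Lambda_i$ with $\Lambda_i\in\mathcal{L}_i$; self-dual means that the dual $\widehat\Lambda$ of every $\Lambda\in\mathcal{L}$ with respect to $\langle\ ,\ \rangle$ is in $\mathcal{L}$). Let $V_{\overline{\mathbb{Q}}_p}=V_1\oplus V_0$ be the weight decomposition for a representative $\mu$; $V_1$ and $V_0$ are totally isotropic of dimension $n$. The reflex field $E$ is the field of definition of $\{\mu\}$, equivalently $E=\mathbb{Q}_p(\operatorname{tr}(b\mid V_1):b\in B)$. Naive local model. Points over an $\mathcal{O}_E$-algebra $R$ are functors $\Lambda\mapsto\mathcal{F}_\Lambda$ from $\mathcal{L}$ (with inclusions as morphisms) to $\mathcal{O}_B\otimes_{\mathbb{Z}_p}R$-modules, with a natural transformation $\mathcal{F}_\Lambda\to\Lambda\otimes_{\mathbb{Z}_p}R$, such that: (1) $\mathcal{F}_\Lambda$ is a submodule of $\Lambda\otimes R$ that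 is an $R$-direct summand, and the map is the inclusion (so in particular $\Lambda\otimes R\to\Lambda'\otimes R$ carries $\mathcal{F}_\Lambda$ into $\mathcal{F}_{\Lambda'}$ for $\Lambda\subset\Lambda'$); (2) for $b\in B$ normalizing $\mathcal{O}_B$ (invertible), the isomorphism $(\Lambda\otimes R)^b\xrightarrow{b}b\Lambda\otimes R$ identifies $(\mathcal{F}_\Lambda)^b$ with $\mathcal{F}_{b\Lambda}$, where $N^b$ denotes $N$ with $\mathcal{O}_B$-action $x\cdot n=b^{-1}xb\,n$; (3) $\mathcal{F}_\Lambda$ and $\mathcal{F}_{\widehat\Lambda}$ pair to $0$ under the perfect pairing $(\Lambda\otimes R)\times(\widehat\Lambda\otimes R)\to R$; (4) the Kottwitz condition displayed in the claim. Equality of polynomial functions means: for a $\mathbb{Z}_p$-basis $b_1,\dots,b_t$ of $\mathcal{O}_B$, $\det(\sum X_ib_i\mid\mathcal{F}_\Lambda)\in R[X_1,\dots,X_t]$ is the image of $\det(\sum X_ib_i\mid V_1)\in\mathcal{O}_E[X_1,\dots,X_t]$. Condition $(\mathrm{K}_n)$. For $b\in\mathcal{O}_B$ write the characteristic polynomial of $b$ on $V_1$ as $\prod_{i=1}^d(T-\alpha_i)^{m_i}$ with distinct $\alpha_i\in\overline{\mathbb{Q}}_p$, $m_1+\dots+m_d=n$. Let $V_{\overline{\mathbb{Q}}_p,\alpha_i}$ be the generalized $\alpha_i$-eigenspace of $b$ on $V_{\overline{\mathbb{Q}}_p}$, and put ${}^nW_{b,\overline{\mathbb{Q}}_p}=\bigwedge^{m_1}V_{\overline{\mathbb{Q}}_p,\alpha_1}\otimes\dots\otimes\bigwedge^{m_d}V_{\overline{\mathbb{Q}}_p,\alpha_d}\subset\bigwedge^n_{\overline{\mathbb{Q}}_p}V_{\overline{\mathbb{Q}}_p}$;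 it is defined over $E$, with descent ${}^nW_b\subset\bigwedge^n_EV_E$. Put ${}^nW=\bigcap_{b\in\mathcal{O}_B}{}^nW_b$ and, for $\Lambda\in\mathcal{L}$, ${}^nW(\Lambda)={}^nW\cap\bigwedge^n_{\mathcal{O}_E}(\Lambda\otimes_{\mathbb{Z}_p}\mathcal{O}_E)$. Condition $(\mathrm{K}_n)$: for all $\Lambda\in\mathcal{L}$, $\bigwedge^n_R\mathcal{F}_\Lambda\subset\bigwedge^n_R(\Lambda\otimes_{\mathbb{Z}_p}R)$ is contained in $\operatorname{im}[{}^nW(\Lambda)\otimes_{\mathcal{O}_E}R\to\bigwedge^n_R(\Lambda\otimes_{\mathbb{Z}_p}R)]$. *)

theory Defs
  imports
    "HOL-Algebra.Algebraic_Closure_Type"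
    "HOL-Algebra.Generated_Fields"
    "HOL-Algebra.Bij"
    "HOL-Library.Poly_Mapping"
    "Jordan_Normal_Form.Char_Poly"
    "Jordan_Normal_Form.Missing_VectorSpace"
begin

text \<open>
  Coefficient rings are types (with possibly a subring of the type as carrier); modules and
  non-commutative algebras are records with explicit carrier.  The fields \<^const>\<open>monoid.mult\<close> and
  \<^const>\<open>monoid.one\<close> of a module record are junk unless the record is used as an algebra.
\<close>

abbreviation tring :: "'a::comm_ring_1 ring"
  where "tring \<equiv> ring_of_type_algebra"

abbreviation subtring :: "'a::comm_ring_1 set \<Rightarrow> 'a ring"
  where "subtring S \<equiv> tring\<lparr>carrier := S\<rparr>"

abbreviation restr :: "('a, 'm) module \<Rightarrow> 'm set \<Rightarrow> ('a, 'm) module"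
  where "restr M N \<equiv> M\<lparr>carrier := N\<rparr>"

abbreviation mspan :: "'a ring \<Rightarrow> ('a, 'm) module \<Rightarrow> 'm set \<Rightarrow> 'm set"
  where "mspan \<equiv> LinearCombinations.module.span"


section \<open>Base change and exterior powers\<close>

definition free_module :: "'s::comm_ring_1 ring \<Rightarrow> 'x set \<Rightarrow> ('s, 'x \<Rightarrow>\<^sub>0 's) module" where
  "free_module S Z =
    \<lparr>carrier = {f. Poly_Mapping.keys f \<subseteq> Z \<and> range (Poly_Mapping.lookup f) \<subseteq> carrier S},
     monoid.mult = undefined, one = undefined, zero = 0, add = (+),
     module.smult = (\<lambda>a. Poly_Mapping.map ((*) a))\<rparr>"

definition quot_module :: "('s, 'm) module \<Rightarrow> 'm set \<Rightarrow> ('s, 'm set) module" where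
  "quot_module M N =
    \<lparr>carrier = a_rcosets\<^bsub>M\<^esub> N,
     monoid.mult = undefined, one = undefined, zero = N, add = set_add M,
     module.smult = (\<lambda>a Z. \<Union>x\<in>Z. N +>\<^bsub>M\<^esub> (a \<odot>\<^bsub>M\<^esub> x))\<rparr>"

text \<open>\<open>free_map f \<theta>\<close> sends \<open>\<Sum> s\<^sub>k [k]\<close> to \<open>\<Sum> \<theta>(s\<^sub>k) [f k]\<close>;
  \<open>quot_map M' N' g\<close> is the map induced by \<open>g\<close> with values in the quotient of \<open>M'\<close> by \<open>N'\<close>.\<close>

definition free_map :: "('x \<Rightarrow> 'y) \<Rightarrow> ('s::comm_ring_1 \<Rightarrow> 't::comm_ring_1) \<Rightarrow> ('x \<Rightarrow>\<^sub>0 's) \<Rightarrow> ('y \<Rightarrow>\<^sub>0 't)" where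
  "free_map f \<theta> x = (\<Sum>k\<in>Poly_Mapping.keys x. Poly_Mapping.single (f k) (\<theta> (Poly_Mapping.lookup x k)))"

definition quot_map :: "('t, 'n) module \<Rightarrow> 'n set \<Rightarrow> ('m \<Rightarrow> 'n) \<Rightarrow> 'm set \<Rightarrow> 'n set" where
  "quot_map M' N' g Z = (\<Union>x\<in>Z. N' +>\<^bsub>M'\<^esub> g x)"

text \<open>The tensor product \<open>M \<otimes>\<^sub>A S\<close> along \<open>\<phi> : A \<rightarrow> S\<close>, as the \<open>S\<close>-module generated by symbols
  \<open>[m] = m \<otimes> 1\<close> subject to additivity and \<open>[a m] = \<phi>(a) [m]\<close>.  The pure tensor \<open>m \<otimes> s\<close> is the
  class of \<open>s [m]\<close>.\<close>

definition bc_rel :: "'a ring \<Rightarrow> ('a, 'm) module \<Rightarrow> 's::comm_ring_1 ring \<Rightarrow> ('a \<Rightarrow> 's) \<Rightarrow> ('m \<Rightarrow>\<^sub>0 's) set" where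
  "bc_rel A M S \<phi> = mspan S (free_module S (carrier M))
    ({Poly_Mapping.single (x \<oplus>\<^bsub>M\<^esub> y) 1 - Poly_Mapping.single x 1 - Poly_Mapping.single y 1 | x y.
        x \<in> carrier M \<and> y \<in> carrier M} \<union>
     {Poly_Mapping.single (a \<odot>\<^bsub>M\<^esub> x) 1 - Poly_Mapping.single x (\<phi> a) | a x.
        a \<in> carrier A \<and> x \<in> carrier M})"

definition base_change ::
    "'a ring \<Rightarrow> ('a, 'm) module \<Rightarrow> 's::comm_ring_1 ring \<Rightarrow> ('a \<Rightarrow> 's) \<Rightarrow> ('s, ('m \<Rightarrow>\<^sub>0 's) set) module" where
  "base_change A M S \<phi> = quot_module (free_module S (carrier M)) (bc_rel A M S \<phi>)"

text \<open>The map \<open>m \<otimes> s \<mapsto> f m \<otimes> \<theta> s\<close> with target \<open>M' \<otimes>\<^bsub>A'\<^esub> S'\<close>.\<close>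

definition bc_map ::
    "'a ring \<Rightarrow> ('a, 'n) module \<Rightarrow> 't::comm_ring_1 ring \<Rightarrow> ('a \<Rightarrow> 't) \<Rightarrow> ('m \<Rightarrow> 'n) \<Rightarrow> ('s::comm_ring_1 \<Rightarrow> 't) \<Rightarrow>
     ('m \<Rightarrow>\<^sub>0 's) set \<Rightarrow> ('n \<Rightarrow>\<^sub>0 't) set" where
  "bc_map A' M' S' \<phi>' f \<theta> =
    quot_map (free_module S' (carrier M')) (bc_rel A' M' S' \<phi>') (free_map f \<theta>)"

text \<open>The form \<open>(m \<otimes> s, m' \<otimes> s') \<mapsto> s s' \<phi>(h m m')\<close>; the value is independent of the
  representatives chosen.\<close>

definition bc_form :: "('m \<Rightarrow> 'n \<Rightarrow> 'a) \<Rightarrow> ('a \<Rightarrow> 's::comm_ring_1) \<Rightarrow> ('m \<Rightarrow>\<^sub>0 's) set \<Rightarrow> ('n \<Rightarrow>\<^sub>0 's) set \<Rightarrow> 's" where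
  "bc_form h \<phi> Z Y = (let x = (SOME x. x \<in> Z); y = (SOME y. y \<in> Y) in
    (\<Sum>m\<in>Poly_Mapping.keys x. \<Sum>m'\<in>Poly_Mapping.keys y.
      Poly_Mapping.lookup x m * Poly_Mapping.lookup y m' * \<phi> (h m m')))"

definition tuples :: "('a, 'm) module \<Rightarrow> nat \<Rightarrow> 'm list set" where
  "tuples M k = {xs. length xs = k \<and> set xs \<subseteq> carrier M}"

text \<open>The exterior power, generated by symbols \<open>[x\<^sub>1, \<dots>, x\<^sub>k]\<close> subject to multilinearity and
  to the vanishing of symbols with a repeated entry.\<close>

definition ext_rel :: "'s::comm_ring_1 ring \<Rightarrow> ('s, 'm) module \<Rightarrow> nat \<Rightarrow> ('m list \<Rightarrow>\<^sub>0 's) set" where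
  "ext_rel S M k = mspan S (free_module S (tuples M k))
    ({Poly_Mapping.single (xs[i := x \<oplus>\<^bsub>M\<^esub> y]) 1 - Poly_Mapping.single (xs[i := x]) 1
        - Poly_Mapping.single (xs[i := y]) 1 | xs i x y.
        xs \<in> tuples M k \<and> i < k \<and> x \<in> carrier M \<and> y \<in> carrier M} \<union>
     {Poly_Mapping.single (xs[i := a \<odot>\<^bsub>M\<^esub> x]) 1 - Poly_Mapping.single (xs[i := x]) a | xs i a x.
        xs \<in> tuples M k \<and> i < k \<and> a \<in> carrier S \<and> x \<in> carrier M} \<union>
     {Poly_Mapping.single xs 1 | xs. xs \<in> tuples M k \<and> \<not> distinct xs})"

definition exterior_power ::
    "'s::comm_ring_1 ring \<Rightarrow> ('s, 'm) module \<Rightarrow> nat \<Rightarrow> ('s, ('m list \<Rightarrow>\<^sub>0 's) set) module" where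
  "exterior_power S M k = quot_module (free_module S (tuples M k)) (ext_rel S M k)"

definition wedge :: "'s::comm_ring_1 ring \<Rightarrow> ('s, 'm) module \<Rightarrow> 'm list \<Rightarrow> ('m list \<Rightarrow>\<^sub>0 's) set" where
  "wedge S M xs =
    ext_rel S M (length xs) +>\<^bsub>free_module S (tuples M (length xs))\<^esub> Poly_Mapping.single xs 1"

text \<open>For \<open>f\<close> semilinear over \<open>\<theta>\<close>: the map \<open>x\<^sub>1 \<and> \<dots> \<and> x\<^sub>k \<mapsto> f x\<^sub>1 \<and> \<dots> \<and> f x\<^sub>k\<close> with target the
  exterior power of \<open>M'\<close> over \<open>S'\<close>.\<close>

definition ext_map ::
    "'t::comm_ring_1 ring \<Rightarrow> ('t, 'n) module \<Rightarrow> nat \<Rightarrow> ('m \<Rightarrow> 'n) \<Rightarrow> ('s::comm_ring_1 \<Rightarrow> 't) \<Rightarrow>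
     ('m list \<Rightarrow>\<^sub>0 's) set \<Rightarrow> ('n list \<Rightarrow>\<^sub>0 't) set" where
  "ext_map S' M' k f \<theta> =
    quot_map (free_module S' (tuples M' k)) (ext_rel S' M' k) (free_map (map f) \<theta>)"


section \<open>Bases, determinants, ranks\<close>

definition has_coords :: "'a ring \<Rightarrow> ('a, 'm) module \<Rightarrow> 'm list \<Rightarrow> 'm \<Rightarrow> (nat \<Rightarrow> 'a) \<Rightarrow> bool" where
  "has_coords A M es x c \<longleftrightarrow>
    c \<in> {..<length es} \<rightarrow>\<^sub>E carrier A \<and> x = (\<Oplus>\<^bsub>M\<^esub>i\<in>{..<length es}. c i \<odot>\<^bsub>M\<^esub> (es ! i))"

definition free_basis :: "'a ring \<Rightarrow> ('a, 'm) module \<Rightarrow> 'm list \<Rightarrow> bool" where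
  "free_basis A M es \<longleftrightarrow> set es \<subseteq> carrier M \<and> (\<forall>x\<in>carrier M. \<exists>!c. has_coords A M es x c)"

definition chosen_basis :: "'a ring \<Rightarrow> ('a, 'm) module \<Rightarrow> 'm list" where
  "chosen_basis A M = (SOME es. free_basis A M es)"

definition end_mat :: "'a ring \<Rightarrow> ('a, 'm) module \<Rightarrow> ('m \<Rightarrow> 'm) \<Rightarrow> 'a mat" where
  "end_mat A M f = (let es = chosen_basis A M; m = length es in
    mat m m (\<lambda>(i, j). (THE c. has_coords A M es (f (es ! j)) c) i))"

definition end_trace :: "'a::comm_ring_1 ring \<Rightarrow> ('a, 'm) module \<Rightarrow> ('m \<Rightarrow> 'm) \<Rightarrow> 'a" where
  "end_trace A M f = (\<Sum>i<dim_row (end_mat A M f). end_mat A M f $$ (i, i))"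

text \<open>The polynomial \<open>det (g + X\<^sub>0 f\<^sub>0 + X\<^sub>1 f\<^sub>1 + \<dots> | M)\<close> for endomorphisms of a free module of
  finite rank.  Polynomials in the \<open>X\<^sub>k\<close> are finitely supported functions on exponent vectors.\<close>

definition det_pencil ::
    "'a::comm_ring_1 ring \<Rightarrow> ('a, 'm) module \<Rightarrow> ('m \<Rightarrow> 'm) \<Rightarrow> ('m \<Rightarrow> 'm) list \<Rightarrow> ((nat \<Rightarrow>\<^sub>0 nat) \<Rightarrow>\<^sub>0 'a)" where
  "det_pencil A M g fs = (let m = length (chosen_basis A M) in
    det (mat m m (\<lambda>(i, j).
      Poly_Mapping.single 0 (end_mat A M g $$ (i, j)) +
      (\<Sum>k<length fs. Poly_Mapping.single (Poly_Mapping.single k 1) (end_mat A M (fs ! k) $$ (i, j))))))"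

definition free_det_poly ::
    "'a::comm_ring_1 ring \<Rightarrow> ('a, 'm) module \<Rightarrow> ('m \<Rightarrow> 'm) list \<Rightarrow> ((nat \<Rightarrow>\<^sub>0 nat) \<Rightarrow>\<^sub>0 'a)" where
  "free_det_poly A M fs = det_pencil A M (\<lambda>_. \<zero>\<^bsub>M\<^esub>) fs"

definition complementary :: "'a ring \<Rightarrow> ('a, 'm) module \<Rightarrow> 'm set \<Rightarrow> 'm set \<Rightarrow> bool" where
  "complementary A M P C \<longleftrightarrow> Module.submodule P A M \<and> Module.submodule C A M \<and>
    (\<forall>x\<in>carrier M. \<exists>!(y, z). y \<in> P \<and> z \<in> C \<and> x = y \<oplus>\<^bsub>M\<^esub> z)"

definition direct_summand :: "'a ring \<Rightarrow> ('a, 'm) module \<Rightarrow> 'm set \<Rightarrow> bool" where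
  "direct_summand A M P \<longleftrightarrow> (\<exists>C. complementary A M P C)"

definition proj_along :: "('a, 'm) module \<Rightarrow> 'm set \<Rightarrow> 'm set \<Rightarrow> 'm \<Rightarrow> 'm" where
  "proj_along M P C x = (THE y. y \<in> P \<and> (\<exists>z\<in>C. x = y \<oplus>\<^bsub>M\<^esub> z))"

text \<open>A direct summand \<open>P\<close> of a free module \<open>M\<close> need not be free.  As usual for finitely
  generated projective modules, the determinant of an endomorphism \<open>f\<close> of \<open>P\<close> is that of
  \<open>f \<oplus> id\<close> on \<open>M = P \<oplus> C\<close>, which does not depend on \<open>C\<close>; here for \<open>f = \<Sum> X\<^sub>k f\<^sub>k\<close>.\<close>

definition summand_det_poly ::
    "'a::comm_ring_1 ring \<Rightarrow> ('a, 'm) module \<Rightarrow> 'm set \<Rightarrow> ('m \<Rightarrow> 'm) list \<Rightarrow> ((nat \<Rightarrow>\<^sub>0 nat) \<Rightarrow>\<^sub>0 'a)" where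
  "summand_det_poly A M P fs = (let C = (SOME C. complementary A M P C); \<pi> = proj_along M P C in
    det_pencil A M (\<lambda>x. x \<ominus>\<^bsub>M\<^esub> \<pi> x) (map (\<lambda>f. f \<circ> \<pi>) fs))"

text \<open>For a direct summand \<open>P\<close> of a finite free module: for every prime \<open>\<pp>\<close> there are
  \<open>x\<^sub>1, \<dots>, x\<^sub>n \<in> P\<close> whose images form a basis of the localization of \<open>P\<close> at \<open>\<pp>\<close>.\<close>

definition has_rank :: "('a::comm_ring_1, 'm) module \<Rightarrow> 'm set \<Rightarrow> nat \<Rightarrow> bool" where
  "has_rank M P n \<longleftrightarrow> (\<forall>\<pp>. primeideal \<pp> (tring :: 'a ring) \<longrightarrow>
    (\<exists>xs. length xs = n \<and> set xs \<subseteq> P \<and>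
      (\<forall>y\<in>P. \<exists>s. s \<notin> \<pp> \<and> s \<odot>\<^bsub>M\<^esub> y \<in> mspan tring M (set xs)) \<and>
      (\<forall>c. (\<Oplus>\<^bsub>M\<^esub>i\<in>{..<n}. c i \<odot>\<^bsub>M\<^esub> (xs ! i)) = \<zero>\<^bsub>M\<^esub> \<longrightarrow> (\<exists>s. s \<notin> \<pp> \<and> (\<forall>i<n. s * c i = 0)))))"


section \<open>The field of p-adic numbers, lattices, orders\<close>

text \<open>The completion of the rational numbers with respect to the p-adic absolute value.  A
  multiplicative ultrametric norm with the given value at \<open>p\<close> restricts to the p-adic absolute
  value on the rationals.\<close>

definition padic_field :: "nat \<Rightarrow> ('q::field_char_0 \<Rightarrow> real) \<Rightarrow> bool" where
  "padic_field p nrm \<longleftrightarrow> Factorial_Ring.prime p \<and>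
    (\<forall>x. 0 \<le> nrm x) \<and> (\<forall>x. nrm x = 0 \<longleftrightarrow> x = 0) \<and>
    (\<forall>x y. nrm (x * y) = nrm x * nrm y) \<and>
    (\<forall>x y. nrm (x + y) \<le> max (nrm x) (nrm y)) \<and>
    nrm (of_nat p) = 1 / real p \<and>
    (\<forall>x. \<forall>\<epsilon>>0. \<exists>r. nrm (x - of_rat r) < \<epsilon>) \<and>
    (\<forall>s :: nat \<Rightarrow> 'q. (\<forall>\<epsilon>>0. \<exists>N. \<forall>i\<ge>N. \<forall>j\<ge>N. nrm (s i - s j) < \<epsilon>) \<longrightarrow>
      (\<exists>l. \<forall>\<epsilon>>0. \<exists>N. \<forall>i\<ge>N. nrm (s i - l) < \<epsilon>))"

definition Zp :: "('q::field_char_0 \<Rightarrow> real) \<Rightarrow> 'q set" where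
  "Zp nrm = {x. nrm x \<le> 1}"

text \<open>The integral closure of \<open>\<int>\<^sub>p\<close> in a subfield of the algebraic closure of \<open>\<rat>\<^sub>p\<close>.\<close>

definition integers_of :: "('q::field_char_0 \<Rightarrow> real) \<Rightarrow> 'q alg_closure set \<Rightarrow> 'q alg_closure set" where
  "integers_of nrm K = {x \<in> K. \<exists>f :: 'q Polynomial.poly.
    Polynomial.lead_coeff f = 1 \<and> (\<forall>i. Polynomial.coeff f i \<in> Zp nrm) \<and>
    Polynomial.poly (Polynomial.map_poly to_ac f) x = 0}"

text \<open>\<open>L\<close> is a \<open>\<int>\<^sub>p\<close>-lattice in the \<open>\<rat>\<^sub>p\<close>-subspace \<open>W\<close> of \<open>M\<close>.\<close>

definition is_lattice :: "('q::field_char_0 \<Rightarrow> real) \<Rightarrow> ('q, 'm) module \<Rightarrow> 'm set \<Rightarrow> 'm set \<Rightarrow> bool" where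
  "is_lattice nrm M W L \<longleftrightarrow>
    (\<exists>Z. finite Z \<and> Z \<subseteq> W \<and> L = mspan (subtring (Zp nrm)) M Z) \<and> mspan tring M L = W"

definition is_order :: "('q::field_char_0 \<Rightarrow> real) \<Rightarrow> ('q, 'b) module \<Rightarrow> 'b set \<Rightarrow> bool" where
  "is_order nrm B O' \<longleftrightarrow> subring O' B \<and> is_lattice nrm B (carrier B) O'"

definition is_maximal_order :: "('q::field_char_0 \<Rightarrow> real) \<Rightarrow> ('q, 'b) module \<Rightarrow> 'b set \<Rightarrow> bool" where
  "is_maximal_order nrm B O' \<longleftrightarrow> is_order nrm B O' \<and> (\<forall>O''. is_order nrm B O'' \<and> O' \<subseteq> O'' \<longrightarrow> O'' = O')"


section \<open>Semisimple algebras\<close>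

definition left_ideal :: "('b, 'c) ring_scheme \<Rightarrow> 'b set \<Rightarrow> bool" where
  "left_ideal B I \<longleftrightarrow> additive_subgroup I B \<and> (\<forall>x\<in>carrier B. \<forall>y\<in>I. x \<otimes>\<^bsub>B\<^esub> y \<in> I)"

definition semisimple_ring :: "('b, 'c) ring_scheme \<Rightarrow> bool" where
  "semisimple_ring B \<longleftrightarrow> (\<forall>I. left_ideal B I \<longrightarrow>
    (\<exists>J. left_ideal B J \<and> I \<inter> J = {\<zero>\<^bsub>B\<^esub>} \<and> set_add B I J = carrier B))"

definition center :: "('b, 'c) ring_scheme \<Rightarrow> 'b set" where
  "center B = {x \<in> carrier B. \<forall>y\<in>carrier B. x \<otimes>\<^bsub>B\<^esub> y = y \<otimes>\<^bsub>B\<^esub> x}"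

text \<open>An internal decomposition of \<open>F\<close> as a finite product of fields, given by orthogonal
  idempotents.\<close>

definition finite_product_of_fields :: "('b, 'c) ring_scheme \<Rightarrow> bool" where
  "finite_product_of_fields F \<longleftrightarrow> (\<exists>I. finite I \<and> I \<subseteq> carrier F \<and>
    (\<forall>e\<in>I. \<forall>f\<in>I. e \<otimes>\<^bsub>F\<^esub> f = (if e = f then e else \<zero>\<^bsub>F\<^esub>)) \<and>
    (\<Oplus>\<^bsub>F\<^esub>e\<in>I. e) = \<one>\<^bsub>F\<^esub> \<and>
    (\<forall>e\<in>I. field (F\<lparr>carrier := (\<lambda>x. e \<otimes>\<^bsub>F\<^esub> x) ` carrier F, one := e\<rparr>)))"

text \<open>The central idempotents \<open>e\<close> for which \<open>e B\<close> is simple; the \<open>e B\<close> are the simple factors of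
  a semisimple \<open>B\<close>.  Two-sided ideals of the ring \<open>e B\<close> are the two-sided ideals of \<open>B\<close> contained
  in it.\<close>

definition simple_factors :: "('b, 'c) ring_scheme \<Rightarrow> 'b set" where
  "simple_factors B = {e \<in> center B. e \<otimes>\<^bsub>B\<^esub> e = e \<and> e \<noteq> \<zero>\<^bsub>B\<^esub> \<and>
    (\<forall>I. ideal I B \<and> I \<subseteq> (\<lambda>x. e \<otimes>\<^bsub>B\<^esub> x) ` carrier B \<longrightarrow>
      I = {\<zero>\<^bsub>B\<^esub>} \<or> I = (\<lambda>x. e \<otimes>\<^bsub>B\<^esub> x) ` carrier B)}"


section \<open>Local PEL data\<close>

text \<open>\<open>cochars\<close> is the conjugacy class of cocharacters, each of them a function on
  the nonzero elements of the algebraic closure of \<open>\<rat>\<^sub>p\<close>.\<close>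

record (overloaded) ('q, 'b, 'v) pel_datum =
  cent :: "'b set"
  alg :: "('q, 'b) module"
  space :: "('q, 'v) module"
  act :: "'b \<Rightarrow> 'v \<Rightarrow> 'v"
  form :: "'v \<Rightarrow> 'v \<Rightarrow> 'q"
  invol :: "'b \<Rightarrow> 'b"
  max_order :: "'b set"
  cochars :: "('q alg_closure \<Rightarrow> ('v \<Rightarrow>\<^sub>0 'q alg_closure) set \<Rightarrow> ('v \<Rightarrow>\<^sub>0 'q alg_closure) set) set"
  chain :: "'v set set"

type_synonym ('q, 'v) vbar = "('v \<Rightarrow>\<^sub>0 'q alg_closure) set"

abbreviation space_over ::
    "('q::field_char_0, 'b, 'v) pel_datum \<Rightarrow> 's::comm_ring_1 ring \<Rightarrow> ('q \<Rightarrow> 's) \<Rightarrow> ('s, ('v \<Rightarrow>\<^sub>0 's) set) module" where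
  "space_over D S \<phi> \<equiv> base_change tring (space D) S \<phi>"

abbreviation act_over ::
    "('q::field_char_0, 'b, 'v) pel_datum \<Rightarrow> 's::comm_ring_1 ring \<Rightarrow> ('q \<Rightarrow> 's) \<Rightarrow> 'b \<Rightarrow> ('v \<Rightarrow>\<^sub>0 's) set \<Rightarrow> ('v \<Rightarrow>\<^sub>0 's) set" where
  "act_over D S \<phi> b \<equiv> bc_map tring (space D) S \<phi> (act D b) id"

abbreviation Vbar :: "('q::field_char_0, 'b, 'v) pel_datum \<Rightarrow> ('q alg_closure, ('q, 'v) vbar) module" where
  "Vbar D \<equiv> space_over D tring to_ac"

definition is_similitude ::
    "('q::field_char_0, 'b, 'v) pel_datum \<Rightarrow> ('q \<Rightarrow> 's::comm_ring_1) \<Rightarrow>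
     (('v \<Rightarrow>\<^sub>0 's) set \<Rightarrow> ('v \<Rightarrow>\<^sub>0 's) set) \<Rightarrow> 's \<Rightarrow> bool" where
  "is_similitude D \<phi> g c \<longleftrightarrow>
    g \<in> Bij (carrier (space_over D tring \<phi>)) \<and>
    g \<in> module_hom tring (space_over D tring \<phi>) (space_over D tring \<phi>) \<and>
    (\<forall>b\<in>carrier (alg D). \<forall>x\<in>carrier (space_over D tring \<phi>).
      g (act_over D tring \<phi> b x) = act_over D tring \<phi> b (g x)) \<and>
    c dvd 1 \<and>
    (\<forall>x\<in>carrier (space_over D tring \<phi>). \<forall>y\<in>carrier (space_over D tring \<phi>).
      bc_form (form D) \<phi> (g x) (g y) = c * bc_form (form D) \<phi> x y)"

text \<open>The points of the group \<open>G\<close> over the algebra given by \<open>\<phi> : \<rat>\<^sub>p \<rightarrow> 's\<close>.\<close>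

definition G_points ::
    "('q::field_char_0, 'b, 'v) pel_datum \<Rightarrow> ('q \<Rightarrow> 's::comm_ring_1) \<Rightarrow> (('v \<Rightarrow>\<^sub>0 's) set \<Rightarrow> ('v \<Rightarrow>\<^sub>0 's) set) set" where
  "G_points D \<phi> = {g. \<exists>c. is_similitude D \<phi> g c}"

text \<open>A homomorphism of algebraic groups from \<open>\<G>\<^sub>m\<close> to \<open>G\<close> over the algebraic closure, given on
  points; being a morphism of varieties means that matrix coefficients are Laurent polynomials.\<close>

definition cocharacter ::
    "('q::field_char_0, 'b, 'v) pel_datum \<Rightarrow> ('q alg_closure \<Rightarrow> ('q, 'v) vbar \<Rightarrow> ('q, 'v) vbar) \<Rightarrow> bool" where
  "cocharacter D \<mu> \<longleftrightarrow>
    \<mu> \<in> (- {0}) \<rightarrow>\<^sub>E G_points D to_ac \<and>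
    (\<forall>z w. z \<noteq> 0 \<longrightarrow> w \<noteq> 0 \<longrightarrow> (\<forall>x\<in>carrier (Vbar D). \<mu> (z * w) x = \<mu> z (\<mu> w x))) \<and>
    (\<forall>x\<in>carrier (Vbar D). \<exists>(N::int) u. u \<in> {-N..N} \<rightarrow> carrier (Vbar D) \<and>
      (\<forall>z. z \<noteq> 0 \<longrightarrow> \<mu> z x = (\<Oplus>\<^bsub>Vbar D\<^esub>i\<in>{-N..N}. (z powi i) \<odot>\<^bsub>Vbar D\<^esub> u i)))"

definition conj_class ::
    "('q::field_char_0, 'b, 'v) pel_datum \<Rightarrow> ('q alg_closure \<Rightarrow> ('q, 'v) vbar \<Rightarrow> ('q, 'v) vbar) \<Rightarrow>
     ('q alg_closure \<Rightarrow> ('q, 'v) vbar \<Rightarrow> ('q, 'v) vbar) set" where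
  "conj_class D \<mu> =
    (\<lambda>g. \<lambda>z\<in>- {0}. \<lambda>x\<in>carrier (Vbar D). g (\<mu> z (inv_into (carrier (Vbar D)) g x))) ` G_points D to_ac"

definition weight_space ::
    "('q::field_char_0, 'b, 'v) pel_datum \<Rightarrow> ('q alg_closure \<Rightarrow> ('q, 'v) vbar \<Rightarrow> ('q, 'v) vbar) \<Rightarrow> int \<Rightarrow> ('q, 'v) vbar set" where
  "weight_space D \<mu> i =
    {x \<in> carrier (Vbar D). \<forall>z. z \<noteq> 0 \<longrightarrow> \<mu> z x = (z powi i) \<odot>\<^bsub>Vbar D\<^esub> x}"

definition dual_lattice ::
    "('q::field_char_0 \<Rightarrow> real) \<Rightarrow> ('q, 'b, 'v) pel_datum \<Rightarrow> 'v set \<Rightarrow> 'v set" where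
  "dual_lattice nrm D \<Lambda> = {w \<in> carrier (space D). \<forall>v\<in>\<Lambda>. form D v w \<in> Zp nrm}"

text \<open>A chain of lattices in the factor \<open>e V\<close> for the order \<open>e O\<^sub>B\<close> of the simple factor \<open>e B\<close>; the
  pair \<open>b, c\<close> below consists of a unit of \<open>e B\<close> and its inverse.\<close>

definition lattice_chain ::
    "('q::field_char_0 \<Rightarrow> real) \<Rightarrow> ('q, 'b, 'v) pel_datum \<Rightarrow> 'b \<Rightarrow> 'v set set \<Rightarrow> bool" where
  "lattice_chain nrm D e C \<longleftrightarrow>
    (let B = alg D; eB = (\<lambda>x. e \<otimes>\<^bsub>B\<^esub> x) ` carrier B; eO = (\<lambda>x. e \<otimes>\<^bsub>B\<^esub> x) ` max_order D in
      C \<noteq> {} \<and>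
      (\<forall>\<Lambda>\<in>C. is_lattice nrm (space D) (act D e ` carrier (space D)) \<Lambda> \<and> (\<forall>x\<in>eO. act D x ` \<Lambda> \<subseteq> \<Lambda>)) \<and>
      (\<forall>\<Lambda>\<in>C. \<forall>\<Lambda>'\<in>C. \<Lambda> \<subseteq> \<Lambda>' \<or> \<Lambda>' \<subseteq> \<Lambda>) \<and>
      (\<forall>b\<in>eB. \<forall>c\<in>eB. b \<otimes>\<^bsub>B\<^esub> c = e \<and> c \<otimes>\<^bsub>B\<^esub> b = e \<and> (\<lambda>x. b \<otimes>\<^bsub>B\<^esub> x \<otimes>\<^bsub>B\<^esub> c) ` eO = eO \<longrightarrow>
        (\<forall>\<Lambda>\<in>C. act D b ` \<Lambda> \<in> C)))"

definition is_multichain ::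
    "('q::field_char_0 \<Rightarrow> real) \<Rightarrow> ('q, 'b, 'v) pel_datum \<Rightarrow> 'v set set \<Rightarrow> bool" where
  "is_multichain nrm D \<L> \<longleftrightarrow> (\<exists>C.
    (\<forall>e\<in>simple_factors (alg D). lattice_chain nrm D e (C e)) \<and>
    \<L> = {{(\<Oplus>\<^bsub>space D\<^esub>e\<in>simple_factors (alg D). u e) | u. \<forall>e\<in>simple_factors (alg D). u e \<in> L e} | L.
      \<forall>e\<in>simple_factors (alg D). L e \<in> C e})"

locale local_PEL_datum =
  fixes p :: nat
    and nrm :: "'q::field_char_0 \<Rightarrow> real"
    and D :: "('q, 'b, 'v) pel_datum"
  assumes padic: "padic_field p nrm"
    and B_ring: "ring (alg D)"
    and B_vectorspace: "vectorspace tring (alg D)"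
    and B_finite: "vectorspace.fin_dim tring (alg D)"
    and B_algebra: "\<And>a x y. x \<in> carrier (alg D) \<Longrightarrow> y \<in> carrier (alg D) \<Longrightarrow>
        (a \<odot>\<^bsub>alg D\<^esub> x) \<otimes>\<^bsub>alg D\<^esub> y = a \<odot>\<^bsub>alg D\<^esub> (x \<otimes>\<^bsub>alg D\<^esub> y) \<and>
        x \<otimes>\<^bsub>alg D\<^esub> (a \<odot>\<^bsub>alg D\<^esub> y) = a \<odot>\<^bsub>alg D\<^esub> (x \<otimes>\<^bsub>alg D\<^esub> y)"
    and B_semisimple: "semisimple_ring (alg D)"
    and F_center: "cent D = center (alg D)"
    and F_fields: "finite_product_of_fields ((alg D)\<lparr>carrier := cent D\<rparr>)"
    and V_vectorspace: "vectorspace tring (space D)"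
    and V_finite: "vectorspace.fin_dim tring (space D)"
    and act_hom: "\<And>b. b \<in> carrier (alg D) \<Longrightarrow> act D b \<in> module_hom tring (space D) (space D)"
    and act_add: "\<And>b c v. b \<in> carrier (alg D) \<Longrightarrow> c \<in> carrier (alg D) \<Longrightarrow> v \<in> carrier (space D) \<Longrightarrow>
        act D (b \<oplus>\<^bsub>alg D\<^esub> c) v = act D b v \<oplus>\<^bsub>space D\<^esub> act D c v"
    and act_mult: "\<And>b c v. b \<in> carrier (alg D) \<Longrightarrow> c \<in> carrier (alg D) \<Longrightarrow> v \<in> carrier (space D) \<Longrightarrow>
        act D (b \<otimes>\<^bsub>alg D\<^esub> c) v = act D b (act D c v)"
    and act_one: "\<And>v. v \<in> carrier (space D) \<Longrightarrow> act D \<one>\<^bsub>alg D\<^esub> v = v"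
    and act_smult: "\<And>a b v. b \<in> carrier (alg D) \<Longrightarrow> v \<in> carrier (space D) \<Longrightarrow>
        act D (a \<odot>\<^bsub>alg D\<^esub> b) v = a \<odot>\<^bsub>space D\<^esub> act D b v"
    and form_add_left: "\<And>u v w. u \<in> carrier (space D) \<Longrightarrow> v \<in> carrier (space D) \<Longrightarrow> w \<in> carrier (space D) \<Longrightarrow>
        form D (u \<oplus>\<^bsub>space D\<^esub> v) w = form D u w + form D v w"
    and form_add_right: "\<And>u v w. u \<in> carrier (space D) \<Longrightarrow> v \<in> carrier (space D) \<Longrightarrow> w \<in> carrier (space D) \<Longrightarrow>
        form D u (v \<oplus>\<^bsub>space D\<^esub> w) = form D u v + form D u w"
    and form_smult: "\<And>a v w. v \<in> carrier (space D) \<Longrightarrow> w \<in> carrier (space D) \<Longrightarrow>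
        form D (a \<odot>\<^bsub>space D\<^esub> v) w = a * form D v w \<and> form D v (a \<odot>\<^bsub>space D\<^esub> w) = a * form D v w"
    and form_alternating: "\<And>v. v \<in> carrier (space D) \<Longrightarrow> form D v v = 0"
    and form_nondegenerate: "\<And>v. v \<in> carrier (space D) \<Longrightarrow>
        (\<forall>w\<in>carrier (space D). form D v w = 0) \<Longrightarrow> v = \<zero>\<^bsub>space D\<^esub>"
    and invol_hom: "invol D \<in> module_hom tring (alg D) (alg D)"
    and invol_mult: "\<And>b c. b \<in> carrier (alg D) \<Longrightarrow> c \<in> carrier (alg D) \<Longrightarrow>
        invol D (b \<otimes>\<^bsub>alg D\<^esub> c) = invol D c \<otimes>\<^bsub>alg D\<^esub> invol D b"
    and invol_invol: "\<And>b. b \<in> carrier (alg D) \<Longrightarrow> invol D (invol D b) = b"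
    and form_invol: "\<And>b v w. b \<in> carrier (alg D) \<Longrightarrow> v \<in> carrier (space D) \<Longrightarrow> w \<in> carrier (space D) \<Longrightarrow>
        form D (act D b v) w = form D v (act D (invol D b) w)"
    and order_maximal: "is_maximal_order nrm (alg D) (max_order D)"
    and order_invol: "invol D ` max_order D = max_order D"
    and cochars_class: "\<exists>\<mu>. cocharacter D \<mu> \<and> cochars D = conj_class D \<mu>"
    and cochars_weights: "\<And>\<mu>. \<mu> \<in> cochars D \<Longrightarrow>
        complementary tring (Vbar D) (weight_space D \<mu> 1) (weight_space D \<mu> 0)"
    and cochars_similitude: "\<And>\<mu> z. \<mu> \<in> cochars D \<Longrightarrow> z \<noteq> 0 \<Longrightarrow> is_similitude D to_ac (\<mu> z) z"
    and chain_multichain: "is_multichain nrm D (chain D)"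
    and chain_self_dual: "\<And>\<Lambda>. \<Lambda> \<in> chain D \<Longrightarrow> dual_lattice nrm D \<Lambda> \<in> chain D"

text \<open>The weight space \<open>V\<^sub>1\<close> with its \<open>B\<close>-action, and the reflex field \<open>\<rat>\<^sub>p(tr(b | V\<^sub>1) : b \<in> B)\<close>.\<close>

abbreviation V1 ::
    "('q::field_char_0, 'b, 'v) pel_datum \<Rightarrow> ('q alg_closure \<Rightarrow> ('q, 'v) vbar \<Rightarrow> ('q, 'v) vbar) \<Rightarrow>
     ('q alg_closure, ('q, 'v) vbar) module" where
  "V1 D \<mu> \<equiv> restr (Vbar D) (weight_space D \<mu> 1)"

abbreviation actbar :: "('q::field_char_0, 'b, 'v) pel_datum \<Rightarrow> 'b \<Rightarrow> ('q, 'v) vbar \<Rightarrow> ('q, 'v) vbar" where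
  "actbar D \<equiv> act_over D tring to_ac"

definition reflex_field ::
    "('q::field_char_0, 'b, 'v) pel_datum \<Rightarrow> ('q alg_closure \<Rightarrow> ('q, 'v) vbar \<Rightarrow> ('q, 'v) vbar) \<Rightarrow> 'q alg_closure set" where
  "reflex_field D \<mu> = generate_field tring
    (range to_ac \<union> (\<lambda>b. end_trace tring (V1 D \<mu>) (actbar D b)) ` carrier (alg D))"

abbreviation OE ::
    "('q::field_char_0 \<Rightarrow> real) \<Rightarrow> ('q, 'b, 'v) pel_datum \<Rightarrow> ('q alg_closure \<Rightarrow> ('q, 'v) vbar \<Rightarrow> ('q, 'v) vbar) \<Rightarrow>
     'q alg_closure set" where
  "OE nrm D \<mu> \<equiv> integers_of nrm (reflex_field D \<mu>)"


section \<open>The naive local model\<close>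

text \<open>\<open>lat nrm D S \<phi> \<Lambda>\<close> is \<open>\<Lambda> \<otimes> S\<close> over \<open>\<int>\<^sub>p\<close>, with \<open>\<phi> : \<int>\<^sub>p \<rightarrow> S\<close>, and \<open>lat_map nrm D S \<phi> \<Lambda>' f\<close> is
  \<open>f \<otimes> 1\<close> with target \<open>\<Lambda>' \<otimes> S\<close>.\<close>

abbreviation lat ::
    "('q::field_char_0 \<Rightarrow> real) \<Rightarrow> ('q, 'b, 'v) pel_datum \<Rightarrow> 's::comm_ring_1 ring \<Rightarrow> ('q \<Rightarrow> 's) \<Rightarrow> 'v set \<Rightarrow>
     ('s, ('v \<Rightarrow>\<^sub>0 's) set) module" where
  "lat nrm D S \<phi> \<Lambda> \<equiv> base_change (subtring (Zp nrm)) (restr (space D) \<Lambda>) S \<phi>"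

abbreviation lat_map ::
    "('q::field_char_0 \<Rightarrow> real) \<Rightarrow> ('q, 'b, 'v) pel_datum \<Rightarrow> 's::comm_ring_1 ring \<Rightarrow> ('q \<Rightarrow> 's) \<Rightarrow> 'v set \<Rightarrow>
     ('v \<Rightarrow> 'v) \<Rightarrow> ('v \<Rightarrow>\<^sub>0 's) set \<Rightarrow> ('v \<Rightarrow>\<^sub>0 's) set" where
  "lat_map nrm D S \<phi> \<Lambda>' f \<equiv> bc_map (subtring (Zp nrm)) (restr (space D) \<Lambda>') S \<phi> f id"

text \<open>In the following \<open>\<phi> : \<int>\<^sub>p \<rightarrow> 'r\<close> is the structure map of the coefficient ring.\<close>

definition lm_submodules ::
    "('q::field_char_0 \<Rightarrow> real) \<Rightarrow> ('q, 'b, 'v) pel_datum \<Rightarrow> ('q \<Rightarrow> 'r::comm_ring_1) \<Rightarrow>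
     ('v set \<Rightarrow> ('v \<Rightarrow>\<^sub>0 'r) set set) \<Rightarrow> bool" where
  "lm_submodules nrm D \<phi> \<F> \<longleftrightarrow>
    (\<forall>\<Lambda>\<in>chain D. direct_summand tring (lat nrm D tring \<phi> \<Lambda>) (\<F> \<Lambda>) \<and>
      (\<forall>b\<in>max_order D. lat_map nrm D tring \<phi> \<Lambda> (act D b) ` \<F> \<Lambda> \<subseteq> \<F> \<Lambda>)) \<and>
    (\<forall>\<Lambda>\<in>chain D. \<forall>\<Lambda>'\<in>chain D. \<Lambda> \<subseteq> \<Lambda>' \<longrightarrow> lat_map nrm D tring \<phi> \<Lambda>' id ` \<F> \<Lambda> \<subseteq> \<F> \<Lambda>')"

text \<open>Twisting the \<open>O\<^sub>B\<close>-action by conjugation with \<open>b\<close> makes \<open>b \<otimes> 1 : \<Lambda> \<otimes> R \<rightarrow> b\<Lambda> \<otimes> R\<close> linear but does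
  not change the underlying submodules.\<close>

definition lm_periodic ::
    "('q::field_char_0 \<Rightarrow> real) \<Rightarrow> ('q, 'b, 'v) pel_datum \<Rightarrow> ('q \<Rightarrow> 'r::comm_ring_1) \<Rightarrow>
     ('v set \<Rightarrow> ('v \<Rightarrow>\<^sub>0 'r) set set) \<Rightarrow> bool" where
  "lm_periodic nrm D \<phi> \<F> \<longleftrightarrow>
    (\<forall>b\<in>Units (alg D).
      (\<lambda>x. b \<otimes>\<^bsub>alg D\<^esub> x \<otimes>\<^bsub>alg D\<^esub> inv\<^bsub>alg D\<^esub> b) ` max_order D = max_order D \<longrightarrow>
      (\<forall>\<Lambda>\<in>chain D. lat_map nrm D tring \<phi> (act D b ` \<Lambda>) (act D b) ` \<F> \<Lambda> = \<F> (act D b ` \<Lambda>)))"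

definition lm_isotropic ::
    "('q::field_char_0 \<Rightarrow> real) \<Rightarrow> ('q, 'b, 'v) pel_datum \<Rightarrow> ('q \<Rightarrow> 'r::comm_ring_1) \<Rightarrow>
     ('v set \<Rightarrow> ('v \<Rightarrow>\<^sub>0 'r) set set) \<Rightarrow> bool" where
  "lm_isotropic nrm D \<phi> \<F> \<longleftrightarrow>
    (\<forall>\<Lambda>\<in>chain D. \<forall>x\<in>\<F> \<Lambda>. \<forall>y\<in>\<F> (dual_lattice nrm D \<Lambda>). bc_form (form D) \<phi> x y = 0)"

definition kottwitz_condition ::
    "('q::field_char_0 \<Rightarrow> real) \<Rightarrow> ('q, 'b, 'v) pel_datum \<Rightarrow>
     ('q alg_closure \<Rightarrow> ('q, 'v) vbar \<Rightarrow> ('q, 'v) vbar) \<Rightarrow> ('q alg_closure \<Rightarrow> 'r::comm_ring_1) \<Rightarrow>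
     ('v set \<Rightarrow> ('v \<Rightarrow>\<^sub>0 'r) set set) \<Rightarrow> bool" where
  "kottwitz_condition nrm D \<mu> \<phi> \<F> \<longleftrightarrow>
    (\<forall>\<Lambda>\<in>chain D. \<forall>bs. free_basis (subtring (Zp nrm)) (restr (alg D) (max_order D)) bs \<longrightarrow>
      summand_det_poly tring (lat nrm D tring (\<phi> \<circ> to_ac) \<Lambda>) (\<F> \<Lambda>)
        (map (\<lambda>b. lat_map nrm D tring (\<phi> \<circ> to_ac) \<Lambda> (act D b)) bs) =
      Poly_Mapping.map \<phi> (free_det_poly tring (V1 D \<mu>) (map (actbar D) bs)))"


section \<open>The wedge condition\<close>

definition gen_eigenspace :: "('a, 'm) module \<Rightarrow> ('m \<Rightarrow> 'm) \<Rightarrow> 'a \<Rightarrow> 'm set" where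
  "gen_eigenspace M f \<alpha> =
    {x \<in> carrier M. \<exists>k. ((\<lambda>y. f y \<ominus>\<^bsub>M\<^esub> (\<alpha> \<odot>\<^bsub>M\<^esub> y)) ^^ k) x = \<zero>\<^bsub>M\<^esub>}"

text \<open>The list \<open>as\<close> enumerates the roots of the characteristic polynomial of \<open>b\<close> on \<open>V\<^sub>1\<close> with
  multiplicity.  Its order is irrelevant: permuting it permutes the factors of the wedges, so that
  the span is the image of the tensor product of the exterior powers of the generalized
  eigenspaces.\<close>

definition W_bar ::
    "('q::field_char_0, 'b, 'v) pel_datum \<Rightarrow> ('q alg_closure \<Rightarrow> ('q, 'v) vbar \<Rightarrow> ('q, 'v) vbar) \<Rightarrow> nat \<Rightarrow> 'b \<Rightarrow>
     (('q, 'v) vbar list \<Rightarrow>\<^sub>0 'q alg_closure) set set" where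
  "W_bar D \<mu> n b = mspan tring (exterior_power tring (Vbar D) n)
    {wedge tring (Vbar D) vs | vs as. length vs = n \<and> length as = n \<and>
      char_poly (end_mat tring (V1 D \<mu>) (actbar D b)) = (\<Prod>a\<leftarrow>as. [:- a, 1:]) \<and>
      (\<forall>i<n. vs ! i \<in> gen_eigenspace (Vbar D) (actbar D b) (as ! i))}"

text \<open>The descent to \<open>E\<close> and the intersection with the lattice are preimages under the natural
  (injective) maps from the exterior power of \<open>V \<otimes> E\<close> to that of \<open>V \<otimes> \<rat>\<^sub>p\<close>-bar and from the exterior
  power of \<open>\<Lambda> \<otimes> O\<^sub>E\<close> to that of \<open>V \<otimes> E\<close>.\<close>

definition W_E ::
    "('q::field_char_0, 'b, 'v) pel_datum \<Rightarrow> ('q alg_closure \<Rightarrow> ('q, 'v) vbar \<Rightarrow> ('q, 'v) vbar) \<Rightarrow> nat \<Rightarrow> 'b \<Rightarrow>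
     (('q, 'v) vbar list \<Rightarrow>\<^sub>0 'q alg_closure) set set" where
  "W_E D \<mu> n b = (let E = subtring (reflex_field D \<mu>) in
    {x \<in> carrier (exterior_power E (space_over D E to_ac) n).
      ext_map tring (Vbar D) n (bc_map tring (space D) tring to_ac id id) id x \<in> W_bar D \<mu> n b})"

definition W ::
    "('q::field_char_0, 'b, 'v) pel_datum \<Rightarrow> ('q alg_closure \<Rightarrow> ('q, 'v) vbar \<Rightarrow> ('q, 'v) vbar) \<Rightarrow> nat \<Rightarrow>
     (('q, 'v) vbar list \<Rightarrow>\<^sub>0 'q alg_closure) set set" where
  "W D \<mu> n = (\<Inter>b\<in>max_order D. W_E D \<mu> n b)"

definition W_lat ::
    "('q::field_char_0 \<Rightarrow> real) \<Rightarrow> ('q, 'b, 'v) pel_datum \<Rightarrow>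
     ('q alg_closure \<Rightarrow> ('q, 'v) vbar \<Rightarrow> ('q, 'v) vbar) \<Rightarrow> nat \<Rightarrow> 'v set \<Rightarrow>
     (('q, 'v) vbar list \<Rightarrow>\<^sub>0 'q alg_closure) set set" where
  "W_lat nrm D \<mu> n \<Lambda> =
    (let E = subtring (reflex_field D \<mu>); O' = subtring (OE nrm D \<mu>) in
      {x \<in> carrier (exterior_power O' (lat nrm D O' to_ac \<Lambda>) n).
        ext_map E (space_over D E to_ac) n (bc_map tring (space D) E to_ac id id) id x \<in> W D \<mu> n})"

text \<open>The image of \<open>W(\<Lambda>) \<otimes> R\<close> is the \<open>R\<close>-span of the image of \<open>W(\<Lambda>)\<close>.\<close>

definition Kn_condition ::
    "('q::field_char_0 \<Rightarrow> real) \<Rightarrow> ('q, 'b, 'v) pel_datum \<Rightarrow>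
     ('q alg_closure \<Rightarrow> ('q, 'v) vbar \<Rightarrow> ('q, 'v) vbar) \<Rightarrow> nat \<Rightarrow> ('q alg_closure \<Rightarrow> 'r::comm_ring_1) \<Rightarrow>
     ('v set \<Rightarrow> ('v \<Rightarrow>\<^sub>0 'r) set set) \<Rightarrow> bool" where
  "Kn_condition nrm D \<mu> n \<phi> \<F> \<longleftrightarrow>
    (\<forall>\<Lambda>\<in>chain D. let \<Lambda>R = lat nrm D tring (\<phi> \<circ> to_ac) \<Lambda> in
      ext_map tring \<Lambda>R n id id ` carrier (exterior_power tring (restr \<Lambda>R (\<F> \<Lambda>)) n) \<subseteq>
      mspan tring (exterior_power tring \<Lambda>R n)
        (ext_map tring \<Lambda>R n
          (bc_map (subtring (Zp nrm)) (restr (space D) \<Lambda>) tring (\<phi> \<circ> to_ac) id \<phi>) \<phi> `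
          W_lat nrm D \<mu> n \<Lambda>))"

end

theory Submission
  imports Defs "Jordan_Normal_Form.Determinant"
begin

text \<open>Suppose that \<open>b\<close> in the order acts diagonalizably on \<open>Vbar D\<close>.
  Then the n-th exterior power of \<open>b\<close> multiplies a wedge of eigenvectors with
  eigenvalues a_1, ..., a_n by the product of the a_i. When the a_i are the eigenvalues of
  \<open>b\<close> on V_1 with multiplicity, this product is det(b | V_1), so \<open>b\<close> acts
  on \<open>W_bar D \<mu> n b\<close> as the scalar det(b | V_1). The proof shows that
  diagonalizable elements are dense enough for every \<open>b\<close> in the order to act by det(b |
  V_1) on the intersection of these spaces. It then carries this statement from the algebraic
  closure through O_E to \<open>R\<close>, and compares it with the action on the wedge of a local
  basis of the given summand, where \<open>b\<close> acts by its determinant on that summand.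

  Density. Call an element of the order \<open>good\<close> if it has the largest possible number of
  distinct eigenvalues on \<open>Vbar D\<close>. Since \<open>B\<close> is semisimple and the
  characteristic is zero, an element of \<open>B\<close> orthogonal to all of \<open>B\<close> for
  the trace form of \<open>V\<close> acts as zero (\<open>rep_trace_nondegenerate\<close>), and this
  persists for polynomials in \<open>b\<close> over the algebraic closure
  (\<open>abar_trace_nondegenerate\<close>). Let q be the product of T - c over the eigenvalues c of
  a good \<open>b\<close>, and let k be minimal with q^k(b) = 0. If k is at least 2, the number of
  eigenvalues cannot grow along a line b + t y, so a Gram determinant of traces vanishes on the
  line, and its linear term gives tr((q^k)'(b) y) = 0 (\<open>trace_pderiv_zero\<close>). By
  nondegeneracy (q^k)'(b) = 0, and since q' is prime to q already q^(k-1)(b) = 0, a contradiction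
  (\<open>maximal_spectrum_imp_diagonalizable\<close>). On a line through a good element the Gram
  determinant is a nonzero polynomial, and where it does not vanish the elements of the order are
  good (\<open>gram_perturb\<close>). So the scalar identity extends to the whole order
  (\<open>W_bar_identity\<close>).

  Generic elements. The Kottwitz condition concerns the combination of basis elements
  \<open>bs ! l\<close> with indeterminate coefficients X_l. Substituting \<open>T ^ (k ^ l)\<close>
  for X_l loses no information once k exceeds the degree in each variable
  (\<open>map_eq_if_kronecker_eq\<close>). Identities of polynomials in T are then checked at
  natural numbers, where the generic element specializes to an element of the order
  (\<open>K_identity\<close>).

  Descent. The coefficients of the generic determinant on V_1 lie in E, because E contains the
  traces of \<open>B\<close> on V_1 and Newton's identities express determinants by traces
  (\<open>det_in_subfield_if_traces\<close>). They are integral because V_1 is a stable subspace of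
  \<open>Vbar D\<close>, on which the order has matrices over the p-adic integers
  (\<open>det_coeffs_integral\<close>, \<open>det_fmat_OE\<close>). Exterior powers are handled
  through Pluecker coordinates for a single basis of the lattice, which is also a basis of every
  base change of it or of \<open>V\<close>; these coordinates are compatible with all the maps that
  occur (\<open>pluecker_ext_map\<close>). Hence the identity on W(\<Lambda>) has coefficients in
  O_E, \<open>\<phi>\<close> maps it to \<open>R\<close> (\<open>W_lat_identity\<close>), and
  condition (K_n) makes it available for wedges of elements of the summand
  (\<open>R_identity\<close>).

  Conclusion. At a prime of \<open>R\<close> the summand acquires a basis after inverting some s
  outside the prime (\<open>local_basis_matrices\<close>), and Sylvester's determinant identity
  turns the identity for the wedge of this basis into equality of the two determinants up to a power
  of s (\<open>det_summand\<close>). If a coefficient of the two determinants differed, a prime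
  containing the annihilator of the difference would give a contradiction
  (\<open>summand_det\<close>).\<close>

section \<open>Determinants over commutative rings: the identities of Sylvester and
  Cauchy-Binet\<close>

lemma det_block_lower_one:
  fixes A :: "'a::comm_ring_1 mat"
  assumes A: "A \<in> carrier_mat n n" and C: "C \<in> carrier_mat m n"
  shows "det (four_block_mat A (0\<^sub>m n m) C (1\<^sub>m m)) = det A"
  using C
proof (induct m arbitrary: C)
  case 0
  have "four_block_mat A (0\<^sub>m n 0) C (1\<^sub>m 0) = A" using A 0 by (intro eq_matI) auto
  then show ?case by simp
next
  case (Suc m)
  let ?C = "mat m n (\<lambda>(i, j). C $$ (i, j))"
  let ?B1 = "four_block_mat A (0\<^sub>m n m) ?C (1\<^sub>m m)"
  let ?B3 = "mat 1 (n + m) (\<lambda>(i, j). if j < n then C $$ (m, j) else 0)"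
  have B1: "?B1 \<in> carrier_mat (n + m) (n + m)" using A by auto
  have "four_block_mat A (0\<^sub>m n (Suc m)) C (1\<^sub>m (Suc m)) =
      four_block_mat ?B1 (0\<^sub>m (n + m) 1) ?B3 (1\<^sub>m 1)"
  proof (rule eq_matI, goal_cases)
    case (1 i j)
    then have "i < n + m \<or> i = n + m" "j < n + m \<or> j = n + m" using A by auto
    then show ?case using A Suc(2) 1 by (elim disjE) auto
  qed (use A Suc(2) in auto)
  then have "det (four_block_mat A (0\<^sub>m n (Suc m)) C (1\<^sub>m (Suc m))) = det ?B1 * det (1\<^sub>m 1 :: 'a mat)"
    using det_four_block_mat_upper_right_zero_col[OF B1 refl, of ?B3 "1\<^sub>m 1"] by simp
  then show ?case using Suc(1)[of ?C] by simp
qed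

lemma det_block_one_diag:
  fixes D :: "'a::comm_ring_1 mat"
  assumes D: "D \<in> carrier_mat n n"
  shows "det (four_block_mat (1\<^sub>m m) (0\<^sub>m m n) (0\<^sub>m n m) D) = det D"
proof (induct m)
  case 0
  have "four_block_mat (1\<^sub>m 0) (0\<^sub>m 0 n) (0\<^sub>m n 0) D = D" using D by (intro eq_matI) auto
  then show ?case by simp
next
  case (Suc m)
  let ?B4 = "four_block_mat (1\<^sub>m m) (0\<^sub>m m n) (0\<^sub>m n m) D"
  have B4: "?B4 \<in> carrier_mat (m + n) (m + n)" using D by auto
  have "four_block_mat (1\<^sub>m (Suc m)) (0\<^sub>m (Suc m) n) (0\<^sub>m n (Suc m)) D =
     four_block_mat (1\<^sub>m 1) (0\<^sub>m 1 (m + n)) (0\<^sub>m (m + n) 1) ?B4"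
  proof (rule eq_matI, goal_cases)
    case (1 i j)
    then show ?case using D by (cases i; cases j) auto
  qed (use D in auto)
  then show ?case using Suc
      det_four_block_mat_lower_left_zero_col[of "1\<^sub>m 1" "0\<^sub>m 1 (m+n)" "m+n" "0\<^sub>m (m+n) 1" ?B4] B4
    by simp
qed

text \<open>Sylvester's identity. Both determinants come from the block matrix \<open>T\<close>:
  multiplying by the unipotent \<open>L\<close> on the left clears its upper right block and leaves
  s + MC, while multiplying by \<open>L'\<close> on the right clears the same block and leaves s +
  CM. The powers of s stay because the ring may have zero divisors.\<close>

lemma det_one_plus_commute_scaled:
  fixes M C :: "'a::comm_ring_1 mat"
  assumes M: "M \<in> carrier_mat m n" and C: "C \<in> carrier_mat n m"
  shows "s ^ n * det (s \<cdot>\<^sub>m 1\<^sub>m m + M * C) = s ^ m * det (s \<cdot>\<^sub>m 1\<^sub>m n + C * M)"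
proof -
  define T where "T = four_block_mat (s \<cdot>\<^sub>m 1\<^sub>m m) (- M) C (1\<^sub>m n)"
  define L where "L = four_block_mat (1\<^sub>m m) M (0\<^sub>m n m) (1\<^sub>m n)"
  define L' where "L' = four_block_mat (1\<^sub>m m) M (0\<^sub>m n m) (s \<cdot>\<^sub>m 1\<^sub>m n)"
  have car: "T \<in> carrier_mat (m + n) (m + n)" "L \<in> carrier_mat (m + n) (m + n)" "L' \<in> carrier_mat (m + n) (m + n)"
    unfolding T_def L_def L'_def by auto
  have MC: "M * C \<in> carrier_mat m m" "C * M \<in> carrier_mat n n" using M C by auto
  have detL: "det L = 1"
  proof -
    have "det L = det (transpose_mat L)" using car by (simp add: det_transpose)
    also have "transpose_mat L = four_block_mat (1\<^sub>m m) (0\<^sub>m m n) (transpose_mat M) (1\<^sub>m n)"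
      unfolding L_def using M by (subst transpose_four_block_mat) auto
    also have "det \<dots> = 1" using M by (subst det_block_lower_one) auto
    finally show ?thesis .
  qed
  have "L' = four_block_mat (1\<^sub>m m) (0\<^sub>m m n) (0\<^sub>m n m) (s \<cdot>\<^sub>m 1\<^sub>m n) * L"
    unfolding L'_def L_def using M by (subst mult_four_block_mat[of _ m m _ n _ n _ _ m _ n]) auto
  then have "det L' = det (four_block_mat (1\<^sub>m m) (0\<^sub>m m n) (0\<^sub>m n m) (s \<cdot>\<^sub>m 1\<^sub>m n)) * det L"
    using car(2) by (simp add: det_mult[of _ "m + n"])
  then have detL': "det L' = s ^ n"
    using detL by (simp add: det_block_one_diag)
  have "L * T = four_block_mat (s \<cdot>\<^sub>m 1\<^sub>m m + M * C) (0\<^sub>m m n) C (1\<^sub>m n)"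
    unfolding T_def L_def using M C
    by (subst mult_four_block_mat[of _ m m _ n _ n _ _ m _ n]) (auto intro!: cong_four_block_mat)
  then have 1: "det T = det (s \<cdot>\<^sub>m 1\<^sub>m m + M * C)"
    using det_mult[OF car(2,1)] detL MC C by (simp add: det_block_lower_one)
  let ?P = "four_block_mat (s \<cdot>\<^sub>m 1\<^sub>m m) (0\<^sub>m m n) C (1\<^sub>m n)"
  let ?Q = "four_block_mat (1\<^sub>m m) (0\<^sub>m m n) (0\<^sub>m n m) (s \<cdot>\<^sub>m 1\<^sub>m n + C * M)"
  have PQ: "?P \<in> carrier_mat (m + n) (m + n)" "?Q \<in> carrier_mat (m + n) (m + n)" using C MC by auto
  have "T * L' = four_block_mat (s \<cdot>\<^sub>m 1\<^sub>m m) (0\<^sub>m m n) C (s \<cdot>\<^sub>m 1\<^sub>m n + C * M)"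
    unfolding T_def L'_def using M C
    by (subst mult_four_block_mat[of _ m m _ n _ n _ _ m _ n])
      (auto intro!: cong_four_block_mat simp: mult_smult_assoc_mat[of _ m m _ n]
        mult_smult_distrib[of _ m n _ n] comm_add_mat[of _ n n])
  also have "\<dots> = ?P * ?Q"
    using M C MC by (subst mult_four_block_mat[of _ m m _ n _ n _ _ m _ n]) auto
  finally have "det T * s ^ n = s ^ m * det (s \<cdot>\<^sub>m 1\<^sub>m n + C * M)"
    using det_mult[OF car(1,3)] det_mult[OF PQ] detL' C MC
    by (simp add: det_block_lower_one det_block_one_diag)
  then show ?thesis using 1 by (simp add: mult.commute)
qed

text \<open>The Cauchy-Binet formula before sorting: each row of CM is expanded in the rows of M,
  and the determinant is multilinear in its rows. Summing over all maps \<open>f\<close>, rather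
  than over increasing ones, makes the right-hand side the coordinate formula for an exterior power
  of a matrix acting on Pluecker coordinates with arbitrary index maps.\<close>

lemma det_mult_rect:
  fixes C M :: "'a::comm_ring_1 mat"
  assumes C: "C \<in> carrier_mat n m" and M: "M \<in> carrier_mat m n"
  shows "det (C * M) = (\<Sum>f\<in>{0..<n} \<rightarrow>\<^sub>E {0..<m}.
    (\<Prod>i<n. C $$ (i, f i)) * det (mat n n (\<lambda>(i, j). M $$ (f i, j))))"
proof -
  let ?F = "{f. (\<forall>i\<in>{0..<n}. f i \<in> {0..<m}) \<and> (\<forall>i. i \<notin> {0..<n} \<longrightarrow> f i = i)}"
  let ?G = "{0..<n} \<rightarrow>\<^sub>E {0..<m}"
  let ?D = "\<lambda>f. det (mat n n (\<lambda>(i, j). M $$ (f i, j)))"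
  have car: "row M k \<in> carrier_vec n" if "k < m" for k using that M by auto
  have "det (C * M) = det (mat\<^sub>r n n (\<lambda>i. finsum_vec TYPE('a) n (\<lambda>k. C $$ (i,k) \<cdot>\<^sub>v row M k) {0..<m}))"
    using mat_mul_finsum_alt[OF C M] by simp
  also have "\<dots> = (\<Sum>f\<in>?F. det (mat\<^sub>r n n (\<lambda>i. C $$ (i, f i) \<cdot>\<^sub>v row M (f i))))"
    by (rule det_linear_rows_sum) (use M in auto)
  also have "\<dots> = (\<Sum>f\<in>?F. (\<Prod>i<n. C $$ (i, f i)) * ?D f)"
  proof (rule sum.cong[OF refl])
    fix f assume f: "f \<in> ?F"
    let ?g = "\<lambda>i. row M (f i)"
    have "det (mat\<^sub>r n n (\<lambda>i. C $$ (i, f i) \<cdot>\<^sub>v row M (f i))) =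
       (\<Prod>i\<in>{0..<n}. C $$ (i, f i)) * det (mat\<^sub>r n n ?g)"
      by (rule det_rows_mul) (use f M in auto)
    also have "mat\<^sub>r n n ?g = mat n n (\<lambda>(i, j). M $$ (f i, j))"
      using f M by (intro eq_matI) auto
    finally show "det (mat\<^sub>r n n (\<lambda>i. C $$ (i, f i) \<cdot>\<^sub>v row M (f i))) = (\<Prod>i<n. C $$ (i, f i)) * ?D f"
      by (simp add: atLeast0LessThan)
  qed
  \<comment> \<open>The set \<open>?F\<close> consists of maps that are the identity outside the
    index range, \<open>?G\<close> of maps that are undefined there; only the values below n enter
    the summand.\<close>
  also have "\<dots> = (\<Sum>f\<in>?G. (\<Prod>i<n. C $$ (i, f i)) * ?D f)"
  proof (rule sum.reindex_bij_witness[of _ "\<lambda>f i. if i < n then f i else i" "\<lambda>f. restrict f {0..<n}"], goal_cases)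
    case (5 a)
    then show ?case by (auto intro!: arg_cong2[of _ _ _ _ "(*)"] prod.cong arg_cong[of _ _ det] cong_mat)
  qed (auto simp: fun_eq_iff PiE_def extensional_def restrict_def)
  finally show ?thesis .
qed

section \<open>Polynomials in a matrix\<close>

definition poly_mat :: "'a::comm_ring_1 Polynomial.poly \<Rightarrow> 'a mat \<Rightarrow> 'a mat" where
  "poly_mat f A = fold_coeffs (\<lambda>a M. a \<cdot>\<^sub>m 1\<^sub>m (dim_row A) + A * M) f (0\<^sub>m (dim_row A) (dim_row A))"

lemma poly_mat_0: "A \<in> carrier_mat n n \<Longrightarrow> poly_mat 0 A = 0\<^sub>m n n"
  by (simp add: poly_mat_def)

lemma poly_mat_carrier[simp, intro]:
  assumes A: "A \<in> carrier_mat n n" shows "poly_mat f A \<in> carrier_mat n n"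
proof -
  have "foldr (\<lambda>a M. a \<cdot>\<^sub>m 1\<^sub>m n + A * M) xs (0\<^sub>m n n) \<in> carrier_mat n n" for xs
    using A by (induct xs) auto
  then show ?thesis using A by (simp add: poly_mat_def fold_coeffs_def)
qed

lemma poly_mat_dim[simp]: "dim_row (poly_mat f A) = dim_row A" "dim_col (poly_mat f A) = dim_row A"
proof -
  let ?h = "\<lambda>xs. foldr (\<lambda>a M. a \<cdot>\<^sub>m 1\<^sub>m (dim_row A) + A * M) xs (0\<^sub>m (dim_row A) (dim_row A))"
  have "dim_row (?h xs) = dim_row A \<and> dim_col (?h xs) = dim_row A" for xs
    by (induct xs) auto
  then show "dim_row (poly_mat f A) = dim_row A" "dim_col (poly_mat f A) = dim_row A"
    by (simp_all add: poly_mat_def fold_coeffs_def)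
qed

lemma poly_mat_pCons:
  assumes A: "A \<in> carrier_mat n n"
  shows "poly_mat (pCons a f) A = a \<cdot>\<^sub>m 1\<^sub>m n + A * poly_mat f A"
proof (cases "a = 0 \<and> f = 0")
  case True
  then show ?thesis using A by (auto simp: poly_mat_0)
next
  case False
  then show ?thesis using A unfolding poly_mat_def
    by (cases "f = 0") (auto simp: fold_coeffs_pCons_not_0_0_eq)
qed

lemma poly_mat_const: "A \<in> carrier_mat n n \<Longrightarrow> poly_mat [:c:] A = c \<cdot>\<^sub>m 1\<^sub>m n"
  by (simp add: poly_mat_pCons poly_mat_0)

lemma poly_mat_1: "A \<in> carrier_mat n n \<Longrightarrow> poly_mat 1 A = 1\<^sub>m n"
  using poly_mat_const[of A n 1] by (simp add: one_pCons) auto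

lemma poly_mat_X: "A \<in> carrier_mat n n \<Longrightarrow> poly_mat [:0, 1:] A = A"
  using poly_mat_pCons[of A n 0 "[:1:]"] poly_mat_const[of A n 1] by (auto simp: right_mult_one_mat)

lemma poly_mat_add:
  assumes A: "A \<in> carrier_mat n n"
  shows "poly_mat (f + g) A = poly_mat f A + poly_mat g A"
proof (induct f g rule: poly_induct2)
  case 0
  show ?case using A by (simp add: poly_mat_0)
next
  case (pCons a f b g)
  have "A * (poly_mat f A + poly_mat g A) = A * poly_mat f A + A * poly_mat g A"
    using A by (intro mult_add_distrib_mat[of _ n n _ n]) auto
  moreover have "(a + b) \<cdot>\<^sub>m 1\<^sub>m n = a \<cdot>\<^sub>m 1\<^sub>m n + b \<cdot>\<^sub>m (1\<^sub>m n :: 'a mat)"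
    by (intro eq_matI) (auto simp: algebra_simps)
  ultimately show ?case using A pCons
    by (simp add: poly_mat_pCons) (intro eq_matI, auto simp: algebra_simps)
qed

lemma poly_mat_smult:
  assumes A: "A \<in> carrier_mat n n"
  shows "poly_mat (Polynomial.smult c f) A = c \<cdot>\<^sub>m poly_mat f A"
proof (induct f)
  case 0
  show ?case using A by (simp add: poly_mat_0)
next
  case (pCons a f)
  have "A * (c \<cdot>\<^sub>m poly_mat f A) = c \<cdot>\<^sub>m (A * poly_mat f A)"
    using A by (intro mult_smult_distrib) auto
  then show ?case using A pCons
    by (simp add: poly_mat_pCons del: smult_pCons) (intro eq_matI, auto simp: algebra_simps poly_mat_pCons)
qed

lemma poly_mat_mult:
  assumes A: "A \<in> carrier_mat n n"
  shows "poly_mat (f * g) A = poly_mat f A * poly_mat g A"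
proof (induct f)
  case 0
  show ?case using A poly_mat_carrier[OF A, of g] by (simp add: poly_mat_0 left_mult_zero_mat)
next
  case (pCons a f)
  let ?F = "poly_mat f A" let ?G = "poly_mat g A"
  have F: "?F \<in> carrier_mat n n" and G: "?G \<in> carrier_mat n n" using A by auto
  have "poly_mat (pCons a f * g) A = a \<cdot>\<^sub>m ?G + A * (?F * ?G)"
    using A F G pCons unfolding mult_pCons_left poly_mat_add[OF A] poly_mat_smult[OF A] poly_mat_pCons[OF A]
    by (intro eq_matI) auto
  also have "A * (?F * ?G) = (A * ?F) * ?G" using A F G by (simp add: assoc_mult_mat[of _ n n _ n _ n])
  also have "a \<cdot>\<^sub>m ?G + (A * ?F) * ?G = (a \<cdot>\<^sub>m 1\<^sub>m n + A * ?F) * ?G"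
    using A F G by (subst add_mult_distrib_mat[of _ n n]) (auto simp: mult_smult_assoc_mat[of _ n n _ n])
  finally show ?case using A by (simp add: poly_mat_pCons[OF A])
qed

lemma poly_mat_commute:
  assumes A: "A \<in> carrier_mat n n"
  shows "poly_mat f A * poly_mat g A = poly_mat g A * poly_mat f A"
  by (simp add: poly_mat_mult[OF A, symmetric] mult.commute)

lemma poly_mat_hom:
  assumes h: "comm_ring_hom h" and A: "A \<in> carrier_mat n n"
  shows "map_mat h (poly_mat f A) = poly_mat (map_poly h f) (map_mat h A)"
proof (induct f)
  case 0
  interpret comm_ring_hom h by fact
  show ?case using A by (auto simp: poly_mat_0[of _ n])
next
  case (pCons a f)
  interpret comm_ring_hom h by fact
  have m: "map_poly h (pCons a f) = pCons (h a) (map_poly h f)"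
    by (simp add: map_poly_pCons_hom)
  have A': "map_mat h A \<in> carrier_mat n n" using A by simp
  have "map_mat h (a \<cdot>\<^sub>m 1\<^sub>m n + A * poly_mat f A) = h a \<cdot>\<^sub>m 1\<^sub>m n + map_mat h (A * poly_mat f A)"
    using A poly_mat_carrier[OF A, of f] by (intro eq_matI) (auto simp: hom_distribs)
  also have "map_mat h (A * poly_mat f A) = map_mat h A * map_mat h (poly_mat f A)"
    using A by (intro mat_hom_mult) auto
  finally show ?case unfolding m poly_mat_pCons[OF A] poly_mat_pCons[OF A'] pCons .
qed

lemma poly_mat_similar:
  assumes "similar_mat_wit A B P Q" "A \<in> carrier_mat n n"
  shows "poly_mat f A = P * poly_mat f B * Q"
proof -
  from similar_mat_witD2[OF assms(2,1)]
  have *: "P * Q = 1\<^sub>m n" "Q * P = 1\<^sub>m n" "A = P * B * Q" and c: "A \<in> carrier_mat n n" "B \<in> carrier_mat n n"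
    "P \<in> carrier_mat n n" "Q \<in> carrier_mat n n" by auto
  show ?thesis
  proof (induct f)
    case 0
    show ?case using c by (simp add: poly_mat_0[of _ n])
  next
    case (pCons a f)
    let ?F = "poly_mat f B"
    have F: "?F \<in> carrier_mat n n" using c by simp
    have "A * (P * ?F * Q) = P * B * (Q * P) * ?F * Q"
      unfolding *(3) using c F by (simp add: assoc_mult_mat[of _ n n _ n _ n] mult_carrier_mat[of _ n n _ n])
    also have "\<dots> = P * (B * ?F) * Q" unfolding *(2) using c F
      by (simp add: assoc_mult_mat[of _ n n _ n _ n])
    finally have 1: "A * (P * ?F * Q) = P * (B * ?F) * Q" .
    have "P * (a \<cdot>\<^sub>m 1\<^sub>m n + B * ?F) * Q = (P * (a \<cdot>\<^sub>m 1\<^sub>m n) + P * (B * ?F)) * Q"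
      using c F by (subst mult_add_distrib_mat[of _ n n]) auto
    also have "\<dots> = P * (a \<cdot>\<^sub>m 1\<^sub>m n) * Q + P * (B * ?F) * Q"
      using c F by (subst add_mult_distrib_mat[of _ n n]) auto
    also have "P * (a \<cdot>\<^sub>m 1\<^sub>m n) * Q = a \<cdot>\<^sub>m 1\<^sub>m n"
      using c *(1) by (simp add: mult_smult_distrib[of _ n n _ n] mult_smult_assoc_mat[of _ n n _ n])
    finally show ?case using c pCons 1 by (simp add: poly_mat_pCons[of _ n])
  qed
qed

lemma poly_mat_upper_triangular:
  assumes B: "B \<in> carrier_mat n n" "upper_triangular B"
  shows "upper_triangular (poly_mat f B) \<and> (\<forall>i<n. poly_mat f B $$ (i, i) = Polynomial.poly f (B $$ (i, i)))"
proof (induct f)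
  case 0
  show ?case using B by (auto simp: poly_mat_0)
next
  case (pCons a f)
  let ?F = "poly_mat f B"
  have F: "?F \<in> carrier_mat n n" using B by auto
  \<comment> \<open>For upper triangular factors, a term of the product on or below the diagonal
    survives only for k = i = j.\<close>
  have 0: "B $$ (i, k) * ?F $$ (k, j) = 0" if "i < n" "j \<le> i" "k < n" "k \<noteq> i \<or> j < i" for i j k
    using that upper_triangularD[OF B(2), of k i] upper_triangularD[OF conjunct1[OF pCons(2)], of j k] B(1)
    by (cases "k < i"; cases "j < k") auto
  have e: "poly_mat (pCons a f) B $$ (i, j) = (if i = j then a else 0) + (\<Sum>k\<in>{0..<n}. B $$ (i, k) * ?F $$ (k, j))"
    if "i < n" "j < n" for i j
    using that B F by (auto simp: poly_mat_pCons scalar_prod_def intro!: sum.cong)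
  have "poly_mat (pCons a f) B $$ (i, j) = 0" if "j < i" "i < n" for i j
    using that 0[of i j] by (subst e) (auto intro!: sum.neutral)
  moreover have "poly_mat (pCons a f) B $$ (i, i) = Polynomial.poly (pCons a f) (B $$ (i, i))" if i: "i < n" for i
  proof -
    have "(\<Sum>k\<in>{0..<n}. B $$ (i, k) * ?F $$ (k, i)) = (\<Sum>k\<in>{0..<n}. if k = i then B $$ (i, i) * ?F $$ (i, i) else 0)"
      using 0[of i i] i by (intro sum.cong) auto
    then show ?thesis using i pCons e[of i i] by simp
  qed
  ultimately show ?case using B by (auto intro!: upper_triangularI)
qed

text \<open>Each multiplication by \<open>B\<close> moves the entries one diagonal further: row i of
  the k-th power starts at column i + k.\<close>

lemma strict_upper_triangular_pow:
  assumes B: "B \<in> carrier_mat n n" "\<And>i j. i < n \<Longrightarrow> j \<le> i \<Longrightarrow> B $$ (i, j) = 0"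
  shows "B ^\<^sub>m n = 0\<^sub>m n n"
proof -
  have "\<forall>i<n. \<forall>j<n. j < i + k \<longrightarrow> (B ^\<^sub>m k) $$ (i, j) = 0" for k
  proof (induct k)
    case (Suc k)
    show ?case
    proof (intro allI impI)
      fix i j assume ij: "i < n" "j < n" "j < i + Suc k"
      have "(B ^\<^sub>m k) $$ (i, l) * B $$ (l, j) = 0" if l: "l < n" for l
        using Suc B(2)[of l j] ij l by (cases "l < i + k") auto
      then show "(B ^\<^sub>m Suc k) $$ (i, j) = 0" using ij B(1)
        by (auto simp: scalar_prod_def intro!: sum.neutral)
    qed
  qed (use B(1) in auto)
  then show ?thesis using B(1) by (intro eq_matI) auto
qed

section \<open>Traces and triangularization\<close>

definition mat_trace :: "'a::comm_ring_1 mat \<Rightarrow> 'a" where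
  "mat_trace A = (\<Sum>i<dim_row A. A $$ (i, i))"

lemma mat_trace_commute:
  assumes "A \<in> carrier_mat n m" "B \<in> carrier_mat m n"
  shows "mat_trace (A * B) = mat_trace (B * A)"
proof -
  have "mat_trace (A * B) = (\<Sum>i<n. \<Sum>k<m. A $$ (i, k) * B $$ (k, i))"
    using assms by (auto simp: mat_trace_def scalar_prod_def atLeast0LessThan intro!: sum.cong)
  also have "\<dots> = (\<Sum>k<m. \<Sum>i<n. B $$ (k, i) * A $$ (i, k))"
    by (subst sum.swap) (simp add: mult.commute)
  also have "\<dots> = mat_trace (B * A)"
    using assms by (auto simp: mat_trace_def scalar_prod_def atLeast0LessThan intro!: sum.cong)
  finally show ?thesis .
qed

lemma mat_trace_add: "A \<in> carrier_mat n n \<Longrightarrow> B \<in> carrier_mat n n \<Longrightarrow> mat_trace (A + B) = mat_trace A + mat_trace B"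
  by (auto simp: mat_trace_def sum.distrib)

lemma mat_trace_smult: "A \<in> carrier_mat n n \<Longrightarrow> mat_trace (c \<cdot>\<^sub>m A) = c * mat_trace A"
  by (auto simp: mat_trace_def sum_distrib_left)

lemma mat_trace_hom:
  assumes "comm_ring_hom h" shows "A \<in> carrier_mat n n \<Longrightarrow> mat_trace (map_mat h A) = h (mat_trace A)"
proof -
  interpret comm_ring_hom h by fact
  show "A \<in> carrier_mat n n \<Longrightarrow> mat_trace (map_mat h A) = h (mat_trace A)"
    by (auto simp: mat_trace_def hom_sum)
qed

lemma mat_trace_similar:
  assumes "similar_mat_wit A B P Q" "A \<in> carrier_mat n n"
  shows "mat_trace A = mat_trace B"
proof -
  from similar_mat_witD2[OF assms(2,1)]
  have *: "Q * P = 1\<^sub>m n" "A = P * B * Q" and c: "B \<in> carrier_mat n n" "P \<in> carrier_mat n n" "Q \<in> carrier_mat n n" by auto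
  have "mat_trace A = mat_trace (Q * (P * B))" unfolding *(2) using c by (intro mat_trace_commute) auto
  also have "Q * (P * B) = B" using c *(1) by (simp flip: assoc_mult_mat[of _ n n _ n _ n])
  finally show ?thesis .
qed

text \<open>Induction on the size: an eigenvector, completed to a basis, becomes the first column of
  a block triangular matrix, and the induction hypothesis applies to the lower right block.\<close>

lemma triangularizable:
  fixes A :: "'a::alg_closed_field mat"
  assumes "A \<in> carrier_mat n n"
  shows "\<exists>B P Q. similar_mat_wit A B P Q \<and> upper_triangular B"
  using assms
proof (induct n arbitrary: A)
  case 0
  then show ?case using similar_mat_wit_refl[of A 0] by (metis carrier_matD(1) less_nat_zero_code upper_triangular_def)
next
  case (Suc n)
  note A = Suc(2)
  have "degree (char_poly A) = Suc n" using degree_monic_char_poly[OF A] by simp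
  then obtain c where "Polynomial.poly (char_poly A) c = 0" using alg_closed_imp_poly_has_root[of "char_poly A"] by auto
  then obtain v where "eigenvector A v c"
    using eigenvalue_root_char_poly[OF A] unfolding eigenvalue_def by blast
  then have v: "v \<in> carrier_vec (Suc n)" "v \<noteq> 0\<^sub>v (Suc n)" "A *\<^sub>v v = c \<cdot>\<^sub>v v"
    using A unfolding eigenvector_def by auto
  then obtain k where k: "k < Suc n" "v $ k \<noteq> 0" by (metis eq_vecI carrier_vecD index_zero_vec)
  \<comment> \<open>For j different from 0 the index \<open>\<tau> j\<close> runs through all
    indices except k. Since v has a nonzero k-th entry, v and the corresponding unit vectors are a
    basis; they are the columns of \<open>P\<close>, and \<open>Q\<close> is the explicit
    inverse.\<close>
  define \<tau> where "\<tau> = Transposition.transpose 0 k"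
  define P where "P = mat (Suc n) (Suc n) (\<lambda>(i, j). if j = 0 then v $ i else if i = \<tau> j then 1 else 0)"
  define Q where "Q = mat (Suc n) (Suc n) (\<lambda>(i, j). if i = 0 then (if j = k then 1 / v $ k else 0)
    else (if j = \<tau> i then 1 else 0) - (if j = k then v $ \<tau> i / v $ k else 0))"
  have \<tau>: "\<tau> j = k \<longleftrightarrow> j = 0" "\<tau> j < Suc n \<longleftrightarrow> j < Suc n" "\<tau> i = \<tau> j \<longleftrightarrow> i = j" for i j
    using k(1) unfolding \<tau>_def by (auto simp: Transposition.transpose_def)
  have P: "P \<in> carrier_mat (Suc n) (Suc n)" and Q: "Q \<in> carrier_mat (Suc n) (Suc n)"
    unfolding P_def Q_def by auto
  have QP: "Q * P = 1\<^sub>m (Suc n)"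
  proof (rule eq_matI)
    fix i j assume "i < dim_row (1\<^sub>m (Suc n) :: 'a mat)" "j < dim_col (1\<^sub>m (Suc n) :: 'a mat)"
    then have ij: "i < Suc n" "j < Suc n" by auto
    have "(Q * P) $$ (i, j) = (\<Sum>l\<in>{0..<Suc n}. Q $$ (i, l) * P $$ (l, j))"
      using ij P Q by (simp add: scalar_prod_def del: sum.atLeast0_lessThan_Suc)
    also have "\<dots> = (\<Sum>l\<in>{0..<Suc n}. (if l = \<tau> i \<and> i \<noteq> 0 then P $$ (\<tau> i, j) else 0) +
        (if l = k then (if i = 0 then P $$ (k, j) / v $ k else - v $ \<tau> i * P $$ (k, j) / v $ k) else 0))"
      using ij unfolding Q_def by (intro sum.cong) (auto simp: algebra_simps)
    also have "\<dots> = (if i \<noteq> 0 then P $$ (\<tau> i, j) else 0) + (if i = 0 then P $$ (k, j) / v $ k else - v $ \<tau> i * P $$ (k, j) / v $ k)"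
      using ij k(1) \<tau>(2)[of i] by (simp add: sum.distrib del: sum.atLeast0_lessThan_Suc)
    also have "\<dots> = (if i = j then 1 else 0)"
      using ij k \<tau> unfolding P_def by (auto simp: eq_commute[of k])
    finally show "(Q * P) $$ (i, j) = 1\<^sub>m (Suc n) $$ (i, j)" using ij by simp
  qed (use P Q in auto)
  then have PQ: "P * Q = 1\<^sub>m (Suc n)" using mat_mult_left_right_inverse[OF Q P] by simp
  define C where "C = Q * A * P"
  have C: "C \<in> carrier_mat (Suc n) (Suc n)" unfolding C_def using A P Q by auto
  have sim: "similar_mat_wit A C P Q"
  proof (rule similar_mat_witI[OF PQ QP])
    have "P * C * Q = (P * Q) * A * (P * Q)"
      unfolding C_def using A P Q by (simp add: assoc_mult_mat[of _ "Suc n" "Suc n" _ "Suc n" _ "Suc n"])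
    then show "A = P * C * Q" using A PQ by simp
  qed (use A C P Q in auto)
  have Pe: "col P 0 = v" unfolding P_def using v by (intro eq_vecI) auto
  have "col C 0 = (Q * A) *\<^sub>v v" unfolding C_def using A P Q Pe by (subst col_mult2[of _ "Suc n" "Suc n" _ "Suc n"]) auto
  also have "\<dots> = Q *\<^sub>v (c \<cdot>\<^sub>v v)" using A Q v by simp
  also have "\<dots> = c \<cdot>\<^sub>v col (Q * P) 0" using Q P v Pe
    by (subst col_mult2[of _ "Suc n" "Suc n" _ "Suc n"]) (auto simp: mult_mat_vec)
  finally have colC: "col C 0 = c \<cdot>\<^sub>v unit_vec (Suc n) 0" unfolding QP by simp
  define r where "r = mat 1 n (\<lambda>(i, j). C $$ (0, Suc j))"
  define D where "D = mat n n (\<lambda>(i, j). C $$ (Suc i, Suc j))"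
  have D: "D \<in> carrier_mat n n" and r: "r \<in> carrier_mat 1 n" unfolding D_def r_def by auto
  have C0: "C $$ (i, 0) = (if i = 0 then c else 0)" if "i < Suc n" for i
    using arg_cong[OF colC, of "\<lambda>u. vec_index u i"] that C by auto
  have Cb: "C = four_block_mat (c \<cdot>\<^sub>m 1\<^sub>m 1) r (0\<^sub>m n 1) D"
  proof (rule eq_matI, goal_cases)
    case (1 i j)
    then show ?case using C C0[of i] unfolding r_def D_def by (cases i; cases j) auto
  qed (use C in \<open>auto simp: D_def\<close>)
  from Suc(1)[OF D] obtain B P' Q' where B: "similar_mat_wit D B P' Q'" "upper_triangular B" by blast
  have BPQ: "B \<in> carrier_mat n n" "P' \<in> carrier_mat n n" "Q' \<in> carrier_mat n n" "P' * Q' = 1\<^sub>m n"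
    using similar_mat_witD2[OF D B(1)] by auto
  have "r = 1\<^sub>m 1 * (r * P') * Q'" using r BPQ by (simp add: assoc_mult_mat[of _ 1 n _ n _ n])
  then have "similar_mat_wit C (four_block_mat (c \<cdot>\<^sub>m 1\<^sub>m 1) (r * P') (0\<^sub>m n 1) B)
     (four_block_mat (1\<^sub>m 1) (0\<^sub>m 1 n) (0\<^sub>m n 1) P') (four_block_mat (1\<^sub>m 1) (0\<^sub>m 1 n) (0\<^sub>m n 1) Q')"
    unfolding Cb using r BPQ D B(1)
    by (intro similar_mat_wit_four_block[OF similar_mat_wit_refl[of _ 1]]) auto
  moreover have "upper_triangular (four_block_mat (c \<cdot>\<^sub>m 1\<^sub>m 1) (r * P') (0\<^sub>m n 1) B)"
    by (rule upper_triangular_four_block[of _ 1]) (use BPQ B in auto)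
  ultimately show ?case using similar_mat_wit_trans[OF sim] by blast
qed

section \<open>Eigenvalues and traces of polynomials in a matrix\<close>

definition spectrum :: "'a::field mat \<Rightarrow> 'a set" where
  "spectrum A = {c. Polynomial.poly (char_poly A) c = 0}"

lemma spectrum_triangular:
  fixes A :: "'a::field mat"
  assumes "similar_mat_wit A B P Q" "A \<in> carrier_mat n n" "upper_triangular B"
  shows "spectrum A = (\<lambda>i. B $$ (i, i)) ` {..<n}"
proof -
  from similar_mat_witD2[OF assms(2,1)] have B: "B \<in> carrier_mat n n" by auto
  have "char_poly A = (\<Prod>a\<leftarrow>diag_mat B. [:- a, 1:])"
    using char_poly_similar[of A B] assms char_poly_upper_triangular[OF B assms(3)]
    unfolding similar_mat_def by metis
  then have "spectrum A = set (diag_mat B)"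
    by (auto simp: spectrum_def poly_prod_list prod_list_zero_iff)
  then show ?thesis using B by (auto simp: diag_mat_def)
qed

lemma trace_poly_mat:
  fixes A :: "'a::field mat"
  assumes s: "similar_mat_wit A B P Q" and A: "A \<in> carrier_mat n n" and u: "upper_triangular B"
  shows "mat_trace (poly_mat f A) = (\<Sum>i<n. Polynomial.poly f (B $$ (i, i)))"
proof -
  from similar_mat_witD2[OF A s]
  have *: "P * Q = 1\<^sub>m n" "Q * P = 1\<^sub>m n" "A = P * B * Q" and B: "B \<in> carrier_mat n n"
    "P \<in> carrier_mat n n" "Q \<in> carrier_mat n n" by auto
  have "similar_mat_wit (poly_mat f A) (poly_mat f B) P Q"
    by (rule similar_mat_witI[OF *(1,2) poly_mat_similar[OF s A]]) (use A B in auto)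
  then have "mat_trace (poly_mat f A) = mat_trace (poly_mat f B)"
    by (rule mat_trace_similar) (use A in auto)
  also have "\<dots> = (\<Sum>i<n. Polynomial.poly f (B $$ (i, i)))"
    using poly_mat_upper_triangular[OF B(1) u] B by (auto simp: mat_trace_def)
  finally show ?thesis .
qed

lemma spectrum_finite: "A \<in> carrier_mat n n \<Longrightarrow> finite (spectrum (A :: 'a::field mat))"
  using degree_monic_char_poly[of A n] poly_roots_finite[of "char_poly A"] unfolding spectrum_def by force

text \<open>The trace of f(A) depends only on the values of f at the eigenvalues, weighted by their
  multiplicities. The weights are positive, hence nonzero in characteristic zero; this is what makes
  traces detect the number of distinct eigenvalues.\<close>

lemma trace_poly_mat_spectrum:
  fixes A :: "'a::alg_closed_field mat"
  assumes A: "A \<in> carrier_mat n n"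
  obtains m where "\<And>f. mat_trace (poly_mat f A) = (\<Sum>c\<in>spectrum A. of_nat (m c) * Polynomial.poly f c)"
    "\<And>c. c \<in> spectrum A \<Longrightarrow> m c > 0"
proof -
  obtain B P Q where s: "similar_mat_wit A B P Q" "upper_triangular B" using triangularizable[OF A] by blast
  note sp = spectrum_triangular[OF s(1) A s(2)]
  define m where "m c = card {i\<in>{..<n}. B $$ (i, i) = c}" for c
  have "mat_trace (poly_mat f A) = (\<Sum>c\<in>spectrum A. of_nat (m c) * Polynomial.poly f c)" for f
  proof -
    have "mat_trace (poly_mat f A) = (\<Sum>c\<in>spectrum A. \<Sum>i\<in>{i\<in>{..<n}. B $$ (i, i) = c}. Polynomial.poly f (B $$ (i, i)))"
      unfolding trace_poly_mat[OF s(1) A s(2)] sp by (rule sum.image_gen) simp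
    also have "\<dots> = (\<Sum>c\<in>spectrum A. of_nat (m c) * Polynomial.poly f c)"
      unfolding m_def by (intro sum.cong) auto
    finally show ?thesis .
  qed
  moreover have "m c > 0" if "c \<in> spectrum A" for c
    using that unfolding m_def sp card_gt_0_iff by auto
  ultimately show ?thesis using that by blast
qed

text \<open>The radical of the minimal polynomial. Over an algebraically closed field a matrix is
  diagonalizable exactly when this polynomial annihilates it.\<close>

definition min_radical :: "'a::field mat \<Rightarrow> 'a Polynomial.poly" where
  "min_radical A = (\<Prod>c\<in>spectrum A. [:- c, 1:])"

lemma min_radical_root: "A \<in> carrier_mat n n \<Longrightarrow> Polynomial.poly (min_radical A) c = 0 \<longleftrightarrow> c \<in> spectrum (A :: 'a::field mat)"
  using spectrum_finite[of A n] by (auto simp: min_radical_def poly_prod prod_zero_iff)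

lemma poly_mat_pow: "A \<in> carrier_mat n n \<Longrightarrow> poly_mat (f ^ k) A = poly_mat f A ^\<^sub>m k"
proof (induct k)
  case (Suc k)
  then show ?case using poly_mat_mult[of A n "f ^ k" f] by (simp add: mult.commute)
qed (auto simp: poly_mat_1)

text \<open>In triangular form the diagonal entries are eigenvalues, so this polynomial takes the
  matrix to a strictly upper triangular one.\<close>

lemma min_radical_nilpotent:
  fixes A :: "'a::alg_closed_field mat"
  assumes A: "A \<in> carrier_mat n n"
  shows "poly_mat (min_radical A ^ n) A = 0\<^sub>m n n"
proof -
  obtain B P Q where s: "similar_mat_wit A B P Q" "upper_triangular B" using triangularizable[OF A] by blast
  from similar_mat_witD2[OF A s(1)] have B: "B \<in> carrier_mat n n" "P \<in> carrier_mat n n" "Q \<in> carrier_mat n n" by auto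
  note sp = spectrum_triangular[OF s(1) A s(2)]
  let ?R = "poly_mat (min_radical A) B"
  have "?R $$ (i, j) = 0" if "i < n" "j \<le> i" for i j
    using poly_mat_upper_triangular[OF B(1) s(2), of "min_radical A"] that B(1) min_radical_root[OF A] sp
    by (cases "j = i") (auto simp: upper_triangular_def)
  then have "?R ^\<^sub>m n = 0\<^sub>m n n" using B(1) by (intro strict_upper_triangular_pow) auto
  then have "poly_mat (min_radical A ^ n) B = 0\<^sub>m n n" using B(1) by (simp add: poly_mat_pow)
  then show ?thesis using poly_mat_similar[OF s(1) A, of "min_radical A ^ n"] B by simp
qed

text \<open>A nonzero eigenvalue c could be isolated by a polynomial that vanishes at 0 and at the
  other eigenvalues, and its positive multiplicity would show up in a trace.\<close>

lemma nilpotent_if_traces_zero: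
  fixes A :: "'a::{alg_closed_field,field_char_0} mat"
  assumes A: "A \<in> carrier_mat n n" and tr: "\<And>k. k > 0 \<Longrightarrow> mat_trace (A ^\<^sub>m k) = 0"
  shows "A ^\<^sub>m n = 0\<^sub>m n n"
proof -
  obtain m where m: "\<And>f. mat_trace (poly_mat f A) = (\<Sum>c\<in>spectrum A. of_nat (m c) * Polynomial.poly f c)"
    "\<And>c. c \<in> spectrum A \<Longrightarrow> m c > 0" using trace_poly_mat_spectrum[OF A] by blast
  \<comment> \<open>By linearity the hypothesis extends to all polynomials without constant term.
    The exponent stays arbitrary because splitting off a coefficient of f raises it by one.\<close>
  have 0: "mat_trace (A ^\<^sub>m Suc k * poly_mat f A) = 0" for f k
  proof (induct f arbitrary: k)
    case 0
    then show ?case using A pow_carrier_mat[OF A, of "Suc k"] by (simp add: poly_mat_0[OF A] mat_trace_def)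
  next
    case (pCons a f)
    have Ak: "A ^\<^sub>m Suc k \<in> carrier_mat n n" using A by (rule pow_carrier_mat)
    let ?F = "poly_mat f A"
    have F: "?F \<in> carrier_mat n n" using A by simp
    have "A ^\<^sub>m Suc k * poly_mat (pCons a f) A = A ^\<^sub>m Suc k * (a \<cdot>\<^sub>m 1\<^sub>m n) + A ^\<^sub>m Suc k * (A * ?F)"
      unfolding poly_mat_pCons[OF A] by (rule mult_add_distrib_mat[OF Ak]) (use A F in auto)
    also have "A ^\<^sub>m Suc k * (a \<cdot>\<^sub>m 1\<^sub>m n) = a \<cdot>\<^sub>m A ^\<^sub>m Suc k"
      using mult_smult_distrib[OF Ak one_carrier_mat, of a] right_mult_one_mat[OF Ak] by metis
    also have "A ^\<^sub>m Suc k * (A * ?F) = A ^\<^sub>m Suc (Suc k) * ?F"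
      using assoc_mult_mat[OF Ak A F] by simp
    finally have "A ^\<^sub>m Suc k * poly_mat (pCons a f) A = a \<cdot>\<^sub>m A ^\<^sub>m Suc k + A ^\<^sub>m Suc (Suc k) * ?F" .
    moreover have "a \<cdot>\<^sub>m A ^\<^sub>m Suc k \<in> carrier_mat n n" "A ^\<^sub>m Suc (Suc k) * ?F \<in> carrier_mat n n"
      using Ak F pow_carrier_mat[OF A, of "Suc (Suc k)"] by (auto simp del: pow_mat.simps)
    ultimately show ?case using pCons(2)[of "Suc k"] tr[of "Suc k"] Ak
      by (simp add: mat_trace_add[of _ n] mat_trace_smult[of _ n] del: pow_mat.simps)
  qed
  have "spectrum A \<subseteq> {0}"
  proof (rule ccontr)
    assume "\<not> spectrum A \<subseteq> {0}"
    then obtain c where c: "c \<in> spectrum A" "c \<noteq> 0" by auto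
    \<comment> \<open>The trace of A f(A) reduces to the single term at c, which is the multiplicity
      of c times c f(c).\<close>
    define f where "f = (\<Prod>e\<in>spectrum A - {c}. [:- e, 1:])"
    have fin: "finite (spectrum A)" using spectrum_finite[OF A] .
    have "mat_trace (poly_mat ([:0, 1:] * f) A) = 0"
      using 0[of 0 f] A by (simp add: poly_mat_mult[OF A] poly_mat_X[OF A] del: mult_pCons_left)
    moreover have "(\<Sum>e\<in>spectrum A. of_nat (m e) * Polynomial.poly ([:0, 1:] * f) e) =
        (\<Sum>e\<in>{c}. of_nat (m e) * Polynomial.poly ([:0, 1:] * f) e)"
      using c fin by (intro sum.mono_neutral_right) (auto simp: f_def poly_prod prod_zero_iff)
    ultimately have "Polynomial.poly f c = 0" using c m(1) m(2)[OF c(1)] by auto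
    then show False using fin by (auto simp: f_def poly_prod prod_zero_iff)
  qed
  obtain B P Q where s: "similar_mat_wit A B P Q" "upper_triangular B" using triangularizable[OF A] by blast
  from similar_mat_witD2[OF A s(1)] have B: "B \<in> carrier_mat n n" "P \<in> carrier_mat n n" "Q \<in> carrier_mat n n" by auto
  have "B $$ (i, j) = 0" if "i < n" "j \<le> i" for i j
    using that B(1) s(2) \<open>spectrum A \<subseteq> {0}\<close> spectrum_triangular[OF s(1) A s(2)]
    by (cases "j = i") (auto simp: upper_triangular_def)
  then have "B ^\<^sub>m n = 0\<^sub>m n n" using B(1) by (intro strict_upper_triangular_pow) auto
  then have "poly_mat ([:0, 1:] ^ n) B = 0\<^sub>m n n" using B(1) by (simp add: poly_mat_pow poly_mat_X)
  then have "poly_mat ([:0, 1:] ^ n) A = 0\<^sub>m n n" using poly_mat_similar[OF s(1) A, of "[:0, 1:] ^ n"] B by simp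
  then show ?thesis using A by (simp add: poly_mat_pow poly_mat_X)
qed

lemma collision:
  fixes f :: "nat \<Rightarrow> nat"
  assumes "k < d" "f \<in> {0..<d} \<rightarrow>\<^sub>E {0..<k}"
  obtains i j where "i < d" "j < d" "i \<noteq> j" "f i = f j"
proof -
  have "f ` {0..<d} \<subseteq> {0..<k}" using assms(2) by (metis PiE_mem image_subsetI)
  then have "card (f ` {0..<d}) \<le> k" using card_mono[of "{0..<k}" "f ` {0..<d}"] by simp
  then have "\<not> inj_on f {0..<d}" using assms(1) by (intro pigeonhole) simp
  then show ?thesis using that unfolding inj_on_def by (meson atLeastLessThan_iff)
qed

section \<open>Gram determinants of the trace form, perturbation and diagonalizability\<close>

text \<open>The trace pairing of polynomials in A factors through evaluation on the spectrum, so the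
  Gram matrix is a product through a space of dimension smaller than d. In the Cauchy-Binet
  expansion every term then has a repeated row.\<close>

lemma gram_degenerate:
  fixes A :: "'a::alg_closed_field mat"
  assumes A: "A \<in> carrier_mat n n" and d: "card (spectrum A) < d"
  shows "det (mat d d (\<lambda>(i, j). mat_trace (poly_mat (u i * v j) A))) = 0"
proof -
  obtain m where m: "\<And>f. mat_trace (poly_mat f A) = (\<Sum>c\<in>spectrum A. of_nat (m c) * Polynomial.poly f c)"
    using trace_poly_mat_spectrum[OF A] by blast
  let ?k = "card (spectrum A)"
  obtain e where e: "bij_betw e {..<?k} (spectrum A)"
    using ex_bij_betw_nat_finite[OF spectrum_finite[OF A]] by (auto simp: atLeast0LessThan)
  let ?U = "mat d ?k (\<lambda>(i, l). Polynomial.poly (u i) (e l))"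
  let ?V = "mat ?k d (\<lambda>(l, j). of_nat (m (e l)) * Polynomial.poly (v j) (e l))"
  have UV: "mat d d (\<lambda>(i, j). mat_trace (poly_mat (u i * v j) A)) = ?U * ?V"
  proof (rule eq_matI)
    fix i j assume "i < dim_row (?U * ?V)" "j < dim_col (?U * ?V)"
    then have ij: "i < d" "j < d" by auto
    then have "(?U * ?V) $$ (i, j) = (\<Sum>l<?k. Polynomial.poly (u i) (e l) * (of_nat (m (e l)) * Polynomial.poly (v j) (e l)))"
      by (simp add: scalar_prod_def atLeast0LessThan)
    also have "\<dots> = (\<Sum>c\<in>spectrum A. Polynomial.poly (u i) c * (of_nat (m c) * Polynomial.poly (v j) c))"
      by (rule sum.reindex_bij_betw[OF e])
    finally show "mat d d (\<lambda>(i, j). mat_trace (poly_mat (u i * v j) A)) $$ (i, j) = (?U * ?V) $$ (i, j)"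
      using ij by (simp add: m algebra_simps)
  qed auto
  have "det (?U * ?V) = (\<Sum>f\<in>{0..<d} \<rightarrow>\<^sub>E {0..<?k}. (\<Prod>i<d. ?U $$ (i, f i)) * det (mat d d (\<lambda>(i, j). ?V $$ (f i, j))))"
    by (rule det_mult_rect) auto
  also have "\<dots> = 0"
  proof (rule sum.neutral, rule ballI)
    fix f assume f: "f \<in> {0..<d} \<rightarrow>\<^sub>E {0..<?k}"
    then obtain i j where ij: "i < d" "j < d" "i \<noteq> j" "f i = f j"
      by (rule collision[OF d])
    have "det (mat d d (\<lambda>(i, j). ?V $$ (f i, j))) = 0"
    proof (rule det_identical_rows)
      show "row (mat d d (\<lambda>(i, j). ?V $$ (f i, j))) i = row (mat d d (\<lambda>(i, j). ?V $$ (f i, j))) j"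
        using ij by (intro eq_vecI) simp_all
    qed (use ij in simp_all)
    then show "(\<Prod>i<d. ?U $$ (i, f i)) * det (mat d d (\<lambda>(i, j). ?V $$ (f i, j))) = 0" by (simp only: mult_zero_right)
  qed
  finally show ?thesis unfolding UV .
qed

text \<open>A polynomial of degree below d that is orthogonal to all polynomials of degree below d
  vanishes at every eigenvalue, as one sees by pairing it with Lagrange polynomials. With d
  eigenvalues it must be zero. A kernel vector \<open>w\<close> of the Gram matrix gives such a
  polynomial \<open>g\<close>.\<close>

lemma gram_nondegenerate:
  fixes A :: "'a::{alg_closed_field,field_char_0} mat"
  assumes A: "A \<in> carrier_mat n n" and d: "d = card (spectrum A)"
  shows "det (mat d d (\<lambda>(i, j). mat_trace (poly_mat ([:0, 1:] ^ i * [:0, 1:] ^ j) A))) \<noteq> 0" (is "det ?G \<noteq> 0")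
proof
  assume "det ?G = 0"
  moreover have G: "?G \<in> carrier_mat d d" by simp
  ultimately obtain w where w: "w \<in> carrier_vec d" "w \<noteq> 0\<^sub>v d" "?G *\<^sub>v w = 0\<^sub>v d"
    using det_0_iff_vec_prod_zero by blast
  obtain m where m: "\<And>f. mat_trace (poly_mat f A) = (\<Sum>c\<in>spectrum A. of_nat (m c) * Polynomial.poly f c)"
    "\<And>c. c \<in> spectrum A \<Longrightarrow> m c > 0" using trace_poly_mat_spectrum[OF A] by blast
  have fin: "finite (spectrum A)" using spectrum_finite[OF A] .
  define \<tau> where "\<tau> f = (\<Sum>c\<in>spectrum A. of_nat (m c) * Polynomial.poly f c)" for f
  have \<tau>_sum: "\<tau> (\<Sum>i\<in>I. Polynomial.smult (a i) (f i)) = (\<Sum>i\<in>I. a i * \<tau> (f i))" for I :: "nat set" and a f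
    unfolding \<tau>_def poly_sum sum_distrib_left by (subst sum.swap) (simp add: algebra_simps)
  define g where "g = (\<Sum>i<d. Polynomial.smult (vec_index w i) ([:0, 1:] ^ i))"
  have g0: "\<tau> ([:0, 1:] ^ j * g) = 0" if "j < d" for j
  proof -
    have "[:0, 1:] ^ j * g = (\<Sum>i<d. Polynomial.smult (vec_index w i) ([:0, 1:] ^ j * [:0, 1:] ^ i))"
      unfolding g_def sum_distrib_left by simp
    then have "\<tau> ([:0, 1:] ^ j * g) = (\<Sum>i<d. vec_index w i * \<tau> ([:0, 1:] ^ j * [:0, 1:] ^ i))"
      unfolding \<tau>_sum[symmetric] by simp
    also have "\<dots> = vec_index (?G *\<^sub>v w) j" using that w(1)
      by (auto simp: scalar_prod_def m \<tau>_def atLeast0LessThan algebra_simps intro!: sum.cong)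
    finally show ?thesis using w that by simp
  qed
  have hg: "\<tau> (h * g) = 0" if "degree h < d" for h
  proof -
    have "h = (\<Sum>i<d. Polynomial.smult (Polynomial.coeff h i) ([:0, 1:] ^ i))"
      by (rule poly_eqI) (use that in \<open>auto simp: coeff_sum coeff_eq_0 monom_altdef[of 1, simplified, symmetric] if_distrib cong: if_cong\<close>)
    then have "h * g = (\<Sum>i<d. Polynomial.smult (Polynomial.coeff h i) ([:0, 1:] ^ i * g))"
      by (metis (no_types, lifting) mult_smult_left sum.cong sum_distrib_right)
    then show ?thesis using g0 by (simp add: \<tau>_sum)
  qed
  have root: "Polynomial.poly g c = 0" if c: "c \<in> spectrum A" for c
  proof -
    \<comment> \<open>Up to a scalar this is the Lagrange polynomial for c; only the term at c
      remains in the pairing with g.\<close>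
    define h where "h = (\<Prod>e\<in>spectrum A - {c}. [:- e, 1:])"
    have "degree h = card (spectrum A - {c})"
      unfolding h_def by (subst degree_prod_eq_sum_degree) auto
    moreover have "card (spectrum A) > 0" using c fin card_gt_0_iff by blast
    ultimately have "degree h < d" using card_Diff_singleton[OF c] d by simp
    then have "\<tau> (h * g) = 0" by (rule hg)
    moreover have "\<tau> (h * g) = (\<Sum>e\<in>{c}. of_nat (m e) * Polynomial.poly (h * g) e)"
      unfolding \<tau>_def using c fin by (intro sum.mono_neutral_right) (auto simp: h_def poly_prod prod_zero_iff)
    moreover have "Polynomial.poly h c \<noteq> 0" using fin by (auto simp: h_def poly_prod prod_zero_iff)
    ultimately show ?thesis using m(2)[OF c] by auto
  qed
  have cg: "Polynomial.coeff g i = (if i < d then vec_index w i else 0)" for i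
    unfolding g_def by (auto simp: coeff_sum monom_altdef[of 1, simplified, symmetric] if_distrib cong: if_cong)
  have "g = 0"
  proof (rule ccontr)
    assume g: "g \<noteq> 0"
    have "d \<le> card {c. Polynomial.poly g c = 0}" unfolding d using root by (intro card_mono poly_roots_finite g) auto
    also have "\<dots> \<le> degree g" using g by (rule card_poly_roots_bound)
    finally have "Polynomial.coeff g (degree g) = 0" using cg[of "degree g"] by simp
    with g show False by simp
  qed
  then have "w = 0\<^sub>v d" using cg w(1) by (intro eq_vecI) (auto, metis)
  with w show False by simp
qed

text \<open>The expansion tr f(A + tY) = tr f(A) + t tr(f'(A) Y) modulo t^2. \<open>A\<close> and
  \<open>Y\<close> need not commute; cyclicity of the trace makes the formula hold all the
  same.\<close>

lemma trace_poly_mat_perturb: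
  fixes A Y :: "'a::idom mat"
  assumes A: "A \<in> carrier_mat n n" and Y: "Y \<in> carrier_mat n n"
  defines "At \<equiv> map_mat (\<lambda>x. [:x:]) A + [:0, 1:] \<cdot>\<^sub>m map_mat (\<lambda>x. [:x:]) Y"
  shows "Polynomial.coeff (mat_trace (poly_mat (map_poly (\<lambda>x. [:x:]) f) At)) 0 = mat_trace (poly_mat f A)"
    and "Polynomial.coeff (mat_trace (poly_mat (map_poly (\<lambda>x. [:x:]) f) At)) 1 = mat_trace (poly_mat (pderiv f) A * Y)"
proof -
  have At: "At \<in> carrier_mat n n" unfolding At_def using A Y by auto
  let ?c0 = "map_mat (\<lambda>p. Polynomial.coeff p 0)" and ?c1 = "map_mat (\<lambda>p. Polynomial.coeff p 1)"
  let ?l = "map_poly (\<lambda>x. [:x:])"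
  have ccar: "?c0 M \<in> carrier_mat n n" "?c1 M \<in> carrier_mat n n" if "M \<in> carrier_mat n n" for M :: "'a Polynomial.poly mat"
    using that by auto
  have c0_mult: "?c0 (M * N) = ?c0 M * ?c0 N" and c1_mult: "?c1 (M * N) = ?c0 M * ?c1 N + ?c1 M * ?c0 N"
    if "M \<in> carrier_mat n n" "N \<in> carrier_mat n n" for M N :: "'a Polynomial.poly mat"
  proof -
    have c1: "Polynomial.coeff (p * q) 1 = Polynomial.coeff p 0 * Polynomial.coeff q 1 + Polynomial.coeff p 1 * Polynomial.coeff q 0"
      for p q :: "'a Polynomial.poly" by (simp add: coeff_mult)
    show "?c0 (M * N) = ?c0 M * ?c0 N"
      using that by (intro eq_matI) (auto simp: scalar_prod_def coeff_sum coeff_mult)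
    show "?c1 (M * N) = ?c0 M * ?c1 N + ?c1 M * ?c0 N"
      using that by (intro eq_matI) (auto simp: scalar_prod_def coeff_sum c1[unfolded One_nat_def] sum.distrib)
  qed
  have c0At: "?c0 At = A" and c1At: "?c1 At = Y" unfolding At_def using A Y by (auto intro!: eq_matI)
  \<comment> \<open>The linear coefficient of f(A + tY) is in general not f'(A) Y, but both have the
    same trace against every polynomial g in A. Carrying g along makes the induction work: cyclicity
    moves a factor A next to g(A), which replaces g by g T.\<close>
  have *: "?c0 (poly_mat (?l f) At) = poly_mat f A \<and>
    (\<forall>g. mat_trace (?c1 (poly_mat (?l f) At) * poly_mat g A) = mat_trace (poly_mat (pderiv f * g) A * Y))" for f
  proof (induct f)
    case 0
    have "mat_trace (?c1 (poly_mat 0 At) * poly_mat g A) = 0" "mat_trace (poly_mat 0 A * Y) = 0" for g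
      using A Y At by (auto simp: poly_mat_0[of _ n] mat_trace_def scalar_prod_def intro!: sum.neutral)
    then show ?case using A At by (auto simp: poly_mat_0[of _ n] intro!: eq_matI)
  next
    case (pCons a f)
    let ?F = "poly_mat (?l f) At"
    have F: "?F \<in> carrier_mat n n" using At by simp
    have l: "?l (pCons a f) = pCons [:a:] (?l f)"
      by (rule poly_eqI) (simp add: coeff_map_poly coeff_pCons split: nat.split)
    have e: "poly_mat (?l (pCons a f)) At = [:a:] \<cdot>\<^sub>m 1\<^sub>m n + At * ?F" unfolding l by (rule poly_mat_pCons[OF At])
    have "?c0 (poly_mat (?l (pCons a f)) At) = a \<cdot>\<^sub>m 1\<^sub>m n + ?c0 (At * ?F)"
      unfolding e using At F by (intro eq_matI) auto
    also have "\<dots> = poly_mat (pCons a f) A"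
      using c0_mult[OF At F] c0At pCons poly_mat_pCons[OF A] by simp
    finally have 0: "?c0 (poly_mat (?l (pCons a f)) At) = poly_mat (pCons a f) A" .
    have e1: "?c1 (poly_mat (?l (pCons a f)) At) = A * ?c1 ?F + Y * poly_mat f A"
    proof -
      have "?c1 (poly_mat (?l (pCons a f)) At) = ?c1 (At * ?F)"
        unfolding e using At F by (intro eq_matI) auto
      then show ?thesis using c1_mult[OF At F] c0At c1At pCons by simp
    qed
    have "mat_trace (?c1 (poly_mat (?l (pCons a f)) At) * poly_mat g A) =
        mat_trace (poly_mat (pderiv (pCons a f) * g) A * Y)" for g
    proof -
      let ?G = "poly_mat g A" and ?D = "?c1 ?F" and ?f = "poly_mat f A"
      have G: "?G \<in> carrier_mat n n" and D: "?D \<in> carrier_mat n n" and f: "?f \<in> carrier_mat n n"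
        and D': "poly_mat (pderiv f * (g * [:0, 1:])) A \<in> carrier_mat n n" "poly_mat (f * g) A \<in> carrier_mat n n"
        using A ccar(2)[OF F] by simp_all
      have "(A * ?D + Y * ?f) * ?G = A * ?D * ?G + Y * ?f * ?G"
        by (rule add_mult_distrib_mat[of _ n n _ _ n]) (use A D Y f G in auto)
      then have "mat_trace ((A * ?D + Y * ?f) * ?G) = mat_trace (A * ?D * ?G) + mat_trace (Y * ?f * ?G)"
        using mat_trace_add[OF mult_carrier_mat[OF mult_carrier_mat[OF A D] G] mult_carrier_mat[OF mult_carrier_mat[OF Y f] G]]
        by (simp only:)
      also have "A * ?D * ?G = A * (?D * ?G)" by (rule assoc_mult_mat[OF A D G])
      also have "mat_trace (A * (?D * ?G)) = mat_trace (?D * ?G * A)"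
        by (rule mat_trace_commute[OF A]) (use D G in auto)
      also have "?D * ?G * A = ?D * (?G * A)" by (rule assoc_mult_mat[OF D G A])
      also have "?G * A = poly_mat (g * [:0, 1:]) A" using poly_mat_mult[OF A, of g "[:0,1:]"] poly_mat_X[OF A] by simp
      also have "mat_trace (?D * poly_mat (g * [:0, 1:]) A) = mat_trace (poly_mat (pderiv f * (g * [:0, 1:])) A * Y)"
        using pCons by blast
      also have "Y * ?f * ?G = Y * (?f * ?G)" by (rule assoc_mult_mat[OF Y f G])
      also have "mat_trace (Y * (?f * ?G)) = mat_trace (?f * ?G * Y)"
        by (rule mat_trace_commute[OF Y]) (use f G in auto)
      also have "?f * ?G = poly_mat (f * g) A" by (rule poly_mat_mult[OF A, symmetric])
      also have "mat_trace (poly_mat (pderiv f * (g * [:0, 1:])) A * Y) + mat_trace (poly_mat (f * g) A * Y) =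
          mat_trace (poly_mat (pderiv f * (g * [:0, 1:])) A * Y + poly_mat (f * g) A * Y)"
        using D' Y by (intro mat_trace_add[symmetric, of _ n]) auto
      also have "poly_mat (pderiv f * (g * [:0, 1:])) A * Y + poly_mat (f * g) A * Y =
          (poly_mat (pderiv f * (g * [:0, 1:])) A + poly_mat (f * g) A) * Y"
        by (rule add_mult_distrib_mat[symmetric]) (use D' Y in auto)
      also have "poly_mat (pderiv f * (g * [:0, 1:])) A + poly_mat (f * g) A = poly_mat (pderiv f * (g * [:0, 1:]) + f * g) A"
        by (rule poly_mat_add[OF A, symmetric])
      also have "pderiv f * (g * [:0, 1:]) + f * g = pderiv (pCons a f) * g"
        by (simp add: pderiv_pCons algebra_simps)
      finally show ?thesis unfolding e1 .
    qed
    then show ?case using 0 by blast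
  qed
  have F: "poly_mat (?l f) At \<in> carrier_mat n n" using At by simp
  have tr: "Polynomial.coeff (mat_trace M) k = mat_trace (map_mat (\<lambda>p. Polynomial.coeff p k) M)"
    if "M \<in> carrier_mat n n" for M :: "'a Polynomial.poly mat" and k
    using that by (auto simp: mat_trace_def coeff_sum)
  show "Polynomial.coeff (mat_trace (poly_mat (?l f) At)) 0 = mat_trace (poly_mat f A)"
    using * tr[OF F, of 0] by simp
  have "?c1 (poly_mat (?l f) At) * poly_mat 1 A = ?c1 (poly_mat (?l f) At)"
    unfolding poly_mat_1[OF A] by (rule right_mult_one_mat[OF ccar(2)[OF F]])
  then have "mat_trace (?c1 (poly_mat (?l f) At)) = mat_trace (poly_mat (pderiv f * 1) A * Y)"
    using * by metis
  then show "Polynomial.coeff (mat_trace (poly_mat (?l f) At)) 1 = mat_trace (poly_mat (pderiv f) A * Y)"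
    using tr[OF F, of 1] by simp
qed

lemma poly_eq_0_if_nats:
  fixes p :: "'a::{idom,ring_char_0} Polynomial.poly"
  assumes "\<And>k :: nat. Polynomial.poly p (of_nat k) = 0"
  shows "p = 0"
proof (rule ccontr)
  assume "p \<noteq> 0"
  then have "finite {x. Polynomial.poly p x = 0}" by (rule poly_roots_finite)
  moreover have "range (of_nat :: nat \<Rightarrow> 'a) \<subseteq> {x. Polynomial.poly p x = 0}" using assms by auto
  ultimately have "finite (range (of_nat :: nat \<Rightarrow> 'a))" by (rule rev_finite_subset)
  then show False using infinite_UNIV_char_0 by (auto dest!: finite_imageD simp: inj_of_nat)
qed

lemma poly_mat_perturb_eval:
  fixes A Y :: "'a::comm_ring_1 mat"
  assumes A: "A \<in> carrier_mat n n" and Y: "Y \<in> carrier_mat n n"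
  defines "At \<equiv> map_mat (\<lambda>x. [:x:]) A + [:0, 1:] \<cdot>\<^sub>m map_mat (\<lambda>x. [:x:]) Y"
  shows "Polynomial.poly (mat_trace (poly_mat (map_poly (\<lambda>x. [:x:]) f) At)) c = mat_trace (poly_mat f (A + c \<cdot>\<^sub>m Y))"
proof -
  have hom: "comm_ring_hom (\<lambda>p. Polynomial.poly p c)" by unfold_locales auto
  have At: "At \<in> carrier_mat n n" unfolding At_def using A Y by auto
  have "map_mat (\<lambda>p. Polynomial.poly p c) At = A + c \<cdot>\<^sub>m Y" unfolding At_def using A Y by (intro eq_matI) auto
  moreover have "map_poly (\<lambda>p. Polynomial.poly p c) (map_poly (\<lambda>x. [:x:]) f) = f"
    by (rule poly_eqI) (simp add: coeff_map_poly)
  ultimately have "map_mat (\<lambda>p. Polynomial.poly p c) (poly_mat (map_poly (\<lambda>x. [:x:]) f) At) = poly_mat f (A + c \<cdot>\<^sub>m Y)"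
    using poly_mat_hom[OF hom At] by simp
  then show ?thesis using mat_trace_hom[OF hom, of "poly_mat (map_poly (\<lambda>x. [:x:]) f) At" n] At by simp
qed

text \<open>If no perturbation of \<open>A\<close> in the direction \<open>Y\<close> has more eigenvalues than \<open>A\<close>, the Gram determinant
  of \<open>1, T, \<dots>, T\<^sup>d\<^sup>-\<^sup>1, u\<close> against \<open>1, T, \<dots>, T\<^sup>d\<^sup>-\<^sup>1, v\<close> vanishes along the perturbation; if \<open>u\<close> and \<open>v\<close> vanish on
  the spectrum, its derivative is a nonzero multiple of \<open>tr ((uv)'(A) Y)\<close>.\<close>

lemma trace_pderiv_zero:
  fixes A Y :: "'a::{alg_closed_field,field_char_0} mat"
  assumes A: "A \<in> carrier_mat n n" and Y: "Y \<in> carrier_mat n n"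
    and max: "\<And>k :: nat. card (spectrum (A + of_nat k \<cdot>\<^sub>m Y)) \<le> card (spectrum A)"
    and u: "\<And>c. c \<in> spectrum A \<Longrightarrow> Polynomial.poly u c = 0" and v: "\<And>c. c \<in> spectrum A \<Longrightarrow> Polynomial.poly v c = 0"
  shows "mat_trace (poly_mat (pderiv (u * v)) A * Y) = 0"
proof -
  define d where "d = card (spectrum A)"
  define At where "At = map_mat (\<lambda>x. [:x:]) A + [:0, 1:] \<cdot>\<^sub>m map_mat (\<lambda>x. [:x:]) Y"
  define us where "us i = (if i < d then [:0, 1:] ^ i else u)" for i
  define vs where "vs i = (if i < d then [:0, 1:] ^ i else v)" for i
  define \<tau> where "\<tau> f = mat_trace (poly_mat (map_poly (\<lambda>x. [:x:]) f) At)" for f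
  define G where "G = mat (Suc d) (Suc d) (\<lambda>(i, j). \<tau> (us i * vs j))"
  have G: "G \<in> carrier_mat (Suc d) (Suc d)" by (simp add: G_def)
  have tr0: "mat_trace (poly_mat f A) = 0" if "\<And>c. c \<in> spectrum A \<Longrightarrow> Polynomial.poly f c = 0" for f
    using trace_poly_mat_spectrum[OF A] that by (metis (no_types, lifting) mult_zero_right sum.neutral)
  have "det G = 0"
  proof (rule poly_eq_0_if_nats)
    fix k :: nat
    have "Polynomial.poly (det G) (of_nat k) = det (mat (Suc d) (Suc d) (\<lambda>(i, j). mat_trace (poly_mat (us i * vs j) (A + of_nat k \<cdot>\<^sub>m Y))))"
      by (rule poly_det_cong[of _ "Suc d"])
        (auto simp: G_def \<tau>_def At_def poly_mat_perturb_eval[OF A Y])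
    also have "\<dots> = 0"
      by (rule gram_degenerate[of _ n]) (use A Y max[of k] in \<open>auto simp: d_def less_Suc_eq_le\<close>)
    finally show "Polynomial.poly (det G) (of_nat k) = 0" .
  qed
  define t :: "'a Polynomial.poly" where "t = [:0, 1:]"
  \<comment> \<open>Since u vanishes on the spectrum, all entries of the last row of
    \<open>G\<close> vanish at t = 0. Here t is divided out of that row, so the determinant of
    \<open>H\<close> at 0 is the linear coefficient of the determinant of \<open>G\<close>.\<close>
  define H where "H = mat (Suc d) (Suc d) (\<lambda>(i, j). if i = d then poly_shift 1 (\<tau> (us i * vs j)) else \<tau> (us i * vs j))"
  have H: "H \<in> carrier_mat (Suc d) (Suc d)" by (simp add: H_def)
  have last_row: "\<tau> (u * vs j) = t * poly_shift 1 (\<tau> (u * vs j))" if "j \<le> d" for j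
  proof -
    have "Polynomial.coeff (\<tau> (u * vs j)) 0 = 0"
      unfolding \<tau>_def At_def trace_poly_mat_perturb(1)[OF A Y] by (rule tr0) (simp add: u)
    then show ?thesis unfolding t_def
      by (intro poly_eqI) (auto simp: coeff_poly_shift coeff_pCons split: nat.split)
  qed
  have "G = multrow d t H"
    using last_row by (intro eq_matI) (auto simp: G_def H_def us_def)
  then have "det G = t * det H" using H det_multrow[of d "Suc d" H t] by simp
  with \<open>det G = 0\<close> have "det H = 0" unfolding t_def by simp
  define H0 where "H0 = map_mat (\<lambda>p. Polynomial.coeff p 0) H"
  have H0: "H0 \<in> carrier_mat (Suc d) (Suc d)" by (simp add: H0_def H_def)
  let ?G0 = "mat d d (\<lambda>(i, j). mat_trace (poly_mat ([:0, 1:] ^ i * [:0, 1:] ^ j) A))"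
  let ?t = "mat_trace (poly_mat (pderiv (u * v)) A * Y)"
  let ?r = "mat 1 d (\<lambda>(i, j). H0 $$ (d, j))"
  have "Polynomial.poly (det H) 0 = det H0"
    by (rule poly_det_cong[OF H0 H]) (auto simp: H0_def H_def poly_0_coeff_0)
  then have "det H0 = 0" using \<open>det H = 0\<close> by simp
  \<comment> \<open>At t = 0 the last column vanishes above the corner because v vanishes on the
    spectrum, and the corner is the linear coefficient of tr((uv)(A + tY)). The upper left block is
    the nondegenerate Gram matrix of \<open>A\<close>.\<close>
  have blk: "H0 = four_block_mat ?G0 (0\<^sub>m d 1) ?r (?t \<cdot>\<^sub>m 1\<^sub>m 1)"
  proof (rule eq_matI, goal_cases)
    case (1 i j)
    then have ij: "i < d \<or> i = d" "j < d \<or> j = d" by auto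
    have 1: "H0 $$ (i, j) = mat_trace (poly_mat ([:0, 1:] ^ i * [:0, 1:] ^ j) A)" if "i < d" "j < d"
      using that trace_poly_mat_perturb(1)[OF A Y] by (simp add: H0_def H_def us_def vs_def \<tau>_def At_def)
    have 2: "H0 $$ (i, j) = 0" if "i < d" "j = d"
    proof -
      have "H0 $$ (i, j) = mat_trace (poly_mat ([:0, 1:] ^ i * v) A)"
        using that trace_poly_mat_perturb(1)[OF A Y] by (simp add: H0_def H_def us_def vs_def \<tau>_def At_def)
      also have "\<dots> = 0" by (rule tr0) (simp add: v)
      finally show ?thesis .
    qed
    have 3: "H0 $$ (i, j) = ?t" if "i = d" "j = d"
      using that trace_poly_mat_perturb(2)[OF A Y, of "u * v"]
      by (simp add: H0_def H_def us_def vs_def \<tau>_def At_def coeff_poly_shift)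
    show ?case using ij 1 2 3 by (elim disjE) auto
  qed (auto simp: H0_def H_def)
  have "det (four_block_mat ?G0 (0\<^sub>m d 1) ?r (?t \<cdot>\<^sub>m 1\<^sub>m 1)) = det ?G0 * det (?t \<cdot>\<^sub>m 1\<^sub>m 1)"
    by (rule det_four_block_mat_upper_right_zero_col) auto
  then have "det H0 = det ?G0 * ?t" unfolding blk[symmetric] by (simp add: det_smult)
  then show ?thesis using \<open>det H0 = 0\<close> gram_nondegenerate[OF A d_def] by simp
qed

lemma bezout_alg_closed:
  fixes p q :: "'a::{alg_closed_field,normalization_euclidean_semiring,factorial_ring_gcd,semiring_gcd_mult_normalize} Polynomial.poly"
  assumes "\<And>c. \<not> (Polynomial.poly p c = 0 \<and> Polynomial.poly q c = 0)"
  obtains a b where "a * p + b * q = 1"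
proof -
  have "p \<noteq> 0 \<or> q \<noteq> 0" using assms by auto
  have "coprime p q"
  proof (rule coprimeI)
    fix d assume d: "d dvd p" "d dvd q"
    then have "d \<noteq> 0" using \<open>p \<noteq> 0 \<or> q \<noteq> 0\<close> by auto
    have "degree d = 0"
    proof (rule ccontr)
      assume "degree d \<noteq> 0"
      then obtain z where "Polynomial.poly d z = 0" using alg_closed_imp_poly_has_root by blast
      then show False using assms d by (metis dvd_trans poly_eq_0_iff_dvd)
    qed
    then show "is_unit d" using \<open>d \<noteq> 0\<close> is_unit_iff_degree by blast
  qed
  then have "fst (bezout_coefficients p q) * p + snd (bezout_coefficients p q) * q = 1"
    unfolding bezout_coefficients_fst_snd by (rule coprime_imp_gcd_eq_1)
  then show ?thesis using that by blast
qed

lemma min_radical_pderiv: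
  assumes A: "A \<in> carrier_mat n n" and c: "c \<in> spectrum (A :: 'a::field_char_0 mat)"
  shows "Polynomial.poly (pderiv (min_radical A)) c \<noteq> 0"
proof -
  have fin: "finite (spectrum A)" by (rule spectrum_finite[OF A])
  have "min_radical A = [:- c, 1:] * (\<Prod>e\<in>spectrum A - {c}. [:- e, 1:])"
    unfolding min_radical_def using fin c by (subst prod.remove[OF fin c]) simp
  then have "Polynomial.poly (pderiv (min_radical A)) c = Polynomial.poly (\<Prod>e\<in>spectrum A - {c}. [:- e, 1:]) c"
    by (simp only: pderiv_mult) (simp add: pderiv_pCons)
  also have "\<dots> \<noteq> 0" using fin by (auto simp: poly_prod prod_zero_iff)
  finally show ?thesis .
qed

text \<open>A matrix with the maximal number of eigenvalues in an algebra with nondegenerate trace form is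
  diagonalizable.\<close>

lemma maximal_spectrum_imp_diagonalizable:
  fixes A :: "'a::{alg_closed_field,field_char_0,normalization_euclidean_semiring,factorial_ring_gcd,semiring_gcd_mult_normalize} mat"
  assumes A: "A \<in> carrier_mat n n" and S: "S \<subseteq> carrier_mat n n"
    and max: "\<And>(k :: nat) Y. Y \<in> S \<Longrightarrow> card (spectrum (A + of_nat k \<cdot>\<^sub>m Y)) \<le> card (spectrum A)"
    and nondeg: "\<And>f. (\<And>Y. Y \<in> S \<Longrightarrow> mat_trace (poly_mat f A * Y) = 0) \<Longrightarrow> poly_mat f A = 0\<^sub>m n n"
  shows "poly_mat (min_radical A) A = 0\<^sub>m n n"
proof -
  let ?q = "min_radical A"
  define k where "k = (LEAST k. poly_mat (?q ^ k) A = 0\<^sub>m n n)"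
  have k: "poly_mat (?q ^ k) A = 0\<^sub>m n n" unfolding k_def using min_radical_nilpotent[OF A] by (rule LeastI)
  have less: "poly_mat (?q ^ j) A \<noteq> 0\<^sub>m n n" if "j < k" for j using that not_less_Least unfolding k_def by blast
  have "k \<le> 1"
  proof (rule ccontr)
    assume "\<not> k \<le> 1"
    then obtain m where m: "k = Suc (Suc m)" by (metis One_nat_def Suc_leI le_Suc_ex not_less_eq_eq add_Suc plus_1_eq_Suc)
    \<comment> \<open>Here k = m + 2, so both q and q^(m+1) vanish on the spectrum, and the
      derivative of their product q^k is k times \<open>?f\<close>. Nondegeneracy gives f(A) = 0;
      since q' is prime to q this forces q^(m+1)(A) = 0, against the minimality of k.\<close>
    let ?f = "?q ^ Suc m * pderiv ?q"
    have "mat_trace (poly_mat ?f A * Y) = 0" if Y: "Y \<in> S" for Y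
    proof -
      have Yc: "Y \<in> carrier_mat n n" using Y S by auto
      have "mat_trace (poly_mat (pderiv (?q * ?q ^ Suc m)) A * Y) = 0"
        by (rule trace_pderiv_zero[OF A Yc max[OF Y]]) (simp_all add: min_radical_root[OF A])
      moreover have "pderiv (?q * ?q ^ Suc m) = Polynomial.smult (of_nat k) ?f"
        using pderiv_power_Suc[of ?q "Suc m"] by (simp add: m)
      ultimately have "of_nat k * mat_trace (poly_mat ?f A * Y) = 0"
        using A Yc mat_trace_smult[of "poly_mat ?f A * Y" n "of_nat k"]
        by (simp add: poly_mat_smult[OF A] mult_smult_assoc_mat[of _ n n _ n] mult_carrier_mat[of _ n n _ n])
      moreover have "of_nat k \<noteq> (0 :: 'a)" unfolding m of_nat_eq_0_iff by simp
      ultimately show ?thesis by (simp only: mult_eq_0_iff) blast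
    qed
    then have 0: "poly_mat ?f A = 0\<^sub>m n n" by (rule nondeg)
    obtain a b where ab: "a * ?q + b * pderiv ?q = 1"
      using bezout_alg_closed[of ?q "pderiv ?q"] min_radical_root[OF A] min_radical_pderiv[OF A] by blast
    have "?q ^ Suc m = (a * ?q + b * pderiv ?q) * ?q ^ Suc m" unfolding ab by simp
    also have "\<dots> = a * ?q ^ k + b * ?f" unfolding m by (simp add: algebra_simps)
    finally have "poly_mat (?q ^ Suc m) A = poly_mat (a * ?q ^ k + b * ?f) A" by (rule arg_cong)
    also have "\<dots> = poly_mat a A * poly_mat (?q ^ k) A + poly_mat b A * poly_mat ?f A"
      by (simp only: poly_mat_add[OF A] poly_mat_mult[OF A])
    also have "\<dots> = 0\<^sub>m n n" unfolding k 0 by (simp add: right_mult_zero_mat[OF poly_mat_carrier[OF A]])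
    finally show False using less[of "Suc m"] m by simp
  qed
  then have "?q = ?q ^ k * ?q ^ (1 - k)" by (cases k) auto
  then have "poly_mat ?q A = poly_mat (?q ^ k) A * poly_mat (?q ^ (1 - k)) A"
    using poly_mat_mult[OF A, of "?q ^ k" "?q ^ (1 - k)"] by simp
  then show ?thesis unfolding k using left_mult_zero_mat[OF poly_mat_carrier[OF A]] by simp
qed

lemma poly_mat_linear:
  assumes A: "A \<in> carrier_mat n n"
  shows "poly_mat [:c, 1:] A = c \<cdot>\<^sub>m 1\<^sub>m n + A"
proof -
  have "poly_mat [:1:] A = 1\<^sub>m n" using poly_mat_1[OF A] by (simp add: one_pCons)
  then show ?thesis using poly_mat_pCons[OF A, of c "[:1:]"] A by simp
qed

text \<open>The squarefree annihilating polynomial and (T - c)^k have a greatest common divisor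
  dividing T - c, so T - c is a combination of the two. Hence whatever is killed by a power of A - c
  is killed by A - c.\<close>

lemma diagonalizable_gen_eigenvector:
  fixes A :: "'a::{alg_closed_field,field_char_0,normalization_euclidean_semiring,factorial_ring_gcd,semiring_gcd_mult_normalize} mat"
  assumes A: "A \<in> carrier_mat n n" and q: "poly_mat (min_radical A) A = 0\<^sub>m n n"
    and v: "v \<in> carrier_vec n" and k: "poly_mat ([:- c, 1:] ^ k) A *\<^sub>v v = 0\<^sub>v n"
  shows "A *\<^sub>v v = c \<cdot>\<^sub>v v"
proof -
  let ?q = "min_radical A"
  have fin: "finite (spectrum A)" by (rule spectrum_finite[OF A])
  obtain r s where rs: "[:- c, 1:] = r * [:- c, 1:] ^ k + s * ?q"
  proof -
    define q1 where "q1 = (\<Prod>e\<in>spectrum A - {c}. [:- e, 1:])"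
    have q1: "Polynomial.poly q1 c \<noteq> 0" using fin by (auto simp: q1_def poly_prod prod_zero_iff)
    obtain a b where ab: "a * [:- c, 1:] ^ k + b * q1 = 1"
      using bezout_alg_closed[of "[:- c, 1:] ^ k" q1] q1 by (auto simp: power_0_left split: if_splits)
    have "[:- c, 1:] * q1 = ?q \<or> q1 = ?q"
      unfolding min_radical_def q1_def using prod.remove[OF fin, of c "\<lambda>e. [:- e, 1:]"] by (cases "c \<in> spectrum A") simp_all
    then obtain s' where s': "[:- c, 1:] * q1 = s' * ?q" by (metis mult_1)
    have "[:- c, 1:] = [:- c, 1:] * (a * [:- c, 1:] ^ k + b * q1)" unfolding ab by simp
    also have "\<dots> = ([:- c, 1:] * a) * [:- c, 1:] ^ k + b * ([:- c, 1:] * q1)"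
      by (simp only: algebra_simps)
    also have "\<dots> = ([:- c, 1:] * a) * [:- c, 1:] ^ k + (b * s') * ?q" unfolding s' by (simp only: mult.assoc)
    finally show ?thesis by (rule that)
  qed
  have "poly_mat [:- c, 1:] A = poly_mat r A * poly_mat ([:- c, 1:] ^ k) A + poly_mat s A * poly_mat ?q A"
    by (subst rs) (simp only: poly_mat_add[OF A] poly_mat_mult[OF A])
  also have "\<dots> = poly_mat r A * poly_mat ([:- c, 1:] ^ k) A"
    unfolding q by (simp only: right_mult_zero_mat[OF poly_mat_carrier[OF A]]
      right_add_zero_mat[OF mult_carrier_mat[OF poly_mat_carrier[OF A] poly_mat_carrier[OF A]]])
  finally have "poly_mat [:- c, 1:] A *\<^sub>v v = poly_mat r A *\<^sub>v (poly_mat ([:- c, 1:] ^ k) A *\<^sub>v v)"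
    using assoc_mult_mat_vec[OF poly_mat_carrier[OF A] poly_mat_carrier[OF A] v] by simp
  also have "\<dots> = 0\<^sub>v n" unfolding k using A by (intro eq_vecI) (auto simp: scalar_prod_def)
  finally have "poly_mat [:- c, 1:] A *\<^sub>v v = 0\<^sub>v n" .
  moreover have "poly_mat [:- c, 1:] A = (- c) \<cdot>\<^sub>m 1\<^sub>m n + A"
    by (rule poly_mat_linear[OF A])
  ultimately have 0: "((- c) \<cdot>\<^sub>m 1\<^sub>m n + A) *\<^sub>v v = 0\<^sub>v n" by simp
  have "((- c) \<cdot>\<^sub>m 1\<^sub>m n + A) *\<^sub>v v = (- c) \<cdot>\<^sub>v v + A *\<^sub>v v"
    using A v by (subst add_mult_distrib_mat_vec[of _ n n]) (auto intro!: eq_vecI)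
  with 0 have "(- c) \<cdot>\<^sub>v v + A *\<^sub>v v = 0\<^sub>v n" by simp
  then have "vec_index ((- c) \<cdot>\<^sub>v v + A *\<^sub>v v) i = 0" if "i < n" for i using that by simp
  then show ?thesis using A v by (intro eq_vecI) (auto simp: algebra_simps)
qed

lemma poly_mat_eigenvector:
  assumes A: "A \<in> carrier_mat n n" and "v \<in> carrier_vec n"
  shows "poly_mat ([:- c, 1:] ^ k) A *\<^sub>v v = ((\<lambda>w. A *\<^sub>v w - c \<cdot>\<^sub>v w) ^^ k) v"
proof (induct k)
  case 0
  then show ?case using assms by (simp add: poly_mat_1)
next
  case (Suc k)
  let ?w = "poly_mat ([:- c, 1:] ^ k) A *\<^sub>v v"
  have w: "?w \<in> carrier_vec n" by (rule mult_mat_vec_carrier[OF poly_mat_carrier[OF A] assms(2)])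
  have "poly_mat [:- c, 1:] A = (- c) \<cdot>\<^sub>m 1\<^sub>m n + A"
    by (rule poly_mat_linear[OF A])
  moreover have "((- c) \<cdot>\<^sub>m 1\<^sub>m n + A) *\<^sub>v ?w = A *\<^sub>v ?w - c \<cdot>\<^sub>v ?w"
    using A w by (subst add_mult_distrib_mat_vec[of _ n n]) (auto intro!: eq_vecI)
  ultimately have "poly_mat ([:- c, 1:] ^ Suc k) A *\<^sub>v v = A *\<^sub>v ?w - c \<cdot>\<^sub>v ?w"
    using assoc_mult_mat_vec[OF poly_mat_carrier[OF A] poly_mat_carrier[OF A] assms(2), of "[:- c, 1:]" "[:- c, 1:] ^ k"]
    by (simp only: power_Suc poly_mat_mult[OF A])
  then show ?case using Suc by simp
qed

section \<open>Subrings, and determinants with values in a subring or a subfield\<close>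

text \<open>Subrings as plain sets. The instances that matter are the p-adic integers, E, O_E, the
  integral elements, and the polynomials with coefficients in one of these.\<close>

definition closed_subring :: "'a::comm_ring_1 set \<Rightarrow> bool" where
  "closed_subring S \<longleftrightarrow> 1 \<in> S \<and> (\<forall>x\<in>S. \<forall>y\<in>S. x - y \<in> S \<and> x * y \<in> S)"

lemma closed_subringD:
  assumes "closed_subring S"
  shows "0 \<in> S" "1 \<in> S" "x \<in> S \<Longrightarrow> - x \<in> S" "x \<in> S \<Longrightarrow> y \<in> S \<Longrightarrow> x + y \<in> S"
    "x \<in> S \<Longrightarrow> y \<in> S \<Longrightarrow> x - y \<in> S" "x \<in> S \<Longrightarrow> y \<in> S \<Longrightarrow> x * y \<in> S"
proof -
  show 1: "1 \<in> S" "x \<in> S \<Longrightarrow> y \<in> S \<Longrightarrow> x - y \<in> S" "x \<in> S \<Longrightarrow> y \<in> S \<Longrightarrow> x * y \<in> S" for x y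
    using assms by (auto simp: closed_subring_def)
  from 1(2)[OF 1(1) 1(1)] show 0: "0 \<in> S" by simp
  show m: "x \<in> S \<Longrightarrow> - x \<in> S" for x using 1(2)[OF 0, of x] by simp
  show "x \<in> S \<Longrightarrow> y \<in> S \<Longrightarrow> x + y \<in> S" using 1(2)[OF _ m, of x y] by simp
qed

lemma closed_subring_sum:
  assumes "closed_subring S" "\<And>i. i \<in> I \<Longrightarrow> f i \<in> S" shows "sum f I \<in> S"
  using assms(2) by (induct I rule: infinite_finite_induct) (auto intro: closed_subringD[OF assms(1)])

lemma closed_subring_prod:
  assumes "closed_subring S" "\<And>i. i \<in> I \<Longrightarrow> f i \<in> S" shows "prod f I \<in> S"
  using assms(2) by (induct I rule: infinite_finite_induct) (auto intro: closed_subringD[OF assms(1)])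

lemma closed_subring_power: "closed_subring S \<Longrightarrow> x \<in> S \<Longrightarrow> x ^ k \<in> S"
  by (induct k) (auto intro: closed_subringD)

lemma closed_subring_of_nat: "closed_subring S \<Longrightarrow> of_nat k \<in> S"
  by (induct k) (auto intro: closed_subringD)

lemma closed_subring_det:
  assumes S: "closed_subring S" and A: "A \<in> carrier_mat n n"
    and e: "\<And>i j. i < n \<Longrightarrow> j < n \<Longrightarrow> A $$ (i, j) \<in> S"
  shows "det A \<in> S"
  unfolding det_def'[OF A]
proof (intro closed_subring_sum[OF S] closed_subringD(6)[OF S] closed_subring_prod[OF S])
  fix p
  show "signof p \<in> S" by (cases p rule: sign_cases) (simp_all add: closed_subringD[OF S])
qed (auto intro!: e dest: permutes_in_image)

lemma closed_subring_polys:
  assumes "closed_subring S" shows "closed_subring {f :: 'a::comm_ring_1 Polynomial.poly. \<forall>i. Polynomial.coeff f i \<in> S}"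
  unfolding closed_subring_def
  by (auto simp: coeff_mult coeff_1 intro!: closed_subring_sum[OF assms] closed_subringD[OF assms])

lemma closed_subring_char_poly:
  assumes S: "closed_subring S" and A: "A \<in> carrier_mat n n"
    and e: "\<And>i j. i < n \<Longrightarrow> j < n \<Longrightarrow> A $$ (i, j) \<in> S"
  shows "Polynomial.coeff (char_poly A) i \<in> S"
proof -
  have "char_poly A \<in> {f. \<forall>i. Polynomial.coeff f i \<in> S}"
    unfolding char_poly_def
  proof (rule closed_subring_det[OF closed_subring_polys[OF S], of _ n])
    show "char_poly_matrix A \<in> carrier_mat n n" using A by simp
    fix i j assume "i < n" "j < n"
    then show "char_poly_matrix A $$ (i, j) \<in> {f. \<forall>i. Polynomial.coeff f i \<in> S}"
      using e A by (auto simp: char_poly_matrix_def coeff_pCons split: nat.split intro: closed_subringD[OF S])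
  qed
  then show ?thesis by simp
qed

text \<open>Newton's identities, in characteristic zero. With F the product of the 1 - c_i X over
  the diagonal entries c_i of a triangular form, the equation F' = - F G, where the coefficients of
  G are the power sums, determines the coefficients of F recursively from the traces of powers. The
  determinant is up to sign the top coefficient.\<close>

lemma det_in_subfield_if_traces:
  fixes M :: "'a::{alg_closed_field,field_char_0} mat"
  assumes M: "M \<in> carrier_mat n n" and E: "closed_subring E" and inv: "\<And>x. x \<in> E \<Longrightarrow> inverse x \<in> E"
    and tr: "\<And>k. k > 0 \<Longrightarrow> mat_trace (M ^\<^sub>m k) \<in> E"
  shows "det M \<in> E"
proof -
  obtain B P Q where s: "similar_mat_wit M B P Q" "upper_triangular B" using triangularizable[OF M] by blast
  from similar_mat_witD2[OF M s(1)] have B: "B \<in> carrier_mat n n" by auto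
  define c where "c i = B $$ (i, i)" for i
  define p where "p k = (\<Sum>i<n. c i ^ k)" for k
  have p: "p k \<in> E" if "k > 0" for k
    using tr[OF that] trace_poly_mat[OF s(1) M s(2), of "[:0, 1:] ^ k"] M
    by (simp add: poly_mat_pow poly_mat_X p_def c_def)
  define F where "F I = (\<Prod>i\<in>I. 1 - fps_const (c i) * fps_X)" for I
  define G where "G I = Abs_fps (\<lambda>k. \<Sum>i\<in>I. c i ^ Suc k)" for I
  \<comment> \<open>The logarithmic derivative: G is the sum of the geometric series c_i / (1 - c_i
    X).\<close>
  have dF: "fps_deriv (F I) = - (F I * G I)" if "finite I" for I
    using that
  proof induct
    case empty
    have "G {} = 0" unfolding G_def by (simp add: fps_eq_iff)
    then show ?case by (simp add: F_def)
  next
    case (insert i I)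
    define l where "l = 1 - fps_const (c i) * fps_X"
    define A where "A = Abs_fps (\<lambda>k. c i ^ Suc k)"
    have 1: "l * A = fps_const (c i)"
    proof (rule fps_ext)
      fix k
      show "fps_nth (l * A) k = fps_nth (fps_const (c i)) k"
        by (cases k) (simp_all add: l_def A_def left_diff_distrib mult.assoc)
    qed
    have G: "G (insert i I) = A + G I"
      unfolding G_def A_def using insert by (simp add: fps_eq_iff)
    have F: "F (insert i I) = l * F I" unfolding F_def l_def using insert by simp
    have "fps_deriv l = - fps_const (c i)" by (simp add: l_def)
    then have "fps_deriv (F (insert i I)) = - fps_const (c i) * F I - l * (F I * G I)"
      unfolding F fps_deriv_mult insert(3) by simp
    also have "\<dots> = - (l * F I * (A + G I))"
    proof -
      have "fps_const (c i) * F I = l * F I * A" unfolding 1[symmetric] by (simp only: mult.assoc mult.commute[of A])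
      then show ?thesis by (simp only: distrib_left minus_mult_left[symmetric] mult.assoc minus_add_distrib diff_conv_add_uminus)
    qed
    also have "\<dots> = - (F (insert i I) * G (insert i I))" unfolding F G ..
    finally show ?case .
  qed
  have rec: "of_nat (Suc k) * fps_nth (F {..<n}) (Suc k) = - (\<Sum>j=0..k. fps_nth (F {..<n}) j * p (Suc (k - j)))" for k
    using arg_cong[OF dF[of "{..<n}"], of "\<lambda>f. fps_nth f k"] by (simp add: fps_mult_nth G_def p_def)
  have F0: "fps_nth (F {..<n}) 0 = 1" 
  proof -
    have "fps_nth (F I) 0 = 1" if "finite I" for I
      using that unfolding F_def by induct (simp_all add: fps_mult_nth_0)
    then show ?thesis by simp
  qed
  have "\<forall>j\<le>k. fps_nth (F {..<n}) j \<in> E" for k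
  proof (induct k)
    case 0
    then show ?case using F0 closed_subringD[OF E] by simp
  next
    case (Suc k)
    have "fps_nth (F {..<n}) (Suc k) = inverse (of_nat (Suc k)) * - (\<Sum>j=0..k. fps_nth (F {..<n}) j * p (Suc (k - j)))"
      unfolding rec[symmetric] by (simp del: of_nat_Suc add: mult.assoc[symmetric])
    also have "\<dots> \<in> E"
      using Suc p by (intro closed_subringD[OF E] closed_subring_sum[OF E] inv closed_subring_of_nat[OF E]) auto
    finally show ?case using Suc by (auto simp: le_Suc_eq)
  qed
  then have Fn: "fps_nth (F {..<n}) n \<in> E" by blast
  \<comment> \<open>The bound on the degree is carried along so that the product with a new linear
    factor has the expected top coefficient.\<close>
  have top: "fps_nth (F I) (card I) = (\<Prod>i\<in>I. - c i) \<and> (\<forall>k > card I. fps_nth (F I) k = 0)" if "finite I" for I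
    using that
  proof induct
    case empty
    then show ?case by (simp add: F_def)
  next
    case (insert i I)
    have F: "F (insert i I) = F I - fps_const (c i) * (fps_X * F I)"
      unfolding F_def using insert by (simp add: left_diff_distrib mult.assoc)
    show ?case using insert by (simp add: F)
  qed
  have "det M = det B" using det_similar s unfolding similar_mat_def by blast
  also have "\<dots> = (\<Prod>i<n. c i)" using det_upper_triangular[OF s(2) B] B
    by (simp add: c_def prod_list_diag_prod atLeast0LessThan)
  also have "\<dots> = (- 1) ^ n * (\<Prod>i<n. - c i)" by (simp add: prod.distrib[symmetric] prod_uminus power_mult_distrib[symmetric] mult.assoc[symmetric])
  also have "\<dots> = (- 1) ^ n * fps_nth (F {..<n}) n" using top[of "{..<n}"] by simp
  also have "\<dots> \<in> E" using Fn by (intro closed_subringD[OF E] closed_subring_power[OF E])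
  finally show ?thesis .
qed

text \<open>Division by X - a for one of the points a leaves a quotient of lower degree whose values
  at the remaining points are again in E.\<close>

lemma coeffs_in_subfield_if_values:
  fixes p :: "'a::field_char_0 Polynomial.poly"
  assumes E: "closed_subring E" and inv: "\<And>x. x \<in> E \<Longrightarrow> inverse x \<in> E"
    and S: "infinite S" "\<And>k :: nat. k \<in> S \<Longrightarrow> Polynomial.poly p (of_nat k) \<in> E"
  shows "Polynomial.coeff p i \<in> E"
  using S
proof (induct "degree p" arbitrary: p S i)
  case 0
  then obtain a where p: "p = [:a:]" using degree_eq_zeroE by metis
  obtain k where "k \<in> S" using 0(2) by fastforce
  then show ?case using 0(3)[of k] p by (auto simp: coeff_pCons closed_subringD[OF E] split: nat.split)
next
  case (Suc d)
  obtain a where a: "a \<in> S" using Suc(3) by fastforce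
  let ?a = "of_nat a :: 'a"
  let ?q = "synthetic_div p ?a"
  have pq: "p = [:- ?a, 1:] * ?q + [:Polynomial.poly p ?a:]" by (rule synthetic_div_correct'[symmetric])
  have q: "Polynomial.coeff ?q i \<in> E" for i
  proof (rule Suc(1)[of _ "S - {a}"])
    show "d = degree ?q" using Suc(2) by (simp add: degree_synthetic_div)
    show "infinite (S - {a})" using Suc(3) by simp
    fix k assume k: "k \<in> S - {a}"
    have "Polynomial.poly p (of_nat k) - Polynomial.poly p ?a = (of_nat k - ?a) * Polynomial.poly ?q (of_nat k)"
      by (subst pq) (simp add: algebra_simps)
    moreover have "of_nat k - ?a \<noteq> (0 :: 'a)" using k by simp
    ultimately have "Polynomial.poly ?q (of_nat k) =
        (Polynomial.poly p (of_nat k) - Polynomial.poly p ?a) * inverse (of_nat k - ?a)"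
      by (simp add: field_simps)
    also have "\<dots> \<in> E" using k a Suc(4) by (intro closed_subringD[OF E] inv closed_subring_of_nat[OF E]) auto
    finally show "Polynomial.poly ?q (of_nat k) \<in> E" .
  qed
  have "?q \<in> {f. \<forall>i. Polynomial.coeff f i \<in> E}" using q by simp
  moreover have "[:- ?a, 1:] \<in> {f. \<forall>i. Polynomial.coeff f i \<in> E}" "[:Polynomial.poly p ?a:] \<in> {f. \<forall>i. Polynomial.coeff f i \<in> E}"
    using Suc(4)[OF a] by (auto simp: coeff_pCons closed_subringD[OF E] closed_subring_of_nat[OF E] split: nat.split)
  ultimately have "p \<in> {f. \<forall>i. Polynomial.coeff f i \<in> E}"
    by (subst pq) (intro closed_subringD[OF closed_subring_polys[OF E]])
  then show ?case by simp
qed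

section \<open>Integral elements of the algebraic closure\<close>

lemma to_ac_hom: "comm_ring_hom (to_ac :: 'q::field \<Rightarrow> 'q alg_closure)"
  by unfold_locales simp_all

definition integral_over :: "'q::field set \<Rightarrow> 'q alg_closure \<Rightarrow> bool" where
  "integral_over S x \<longleftrightarrow> (\<exists>f. Polynomial.lead_coeff f = 1 \<and> (\<forall>i. Polynomial.coeff f i \<in> S) \<and> Polynomial.poly (map_poly to_ac f) x = 0)"

text \<open>An element is integral if and only if it is an eigenvalue of a matrix with entries in the base ring.\<close>

lemma integral_if_eigenvalue:
  assumes S: "closed_subring S" and M: "M \<in> carrier_mat n n" and e: "\<And>i j. i < n \<Longrightarrow> j < n \<Longrightarrow> M $$ (i, j) \<in> S"
    and x: "eigenvalue (map_mat to_ac M) x"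
  shows "integral_over S x"
proof -
  have "Polynomial.poly (map_poly to_ac (char_poly M)) x = 0"
    using x eigenvalue_root_char_poly[of "map_mat to_ac M" n x] M comm_ring_hom.char_poly_hom[OF to_ac_hom M] by simp
  then show ?thesis unfolding integral_over_def
    using closed_subring_char_poly[OF S M e] degree_monic_char_poly[OF M] by metis
qed

text \<open>The matrix is the companion matrix of an integral equation for x, with eigenvector 1, x,
  x^2, ...\<close>

lemma eigenvalue_if_integral:
  assumes S: "closed_subring S" and x: "integral_over S x"
  obtains n M v where "M \<in> carrier_mat n n" "\<And>i j. i < n \<Longrightarrow> j < n \<Longrightarrow> M $$ (i, j) \<in> S"
    "v \<in> carrier_vec n" "v \<noteq> 0\<^sub>v n" "map_mat to_ac M *\<^sub>v v = x \<cdot>\<^sub>v v"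
proof -
  obtain f where f: "Polynomial.lead_coeff f = 1" "\<And>i. Polynomial.coeff f i \<in> S" "Polynomial.poly (map_poly to_ac f) x = 0"
    using x unfolding integral_over_def by auto
  define n where "n = degree f"
  have n: "n > 0"
  proof (rule ccontr)
    assume "\<not> n > 0"
    then obtain a where "f = [:a:]" unfolding n_def using degree_eq_zeroE by blast
    then show False using f(1,3) by (simp add: map_poly_pCons)
  qed
  let ?M = "mat n n (\<lambda>(i, j). if Suc i < n then (if j = Suc i then 1 else 0) else - Polynomial.coeff f j)"
  let ?v = "vec n (\<lambda>i. x ^ i)"
  have xn: "x ^ n = - (\<Sum>j<n. to_ac (Polynomial.coeff f j) * x ^ j)"
  proof -
    have d: "degree (map_poly to_ac f) = n" unfolding n_def by (rule degree_map_poly) (use f(1) in auto)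
    have "0 = (\<Sum>j\<le>n. to_ac (Polynomial.coeff f j) * x ^ j)"
      using f(3) unfolding poly_altdef d by (simp add: coeff_map_poly)
    also have "\<dots> = (\<Sum>j<n. to_ac (Polynomial.coeff f j) * x ^ j) + x ^ n"
      using f(1) by (simp add: lessThan_Suc_atMost[symmetric] n_def)
    finally show ?thesis by (simp add: eq_neg_iff_add_eq_0 add.commute)
  qed
  show ?thesis
  proof (rule that[of ?M n ?v])
    show "?M $$ (i, j) \<in> S" if "i < n" "j < n" for i j
      using that f(2) by (simp add: closed_subringD[OF S])
    show "?v \<noteq> 0\<^sub>v n" using n by (metis index_vec index_zero_vec(1) power_0 zero_neq_one)
    show "map_mat to_ac ?M *\<^sub>v ?v = x \<cdot>\<^sub>v ?v"
    proof (rule eq_vecI)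
      fix i assume "i < dim_vec (x \<cdot>\<^sub>v ?v)"
      then have i: "i < n" by simp
      have "vec_index (map_mat to_ac ?M *\<^sub>v ?v) i = (\<Sum>j<n. to_ac (?M $$ (i, j)) * x ^ j)"
        using i by (simp add: scalar_prod_def atLeast0LessThan)
      also have "\<dots> = x * x ^ i"
      proof (cases "Suc i < n")
        case True
        then have "(\<Sum>j<n. to_ac (?M $$ (i, j)) * x ^ j) = (\<Sum>j<n. if j = Suc i then x ^ j else 0)"
          by (intro sum.cong) auto
        then show ?thesis using True by simp
      next
        case False
        then have "Suc i = n" using i by simp
        then have "x * x ^ i = x ^ n" by auto
        moreover have "(\<Sum>j<n. to_ac (?M $$ (i, j)) * x ^ j) = (\<Sum>j<n. - (to_ac (Polynomial.coeff f j) * x ^ j))"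
          using False i by (intro sum.cong) auto
        ultimately show ?thesis using xn by (simp add: sum_negf)
      qed
      finally show "vec_index (map_mat to_ac ?M *\<^sub>v ?v) i = vec_index (x \<cdot>\<^sub>v ?v) i" using i by simp
    qed simp
  qed auto
qed

lemma sum_div_mod:
  fixes f :: "nat \<Rightarrow> nat \<Rightarrow> 'a::comm_monoid_add"
  assumes "m > 0"
  shows "(\<Sum>l<n * m. f (l div m) (l mod m)) = (\<Sum>i<n. \<Sum>j<m. f i j)"
proof -
  have "(\<Sum>l<n * m. f (l div m) (l mod m)) = (\<Sum>(i, j)\<in>{..<n} \<times> {..<m}. f i j)"
  proof (rule sum.reindex_bij_witness[of _ "\<lambda>(i, j). i * m + j" "\<lambda>l. (l div m, l mod m)"], goal_cases)
    case (4 ij)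
    then obtain i j where ij: "ij = (i, j)" "i < n" "j < m" by auto
    have "i * m + j < Suc i * m" using ij by simp
    also have "\<dots> \<le> n * m" using ij by (intro mult_le_mono1) simp
    finally show ?case using ij by simp
  qed (use assms in \<open>auto simp: less_mult_imp_div_less\<close>)
  then show ?thesis by (simp add: sum.cartesian_product)
qed

text \<open>If M and L have eigenvalues x and y with eigenvectors v and w, then v \<otimes> w is an
  eigenvector of M \<otimes> 1 - 1 \<otimes> L and of (M \<otimes> 1)(1 \<otimes> L) with
  eigenvalues x - y and xy. The matrices \<open>M'\<close>, \<open>L'\<close> and the vector
  \<open>u\<close> are these tensor products, a pair (i, j) being coded as i m + j.\<close>

lemma closed_subring_integral:
  assumes S: "closed_subring (S :: 'q::field set)"
  shows "closed_subring {x. integral_over S x}"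
  unfolding closed_subring_def
proof (intro conjI ballI)
  show "1 \<in> {x. integral_over S x}"
    unfolding integral_over_def
    by (auto intro!: exI[of _ "[:- 1, 1:]"] simp: coeff_pCons closed_subringD[OF S] map_poly_pCons split: nat.split)
  fix x y assume "x \<in> {x. integral_over S x}" "y \<in> {x. integral_over S x}"
  then have xy: "integral_over S x" "integral_over S y" by auto
  obtain n M v where M: "M \<in> carrier_mat n n" "\<And>i j. i < n \<Longrightarrow> j < n \<Longrightarrow> M $$ (i, j) \<in> S"
    "v \<in> carrier_vec n" "v \<noteq> 0\<^sub>v n" "map_mat to_ac M *\<^sub>v v = x \<cdot>\<^sub>v v" by (rule eigenvalue_if_integral[OF S xy(1)]) blast
  obtain m L w where L: "L \<in> carrier_mat m m" "\<And>i j. i < m \<Longrightarrow> j < m \<Longrightarrow> L $$ (i, j) \<in> S"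
    "w \<in> carrier_vec m" "w \<noteq> 0\<^sub>v m" "map_mat to_ac L *\<^sub>v w = y \<cdot>\<^sub>v w" by (rule eigenvalue_if_integral[OF S xy(2)]) blast
  obtain a where a: "a < n" "vec_index v a \<noteq> 0" using M(3,4) by (metis carrier_vecD eq_vecI index_zero_vec)
  obtain b where b: "b < m" "vec_index w b \<noteq> 0" using L(3,4) by (metis carrier_vecD eq_vecI index_zero_vec)
  then have m: "m > 0" by simp
  let ?N = "n * m"
  define u where "u = vec ?N (\<lambda>l. vec_index v (l div m) * vec_index w (l mod m))"
  define M' where "M' = mat ?N ?N (\<lambda>(k, l). if k mod m = l mod m then M $$ (k div m, l div m) else 0)"
  define L' where "L' = mat ?N ?N (\<lambda>(k, l). if k div m = l div m then L $$ (k mod m, l mod m) else 0)"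
  have car: "M' \<in> carrier_mat ?N ?N" "L' \<in> carrier_mat ?N ?N" "u \<in> carrier_vec ?N" by (auto simp: M'_def L'_def u_def)
  have dm: "l div m < n" "l mod m < m" if "l < ?N" for l
    using that m by (simp_all add: less_mult_imp_div_less)
  have u0: "u \<noteq> 0\<^sub>v ?N"
  proof
    assume "u = 0\<^sub>v ?N"
    moreover have ab: "a * m + b < ?N"
    proof -
      have "a * m + b < Suc a * m" using b by simp
      also have "\<dots> \<le> ?N" using a by (intro mult_le_mono1) simp
      finally show ?thesis .
    qed
    ultimately have "vec_index u (a * m + b) = 0" by simp
    then show False using ab a b by (simp add: u_def)
  qed
  have eM: "(\<Sum>j<n. to_ac (M $$ (i, j)) * vec_index v j) = x * vec_index v i" if "i < n" for i
    using arg_cong[OF M(5), of "\<lambda>u. vec_index u i"] that M(1,3) by (simp add: scalar_prod_def atLeast0LessThan)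
  have eL: "(\<Sum>j<m. to_ac (L $$ (i, j)) * vec_index w j) = y * vec_index w i" if "i < m" for i
    using arg_cong[OF L(5), of "\<lambda>u. vec_index u i"] that L(1,3) by (simp add: scalar_prod_def atLeast0LessThan)
  have Mu: "map_mat to_ac M' *\<^sub>v u = x \<cdot>\<^sub>v u"
  proof (rule eq_vecI)
    fix k assume "k < dim_vec (x \<cdot>\<^sub>v u)"
    then have k: "k < ?N" by (simp add: u_def)
    have "vec_index (map_mat to_ac M' *\<^sub>v u) k =
      (\<Sum>l<?N. (if k mod m = l mod m then to_ac (M $$ (k div m, l div m)) * (vec_index v (l div m) * vec_index w (l mod m)) else 0))"
      using k car by (auto simp: scalar_prod_def atLeast0LessThan M'_def u_def intro!: sum.cong)
    also have "\<dots> = (\<Sum>i<n. \<Sum>j<m. if k mod m = j then to_ac (M $$ (k div m, i)) * (vec_index v i * vec_index w j) else 0)"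
      by (rule sum_div_mod[OF m])
    also have "\<dots> = (\<Sum>i<n. to_ac (M $$ (k div m, i)) * vec_index v i) * vec_index w (k mod m)"
      using dm[OF k] by (simp add: sum_distrib_right mult.assoc)
    also have "\<dots> = vec_index (x \<cdot>\<^sub>v u) k" using k dm[OF k] by (simp add: eM u_def)
    finally show "vec_index (map_mat to_ac M' *\<^sub>v u) k = vec_index (x \<cdot>\<^sub>v u) k" .
  qed (use car in simp)
  have Lu: "map_mat to_ac L' *\<^sub>v u = y \<cdot>\<^sub>v u"
  proof (rule eq_vecI)
    fix k assume "k < dim_vec (y \<cdot>\<^sub>v u)"
    then have k: "k < ?N" by (simp add: u_def)
    have "vec_index (map_mat to_ac L' *\<^sub>v u) k =
      (\<Sum>l<?N. (if k div m = l div m then to_ac (L $$ (k mod m, l mod m)) * (vec_index v (l div m) * vec_index w (l mod m)) else 0))"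
      using k car by (auto simp: scalar_prod_def atLeast0LessThan L'_def u_def intro!: sum.cong)
    also have "\<dots> = (\<Sum>i<n. \<Sum>j<m. if k div m = i then to_ac (L $$ (k mod m, j)) * (vec_index v i * vec_index w j) else 0)"
      by (rule sum_div_mod[OF m])
    also have "\<dots> = (\<Sum>i<n. if k div m = i then (\<Sum>j<m. to_ac (L $$ (k mod m, j)) * (vec_index v i * vec_index w j)) else 0)"
      by (intro sum.cong) auto
    also have "\<dots> = vec_index v (k div m) * (\<Sum>j<m. to_ac (L $$ (k mod m, j)) * vec_index w j)"
      using dm[OF k] by (simp add: sum_distrib_left algebra_simps)
    also have "\<dots> = vec_index (y \<cdot>\<^sub>v u) k" using k dm[OF k] by (simp add: eL u_def)
    finally show "vec_index (map_mat to_ac L' *\<^sub>v u) k = vec_index (y \<cdot>\<^sub>v u) k" .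
  qed (use car in simp)
  have ent: "M' $$ (i, j) \<in> S" "L' $$ (i, j) \<in> S" if "i < ?N" "j < ?N" for i j
    using that dm M(2) L(2) by (auto simp: M'_def L'_def closed_subringD[OF S])
  interpret h: comm_ring_hom "to_ac :: 'q \<Rightarrow> 'q alg_closure" by (rule to_ac_hom)
  let ?h = "map_mat (to_ac :: 'q \<Rightarrow> 'q alg_closure)"
  have hc: "?h M' \<in> carrier_mat ?N ?N" "?h L' \<in> carrier_mat ?N ?N" using car by auto
  have "?h (M' - L') = ?h M' - ?h L'" using car by (intro eq_matI) auto
  then have "?h (M' - L') *\<^sub>v u = (x - y) \<cdot>\<^sub>v u"
    using minus_mult_distrib_mat_vec[OF hc car(3)] Mu Lu car(3) by (auto intro!: eq_vecI simp: algebra_simps)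
  then have "eigenvalue (?h (M' - L')) (x - y)"
    using car u0 unfolding eigenvalue_def eigenvector_def by (intro exI[of _ u]) auto
  moreover have "(M' - L') $$ (i, j) \<in> S" if "i < ?N" "j < ?N" for i j
    using that car ent[OF that] by (simp add: closed_subringD[OF S])
  ultimately show "x - y \<in> {x. integral_over S x}"
    using car by (auto intro!: integral_if_eigenvalue[OF S, of "M' - L'" ?N])
  have "?h (M' * L') = ?h M' * ?h L'" by (rule h.mat_hom_mult[OF car(1,2)])
  then have "?h (M' * L') *\<^sub>v u = ?h M' *\<^sub>v (?h L' *\<^sub>v u)" using assoc_mult_mat_vec[OF hc car(3)] by simp
  also have "\<dots> = (x * y) \<cdot>\<^sub>v u" unfolding Lu using mult_mat_vec[OF hc(1) car(3), of y] Mu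
    by (simp add: smult_smult_assoc mult.commute)
  finally have "eigenvalue (?h (M' * L')) (x * y)"
    using car u0 unfolding eigenvalue_def eigenvector_def by (intro exI[of _ u]) auto
  moreover have "(M' * L') $$ (i, j) \<in> S" if "i < ?N" "j < ?N" for i j
    using that car ent by (auto simp: scalar_prod_def intro!: closed_subring_sum[OF S] closed_subringD[OF S])
  ultimately show "x * y \<in> {x. integral_over S x}"
    using car by (auto intro!: integral_if_eigenvalue[OF S, of "M' * L'" ?N])
qed

text \<open>Over the algebraic closure the polynomial is a product of monic linear factors, whose
  coefficients are integral.\<close>

lemma monic_coeffs_integral:
  assumes S: "closed_subring S" and h: "Polynomial.lead_coeff h = 1"
    and roots: "\<And>x. Polynomial.poly h x = 0 \<Longrightarrow> integral_over S x"
  shows "integral_over S (Polynomial.coeff h i)"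
proof -
  let ?I = "{x. integral_over S x}"
  let ?P = "{f. \<forall>i. Polynomial.coeff f i \<in> ?I}"
  have P: "closed_subring ?P" by (intro closed_subring_polys closed_subring_integral S)
  from h have "h \<noteq> 0" by auto
  obtain A where A: "size A = degree h" "h = Polynomial.smult (Polynomial.lead_coeff h) (\<Prod>x\<in>#A. [:- x, 1:])"
    using alg_closed_imp_factorization[OF \<open>h \<noteq> 0\<close>] by blast
  have hA: "h = (\<Prod>x\<in>#A. [:- x, 1:])" using A(2) h by simp
  have "x \<in> ?I" if "x \<in># A" for x
    using that roots[of x] by (auto simp: hA poly_prod_mset prod_mset_zero_iff)
  then have "(\<Prod>x\<in>#A. [:- x, 1:]) \<in> ?P"
  proof (induct A)
    case empty
    then show ?case using closed_subringD(2)[OF P] by simp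
  next
    case (add x A)
    then have "[:- x, 1:] \<in> ?P" using closed_subringD[OF closed_subring_integral[OF S]]
      by (auto simp: coeff_pCons split: nat.split)
    then have "[:- x, 1:] * (\<Prod>x\<in>#A. [:- x, 1:]) \<in> ?P" using add by (intro closed_subringD(6)[OF P]) auto
    then show ?case by (simp only: image_mset_add_mset prod_mset.add_mset)
  qed
  then show ?thesis unfolding hA[symmetric] by simp
qed

text \<open>Substituting a high power \<open>Y\<^sup>M\<close> of the second variable into a monic polynomial in \<open>R[Y][T]\<close> gives a monic
  polynomial whose low coefficients are those of the constant term.\<close>

lemma poly_monom_subst:
  fixes \<chi> :: "'a::comm_ring_1 Polynomial.poly Polynomial.poly"
  assumes mon: "Polynomial.lead_coeff \<chi> = 1" and M: "\<And>j. degree (Polynomial.coeff \<chi> j) < M"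
  shows "Polynomial.lead_coeff (Polynomial.poly \<chi> (Polynomial.monom 1 M)) = 1"
    and "i < M \<Longrightarrow> Polynomial.coeff (Polynomial.poly \<chi> (Polynomial.monom 1 M)) i = Polynomial.coeff (Polynomial.coeff \<chi> 0) i"
proof -
  let ?m = "degree \<chi>" and ?h = "Polynomial.poly \<chi> (Polynomial.monom 1 M)"
  have h: "Polynomial.coeff ?h i = (\<Sum>j\<le>?m. if M * j \<le> i then Polynomial.coeff (Polynomial.coeff \<chi> j) (i - M * j) else 0)" for i
    unfolding poly_altdef coeff_sum
    by (intro sum.cong refl, subst mult.commute) (simp add: monom_power coeff_monom_mult)
  have "M > 0" using M[of 0] by simp
  have big: "Polynomial.coeff ?h i = 0" if "i > M * ?m" for i
  proof -
    have "Polynomial.coeff (Polynomial.coeff \<chi> j) (i - M * j) = 0" if j: "j \<le> ?m" for j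
    proof (cases "j = ?m")
      case True
      then show ?thesis using mon \<open>i > M * ?m\<close> by simp
    next
      case False
      then have "M * Suc j \<le> M * ?m" using j by (intro mult_le_mono2) simp
      then have "i - M * j > M" using \<open>i > M * ?m\<close> by simp
      then show ?thesis using M[of j] by (intro coeff_eq_0) simp
    qed
    then show ?thesis unfolding h by (intro sum.neutral) auto
  qed
  have top: "Polynomial.coeff ?h (M * ?m) = 1"
  proof -
    have "Polynomial.coeff (Polynomial.coeff \<chi> j) (M * ?m - M * j) = 0" if j: "j < ?m" for j
    proof -
      have "M * Suc j \<le> M * ?m" using j by (intro mult_le_mono2) simp
      then show ?thesis using M[of j] by (intro coeff_eq_0) simp
    qed
    then have "Polynomial.coeff ?h (M * ?m) = (\<Sum>j\<in>{?m}. if M * j \<le> M * ?m then Polynomial.coeff (Polynomial.coeff \<chi> j) (M * ?m - M * j) else 0)"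
      unfolding h by (intro sum.mono_neutral_right) auto
    then show ?thesis using mon by simp
  qed
  have "degree ?h = M * ?m"
  proof (rule antisym)
    show "degree ?h \<le> M * ?m" using big by (intro degree_le) auto
    show "M * ?m \<le> degree ?h" using top by (intro le_degree) simp
  qed
  then show "Polynomial.lead_coeff ?h = 1" using top by simp
  assume i: "i < M"
  have "Polynomial.coeff ?h i = (\<Sum>j\<in>{0}. if M * j \<le> i then Polynomial.coeff (Polynomial.coeff \<chi> j) (i - M * j) else 0)"
    unfolding h
  proof (intro sum.mono_neutral_right ballI)
    fix j assume "j \<in> {..?m} - {0}"
    then have "M * 1 \<le> M * j" by (intro mult_le_mono2) simp
    with i have "\<not> M * j \<le> i" by linarith
    then show "(if M * j \<le> i then Polynomial.coeff (Polynomial.coeff \<chi> j) (i - M * j) else 0) = 0" by simp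
  qed auto
  then show "Polynomial.coeff ?h i = Polynomial.coeff (Polynomial.coeff \<chi> 0) i" by simp
qed

lemma char_poly_coeff_0:
  assumes A: "A \<in> carrier_mat n n"
  shows "Polynomial.coeff (char_poly A) 0 = (- 1) ^ n * det (A :: 'a::comm_ring_1 mat)"
proof -
  have "Polynomial.coeff (char_poly A) 0 = det (- A)"
    unfolding char_poly_def poly_0_coeff_0[symmetric]
    by (rule poly_det_cong[of _ n]) (use A in \<open>auto simp: char_poly_matrix_def\<close>)
  also have "- A = (- 1) \<cdot>\<^sub>m A" by auto
  finally show ?thesis using A by (simp add: det_smult)
qed

text \<open>A determinant of polynomials is integral if, pointwise, its matrix has only integral eigenvalues: the substitution
  \<open>T = Y\<^sup>M\<close> in the characteristic polynomial turns integrality of the roots into integrality of the coefficients.\<close>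

lemma det_coeffs_integral:
  fixes F :: "'q::field alg_closure Polynomial.poly mat" and A :: "'q Polynomial.poly mat"
  assumes S: "closed_subring S" and F: "F \<in> carrier_mat m m" and A: "A \<in> carrier_mat n n"
    and AS: "\<And>i j k. i < n \<Longrightarrow> j < n \<Longrightarrow> Polynomial.coeff (A $$ (i, j)) k \<in> S"
    and ev: "\<And>y c. eigenvalue (map_mat (\<lambda>p. Polynomial.poly p y) F) c \<Longrightarrow>
       eigenvalue (map_mat (\<lambda>p. Polynomial.poly (map_poly to_ac p) y) A) c"
  shows "integral_over S (Polynomial.coeff (det F) i)"
proof -
  define D where "D = (\<lambda>\<chi> :: 'q alg_closure Polynomial.poly Polynomial.poly. \<Sum>j\<le>degree \<chi>. degree (Polynomial.coeff \<chi> j))"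
  define D' where "D' = (\<lambda>\<chi> :: 'q Polynomial.poly Polynomial.poly. \<Sum>j\<le>degree \<chi>. degree (Polynomial.coeff \<chi> j))"
  \<comment> \<open>Larger than the degree in Y of every coefficient of both characteristic
    polynomials, so that the terms coming from different powers of T do not overlap with the
    constant term below Y^M, and larger than the degree of det F, so that all its coefficients are
    seen there.\<close>
  define M where "M = Suc (D (char_poly F) + D' (char_poly A) + degree (det F))"
  have MF: "degree (Polynomial.coeff (char_poly F) j) < M" for j
    by (cases "j \<le> degree (char_poly F)")
      (use member_le_sum[of j "{..degree (char_poly F)}" "\<lambda>j. degree (Polynomial.coeff (char_poly F) j)"] in
        \<open>auto simp: M_def D_def coeff_eq_0\<close>)
  have MA: "degree (Polynomial.coeff (char_poly A) j) < M" for j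
    by (cases "j \<le> degree (char_poly A)")
      (use member_le_sum[of j "{..degree (char_poly A)}" "\<lambda>j. degree (Polynomial.coeff (char_poly A) j)"] in
        \<open>auto simp: M_def D'_def coeff_eq_0\<close>)
  define hF where "hF = Polynomial.poly (char_poly F) (Polynomial.monom 1 M)"
  define hA where "hA = Polynomial.poly (char_poly A) (Polynomial.monom 1 M)"
  have monF: "Polynomial.lead_coeff hF = 1"
    unfolding hF_def using poly_monom_subst(1)[OF _ MF] degree_monic_char_poly[OF F] by simp
  have monA: "Polynomial.lead_coeff hA = 1"
    unfolding hA_def using poly_monom_subst(1)[OF _ MA] degree_monic_char_poly[OF A] by simp
  let ?P = "{f :: 'q Polynomial.poly. \<forall>i. Polynomial.coeff f i \<in> S}"
  have P: "closed_subring ?P" by (rule closed_subring_polys[OF S])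
  have coefA: "hA \<in> ?P"
  proof -
    have "Polynomial.coeff (char_poly A) j \<in> ?P" for j by (rule closed_subring_char_poly[OF P A]) (use AS in auto)
    moreover have "Polynomial.monom 1 M \<in> ?P" using closed_subringD[OF S] by (auto simp: coeff_monom)
    ultimately show ?thesis unfolding hA_def poly_altdef
      by (intro closed_subring_sum[OF P] closed_subringD(6)[OF P] closed_subring_power[OF P])
  qed
  have root: "integral_over S y" if y: "Polynomial.poly hF y = 0" for y
  proof -
    have e1: "comm_ring_hom (\<lambda>p :: 'q alg_closure Polynomial.poly. Polynomial.poly p y)" by unfold_locales auto
    interpret comm_ring_hom "to_ac :: 'q \<Rightarrow> 'q alg_closure" by (rule to_ac_hom)
    interpret m: map_poly_comm_ring_hom "to_ac :: 'q \<Rightarrow> 'q alg_closure" ..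
    have e2: "comm_ring_hom (\<lambda>p :: 'q Polynomial.poly. Polynomial.poly (map_poly to_ac p) y)"
      by unfold_locales (simp_all add: m.hom_mult m.hom_add m.hom_one m.hom_zero)
    have sub: "\<phi> (Polynomial.poly \<chi> z) = Polynomial.poly (map_poly \<phi> \<chi>) (\<phi> z)"
      if "comm_ring_hom \<phi>" for \<phi> :: "'c::comm_ring_1 \<Rightarrow> 'd::comm_ring_1" and \<chi> z
    proof -
      interpret g: comm_ring_hom \<phi> by fact
      show ?thesis by (rule g.poly_map_poly[symmetric])
    qed
    let ?Fy = "map_mat (\<lambda>p. Polynomial.poly p y) F" and ?Ay = "map_mat (\<lambda>p. Polynomial.poly (map_poly to_ac p) y) A"
    have Fy: "?Fy \<in> carrier_mat m m" and Ay: "?Ay \<in> carrier_mat n n" using F A by auto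
    have "Polynomial.poly (char_poly ?Fy) (y ^ M) = 0"
      using sub[OF e1, of "char_poly F" "Polynomial.monom 1 M"] y
      unfolding comm_ring_hom.char_poly_hom[OF e1 F] hF_def by (simp add: poly_monom)
    then have "eigenvalue ?Fy (y ^ M)" using eigenvalue_root_char_poly[OF Fy] by simp
    \<comment> \<open>If y is a root of \<open>hF\<close>, then \<open>y ^ M\<close> is an
      eigenvalue of F(y), hence of A(y), so that y is a root of \<open>hA\<close>, which is monic
      with coefficients in S.\<close>
    then have "eigenvalue ?Ay (y ^ M)" by (rule ev)
    then have "Polynomial.poly (char_poly ?Ay) (y ^ M) = 0" using eigenvalue_root_char_poly[OF Ay] by simp
    then have "Polynomial.poly (map_poly to_ac hA) y = 0"
      using sub[OF e2, of "char_poly A" "Polynomial.monom 1 M"]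
      unfolding comm_ring_hom.char_poly_hom[OF e2 A] hA_def by (simp add: poly_monom map_poly_monom)
    then show ?thesis unfolding integral_over_def using monA coefA by blast
  qed
  have int: "integral_over S (Polynomial.coeff hF i)" for i by (rule monic_coeffs_integral[OF S monF root])
  let ?I = "{x. integral_over S x}"
  have I: "closed_subring ?I" by (rule closed_subring_integral[OF S])
  show ?thesis
  proof (cases "i < M")
    case True
    have "Polynomial.coeff hF i = Polynomial.coeff ((- 1) ^ m * det F) i"
      unfolding hF_def using poly_monom_subst(2)[OF _ MF True] degree_monic_char_poly[OF F] char_poly_coeff_0[OF F] by simp
    also have "\<dots> = (- 1) ^ m * Polynomial.coeff (det F) i"
      by (cases "even m") (simp_all add: uminus_power_if)
    finally have "Polynomial.coeff (det F) i = (- 1) ^ m * Polynomial.coeff hF i"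
      by (cases "even m") (simp_all add: uminus_power_if)
    also have "\<dots> \<in> ?I" using int by (intro closed_subringD[OF I] closed_subring_power[OF I]) auto
    finally show ?thesis by simp
  next
    case False
    then have "Polynomial.coeff (det F) i = 0" by (intro coeff_eq_0) (simp add: M_def)
    then show ?thesis using closed_subringD(1)[OF I] by simp
  qed
qed

section \<open>Kronecker substitution\<close>

text \<open>The exponent of T in the image of a monomial when the k-th variable is replaced by
  \<open>T ^ (N ^ k)\<close>. When all exponents are below N they are its digits in base N.\<close>

definition kcode :: "nat \<Rightarrow> (nat \<Rightarrow>\<^sub>0 nat) \<Rightarrow> nat" where
  "kcode N \<alpha> = (\<Sum>k\<in>Poly_Mapping.keys \<alpha>. Poly_Mapping.lookup \<alpha> k * N ^ k)"

definition kronecker :: "nat \<Rightarrow> ((nat \<Rightarrow>\<^sub>0 nat) \<Rightarrow>\<^sub>0 'a) \<Rightarrow> 'a::comm_ring_1 Polynomial.poly" where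
  "kronecker N p = (\<Sum>\<alpha>\<in>Poly_Mapping.keys p. Polynomial.monom (Poly_Mapping.lookup p \<alpha>) (kcode N \<alpha>))"

lemma kcode_superset: "finite I \<Longrightarrow> Poly_Mapping.keys \<alpha> \<subseteq> I \<Longrightarrow> kcode N \<alpha> = (\<Sum>k\<in>I. Poly_Mapping.lookup \<alpha> k * N ^ k)"
  unfolding kcode_def by (rule sum.mono_neutral_left) (auto simp: in_keys_iff)

lemma kcode_add: "kcode N (\<alpha> + \<beta>) = kcode N \<alpha> + kcode N \<beta>"
proof -
  let ?I = "Poly_Mapping.keys \<alpha> \<union> Poly_Mapping.keys \<beta>"
  have "Poly_Mapping.keys (\<alpha> + \<beta>) \<subseteq> ?I" by (rule keys_add)
  then show ?thesis
    by (subst (1 2 3) kcode_superset[of ?I]) (auto simp: lookup_add sum.distrib algebra_simps)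
qed

lemma kronecker_superset:
  "finite I \<Longrightarrow> Poly_Mapping.keys p \<subseteq> I \<Longrightarrow> kronecker N p = (\<Sum>\<alpha>\<in>I. Polynomial.monom (Poly_Mapping.lookup p \<alpha>) (kcode N \<alpha>))"
  unfolding kronecker_def by (rule sum.mono_neutral_left) (auto simp: in_keys_iff)

lemma kronecker_add: "kronecker N (p + q) = kronecker N p + kronecker N q"
proof -
  let ?I = "Poly_Mapping.keys p \<union> Poly_Mapping.keys q"
  have "Poly_Mapping.keys (p + q) \<subseteq> ?I" by (rule keys_add)
  then show ?thesis
    by (subst (1 2 3) kronecker_superset[of ?I]) (auto simp: lookup_add sum.distrib add_monom[symmetric])
qed

lemma kronecker_0: "kronecker N 0 = 0" by (simp add: kronecker_def)

lemma kronecker_sum: "kronecker N (\<Sum>i\<in>I. f i) = (\<Sum>i\<in>I. kronecker N (f i))"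
  by (induct I rule: infinite_finite_induct) (simp_all add: kronecker_0 kronecker_add)

lemma kronecker_single: "kronecker N (Poly_Mapping.single \<alpha> a) = Polynomial.monom a (kcode N \<alpha>)"
  by (cases "a = 0") (auto simp: kronecker_def)

lemma poly_mapping_sum_single: "p = (\<Sum>\<alpha>\<in>Poly_Mapping.keys p. Poly_Mapping.single \<alpha> (Poly_Mapping.lookup p \<alpha>))"
  by (rule poly_mapping_eqI) (auto simp: lookup_sum lookup_single when_def in_keys_iff cong: if_cong)

lemma kronecker_mult: "kronecker N (p * q) = kronecker N p * kronecker N q"
proof -
  have "p * q = (\<Sum>\<alpha>\<in>Poly_Mapping.keys p. \<Sum>\<beta>\<in>Poly_Mapping.keys q.
      Poly_Mapping.single (\<alpha> + \<beta>) (Poly_Mapping.lookup p \<alpha> * Poly_Mapping.lookup q \<beta>))"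
    using arg_cong2[of _ _ _ _ "(*)", OF poly_mapping_sum_single[of p] poly_mapping_sum_single[of q]]
    unfolding sum_product mult_single .
  then show ?thesis
    by (simp add: kronecker_sum kronecker_single kcode_add mult_monom[symmetric])
      (simp add: kronecker_def sum_product)
qed

lemma kronecker_hom: "comm_ring_hom (kronecker N)"
proof
  show "kronecker N 1 = 1" using kronecker_single[of N 0 1] by (simp add: kcode_def)
qed (simp_all add: kronecker_add kronecker_mult kronecker_0)

text \<open>A bound for the degree in each variable separately, which is what reading off digits
  requires.\<close>

definition exps_le :: "nat \<Rightarrow> ((nat \<Rightarrow>\<^sub>0 nat) \<Rightarrow>\<^sub>0 'a::comm_ring_1) \<Rightarrow> bool" where
  "exps_le d p \<longleftrightarrow> (\<forall>\<alpha>\<in>Poly_Mapping.keys p. \<forall>k. Poly_Mapping.lookup \<alpha> k \<le> d)"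

lemma exps_le_add: "exps_le d p \<Longrightarrow> exps_le d q \<Longrightarrow> exps_le d (p + q)"
  using keys_add[of p q] unfolding exps_le_def by blast

lemma exps_le_0: "exps_le d 0" by (simp add: exps_le_def)

lemma exps_le_sum: "(\<And>i. i \<in> I \<Longrightarrow> exps_le d (f i)) \<Longrightarrow> exps_le d (\<Sum>i\<in>I. f i)"
  by (induct I rule: infinite_finite_induct) (auto simp: exps_le_0 intro: exps_le_add)

lemma exps_le_mult: "exps_le d p \<Longrightarrow> exps_le e q \<Longrightarrow> exps_le (d + e) (p * q)"
  using keys_mult[of p q] unfolding exps_le_def by (fastforce simp: lookup_add intro: add_mono)

lemma exps_le_prod: "(\<And>i. i \<in> I \<Longrightarrow> exps_le 1 (f i)) \<Longrightarrow> exps_le (card I) (\<Prod>i\<in>I. f i)"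
proof (induct I rule: infinite_finite_induct)
  case (insert i I)
  then show ?case using exps_le_mult[of 1 "f i" "card I" "prod f I"] by simp
qed (auto simp: exps_le_def)

lemma exps_le_det:
  assumes A: "A \<in> carrier_mat n n" and e: "\<And>i j. i < n \<Longrightarrow> j < n \<Longrightarrow> exps_le 1 (A $$ (i, j))"
  shows "exps_le n (det A)"
  unfolding det_def'[OF A]
proof (intro exps_le_sum)
  fix p assume p: "p \<in> {p. p permutes {0..<n}}"
  have "exps_le n (\<Prod>i = 0..<n. A $$ (i, p i))"
    using exps_le_prod[of "{0..<n}" "\<lambda>i. A $$ (i, p i)"] e p by (auto dest: permutes_in_image)
  moreover have "exps_le 0 (signof p :: (nat \<Rightarrow>\<^sub>0 nat) \<Rightarrow>\<^sub>0 'a)"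
    by (cases p rule: sign_cases) (auto simp: exps_le_def)
  ultimately show "exps_le n (signof p * (\<Prod>i = 0..<n. A $$ (i, p i)))" using exps_le_mult by fastforce
qed

lemma digits_unique:
  fixes a b :: "nat \<Rightarrow> nat"
  assumes "(\<Sum>k<t. a k * N ^ k) = (\<Sum>k<t. b k * N ^ k)" "\<And>k. a k < N" "\<And>k. b k < N" "k < t"
  shows "a k = b k"
  using assms
proof (induct t arbitrary: a b k)
  case (Suc t)
  have e: "(\<Sum>k<Suc t. c k * N ^ k) = c 0 + N * (\<Sum>k<t. c (Suc k) * N ^ k)" for c :: "nat \<Rightarrow> nat"
    by (simp only: sum.lessThan_Suc_shift) (simp add: sum_distrib_left algebra_simps)
  have N: "N > 0" using Suc(3)[of 0] by simp
  have "a 0 + N * (\<Sum>k<t. a (Suc k) * N ^ k) = b 0 + N * (\<Sum>k<t. b (Suc k) * N ^ k)"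
    using Suc(2) unfolding e .
  then have "(a 0 + N * (\<Sum>k<t. a (Suc k) * N ^ k)) mod N = (b 0 + N * (\<Sum>k<t. b (Suc k) * N ^ k)) mod N"
    "(a 0 + N * (\<Sum>k<t. a (Suc k) * N ^ k)) div N = (b 0 + N * (\<Sum>k<t. b (Suc k) * N ^ k)) div N" by simp_all
  then have "a 0 = b 0" "(\<Sum>k<t. a (Suc k) * N ^ k) = (\<Sum>k<t. b (Suc k) * N ^ k)"
    using Suc(3,4) N by simp_all
  then show ?case using Suc(1)[of "\<lambda>k. a (Suc k)" "\<lambda>k. b (Suc k)"] Suc(3,4,5) by (cases k) auto
qed simp

lemma kcode_inj:
  assumes "kcode N \<alpha> = kcode N \<beta>" "\<And>k. Poly_Mapping.lookup \<alpha> k < N" "\<And>k. Poly_Mapping.lookup \<beta> k < N"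
  shows "\<alpha> = \<beta>"
proof -
  have "finite (Poly_Mapping.keys \<alpha> \<union> Poly_Mapping.keys \<beta>)" by simp
  then obtain t where t: "Poly_Mapping.keys \<alpha> \<union> Poly_Mapping.keys \<beta> \<subseteq> {..<t}"
    using finite_nat_iff_bounded by auto
  then have "(\<Sum>k<t. Poly_Mapping.lookup \<alpha> k * N ^ k) = (\<Sum>k<t. Poly_Mapping.lookup \<beta> k * N ^ k)"
    using assms(1) kcode_superset[of "{..<t}"] by simp
  then have "Poly_Mapping.lookup \<alpha> k = Poly_Mapping.lookup \<beta> k" if "k < t" for k
    using digits_unique[of "Poly_Mapping.lookup \<alpha>" N t "Poly_Mapping.lookup \<beta>" k] assms(2,3) that by simp
  moreover have "Poly_Mapping.lookup \<alpha> k = Poly_Mapping.lookup \<beta> k" if "\<not> k < t" for k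
    using t that by (metis UnCI in_keys_iff lessThan_iff subsetD)
  ultimately show ?thesis by (intro poly_mapping_eqI) blast
qed

lemma coeff_kronecker:
  assumes p: "exps_le d p" and d: "d < N" and \<alpha>: "\<And>k. Poly_Mapping.lookup \<alpha> k < N"
  shows "Polynomial.coeff (kronecker N p) (kcode N \<alpha>) = Poly_Mapping.lookup p \<alpha>"
proof -
  have "Polynomial.coeff (kronecker N p) (kcode N \<alpha>) =
      (\<Sum>\<beta>\<in>Poly_Mapping.keys p. if \<beta> = \<alpha> then Poly_Mapping.lookup p \<alpha> else 0)"
    unfolding kronecker_def coeff_sum
  proof (rule sum.cong[OF refl])
    fix \<beta> assume "\<beta> \<in> Poly_Mapping.keys p"
    then have "Poly_Mapping.lookup \<beta> k < N" for k using p d unfolding exps_le_def by (meson le_less_trans)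
    then have "kcode N \<beta> = kcode N \<alpha> \<longleftrightarrow> \<beta> = \<alpha>" using kcode_inj[of N \<beta> \<alpha>] \<alpha> by auto
    then show "Polynomial.coeff (Polynomial.monom (Poly_Mapping.lookup p \<beta>) (kcode N \<beta>)) (kcode N \<alpha>) =
        (if \<beta> = \<alpha> then Poly_Mapping.lookup p \<alpha> else 0)" by simp
  qed
  then show ?thesis by (auto simp: in_keys_iff)
qed

text \<open>For N above the degrees, distinct monomials are sent to distinct powers of T, so
  coefficients can be compared after the substitution. The map \<open>\<phi>\<close> is only
  required to fix 0: it is applied coefficient by coefficient, and additivity does not
  enter.\<close>

lemma map_eq_if_kronecker_eq:
  fixes \<phi> :: "'a::comm_ring_1 \<Rightarrow> 'b::comm_ring_1"
  assumes p: "exps_le d p" and q: "exps_le e q" and N: "d < N" "e < N" and \<phi>: "\<phi> 0 = 0"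
    and eq: "\<And>i. Polynomial.coeff (kronecker N q) i = \<phi> (Polynomial.coeff (kronecker N p) i)"
  shows "q = Poly_Mapping.map \<phi> p"
proof (rule poly_mapping_eqI)
  fix \<alpha>
  show "Poly_Mapping.lookup q \<alpha> = Poly_Mapping.lookup (Poly_Mapping.map \<phi> p) \<alpha>"
  proof (cases "\<forall>k. Poly_Mapping.lookup \<alpha> k < N")
    case True
    then show ?thesis using eq[of "kcode N \<alpha>"] coeff_kronecker[OF p N(1), of \<alpha>] coeff_kronecker[OF q N(2), of \<alpha>] \<phi>
      by (simp add: map.rep_eq when_def)
  next
    case False
    then have "\<alpha> \<notin> Poly_Mapping.keys p" "\<alpha> \<notin> Poly_Mapping.keys q"
      using p q N unfolding exps_le_def by (meson le_less_trans)+
    then show ?thesis using \<phi> by (simp add: map.rep_eq in_keys_iff)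
  qed
qed

section \<open>Subrings as coefficient rings, and free modules on a set of symbols\<close>

lemma tring_simps[simp]:
  "carrier tring = UNIV" "monoid.mult tring = (*)" "monoid.one tring = 1" "ring.zero tring = 0" "ring.add tring = (+)"
  by (simp_all add: ring_of_type_algebra_def fun_eq_iff)

lemma subtring_UNIV: "subtring UNIV = tring"
  by (simp add: ring_of_type_algebra_def)

lemma closed_subring_UNIV[simp]: "closed_subring UNIV" by (simp add: closed_subring_def)

lemma cring_subtring:
  assumes S: "closed_subring S" shows "cring (subtring S)"
proof (rule cringI)
  show "abelian_group (subtring S)"
    by (rule abelian_groupI) (auto simp: closed_subringD[OF S] algebra_simps intro!: bexI[of _ "- x" for x])
  show "comm_monoid (subtring S)"
    by (rule comm_monoidI) (auto simp: closed_subringD[OF S] algebra_simps)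
qed (auto simp: algebra_simps)

abbreviation scale :: "'s::comm_ring_1 \<Rightarrow> ('x \<Rightarrow>\<^sub>0 's) \<Rightarrow> ('x \<Rightarrow>\<^sub>0 's)" where
  "scale a \<equiv> Poly_Mapping.map ((*) a)"

lemma lookup_scale[simp]: "Poly_Mapping.lookup (scale a x) k = a * Poly_Mapping.lookup x k"
  by (simp add: map.rep_eq when_def)

lemma keys_scale: "Poly_Mapping.keys (scale a x) \<subseteq> Poly_Mapping.keys x"
  by (auto simp: in_keys_iff)

text \<open>The linear form on the free module with prescribed values on the generators.\<close>

definition functional :: "('x \<Rightarrow> 's::comm_ring_1) \<Rightarrow> ('x \<Rightarrow>\<^sub>0 's) \<Rightarrow> 's" where
  "functional \<beta> x = (\<Sum>k\<in>Poly_Mapping.keys x. Poly_Mapping.lookup x k * \<beta> k)"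

lemma functional_superset:
  "finite I \<Longrightarrow> Poly_Mapping.keys x \<subseteq> I \<Longrightarrow> functional \<beta> x = (\<Sum>k\<in>I. Poly_Mapping.lookup x k * \<beta> k)"
  unfolding functional_def by (rule sum.mono_neutral_left) (auto simp: in_keys_iff)

lemma functional_add: "functional \<beta> (x + y) = functional \<beta> x + functional \<beta> y"
proof -
  let ?I = "Poly_Mapping.keys x \<union> Poly_Mapping.keys y"
  have "Poly_Mapping.keys (x + y) \<subseteq> ?I" by (rule keys_add)
  then show ?thesis
    by (subst (1 2 3) functional_superset[of ?I]) (auto simp: lookup_add sum.distrib algebra_simps)
qed

lemma functional_scale: "functional \<beta> (scale a x) = a * functional \<beta> x"
  by (subst functional_superset[OF _ keys_scale]) (auto simp: functional_def sum_distrib_left mult.assoc)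

lemma functional_0[simp]: "functional \<beta> 0 = 0" by (simp add: functional_def)

lemma functional_diff: "functional \<beta> (x - y) = functional \<beta> x - functional \<beta> y"
proof -
  have "x - y + y = x" by simp
  then show ?thesis using functional_add[of \<beta> "x - y" y] by (metis add_diff_cancel_right')
qed

lemma functional_sum: "functional \<beta> (sum f I) = (\<Sum>i\<in>I. functional \<beta> (f i))"
  by (induct I rule: infinite_finite_induct) (simp_all add: functional_add)

lemma functional_single[simp]: "functional \<beta> (Poly_Mapping.single k a) = a * \<beta> k"
  by (cases "a = 0") (simp_all add: functional_def)

lemma functional_cong: "(\<And>k. k \<in> Poly_Mapping.keys x \<Longrightarrow> \<beta> k = \<gamma> k) \<Longrightarrow> functional \<beta> x = functional \<gamma> x"
  by (simp add: functional_def)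

lemma free_map_superset:
  assumes "\<theta> 0 = 0" "finite I" "Poly_Mapping.keys x \<subseteq> I"
  shows "free_map f \<theta> x = (\<Sum>k\<in>I. Poly_Mapping.single (f k) (\<theta> (Poly_Mapping.lookup x k)))"
  unfolding free_map_def using assms by (intro sum.mono_neutral_left) (auto simp: in_keys_iff)

text \<open>Homomorphisms relative to a subset: the structure map \<open>\<phi>\<close> is a
  function on the whole algebraic closure but respects sums and products on O_E only.\<close>

definition hom_on :: "'s::comm_ring_1 set \<Rightarrow> ('s \<Rightarrow> 't::comm_ring_1) \<Rightarrow> bool" where
  "hom_on S \<theta> \<longleftrightarrow> \<theta> 1 = 1 \<and> (\<forall>x\<in>S. \<forall>y\<in>S. \<theta> (x + y) = \<theta> x + \<theta> y \<and> \<theta> (x * y) = \<theta> x * \<theta> y)"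

lemma hom_onD:
  assumes "hom_on S \<theta>" "closed_subring S"
  shows "\<theta> 1 = 1" "\<theta> 0 = 0" "x \<in> S \<Longrightarrow> \<theta> (- x) = - \<theta> x" "x \<in> S \<Longrightarrow> y \<in> S \<Longrightarrow> \<theta> (x + y) = \<theta> x + \<theta> y"
    "x \<in> S \<Longrightarrow> y \<in> S \<Longrightarrow> \<theta> (x - y) = \<theta> x - \<theta> y" "x \<in> S \<Longrightarrow> y \<in> S \<Longrightarrow> \<theta> (x * y) = \<theta> x * \<theta> y"
proof -
  show 1: "\<theta> 1 = 1" and a: "x \<in> S \<Longrightarrow> y \<in> S \<Longrightarrow> \<theta> (x + y) = \<theta> x + \<theta> y" "x \<in> S \<Longrightarrow> y \<in> S \<Longrightarrow> \<theta> (x * y) = \<theta> x * \<theta> y" for x y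
    using assms by (auto simp: hom_on_def)
  show 0: "\<theta> 0 = 0" using a(1)[of 0 0] closed_subringD[OF assms(2)] by simp
  show m: "x \<in> S \<Longrightarrow> \<theta> (- x) = - \<theta> x" for x
    using a(1)[of x "- x"] 0 closed_subringD[OF assms(2)] by (simp add: eq_neg_iff_add_eq_0 add.commute)
  show "x \<in> S \<Longrightarrow> y \<in> S \<Longrightarrow> \<theta> (x - y) = \<theta> x - \<theta> y"
    using a(1)[of x "- y"] m closed_subringD[OF assms(2)] by simp
qed

lemma hom_on_sum:
  assumes "hom_on S \<theta>" "closed_subring S" "\<And>i. i \<in> I \<Longrightarrow> f i \<in> S"
  shows "\<theta> (sum f I) = (\<Sum>i\<in>I. \<theta> (f i))"
  using assms(3) by (induct I rule: infinite_finite_induct)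
    (auto simp: hom_onD[OF assms(1,2)] closed_subring_sum[OF assms(2)])

lemma hom_on_prod:
  assumes "hom_on S \<theta>" "closed_subring S" "\<And>i. i \<in> I \<Longrightarrow> f i \<in> S"
  shows "\<theta> (prod f I) = (\<Prod>i\<in>I. \<theta> (f i))"
  using assms(3) by (induct I rule: infinite_finite_induct)
    (auto simp: hom_onD[OF assms(1,2)] closed_subring_prod[OF assms(2)])

lemma hom_on_det:
  assumes h: "hom_on S \<theta>" and S: "closed_subring S" and A: "A \<in> carrier_mat n n"
    and e: "\<And>i j. i < n \<Longrightarrow> j < n \<Longrightarrow> A $$ (i, j) \<in> S"
  shows "\<theta> (det A) = det (map_mat \<theta> A)"
proof -
  have p: "(\<Prod>i = 0..<n. A $$ (i, p i)) \<in> S" "signof p \<in> S" if "p permutes {0..<n}" for p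
    using that e by (auto intro!: closed_subring_prod[OF S] dest: permutes_in_image)
      (cases p rule: sign_cases; simp add: closed_subringD[OF S])
  have "\<theta> (det A) = (\<Sum>p\<in>{p. p permutes {0..<n}}. \<theta> (signof p * (\<Prod>i = 0..<n. A $$ (i, p i))))"
    unfolding det_def'[OF A] using p by (intro hom_on_sum[OF h S]) (auto intro: closed_subringD[OF S])
  also have "\<dots> = (\<Sum>p\<in>{p. p permutes {0..<n}}. signof p * (\<Prod>i = 0..<n. map_mat \<theta> A $$ (i, p i)))"
  proof (rule sum.cong[OF refl])
    fix p assume "p \<in> {p. p permutes {0..<n}}"
    then have pp: "p permutes {0..<n}" by simp
    have "\<theta> (signof p) = signof p"
      by (cases p rule: sign_cases) (simp_all add: hom_onD[OF h S] closed_subringD[OF S])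
    moreover have "\<theta> (\<Prod>i = 0..<n. A $$ (i, p i)) = (\<Prod>i = 0..<n. map_mat \<theta> A $$ (i, p i))"
      using pp e A by (subst hom_on_prod[OF h S]) (auto dest: permutes_in_image intro!: prod.cong)
    ultimately show "\<theta> (signof p * (\<Prod>i = 0..<n. A $$ (i, p i))) = signof p * (\<Prod>i = 0..<n. map_mat \<theta> A $$ (i, p i))"
      using p[OF pp] by (simp add: hom_onD[OF h S])
  qed
  also have "\<dots> = det (map_mat \<theta> A)" using A by (subst det_def'[of _ n]) auto
  finally show ?thesis .
qed

lemma functional_free_map:
  assumes h: "hom_on S \<theta>" "closed_subring S"
    and x: "range (Poly_Mapping.lookup x) \<subseteq> S" and \<beta>: "\<And>k. k \<in> Poly_Mapping.keys x \<Longrightarrow> \<beta>' k \<in> S \<and> \<beta> (f k) = \<theta> (\<beta>' k)"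
  shows "functional \<beta> (free_map f \<theta> x) = \<theta> (functional \<beta>' x)"
proof -
  have x': "Poly_Mapping.lookup x k \<in> S" for k using x by auto
  have "functional \<beta> (free_map f \<theta> x) = (\<Sum>k\<in>Poly_Mapping.keys x. \<theta> (Poly_Mapping.lookup x k * \<beta>' k))"
    unfolding free_map_def functional_sum using \<beta> x' by (intro sum.cong) (auto simp: hom_onD[OF h])
  also have "\<dots> = \<theta> (functional \<beta>' x)"
    unfolding functional_def using \<beta> x' by (intro hom_on_sum[OF h, symmetric]) (auto intro: closed_subringD[OF h(2)])
  finally show ?thesis .
qed

lemma free_map_add:
  assumes h: "hom_on S \<theta>" "closed_subring S" and "range (Poly_Mapping.lookup x) \<subseteq> S" "range (Poly_Mapping.lookup y) \<subseteq> S"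
  shows "free_map f \<theta> (x + y) = free_map f \<theta> x + free_map f \<theta> y"
proof -
  let ?I = "Poly_Mapping.keys x \<union> Poly_Mapping.keys y"
  have "\<theta> (Poly_Mapping.lookup x k + Poly_Mapping.lookup y k) = \<theta> (Poly_Mapping.lookup x k) + \<theta> (Poly_Mapping.lookup y k)" for k
    using assms(3,4) by (intro hom_onD[OF h]) auto
  moreover have "Poly_Mapping.keys (x + y) \<subseteq> ?I" by (rule keys_add)
  ultimately show ?thesis
    by (subst (1 2 3) free_map_superset[of _ ?I]) (auto simp: hom_onD[OF h] lookup_add sum.distrib single_add)
qed

lemma scale_single[simp]: "scale a (Poly_Mapping.single k b) = Poly_Mapping.single k (a * b)"
  by (rule poly_mapping_eqI) (simp add: lookup_single when_def)

lemma scale_add: "scale a (x + y) = scale a x + scale a y"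
  by (rule poly_mapping_eqI) (simp add: lookup_add algebra_simps)

lemma scale_add_left: "scale (a + b) x = scale a x + scale b x"
  by (rule poly_mapping_eqI) (simp add: lookup_add algebra_simps)

lemma scale_scale: "scale (a * b) x = scale a (scale b x)"
  by (rule poly_mapping_eqI) (simp add: mult.assoc)

lemma scale_one[simp]: "scale 1 x = x"
  by (rule poly_mapping_eqI) simp

lemma scale_0[simp]: "scale a 0 = 0" by (rule poly_mapping_eqI) simp

lemma scale_sum: "scale a (sum f I) = (\<Sum>i\<in>I. scale a (f i))"
  by (induct I rule: infinite_finite_induct) (simp_all add: scale_add)

lemma scale_diff: "scale a (x - y) = scale a x - scale a y"
  by (rule poly_mapping_eqI) (simp add: lookup_minus algebra_simps)

lemma free_map_scale:
  assumes h: "hom_on S \<theta>" "closed_subring S" and "range (Poly_Mapping.lookup x) \<subseteq> S" "a \<in> S"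
  shows "free_map f \<theta> (scale a x) = scale (\<theta> a) (free_map f \<theta> x)"
proof -
  have "\<theta> (a * Poly_Mapping.lookup x k) = \<theta> a * \<theta> (Poly_Mapping.lookup x k)" for k
    using assms(3,4) by (intro hom_onD[OF h]) auto
  then show ?thesis
    by (subst (1 2) free_map_superset[of _ "Poly_Mapping.keys x"]) (auto simp: hom_onD[OF h] scale_sum keys_scale)
qed

lemma free_map_single: "\<theta> 0 = 0 \<Longrightarrow> free_map f \<theta> (Poly_Mapping.single k a) = Poly_Mapping.single (f k) (\<theta> a)"
  by (cases "a = 0") (auto simp: free_map_def)

definition finsupp :: "'s::comm_ring_1 set \<Rightarrow> 'x set \<Rightarrow> ('x \<Rightarrow>\<^sub>0 's) set" where
  "finsupp S Z = {f. Poly_Mapping.keys f \<subseteq> Z \<and> range (Poly_Mapping.lookup f) \<subseteq> S}"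

lemma finsuppD: "x \<in> finsupp S Z \<Longrightarrow> Poly_Mapping.keys x \<subseteq> Z" "x \<in> finsupp S Z \<Longrightarrow> range (Poly_Mapping.lookup x) \<subseteq> S"
  "x \<in> finsupp S Z \<Longrightarrow> Poly_Mapping.lookup x k \<in> S"
  by (auto simp: finsupp_def)

lemma finsupp_closed:
  assumes S: "closed_subring S"
  shows "0 \<in> finsupp S Z" "x \<in> finsupp S Z \<Longrightarrow> y \<in> finsupp S Z \<Longrightarrow> x + y \<in> finsupp S Z"
    "x \<in> finsupp S Z \<Longrightarrow> y \<in> finsupp S Z \<Longrightarrow> x - y \<in> finsupp S Z"
    "a \<in> S \<Longrightarrow> x \<in> finsupp S Z \<Longrightarrow> scale a x \<in> finsupp S Z"
    "k \<in> Z \<Longrightarrow> a \<in> S \<Longrightarrow> Poly_Mapping.single k a \<in> finsupp S Z"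
  using keys_add[of x y] keys_diff[of x y] keys_scale[of a x] closed_subringD[OF S]
  unfolding finsupp_def by (auto simp: image_subset_iff lookup_add lookup_minus lookup_single when_def split: if_splits)

lemma free_map_closed:
  assumes h: "hom_on S \<theta>" "closed_subring S" "\<theta> ` S \<subseteq> T" "closed_subring T" and f: "f ` Z \<subseteq> Y" and x: "x \<in> finsupp S Z"
  shows "free_map f \<theta> x \<in> finsupp T Y"
proof -
  have 1: "sum g I \<in> finsupp T Y" if "\<And>k. k \<in> I \<Longrightarrow> g k \<in> finsupp T Y" for g I
    using that by (induct I rule: infinite_finite_induct) (simp_all only: sum.infinite sum.empty sum.insert finsupp_closed[OF h(4)] insert_iff simp_thms)
  have 2: "Poly_Mapping.single (f k) (\<theta> (Poly_Mapping.lookup x k)) \<in> finsupp T Y" if "k \<in> Poly_Mapping.keys x" for k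
    using that finsuppD[OF x] f h(3) by (intro finsupp_closed(5)[OF h(4)]) blast+
  show ?thesis unfolding free_map_def by (rule 1, rule 2)
qed

lemma free_module_simps[simp]:
  "carrier (free_module (subtring S) Z) = finsupp S Z" "ring.zero (free_module (subtring S) Z) = 0"
  "ring.add (free_module (subtring S) Z) = (+)" "module.smult (free_module (subtring S) Z) = scale"
  by (simp_all add: free_module_def finsupp_def)

lemma free_module_module:
  assumes S: "closed_subring S" shows "module (subtring S) (free_module (subtring S) Z)"
proof (rule module_criteria)
  show "\<forall>v\<in>carrier (free_module (subtring S) Z). \<exists>w\<in>carrier (free_module (subtring S) Z).
      v \<oplus>\<^bsub>free_module (subtring S) Z\<^esub> w = \<zero>\<^bsub>free_module (subtring S) Z\<^esub>"
    using finsupp_closed(3)[OF S finsupp_closed(1)[OF S, of Z]] by (intro ballI bexI[of _ "0 - x" for x]) simp_all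
qed (auto simp: cring_subtring[OF S] closed_subringD[OF S] finsupp_closed[OF S]
     scale_add scale_add_left scale_scale add.commute add.assoc add.left_commute)

section \<open>Quotients of free modules\<close>

text \<open>The common shape of base changes and exterior powers: a free module on symbols modulo
  the span of explicit relations. Maps and forms are defined on symbols and checked on
  \<open>gens\<close>.\<close>

locale free_quotient =
  fixes S :: "'s::comm_ring_1 set" and Z :: "'x set" and gens :: "('x \<Rightarrow>\<^sub>0 's) set"
  assumes S: "closed_subring S" and gens: "gens \<subseteq> finsupp S Z"
begin

abbreviation F where "F \<equiv> free_module (subtring S) Z"
definition rel where "rel = mspan (subtring S) F gens"
abbreviation Q where "Q \<equiv> quot_module F rel"
definition cls where "cls x = rel +>\<^bsub>F\<^esub> x"

sublocale F: module "subtring S" F by (rule free_module_module[OF S])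

lemma rel_submodule: "LinearCombinations.submodule (subtring S) rel F"
  unfolding rel_def by (rule F.span_is_submodule) (use gens in simp)

lemma rel_closed:
  shows "rel \<subseteq> finsupp S Z" "0 \<in> rel" "x \<in> rel \<Longrightarrow> y \<in> rel \<Longrightarrow> x + y \<in> rel"
    "a \<in> S \<Longrightarrow> x \<in> rel \<Longrightarrow> scale a x \<in> rel" "x \<in> rel \<Longrightarrow> - x \<in> rel" "x \<in> rel \<Longrightarrow> y \<in> rel \<Longrightarrow> x - y \<in> rel"
proof -
  have 0: "rel \<subseteq> finsupp S Z" and 1: "0 \<in> rel" "\<And>x y. x \<in> rel \<Longrightarrow> y \<in> rel \<Longrightarrow> x + y \<in> rel"
    "\<And>a x. a \<in> S \<Longrightarrow> x \<in> rel \<Longrightarrow> scale a x \<in> rel"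
    using rel_submodule unfolding LinearCombinations.submodule_def by auto
  have m: "x \<in> rel \<Longrightarrow> - x \<in> rel" for x
  proof -
    have "scale (- 1) x = - x" by (rule poly_mapping_eqI) simp
    then show "x \<in> rel \<Longrightarrow> - x \<in> rel" using 1(3)[of "- 1" x] closed_subringD[OF S] by simp
  qed
  show "rel \<subseteq> finsupp S Z" "0 \<in> rel" "x \<in> rel \<Longrightarrow> y \<in> rel \<Longrightarrow> x + y \<in> rel" "a \<in> S \<Longrightarrow> x \<in> rel \<Longrightarrow> scale a x \<in> rel"
    "x \<in> rel \<Longrightarrow> - x \<in> rel"
    by (fact 0 1 m)+
  show "x \<in> rel \<Longrightarrow> y \<in> rel \<Longrightarrow> x - y \<in> rel" using 1(2)[OF _ m, of x y] by simp
qed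

lemma gens_rel: "gens \<subseteq> rel"
  unfolding rel_def by (rule F.in_own_span) (use gens in simp)

lemma rel_induct:
  assumes "x \<in> rel" and "P 0" and "\<And>g. g \<in> gens \<Longrightarrow> P g"
    and "\<And>x y. x \<in> finsupp S Z \<Longrightarrow> y \<in> finsupp S Z \<Longrightarrow> P x \<Longrightarrow> P y \<Longrightarrow> P (x + y)"
    and "\<And>a x. a \<in> S \<Longrightarrow> x \<in> finsupp S Z \<Longrightarrow> P x \<Longrightarrow> P (scale a x)"
  shows "P x"
proof -
  have "LinearCombinations.submodule (subtring S) {x \<in> finsupp S Z. P x} F"
    unfolding LinearCombinations.submodule_def
    using assms(2,4,5) finsupp_closed[OF S] F.module_axioms by auto
  then have "rel \<subseteq> {x \<in> finsupp S Z. P x}"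
    unfolding rel_def using gens assms(3) by (intro F.span_is_subset) auto
  then show ?thesis using assms(1) by auto
qed

lemma cls: "cls x = (\<lambda>h. h + x) ` rel"
  unfolding cls_def a_r_coset_def' by auto

lemma cls_eq_iff: "cls x = cls y \<longleftrightarrow> x - y \<in> rel"
proof
  assume "cls x = cls y"
  then have "x \<in> cls y" using rel_closed(2) by (metis (no_types, lifting) add_0 cls image_eqI)
  then show "x - y \<in> rel" by (auto simp: cls)
next
  assume d: "x - y \<in> rel"
  have "h + x \<in> (\<lambda>h. h + y) ` rel" if "h \<in> rel" for h
    using rel_closed(3)[OF that d] by (intro image_eqI[of _ _ "h + (x - y)"]) auto
  moreover have "h + y \<in> (\<lambda>h. h + x) ` rel" if "h \<in> rel" for h
    using rel_closed(6)[OF that d] by (intro image_eqI[of _ _ "h - (x - y)"]) auto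
  ultimately show "cls x = cls y" unfolding cls by blast
qed

lemma carrier_Q: "carrier Q = cls ` finsupp S Z"
  by (auto simp: quot_module_def A_RCOSETS_def' cls_def a_r_coset_def')

lemma zero_Q: "ring.zero Q = cls 0"
  by (simp add: quot_module_def cls)

lemma add_Q: "cls x \<oplus>\<^bsub>Q\<^esub> cls y = cls (x + y)"
proof -
  have "cls x \<oplus>\<^bsub>Q\<^esub> cls y = {h + g |h g. h \<in> cls x \<and> g \<in> cls y}"
    by (auto simp: quot_module_def set_add_def')
  also have "\<dots> = cls (x + y)"
  proof (intro equalityI subsetI)
    fix z assume "z \<in> {h + g |h g. h \<in> cls x \<and> g \<in> cls y}"
    then obtain a b where "a \<in> rel" "b \<in> rel" "z = (a + x) + (b + y)" by (auto simp: cls)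
    then show "z \<in> cls (x + y)" unfolding cls
      by (intro image_eqI[of _ _ "a + b"]) (auto simp: rel_closed algebra_simps)
  next
    fix z assume "z \<in> cls (x + y)"
    then obtain a where "a \<in> rel" "z = a + (x + y)" by (auto simp: cls)
    then show "z \<in> {h + g |h g. h \<in> cls x \<and> g \<in> cls y}"
    proof -
      have "z = (a + x) + (0 + y)" "a + x \<in> cls x" "0 + y \<in> cls y"
        using \<open>z = a + (x + y)\<close> \<open>a \<in> rel\<close> rel_closed(2) unfolding cls by (simp_all add: add.assoc)
      then show ?thesis by blast
    qed
  qed
  finally show ?thesis .
qed

lemma smult_Q: "a \<in> S \<Longrightarrow> a \<odot>\<^bsub>Q\<^esub> cls x = cls (scale a x)"
proof -
  assume a: "a \<in> S"
  have 1: "cls (scale a z) = cls (scale a x)" if "z \<in> cls x" for z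
    using that a rel_closed(4) unfolding cls_eq_iff scale_diff[symmetric] by (auto simp: cls)
  have 2: "x \<in> cls x" using rel_closed(2) unfolding cls by (intro image_eqI[of _ _ 0]) auto
  have "a \<odot>\<^bsub>Q\<^esub> cls x = (\<Union>z\<in>cls x. cls (scale a z))" unfolding quot_module_def cls_def by simp
  also have "\<dots> = (\<Union>z\<in>cls x. cls (scale a x))" by (rule SUP_cong[OF refl 1])
  also have "\<dots> = cls (scale a x)" using 2 by (simp only: UN_constant split: if_split) blast
  finally show ?thesis .
qed

lemma module_Q: "module (subtring S) Q"
proof (rule module_criteria)
  show "\<forall>v\<in>carrier Q. \<exists>w\<in>carrier Q. v \<oplus>\<^bsub>Q\<^esub> w = \<zero>\<^bsub>Q\<^esub>"
  proof
    fix v assume "v \<in> carrier Q"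
    then obtain x where "x \<in> finsupp S Z" "v = cls x" by (auto simp: carrier_Q)
    then show "\<exists>w\<in>carrier Q. v \<oplus>\<^bsub>Q\<^esub> w = \<zero>\<^bsub>Q\<^esub>"
      using finsupp_closed(3)[OF S finsupp_closed(1)[OF S], of x Z]
      by (intro bexI[of _ "cls (0 - x)"]) (simp_all add: add_Q zero_Q carrier_Q)
  qed
qed (auto simp: cring_subtring[OF S] carrier_Q zero_Q add_Q smult_Q closed_subringD[OF S] finsupp_closed[OF S]
     scale_add scale_add_left scale_scale add.commute add.assoc add.left_commute)

end

text \<open>The value of a linear form on a coset, at an arbitrary representative. It is well
  defined when the form kills the relations (\<open>class_value_cls\<close>).\<close>

definition class_value :: "('x \<Rightarrow> 's::comm_ring_1) \<Rightarrow> ('x \<Rightarrow>\<^sub>0 's) set \<Rightarrow> 's" where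
  "class_value \<beta> C = functional \<beta> (SOME x. x \<in> C)"

lemma class_value_eqI:
  assumes "C \<noteq> {}" "\<And>x. x \<in> C \<Longrightarrow> functional \<beta> x = c"
  shows "class_value \<beta> C = c"
  unfolding class_value_def using assms by (metis ex_in_conv someI_ex)

context free_quotient
begin

lemma functional_rel:
  assumes "\<And>g. g \<in> gens \<Longrightarrow> functional \<beta> g = 0" "x \<in> rel"
  shows "functional \<beta> x = 0"
  using assms(2) by (rule rel_induct) (simp_all add: assms(1) functional_add functional_scale)

lemma class_value_cls:
  assumes "\<And>g. g \<in> gens \<Longrightarrow> functional \<beta> g = 0"
  shows "class_value \<beta> (cls x) = functional \<beta> x"
  by (rule class_value_eqI) (use rel_closed(2) in \<open>auto simp: cls functional_add functional_rel[OF assms]\<close>)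

lemma rel_sum: "(\<And>i. i \<in> I \<Longrightarrow> g i \<in> rel) \<Longrightarrow> sum g I \<in> rel"
  by (induct I rule: infinite_finite_induct) (auto simp: rel_closed)

lemma functional_closed:
  assumes "x \<in> finsupp S Z" "\<And>k. k \<in> Z \<Longrightarrow> \<beta> k \<in> S" shows "functional \<beta> x \<in> S"
  unfolding functional_def using finsuppD[OF assms(1)] assms(2)
  by (intro closed_subring_sum[OF S] closed_subringD[OF S]) auto

lemma class_value_quot_map:
  assumes "\<And>g. g \<in> gens \<Longrightarrow> functional \<beta> g = 0" "C \<noteq> {}" "\<And>x. x \<in> C \<Longrightarrow> functional \<beta> (h x) = c"
  shows "class_value \<beta> (quot_map F rel h C) = c"
proof (rule class_value_eqI)
  show "quot_map F rel h C \<noteq> {}" using assms(2) rel_closed(2) by (auto simp: quot_map_def cls_def[symmetric] cls)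
  fix x assume "x \<in> quot_map F rel h C"
  then obtain y r where "y \<in> C" "r \<in> rel" "x = r + h y" by (auto simp: quot_map_def cls_def[symmetric] cls)
  then show "functional \<beta> x = c" using assms(3) functional_rel[OF assms(1)] by (simp add: functional_add)
qed

lemma cls_nonempty: "cls x \<noteq> {}" using rel_closed(2) by (auto simp: cls)

lemma cls_subset: "x \<in> finsupp S Z \<Longrightarrow> cls x \<subseteq> finsupp S Z"
  using rel_closed(1) finsupp_closed(2)[OF S] by (auto simp: cls)

lemma quot_map_closed_eq:
  assumes "\<And>y. y \<in> C \<Longrightarrow> cls (h y) = cls z" "C \<noteq> {}"
  shows "quot_map F rel h C = cls z"
proof -
  have "quot_map F rel h C = (\<Union>x\<in>C. cls (h x))" by (simp add: quot_map_def cls_def)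
  also have "\<dots> = (\<Union>x\<in>C. cls z)" by (rule SUP_cong[OF refl assms(1)])
  also have "\<dots> = cls z" using assms(2) by simp
  finally show ?thesis .
qed

end

text \<open>\<open>quot_map\<close> forms a union over all representatives of a coset. When
  relations go to relations, all of them contribute the same coset, and the union is the expected
  image.\<close>

lemma quot_map_free_map:
  assumes "free_quotient S Z gens" "free_quotient S' Z' gens'"
    and h: "hom_on S \<theta>" "\<theta> ` S \<subseteq> S'" and f: "f ` Z \<subseteq> Z'"
    and g: "\<And>g. g \<in> gens \<Longrightarrow> free_map f \<theta> g \<in> free_quotient.rel S' Z' gens'"
    and x: "x \<in> finsupp S Z"
  shows "quot_map (free_module (subtring S') Z') (free_quotient.rel S' Z' gens') (free_map f \<theta>) (free_quotient.cls S Z gens x) =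
     free_quotient.cls S' Z' gens' (free_map f \<theta> x)"
proof -
  interpret A: free_quotient S Z gens by fact
  interpret B: free_quotient S' Z' gens' by fact
  have rel: "free_map f \<theta> r \<in> B.rel" if "r \<in> A.rel" for r
    using that
  proof (rule A.rel_induct)
    show "free_map f \<theta> 0 \<in> B.rel" by (simp add: free_map_def B.rel_closed)
    show "free_map f \<theta> (x + y) \<in> B.rel" if "x \<in> finsupp S Z" "y \<in> finsupp S Z" "free_map f \<theta> x \<in> B.rel" "free_map f \<theta> y \<in> B.rel" for x y
      using that by (simp add: free_map_add[OF h(1) A.S finsuppD(2) finsuppD(2)] B.rel_closed)
    show "free_map f \<theta> (scale a x) \<in> B.rel" if "a \<in> S" "x \<in> finsupp S Z" "free_map f \<theta> x \<in> B.rel" for a x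
      using that h(2) by (simp add: free_map_scale[OF h(1) A.S finsuppD(2)] B.rel_closed image_subset_iff)
  qed (rule g)
  show ?thesis
  proof (rule B.quot_map_closed_eq[OF _ A.cls_nonempty])
    fix y assume "y \<in> A.cls x"
    then obtain r where r: "r \<in> A.rel" "y = r + x" by (auto simp: A.cls)
    then have "free_map f \<theta> y = free_map f \<theta> r + free_map f \<theta> x"
      using A.rel_closed(1) x by (auto intro!: free_map_add[OF h(1) A.S] finsuppD(2))
    then show "B.cls (free_map f \<theta> y) = B.cls (free_map f \<theta> x)"
      using rel[OF r(1)] by (simp add: B.cls_eq_iff)
  qed
qed

section \<open>Base change\<close>

locale base_change_module =
  fixes A :: "'a::comm_ring_1 set" and M :: "('a, 'm) module" and S :: "'s::comm_ring_1 set" and \<phi> :: "'a \<Rightarrow> 's"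
  assumes A: "closed_subring A" and M: "module (subtring A) M" and S_closed: "closed_subring S"
    and \<phi>: "hom_on A \<phi>" and \<phi>_closed: "\<phi> ` A \<subseteq> S"
begin

sublocale M: module "subtring A" M by (rule M)

lemma \<phi>_in: "a \<in> A \<Longrightarrow> \<phi> a \<in> S" using \<phi>_closed by auto

definition bc_gens where "bc_gens =
    {Poly_Mapping.single (x \<oplus>\<^bsub>M\<^esub> y) 1 - Poly_Mapping.single x 1 - Poly_Mapping.single y 1 | x y.
        x \<in> carrier M \<and> y \<in> carrier M} \<union>
     {Poly_Mapping.single (a \<odot>\<^bsub>M\<^esub> x) 1 - Poly_Mapping.single x (\<phi> a) | a x.
        a \<in> carrier (subtring A) \<and> x \<in> carrier M}"

sublocale free_quotient S "carrier M" bc_gens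
proof
  show "bc_gens \<subseteq> finsupp S (carrier M)"
    unfolding bc_gens_def using \<phi>_closed
    by (auto intro!: finsupp_closed[OF S_closed] closed_subringD[OF S_closed] M.smult_closed M.M.a_closed)
qed (rule S_closed)

lemma bc_rel_eq: "bc_rel (subtring A) M (subtring S) \<phi> = rel"
  unfolding bc_rel_def rel_def unfolding bc_gens_def by (rule refl)

lemma base_change_eq: "base_change (subtring A) M (subtring S) \<phi> = Q"
  unfolding base_change_def bc_rel_eq by (rule refl)

definition pure where "pure m = cls (Poly_Mapping.single m 1)"

lemma rel_add: "x \<in> carrier M \<Longrightarrow> y \<in> carrier M \<Longrightarrow>
    Poly_Mapping.single (x \<oplus>\<^bsub>M\<^esub> y) 1 - (Poly_Mapping.single x 1 + Poly_Mapping.single y 1) \<in> rel"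
  using gens_rel unfolding bc_gens_def by (force simp: diff_diff_eq)

lemma rel_smult: "a \<in> A \<Longrightarrow> x \<in> carrier M \<Longrightarrow>
    Poly_Mapping.single (a \<odot>\<^bsub>M\<^esub> x) 1 - Poly_Mapping.single x (\<phi> a) \<in> rel"
  using gens_rel unfolding bc_gens_def by force

lemma functional_gens:
  assumes add: "\<And>x y. x \<in> carrier M \<Longrightarrow> y \<in> carrier M \<Longrightarrow> \<beta> (x \<oplus>\<^bsub>M\<^esub> y) = \<beta> x + \<beta> y"
    and smult: "\<And>a x. a \<in> A \<Longrightarrow> x \<in> carrier M \<Longrightarrow> \<beta> (a \<odot>\<^bsub>M\<^esub> x) = \<phi> a * \<beta> x"
    and "g \<in> bc_gens"
  shows "functional \<beta> g = 0"
  using assms unfolding bc_gens_def by (auto simp: functional_diff)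

end

text \<open>A finite basis of \<open>M\<close> over \<open>A\<close>, given by the basis vectors and the coordinate functions.\<close>

locale based_module =
  fixes A :: "'a::comm_ring_1 set" and M :: "('a, 'm) module" and N :: nat and e :: "nat \<Rightarrow> 'm" and co :: "nat \<Rightarrow> 'm \<Rightarrow> 'a"
  assumes A: "closed_subring A" and M: "module (subtring A) M"
    and e_closed: "\<And>i. i < N \<Longrightarrow> e i \<in> carrier M"
    and co_closed: "\<And>i x. i < N \<Longrightarrow> x \<in> carrier M \<Longrightarrow> co i x \<in> A"
    and co_add: "\<And>i x y. i < N \<Longrightarrow> x \<in> carrier M \<Longrightarrow> y \<in> carrier M \<Longrightarrow> co i (x \<oplus>\<^bsub>M\<^esub> y) = co i x + co i y"
    and co_smult: "\<And>i a x. i < N \<Longrightarrow> a \<in> A \<Longrightarrow> x \<in> carrier M \<Longrightarrow> co i (a \<odot>\<^bsub>M\<^esub> x) = a * co i x"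
    and co_e: "\<And>i j. i < N \<Longrightarrow> j < N \<Longrightarrow> co i (e j) = (if i = j then 1 else 0)"
    and co_inj: "\<And>x. x \<in> carrier M \<Longrightarrow> (\<And>i. i < N \<Longrightarrow> co i x = 0) \<Longrightarrow> x = \<zero>\<^bsub>M\<^esub>"
begin

sublocale M: module "subtring A" M by (rule M)

lemma co_zero: "i < N \<Longrightarrow> co i \<zero>\<^bsub>M\<^esub> = 0"
  using co_smult[of i 0 "\<zero>\<^bsub>M\<^esub>"] closed_subringD[OF A] M.smult_r_null[of 0] by simp

lemma co_neg: "i < N \<Longrightarrow> x \<in> carrier M \<Longrightarrow> co i (\<ominus>\<^bsub>M\<^esub> x) = - co i x"
  using co_add[of i x "\<ominus>\<^bsub>M\<^esub> x"] co_zero[of i] by (simp add: M.M.r_neg eq_neg_iff_add_eq_0 add.commute)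

lemma co_minus: "i < N \<Longrightarrow> x \<in> carrier M \<Longrightarrow> y \<in> carrier M \<Longrightarrow> co i (x \<ominus>\<^bsub>M\<^esub> y) = co i x - co i y"
  by (simp add: a_minus_def co_add co_neg)

lemma co_finsum: "finite I \<Longrightarrow> i < N \<Longrightarrow> f \<in> I \<rightarrow> carrier M \<Longrightarrow> co i (finsum M f I) = (\<Sum>j\<in>I. co i (f j))"
  by (induct I rule: finite_induct) (auto simp: co_zero co_add Pi_iff M.M.finsum_insert M.M.finsum_closed)

lemma co_lincomb:
  assumes "i < N" "\<And>j. j < N \<Longrightarrow> a j \<in> A"
  shows "co i (\<Oplus>\<^bsub>M\<^esub>j\<in>{..<N}. a j \<odot>\<^bsub>M\<^esub> e j) = a i"
proof -
  have "co i (\<Oplus>\<^bsub>M\<^esub>j\<in>{..<N}. a j \<odot>\<^bsub>M\<^esub> e j) = (\<Sum>j\<in>{..<N}. co i (a j \<odot>\<^bsub>M\<^esub> e j))"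
    using assms e_closed by (intro co_finsum) auto
  also have "\<dots> = (\<Sum>j\<in>{..<N}. if j = i then a i else 0)"
    using assms e_closed by (intro sum.cong) (auto simp: co_smult co_e)
  finally show ?thesis using assms(1) by simp
qed

lemma co_ext: "x \<in> carrier M \<Longrightarrow> y \<in> carrier M \<Longrightarrow> (\<And>i. i < N \<Longrightarrow> co i x = co i y) \<Longrightarrow> x = y"
  using co_inj[of "x \<ominus>\<^bsub>M\<^esub> y"] M.M.minus_equality[of x "\<ominus>\<^bsub>M\<^esub> y"]
  by (simp add: co_minus a_minus_def co_add co_neg)

lemma lincomb_co: "x \<in> carrier M \<Longrightarrow> x = (\<Oplus>\<^bsub>M\<^esub>j\<in>{..<N}. co j x \<odot>\<^bsub>M\<^esub> e j)"
  by (rule co_ext) (auto simp: co_lincomb co_closed e_closed intro!: M.M.finsum_closed)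

lemma has_coords_iff:
  assumes "x \<in> carrier M"
  shows "has_coords (subtring A) M (map e [0..<N]) x c \<longleftrightarrow> c = restrict (\<lambda>i. co i x) {..<N}"
proof -
  have es: "(\<Oplus>\<^bsub>M\<^esub>i\<in>{..<N}. c i \<odot>\<^bsub>M\<^esub> (map e [0..<N] ! i)) = (\<Oplus>\<^bsub>M\<^esub>i\<in>{..<N}. c i \<odot>\<^bsub>M\<^esub> e i)" if "c \<in> {..<N} \<rightarrow>\<^sub>E A" for c
    using that e_closed by (intro M.M.finsum_cong') (auto simp: PiE_iff)
  show ?thesis
  proof
    assume h: "has_coords (subtring A) M (map e [0..<N]) x c"
    then have c: "c \<in> {..<N} \<rightarrow>\<^sub>E A" and x: "x = (\<Oplus>\<^bsub>M\<^esub>i\<in>{..<N}. c i \<odot>\<^bsub>M\<^esub> e i)"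
      using es by (auto simp: has_coords_def)
    show "c = restrict (\<lambda>i. co i x) {..<N}"
      by (rule PiE_ext[OF c]) (use c in \<open>auto simp: x co_lincomb PiE_iff intro!: restrict_PiE_iff[THEN iffD2]\<close>)
  next
    assume c: "c = restrict (\<lambda>i. co i x) {..<N}"
    then have c': "c \<in> {..<N} \<rightarrow>\<^sub>E A" using co_closed assms by (auto simp: restrict_PiE_iff)
    have "x = (\<Oplus>\<^bsub>M\<^esub>i\<in>{..<N}. c i \<odot>\<^bsub>M\<^esub> e i)"
      by (rule co_ext[OF assms]) (use assms c' e_closed in \<open>auto simp: co_lincomb PiE_iff c intro!: M.M.finsum_closed\<close>)
    then show "has_coords (subtring A) M (map e [0..<N]) x c" using c' es by (auto simp: has_coords_def)
  qed
qed

lemma free_basis: "free_basis (subtring A) M (map e [0..<N])"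
  unfolding free_basis_def using has_coords_iff e_closed by auto

end

lemma based_module_free_basis:
  fixes M :: "('a::comm_ring_1, 'm) module"
  assumes A: "closed_subring A" and M: "module (subtring A) M" and es: "free_basis (subtring A) M es"
  shows "based_module A M (length es) (\<lambda>i. es ! i) (\<lambda>i x. (THE c. has_coords (subtring A) M es x c) i)"
proof -
  interpret M: module "subtring A" M by (rule M)
  let ?N = "length es"
  define cc where "cc x = (THE c. has_coords (subtring A) M es x c)" for x
  have ex1: "\<exists>!c. has_coords (subtring A) M es x c" if "x \<in> carrier M" for x using es that by (auto simp: free_basis_def)
  have cc: "has_coords (subtring A) M es x (cc x)" if "x \<in> carrier M" for x
    unfolding cc_def using theI'[OF ex1[OF that]] .
  have uniq: "cc x = c" if "x \<in> carrier M" "has_coords (subtring A) M es x c" for x c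
    using ex1[OF that(1)] cc[OF that(1)] that(2) by blast
  have e: "es ! i \<in> carrier M" if "i < ?N" for i using es that by (auto simp: free_basis_def)
  have lc: "restrict a {..<?N} = cc (\<Oplus>\<^bsub>M\<^esub>i\<in>{..<?N}. a i \<odot>\<^bsub>M\<^esub> (es ! i))" if a: "\<And>i. i < ?N \<Longrightarrow> a i \<in> A" for a
  proof -
    have c: "(\<Oplus>\<^bsub>M\<^esub>i\<in>{..<?N}. a i \<odot>\<^bsub>M\<^esub> (es ! i)) \<in> carrier M" using a e by (intro M.M.finsum_closed) auto
    have "has_coords (subtring A) M es (\<Oplus>\<^bsub>M\<^esub>i\<in>{..<?N}. a i \<odot>\<^bsub>M\<^esub> (es ! i)) (restrict a {..<?N})"
      unfolding has_coords_def using a e by (auto intro!: M.M.finsum_cong' simp: restrict_PiE_iff)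
    then show ?thesis using uniq[OF c] by simp
  qed
  have ccD: "cc x i \<in> A" "x = (\<Oplus>\<^bsub>M\<^esub>i\<in>{..<?N}. cc x i \<odot>\<^bsub>M\<^esub> (es ! i))" if "x \<in> carrier M" "i < ?N" for x i
    using cc[OF that(1)] that(2) by (auto simp: has_coords_def PiE_iff)
  have ccD2: "x = (\<Oplus>\<^bsub>M\<^esub>i\<in>{..<?N}. cc x i \<odot>\<^bsub>M\<^esub> (es ! i))" if "x \<in> carrier M" for x
    using cc[OF that] by (auto simp: has_coords_def)
  show ?thesis
  proof (intro based_module.intro A M, fold cc_def)
    fix i assume i: "i < ?N"
    show "es ! i \<in> carrier M" by (rule e[OF i])
    fix x assume x: "x \<in> carrier M"
    show "cc x i \<in> A" by (rule ccD(1)[OF x i])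
    { fix y assume y: "y \<in> carrier M"
      have "x \<oplus>\<^bsub>M\<^esub> y = (\<Oplus>\<^bsub>M\<^esub>i\<in>{..<?N}. cc x i \<odot>\<^bsub>M\<^esub> (es ! i)) \<oplus>\<^bsub>M\<^esub> (\<Oplus>\<^bsub>M\<^esub>i\<in>{..<?N}. cc y i \<odot>\<^bsub>M\<^esub> (es ! i))"
        using ccD2[OF x] ccD2[OF y] by simp
      also have "\<dots> = (\<Oplus>\<^bsub>M\<^esub>i\<in>{..<?N}. cc x i \<odot>\<^bsub>M\<^esub> (es ! i) \<oplus>\<^bsub>M\<^esub> cc y i \<odot>\<^bsub>M\<^esub> (es ! i))"
        using ccD(1)[OF x] ccD(1)[OF y] e by (intro M.M.finsum_addf[symmetric]) auto
      also have "\<dots> = (\<Oplus>\<^bsub>M\<^esub>i\<in>{..<?N}. (cc x i + cc y i) \<odot>\<^bsub>M\<^esub> (es ! i))"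
        using ccD(1)[OF x] ccD(1)[OF y] e M.smult_l_distr by (intro M.M.finsum_cong') auto
      finally have "cc (x \<oplus>\<^bsub>M\<^esub> y) = restrict (\<lambda>i. cc x i + cc y i) {..<?N}"
        using lc[of "\<lambda>i. cc x i + cc y i"] ccD(1)[OF x] ccD(1)[OF y] closed_subringD[OF A] by simp
      then show "cc (x \<oplus>\<^bsub>M\<^esub> y) i = cc x i + cc y i" using i by simp }
    { fix a assume a: "a \<in> A"
      have "a \<odot>\<^bsub>M\<^esub> x = a \<odot>\<^bsub>M\<^esub> (\<Oplus>\<^bsub>M\<^esub>i\<in>{..<?N}. cc x i \<odot>\<^bsub>M\<^esub> (es ! i))"
        using ccD2[OF x] by simp
      also have "\<dots> = (\<Oplus>\<^bsub>M\<^esub>i\<in>{..<?N}. a \<odot>\<^bsub>M\<^esub> (cc x i \<odot>\<^bsub>M\<^esub> (es ! i)))"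
        using ccD(1)[OF x] a e by (intro M.finsum_smult_ldistr) auto
      also have "\<dots> = (\<Oplus>\<^bsub>M\<^esub>i\<in>{..<?N}. (a * cc x i) \<odot>\<^bsub>M\<^esub> (es ! i))"
        using ccD(1)[OF x] a e M.smult_assoc1 by (intro M.M.finsum_cong') auto
      finally have "cc (a \<odot>\<^bsub>M\<^esub> x) = restrict (\<lambda>i. a * cc x i) {..<?N}"
        using lc[of "\<lambda>i. a * cc x i"] ccD(1)[OF x] a closed_subringD[OF A] by simp
      then show "cc (a \<odot>\<^bsub>M\<^esub> x) i = a * cc x i" using i by simp }
  next
    fix i j assume ij: "i < ?N" "j < ?N"
    have "(\<Oplus>\<^bsub>M\<^esub>i\<in>{..<?N}. (if i = j then 1 else 0) \<odot>\<^bsub>M\<^esub> (es ! i)) = (\<Oplus>\<^bsub>M\<^esub>i\<in>{..<?N}. if j = i then es ! i else \<zero>\<^bsub>M\<^esub>)"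
      using e M.smult_one M.smult_l_null by (intro M.M.finsum_cong') auto
    also have "\<dots> = es ! j" using ij e by (intro M.M.finsum_singleton) auto
    finally have "cc (es ! j) = restrict (\<lambda>i. if i = j then 1 else 0) {..<?N}"
      using lc[of "\<lambda>i. if i = j then 1 else 0"] closed_subringD[OF A] by simp
    then show "cc (es ! j) i = (if i = j then 1 else 0)" using ij by simp
  next
    fix x assume x: "x \<in> carrier M" "\<And>i. i < ?N \<Longrightarrow> cc x i = 0"
    have "x = (\<Oplus>\<^bsub>M\<^esub>i\<in>{..<?N}. cc x i \<odot>\<^bsub>M\<^esub> (es ! i))" by (rule ccD2[OF x(1)])
    also have "\<dots> = (\<Oplus>\<^bsub>M\<^esub>i\<in>{..<?N}. \<zero>\<^bsub>M\<^esub>)" using e x(2) M.smult_l_null by (intro M.M.finsum_cong') auto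
    finally show "x = \<zero>\<^bsub>M\<^esub>" by simp
  qed
qed

definition linear_on :: "'a::comm_ring_1 set \<Rightarrow> ('a, 'm) module \<Rightarrow> ('a, 'n) module \<Rightarrow> ('m \<Rightarrow> 'n) \<Rightarrow> bool" where
  "linear_on A M M' f \<longleftrightarrow> f \<in> carrier M \<rightarrow> carrier M' \<and>
    (\<forall>x\<in>carrier M. \<forall>y\<in>carrier M. f (x \<oplus>\<^bsub>M\<^esub> y) = f x \<oplus>\<^bsub>M'\<^esub> f y) \<and>
    (\<forall>a\<in>A. \<forall>x\<in>carrier M. f (a \<odot>\<^bsub>M\<^esub> x) = a \<odot>\<^bsub>M'\<^esub> f x)"

lemma linear_onD:
  assumes "linear_on A M M' f"
  shows "x \<in> carrier M \<Longrightarrow> f x \<in> carrier M'" "x \<in> carrier M \<Longrightarrow> y \<in> carrier M \<Longrightarrow> f (x \<oplus>\<^bsub>M\<^esub> y) = f x \<oplus>\<^bsub>M'\<^esub> f y"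
    "a \<in> A \<Longrightarrow> x \<in> carrier M \<Longrightarrow> f (a \<odot>\<^bsub>M\<^esub> x) = a \<odot>\<^bsub>M'\<^esub> f x"
  using assms by (auto simp: linear_on_def)

lemma linear_on_comp: "linear_on A M M' f \<Longrightarrow> linear_on A M' M'' g \<Longrightarrow> linear_on A M M'' (g \<circ> f)"
  by (auto simp: linear_on_def Pi_iff)

context based_module
begin

definition covec where "covec x = vec N (\<lambda>i. co i x)"
definition mat_of where "mat_of f = mat N N (\<lambda>(i, j). co i (f (e j)))"

lemma covec_carrier[simp]: "covec x \<in> carrier_vec N" "dim_vec (covec x) = N" by (auto simp: covec_def)
lemma mat_of_carrier[simp]: "mat_of f \<in> carrier_mat N N" "dim_row (mat_of f) = N" "dim_col (mat_of f) = N"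
  by (auto simp: mat_of_def)
lemma index_covec[simp]: "i < N \<Longrightarrow> vec_index (covec x) i = co i x" by (simp add: covec_def)
lemma index_mat_of[simp]: "i < N \<Longrightarrow> j < N \<Longrightarrow> mat_of f $$ (i, j) = co i (f (e j))" by (simp add: mat_of_def)

lemma covec_inj: "x \<in> carrier M \<Longrightarrow> y \<in> carrier M \<Longrightarrow> covec x = covec y \<Longrightarrow> x = y"
  by (rule co_ext) (auto dest!: arg_cong[of _ _ "\<lambda>v. vec_index v _"] simp: vec_eq_iff)

lemma functional_expand:
  assumes add: "\<And>x y. x \<in> carrier M \<Longrightarrow> y \<in> carrier M \<Longrightarrow> \<gamma> (x \<oplus>\<^bsub>M\<^esub> y) = \<gamma> x + \<gamma> y"
    and smult: "\<And>a x. a \<in> A \<Longrightarrow> x \<in> carrier M \<Longrightarrow> \<gamma> (a \<odot>\<^bsub>M\<^esub> x) = a * \<gamma> x"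
    and x: "x \<in> carrier M"
  shows "\<gamma> x = (\<Sum>j<N. co j x * \<gamma> (e j))"
proof -
  have z: "\<gamma> \<zero>\<^bsub>M\<^esub> = 0" using smult[of 0 "\<zero>\<^bsub>M\<^esub>"] closed_subringD[OF A] M.smult_r_null[of 0] by simp
  have s: "\<gamma> (finsum M f I) = (\<Sum>j\<in>I. \<gamma> (f j))" if "finite I" "f \<in> I \<rightarrow> carrier M" for f and I :: "nat set"
    using that by (induct I rule: finite_induct) (auto simp: z add Pi_iff M.M.finsum_insert M.M.finsum_closed)
  have "\<gamma> x = \<gamma> (\<Oplus>\<^bsub>M\<^esub>j\<in>{..<N}. co j x \<odot>\<^bsub>M\<^esub> e j)" using lincomb_co[OF x] by simp
  also have "\<dots> = (\<Sum>j\<in>{..<N}. \<gamma> (co j x \<odot>\<^bsub>M\<^esub> e j))"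
    using co_closed e_closed x by (intro s) auto
  also have "\<dots> = (\<Sum>j<N. co j x * \<gamma> (e j))" using co_closed e_closed x smult by (intro sum.cong) auto
  finally show ?thesis .
qed

lemma co_linear:
  assumes f: "linear_on A M M f" and x: "x \<in> carrier M" and i: "i < N"
  shows "co i (f x) = (\<Sum>j<N. mat_of f $$ (i, j) * co j x)"
proof -
  have "co i (f x) = (\<Sum>j<N. co j x * co i (f (e j)))"
    by (rule functional_expand[OF _ _ x]) (use i in \<open>auto simp: linear_onD[OF f] co_add co_smult\<close>)
  then show ?thesis using i by (simp add: mult.commute)
qed

lemma covec_linear:
  assumes f: "linear_on A M M f" and x: "x \<in> carrier M"
  shows "covec (f x) = mat_of f *\<^sub>v covec x"
  by (rule eq_vecI) (auto simp: co_linear[OF f x] scalar_prod_def atLeast0LessThan)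

lemma covec_smult: "a \<in> A \<Longrightarrow> x \<in> carrier M \<Longrightarrow> covec (a \<odot>\<^bsub>M\<^esub> x) = a \<cdot>\<^sub>v covec x"
  by (rule eq_vecI) (auto simp: co_smult)

lemma covec_minus: "x \<in> carrier M \<Longrightarrow> y \<in> carrier M \<Longrightarrow> covec (x \<ominus>\<^bsub>M\<^esub> y) = covec x - covec y"
  by (rule eq_vecI) (auto simp: co_minus)

lemma covec_zero: "covec \<zero>\<^bsub>M\<^esub> = 0\<^sub>v N"
  by (rule eq_vecI) (auto simp: co_zero)

lemma mat_of_comp:
  assumes f: "linear_on A M M f" and g: "linear_on A M M g"
  shows "mat_of (f \<circ> g) = mat_of f * mat_of g"
  by (rule eq_matI) (auto simp: co_linear[OF f] linear_onD[OF g] e_closed scalar_prod_def atLeast0LessThan)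

lemma mat_of_add:
  assumes "linear_on A M M f" "linear_on A M M g" "\<And>x. x \<in> carrier M \<Longrightarrow> h x = f x \<oplus>\<^bsub>M\<^esub> g x"
  shows "mat_of h = mat_of f + mat_of g"
  by (rule eq_matI) (auto simp: assms(3) e_closed co_add linear_onD[OF assms(1)] linear_onD[OF assms(2)])

lemma mat_of_smult:
  assumes "linear_on A M M f" "a \<in> A" "\<And>x. x \<in> carrier M \<Longrightarrow> h x = a \<odot>\<^bsub>M\<^esub> f x"
  shows "mat_of h = a \<cdot>\<^sub>m mat_of f"
  by (rule eq_matI) (auto simp: assms(2,3) e_closed co_smult linear_onD[OF assms(1)])

lemma mat_of_id: "(\<And>x. x \<in> carrier M \<Longrightarrow> h x = x) \<Longrightarrow> mat_of h = 1\<^sub>m N"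
  by (rule eq_matI) (auto simp: e_closed co_e)

lemma mat_of_cong: "(\<And>x. x \<in> carrier M \<Longrightarrow> f x = g x) \<Longrightarrow> mat_of f = mat_of g"
  by (rule eq_matI) (auto simp: e_closed)

end

text \<open>\<open>chosen_basis\<close> is a basis as soon as any basis exists, and then
  \<open>end_mat\<close> is an ordinary matrix with respect to it. Nothing else is known about this
  basis, so later arguments must compare it with the lattice basis.\<close>

lemma end_mat_eq:
  fixes M :: "('a::comm_ring_1, 'm) module"
  assumes M: "module tring M" and ex: "free_basis tring M es0"
  obtains e co where "based_module UNIV M (length (chosen_basis tring M)) e co"
    "\<And>f. linear_on UNIV M M f \<Longrightarrow> end_mat tring M f = based_module.mat_of (length (chosen_basis tring M)) e co f"
proof -
  let ?es = "chosen_basis tring M"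
  have es: "free_basis tring M ?es" unfolding chosen_basis_def using ex by (rule someI)
  interpret based_module UNIV M "length ?es" "\<lambda>i. ?es ! i" "\<lambda>i x. (THE c. has_coords tring M ?es x c) i"
    using based_module_free_basis[of UNIV M ?es] M es by (simp add: subtring_UNIV)
  show ?thesis
  proof (rule that[OF based_module_axioms])
    fix f assume "linear_on UNIV M M f"
    show "end_mat tring M f = mat_of f"
      unfolding end_mat_def mat_of_def Let_def by (rule refl)
  qed
qed

locale based_base_change = base_change_module A M S \<phi> + based_module A M N e co
  for A :: "'a::comm_ring_1 set" and M :: "('a, 'm) module" and S :: "'s::comm_ring_1 set" and \<phi> N e co
begin

text \<open>The S-linear extension of the coordinate function \<open>co i\<close> to the base
  change.\<close>

definition coS where "coS i = class_value (\<lambda>m. \<phi> (co i m))"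

lemma co_gens: "i < N \<Longrightarrow> g \<in> bc_gens \<Longrightarrow> functional (\<lambda>m. \<phi> (co i m)) g = 0"
  by (rule functional_gens) (auto simp: co_add co_smult co_closed hom_onD[OF \<phi> A])

lemma coS_cls: "i < N \<Longrightarrow> coS i (cls x) = functional (\<lambda>m. \<phi> (co i m)) x"
  unfolding coS_def by (rule class_value_cls[OF co_gens])

lemma rel_expand_single:
  assumes m: "m \<in> carrier M"
  shows "Poly_Mapping.single m 1 - (\<Sum>i<N. Poly_Mapping.single (e i) (\<phi> (co i m))) \<in> rel"
proof -
  have fs: "Poly_Mapping.single (finsum M f I) 1 - (\<Sum>i\<in>I. Poly_Mapping.single (f i) 1) \<in> rel"
    if "finite I" "f \<in> I \<rightarrow> carrier M" for f and I :: "nat set"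
    using that
  proof (induct I rule: finite_induct)
    case empty
    have "Poly_Mapping.single \<zero>\<^bsub>M\<^esub> 1 - Poly_Mapping.single \<zero>\<^bsub>M\<^esub> (\<phi> 0) \<in> rel"
      using rel_smult[of 0 "\<zero>\<^bsub>M\<^esub>"] closed_subringD[OF A] M.smult_r_null[of 0] by simp
    then show ?case using hom_onD(2)[OF \<phi> A] by simp
  next
    case (insert i I)
    then have c: "f i \<in> carrier M" "finsum M f I \<in> carrier M" "f \<in> I \<rightarrow> carrier M"
      by (auto intro: M.M.finsum_closed)
    have "finsum M f (insert i I) = f i \<oplus>\<^bsub>M\<^esub> finsum M f I" using insert c by (intro M.M.finsum_insert) auto
    then have "Poly_Mapping.single (finsum M f (insert i I)) (1 :: 's) - (\<Sum>j\<in>insert i I. Poly_Mapping.single (f j) 1) =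
      (Poly_Mapping.single (f i \<oplus>\<^bsub>M\<^esub> finsum M f I) 1 - (Poly_Mapping.single (f i) 1 + Poly_Mapping.single (finsum M f I) 1)) +
      (Poly_Mapping.single (finsum M f I) 1 - (\<Sum>j\<in>I. Poly_Mapping.single (f j) 1))" (is "_ = ?a + ?b")
    proof -
      have "u - (v + w) = (u - (v + t)) + (t - w)" for u v w t :: "'m \<Rightarrow>\<^sub>0 's" by simp
      then show ?thesis using insert by simp
    qed
    also have "\<dots> \<in> rel" by (rule rel_closed(3)[OF rel_add[OF c(1,2)] insert(3)[OF c(3)]])
    finally show ?case .
  qed
  have f: "(\<lambda>i. co i m \<odot>\<^bsub>M\<^esub> e i) \<in> {..<N} \<rightarrow> carrier M" using co_closed m e_closed by auto
  have 1: "Poly_Mapping.single m 1 - (\<Sum>i<N. Poly_Mapping.single (co i m \<odot>\<^bsub>M\<^esub> e i) 1) \<in> rel"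
    using fs[OF _ f] lincomb_co[OF m] by simp
  have 2: "(\<Sum>i<N. Poly_Mapping.single (co i m \<odot>\<^bsub>M\<^esub> e i) 1 - Poly_Mapping.single (e i) (\<phi> (co i m))) \<in> rel"
    by (rule rel_sum, rule rel_smult) (simp_all add: co_closed m e_closed)
  from rel_closed(3)[OF 1 2] show ?thesis by (simp add: sum_subtractf)
qed

text \<open>Every class is the combination of the \<open>pure (e i)\<close> with its coordinates as
  coefficients. Therefore an element whose coordinates vanish is zero, and the base change of a
  basis is a basis (\<open>based\<close>).\<close>

lemma rel_expand:
  assumes x: "x \<in> finsupp S (carrier M)"
  shows "x - (\<Sum>i<N. Poly_Mapping.single (e i) (functional (\<lambda>m. \<phi> (co i m)) x)) \<in> rel"
proof -
  let ?K = "Poly_Mapping.keys x" and ?l = "Poly_Mapping.lookup x"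
  have "x = (\<Sum>k\<in>?K. scale (?l k) (Poly_Mapping.single k 1))"
    using poly_mapping_sum_single[of x] by simp
  moreover have "(\<Sum>i<N. Poly_Mapping.single (e i) (functional (\<lambda>m. \<phi> (co i m)) x)) =
      (\<Sum>k\<in>?K. scale (?l k) (\<Sum>i<N. Poly_Mapping.single (e i) (\<phi> (co i k))))"
  proof -
    have "Poly_Mapping.single (e i) (functional (\<lambda>m. \<phi> (co i m)) x) = (\<Sum>k\<in>?K. Poly_Mapping.single (e i) (?l k * \<phi> (co i k)))" for i
      unfolding functional_def by (induct rule: infinite_finite_induct) (simp_all add: single_add)
    then show ?thesis by (simp add: scale_sum) (rule sum.swap)
  qed
  ultimately have eq: "x - (\<Sum>i<N. Poly_Mapping.single (e i) (functional (\<lambda>m. \<phi> (co i m)) x)) =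
      (\<Sum>k\<in>?K. scale (?l k) (Poly_Mapping.single k 1 - (\<Sum>i<N. Poly_Mapping.single (e i) (\<phi> (co i k)))))"
    unfolding scale_diff sum_subtractf by (rule arg_cong2)
  note eq
  also have "(\<Sum>k\<in>?K. scale (?l k) (Poly_Mapping.single k 1 - (\<Sum>i<N. Poly_Mapping.single (e i) (\<phi> (co i k))))) \<in> rel"
    by (rule rel_sum, rule rel_closed(4), rule finsuppD(3)[OF x], rule rel_expand_single) (use finsuppD(1)[OF x] in auto)
  finally show ?thesis .
qed

lemma coS_closed: "i < N \<Longrightarrow> c \<in> carrier Q \<Longrightarrow> coS i c \<in> S"
  by (auto simp: carrier_Q coS_cls intro!: functional_closed \<phi>_in co_closed)

lemma pure_closed: "m \<in> carrier M \<Longrightarrow> pure m \<in> carrier Q"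
  unfolding carrier_Q pure_def by (intro imageI finsupp_closed(5)[OF S_closed] closed_subringD(2)[OF S_closed])

lemma coS_pure: "i < N \<Longrightarrow> coS i (pure m) = \<phi> (co i m)"
  by (simp add: pure_def coS_cls)

lemma based: "based_module S Q N (\<lambda>i. pure (e i)) coS"
proof (intro based_module.intro S_closed module_Q)
  fix i assume i: "i < N"
  show "pure (e i) \<in> carrier Q" by (rule pure_closed[OF e_closed[OF i]])
  show "coS i x \<in> S" if "x \<in> carrier Q" for x by (rule coS_closed[OF i that])
  show "coS i (x \<oplus>\<^bsub>Q\<^esub> y) = coS i x + coS i y" if "x \<in> carrier Q" "y \<in> carrier Q" for x y
    using that i by (auto simp: carrier_Q add_Q coS_cls functional_add)
  show "coS i (a \<odot>\<^bsub>Q\<^esub> x) = a * coS i x" if "a \<in> S" "x \<in> carrier Q" for a x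
    using that i by (auto simp: carrier_Q smult_Q coS_cls functional_scale)
  show "coS i (pure (e j)) = (if i = j then 1 else 0)" if "j < N" for j
    using that i by (simp add: coS_pure co_e hom_onD[OF \<phi> A])
next
  fix x assume "x \<in> carrier Q" and 0: "\<And>i. i < N \<Longrightarrow> coS i x = 0"
  then obtain y where y: "y \<in> finsupp S (carrier M)" "x = cls y" by (auto simp: carrier_Q)
  have "functional (\<lambda>m. \<phi> (co i m)) y = 0" if "i < N" for i using 0[OF that] that by (simp add: y(2) coS_cls)
  then have "y - 0 \<in> rel" using rel_expand[OF y(1)] by simp
  then show "x = \<zero>\<^bsub>Q\<^esub>" unfolding zero_Q y(2) cls_eq_iff .
qed

end

lemma bc_map_cls:
  assumes "base_change_module A M S \<phi>" "base_change_module A' M' S' \<phi>'"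
    and \<theta>: "hom_on S \<theta>" "\<theta> ` S \<subseteq> S'" "\<And>a. a \<in> A \<Longrightarrow> \<theta> (\<phi> a) = \<phi>' a" and A: "A \<subseteq> A'"
    and f: "linear_on A M M' f" and x: "x \<in> finsupp S (carrier M)"
  shows "bc_map (subtring A') M' (subtring S') \<phi>' f \<theta> (free_quotient.cls S (carrier M) (base_change_module.bc_gens A M \<phi>) x) =
    free_quotient.cls S' (carrier M') (base_change_module.bc_gens A' M' \<phi>') (free_map f \<theta> x)"
proof -
  interpret X: base_change_module A M S \<phi> by fact
  interpret Y: base_change_module A' M' S' \<phi>' by fact
  show ?thesis
    unfolding bc_map_def Y.bc_rel_eq
  proof (rule quot_map_free_map[OF X.free_quotient_axioms Y.free_quotient_axioms \<theta>(1,2) _ _ x])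
    show "f ` carrier M \<subseteq> carrier M'" using linear_onD(1)[OF f] by auto
    fix g assume "g \<in> X.bc_gens"
    then consider (1) a b where "a \<in> carrier M" "b \<in> carrier M"
        "g = Poly_Mapping.single (a \<oplus>\<^bsub>M\<^esub> b) 1 - Poly_Mapping.single a 1 - Poly_Mapping.single b 1"
      | (2) a b where "a \<in> A" "b \<in> carrier M" "g = Poly_Mapping.single (a \<odot>\<^bsub>M\<^esub> b) 1 - Poly_Mapping.single b (\<phi> a)"
      unfolding X.bc_gens_def by auto
    then show "free_map f \<theta> g \<in> Y.rel"
    proof cases
      case 1
      have r: "range (Poly_Mapping.lookup (Poly_Mapping.single k c)) \<subseteq> S" if "c \<in> S" for k :: 'b and c
        using that closed_subringD[OF X.S_closed] by (auto simp: lookup_single when_def)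
      have "g + (Poly_Mapping.single a 1 + Poly_Mapping.single b 1) = Poly_Mapping.single (a \<oplus>\<^bsub>M\<^esub> b) 1" using 1 by simp
      moreover have g: "g \<in> finsupp S (carrier M)" using \<open>g \<in> X.bc_gens\<close> X.gens by auto
      moreover have ab: "Poly_Mapping.single a 1 + Poly_Mapping.single b 1 \<in> finsupp S (carrier M)"
        using 1 closed_subringD[OF X.S_closed] by (intro finsupp_closed[OF X.S_closed])
      ultimately have "free_map f \<theta> g + free_map f \<theta> (Poly_Mapping.single a 1 + Poly_Mapping.single b 1) =
          Poly_Mapping.single (f (a \<oplus>\<^bsub>M\<^esub> b)) 1"
        using free_map_add[OF \<theta>(1) X.S_closed finsuppD(2)[OF g] finsuppD(2)[OF ab], of f]
        by (simp add: free_map_single hom_onD[OF \<theta>(1) X.S_closed])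
      moreover have "free_map f \<theta> (Poly_Mapping.single a 1 + Poly_Mapping.single b 1) =
          Poly_Mapping.single (f a) 1 + Poly_Mapping.single (f b) 1"
        using free_map_add[OF \<theta>(1) X.S_closed r r, of 1 1 f a b] closed_subringD[OF X.S_closed]
        by (simp add: free_map_single hom_onD[OF \<theta>(1) X.S_closed])
      ultimately have "free_map f \<theta> g + (Poly_Mapping.single (f a) 1 + Poly_Mapping.single (f b) 1) = Poly_Mapping.single (f a \<oplus>\<^bsub>M'\<^esub> f b) 1"
        using linear_onD(2)[OF f 1(1,2)] by (simp only:)
      then have "free_map f \<theta> g = Poly_Mapping.single (f a \<oplus>\<^bsub>M'\<^esub> f b) 1 - (Poly_Mapping.single (f a) 1 + Poly_Mapping.single (f b) 1)"
        unfolding eq_diff_eq .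
      then show ?thesis using Y.rel_add 1 linear_onD(1)[OF f] by simp
    next
      case 2
      have r: "Poly_Mapping.single b (\<phi> a) \<in> finsupp S (carrier M)"
        using 2 X.\<phi>_closed by (intro finsupp_closed[OF X.S_closed]) auto
      have g: "g \<in> finsupp S (carrier M)" using \<open>g \<in> X.bc_gens\<close> X.gens by auto
      have "free_map f \<theta> g + free_map f \<theta> (Poly_Mapping.single b (\<phi> a)) = free_map f \<theta> (Poly_Mapping.single (a \<odot>\<^bsub>M\<^esub> b) 1)"
        using free_map_add[OF \<theta>(1) X.S_closed finsuppD(2)[OF g] finsuppD(2)[OF r], of f] 2 by simp
      then have "free_map f \<theta> g = Poly_Mapping.single (a \<odot>\<^bsub>M'\<^esub> f b) 1 - Poly_Mapping.single (f b) (\<phi>' a)"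
        using 2(1,2) linear_onD(3)[OF f] \<theta>(3) by (simp add: free_map_single hom_onD[OF \<theta>(1) X.S_closed] eq_diff_eq)
      then show ?thesis using Y.rel_smult 2 linear_onD(1)[OF f] A by auto
    qed
  qed
qed

section \<open>Exterior powers and Pluecker coordinates\<close>

lemma mspan_induct:
  assumes M: "module R M" and G: "G \<subseteq> carrier M" and x: "x \<in> mspan R M G"
    and zero: "P \<zero>\<^bsub>M\<^esub>" and base: "\<And>x. x \<in> G \<Longrightarrow> P x"
    and add: "\<And>x y. x \<in> carrier M \<Longrightarrow> y \<in> carrier M \<Longrightarrow> P x \<Longrightarrow> P y \<Longrightarrow> P (x \<oplus>\<^bsub>M\<^esub> y)"
    and smult: "\<And>a x. a \<in> carrier R \<Longrightarrow> x \<in> carrier M \<Longrightarrow> P x \<Longrightarrow> P (a \<odot>\<^bsub>M\<^esub> x)"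
  shows "P x"
proof -
  interpret M: module R M by (rule M)
  have "LinearCombinations.submodule R {x \<in> carrier M. P x} M"
    unfolding LinearCombinations.submodule_def using zero add smult M by auto
  then have "mspan R M G \<subseteq> {x \<in> carrier M. P x}" using G base by (intro M.span_is_subset) auto
  with x show ?thesis by auto
qed

text \<open>The value of the alternating form \<gamma>_0 \<and> ... \<and> \<gamma>_(k-1) on a
  k-tuple of vectors; rows belong to the vectors, columns to the linear forms.\<close>

definition form_det :: "nat \<Rightarrow> (nat \<Rightarrow> 'm \<Rightarrow> 's::comm_ring_1) \<Rightarrow> 'm list \<Rightarrow> 's" where
  "form_det k \<gamma> xs = det (mat k k (\<lambda>(j, i). \<gamma> i (xs ! j)))"

locale ext_module =
  fixes S :: "'s::comm_ring_1 set" and M :: "('s, 'm) module" and k :: nat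
  assumes S_closed: "closed_subring S" and M: "module (subtring S) M"
begin

sublocale M: module "subtring S" M by (rule M)

definition ext_gens where "ext_gens =
    {Poly_Mapping.single (xs[i := x \<oplus>\<^bsub>M\<^esub> y]) 1 - Poly_Mapping.single (xs[i := x]) 1
        - Poly_Mapping.single (xs[i := y]) 1 | xs i x y.
        xs \<in> tuples M k \<and> i < k \<and> x \<in> carrier M \<and> y \<in> carrier M} \<union>
     {Poly_Mapping.single (xs[i := a \<odot>\<^bsub>M\<^esub> x]) 1 - Poly_Mapping.single (xs[i := x]) a | xs i a x.
        xs \<in> tuples M k \<and> i < k \<and> a \<in> carrier (subtring S) \<and> x \<in> carrier M} \<union>
     {Poly_Mapping.single xs 1 | xs. xs \<in> tuples M k \<and> \<not> distinct xs}"

lemma tuples_update: "xs \<in> tuples M k \<Longrightarrow> x \<in> carrier M \<Longrightarrow> xs[i := x] \<in> tuples M k"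
  using set_update_subset_insert[of xs i x] by (auto simp: tuples_def)

sublocale free_quotient S "tuples M k" ext_gens
proof
  show "ext_gens \<subseteq> finsupp S (tuples M k)"
    unfolding ext_gens_def
    by (auto intro!: finsupp_closed[OF S_closed] closed_subringD[OF S_closed] tuples_update M.smult_closed M.M.a_closed)
qed (rule S_closed)

lemma ext_rel_eq: "ext_rel (subtring S) M k = rel"
  unfolding ext_rel_def rel_def unfolding ext_gens_def by (rule refl)

lemma exterior_power_eq: "exterior_power (subtring S) M k = Q"
  unfolding exterior_power_def ext_rel_eq by (rule refl)

lemma wedge_eq: "length xs = k \<Longrightarrow> wedge (subtring S) M xs = cls (Poly_Mapping.single xs 1)"
  unfolding wedge_def cls_def by (simp add: ext_rel_eq)

lemma single_finsupp: "xs \<in> tuples M k \<Longrightarrow> Poly_Mapping.single xs 1 \<in> finsupp S (tuples M k)"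
  by (intro finsupp_closed(5)[OF S_closed] closed_subringD(2)[OF S_closed])

text \<open>The relations of the exterior power state multilinearity and alternation, which a
  determinant has in its rows; so the form descends to the exterior power.\<close>

lemma form_det_gens:
  assumes add: "\<And>i x y. i < k \<Longrightarrow> x \<in> carrier M \<Longrightarrow> y \<in> carrier M \<Longrightarrow> \<gamma> i (x \<oplus>\<^bsub>M\<^esub> y) = \<gamma> i x + \<gamma> i y"
    and smult: "\<And>i a x. i < k \<Longrightarrow> a \<in> S \<Longrightarrow> x \<in> carrier M \<Longrightarrow> \<gamma> i (a \<odot>\<^bsub>M\<^esub> x) = a * \<gamma> i x"
    and g: "g \<in> ext_gens"
  shows "functional (form_det k \<gamma>) g = 0"
proof -
  let ?r = "\<lambda>x. vec k (\<lambda>i. \<gamma> i x)"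
  have row: "form_det k \<gamma> (xs[i := x]) = det (mat\<^sub>r k k (\<lambda>j. if j = i then ?r x else ?r (xs ! j)))"
    if "xs \<in> tuples M k" "i < k" for xs i x
    unfolding form_det_def using that
    by (intro arg_cong[of _ _ det] eq_matI) (auto simp: tuples_def nth_list_update)
  from g consider (1) xs i x y where "xs \<in> tuples M k" "i < k" "x \<in> carrier M" "y \<in> carrier M"
      "g = Poly_Mapping.single (xs[i := x \<oplus>\<^bsub>M\<^esub> y]) 1 - Poly_Mapping.single (xs[i := x]) 1 - Poly_Mapping.single (xs[i := y]) 1"
    | (2) xs i a x where "xs \<in> tuples M k" "i < k" "a \<in> S" "x \<in> carrier M"
      "g = Poly_Mapping.single (xs[i := a \<odot>\<^bsub>M\<^esub> x]) 1 - Poly_Mapping.single (xs[i := x]) a"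
    | (3) xs where "xs \<in> tuples M k" "\<not> distinct xs" "g = Poly_Mapping.single xs 1"
    unfolding ext_gens_def by auto
  then show ?thesis
  proof cases
    case 1
    have e: "?r (x \<oplus>\<^bsub>M\<^esub> y) = ?r x + ?r y" using 1 add by (intro eq_vecI) auto
    have "form_det k \<gamma> (xs[i := x \<oplus>\<^bsub>M\<^esub> y]) = form_det k \<gamma> (xs[i := x]) + form_det k \<gamma> (xs[i := y])"
      unfolding row[OF 1(1,2)] e
      by (rule det_row_add[of "\<lambda>_. ?r x" i k "\<lambda>_. ?r y" "\<lambda>j. ?r (xs ! j)"]) (use 1(2) in auto)
    then show ?thesis by (simp add: 1(5) functional_diff)
  next
    case 2
    let ?A = "mat\<^sub>r k k (\<lambda>j. if j = i then ?r x else ?r (xs ! j))"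
    have "mat\<^sub>r k k (\<lambda>j. if j = i then ?r (a \<odot>\<^bsub>M\<^esub> x) else ?r (xs ! j)) = multrow i a ?A"
      using 2 smult by (intro eq_matI) auto
    then have "form_det k \<gamma> (xs[i := a \<odot>\<^bsub>M\<^esub> x]) = a * form_det k \<gamma> (xs[i := x])"
      unfolding row[OF 2(1,2)] using det_multrow[OF 2(2), of ?A a] by simp
    then show ?thesis by (simp add: 2(5) functional_diff)
  next
    case 3
    then obtain i j where ij: "i < k" "j < k" "i \<noteq> j" "xs ! i = xs ! j"
      by (auto simp: distinct_conv_nth tuples_def)
    have "form_det k \<gamma> xs = 0" unfolding form_det_def
    proof (rule det_identical_rows)
      show "row (mat k k (\<lambda>(j, i). \<gamma> i (xs ! j))) i = row (mat k k (\<lambda>(j, i). \<gamma> i (xs ! j))) j"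
        using ij by (intro eq_vecI) simp_all
    qed (use ij in simp_all)
    then show ?thesis by (simp add: 3(3))
  qed
qed

lemma form_det_closed:
  assumes "\<And>i x. i < k \<Longrightarrow> x \<in> carrier M \<Longrightarrow> \<gamma> i x \<in> S" "xs \<in> tuples M k"
  shows "form_det k \<gamma> xs \<in> S"
  unfolding form_det_def by (rule closed_subring_det[OF S_closed, of _ k]) (use assms in \<open>auto simp: tuples_def subset_iff\<close>)

text \<open>The values of the alternating form \<open>form_det k \<gamma>\<close> on the exterior power are its Pluecker coordinates.\<close>

definition pluecker where "pluecker \<gamma> C = class_value (form_det k \<gamma>) C"

definition linear_family where "linear_family \<gamma> \<longleftrightarrow>
  (\<forall>i<k. \<forall>x\<in>carrier M. (\<forall>y\<in>carrier M. \<gamma> i (x \<oplus>\<^bsub>M\<^esub> y) = \<gamma> i x + \<gamma> i y) \<and> (\<forall>a\<in>S. \<gamma> i (a \<odot>\<^bsub>M\<^esub> x) = a * \<gamma> i x) \<and> \<gamma> i x \<in> S)"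

lemma pluecker_cls: "linear_family \<gamma> \<Longrightarrow> pluecker \<gamma> (cls x) = functional (form_det k \<gamma>) x"
  unfolding pluecker_def by (rule class_value_cls, rule form_det_gens) (auto simp: linear_family_def)

lemma pluecker_wedge: "linear_family \<gamma> \<Longrightarrow> xs \<in> tuples M k \<Longrightarrow> pluecker \<gamma> (wedge (subtring S) M xs) = form_det k \<gamma> xs"
proof -
  assume \<gamma>: "linear_family \<gamma>" and "xs \<in> tuples M k"
  then have "length xs = k" by (simp add: tuples_def)
  with \<gamma> show ?thesis by (simp add: wedge_eq pluecker_cls)
qed

lemma pluecker_add: "linear_family \<gamma> \<Longrightarrow> x \<in> carrier Q \<Longrightarrow> y \<in> carrier Q \<Longrightarrow> pluecker \<gamma> (x \<oplus>\<^bsub>Q\<^esub> y) = pluecker \<gamma> x + pluecker \<gamma> y"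
  by (auto simp: carrier_Q add_Q pluecker_cls functional_add)

lemma pluecker_smult: "linear_family \<gamma> \<Longrightarrow> a \<in> S \<Longrightarrow> x \<in> carrier Q \<Longrightarrow> pluecker \<gamma> (a \<odot>\<^bsub>Q\<^esub> x) = a * pluecker \<gamma> x"
  by (auto simp: carrier_Q smult_Q pluecker_cls functional_scale)

lemma pluecker_zero: "linear_family \<gamma> \<Longrightarrow> pluecker \<gamma> \<zero>\<^bsub>Q\<^esub> = 0"
  by (simp add: zero_Q pluecker_cls)

lemma pluecker_closed: "linear_family \<gamma> \<Longrightarrow> x \<in> carrier Q \<Longrightarrow> pluecker \<gamma> x \<in> S"
  by (auto simp: carrier_Q pluecker_cls linear_family_def intro!: functional_closed form_det_closed)

end

text \<open>Determinants commute with ring homomorphisms, so Pluecker coordinates are natural. The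
  spaces W are defined through preimages under maps of exterior powers; naturality translates
  membership into equations between coordinates.\<close>

lemma pluecker_ext_map:
  assumes "ext_module S M" "ext_module S' M'"
    and \<theta>: "hom_on S \<theta>" and \<gamma>: "ext_module.linear_family S M k \<gamma>" "ext_module.linear_family S' M' k \<gamma>'"
    and f: "\<And>i x. i < k \<Longrightarrow> x \<in> carrier M \<Longrightarrow> \<gamma>' i (f x) = \<theta> (\<gamma> i x)"
    and C: "C \<in> carrier (exterior_power (subtring S) M k)"
  shows "ext_module.pluecker k \<gamma>' (ext_map (subtring S') M' k f \<theta> C) = \<theta> (ext_module.pluecker k \<gamma> C)"
proof -
  interpret X: ext_module S M k by fact
  interpret Y: ext_module S' M' k by fact
  obtain x where x: "x \<in> finsupp S (tuples M k)" "C = X.cls x"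
    using C unfolding X.exterior_power_eq X.carrier_Q by auto
  have val: "functional (form_det k \<gamma>') (free_map (map f) \<theta> y) = \<theta> (functional (form_det k \<gamma>) y)"
    if y: "y \<in> finsupp S (tuples M k)" for y
  proof (rule functional_free_map[OF \<theta> X.S_closed finsuppD(2)[OF y]])
    fix xs assume "xs \<in> Poly_Mapping.keys y"
    then have xs: "xs \<in> tuples M k" using finsuppD(1)[OF y] by auto
    then have len: "length xs = k" "\<And>j. j < k \<Longrightarrow> xs ! j \<in> carrier M" by (auto simp: tuples_def)
    have "form_det k \<gamma>' (map f xs) = det (map_mat \<theta> (mat k k (\<lambda>(j, i). \<gamma> i (xs ! j))))"
      unfolding form_det_def using len f by (intro arg_cong[of _ _ det] eq_matI) auto
    also have "\<dots> = \<theta> (form_det k \<gamma> xs)" unfolding form_det_def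
      by (rule hom_on_det[OF \<theta> X.S_closed, symmetric]) (use \<gamma>(1) len in \<open>auto simp: X.linear_family_def\<close>)
    finally show "form_det k \<gamma> xs \<in> S \<and> form_det k \<gamma>' (map f xs) = \<theta> (form_det k \<gamma> xs)"
      using \<gamma>(1) xs by (auto simp: X.linear_family_def intro!: X.form_det_closed)
  qed
  have "Y.pluecker \<gamma>' (ext_map (subtring S') M' k f \<theta> C) = \<theta> (functional (form_det k \<gamma>) x)"
    unfolding Y.pluecker_def ext_map_def Y.ext_rel_eq x(2)
  proof (rule Y.class_value_quot_map[OF _ X.cls_nonempty])
    fix y assume y: "y \<in> X.cls x"
    then have "y \<in> finsupp S (tuples M k)" using X.cls_subset[OF x(1)] by auto
    moreover have "X.cls y = X.cls x" using y X.cls_eq_iff by (auto simp: X.cls)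
    then have "functional (form_det k \<gamma>) y = functional (form_det k \<gamma>) x"
      using X.pluecker_cls[OF \<gamma>(1)] by metis
    ultimately show "functional (form_det k \<gamma>') (free_map (map f) \<theta> y) = \<theta> (functional (form_det k \<gamma>) x)"
      by (simp add: val)
  qed (rule Y.form_det_gens, use \<gamma>(2) in \<open>auto simp: Y.linear_family_def\<close>)
  then show ?thesis using X.pluecker_cls[OF \<gamma>(1)] x(2) by simp
qed

lemma ext_map_closed:
  assumes "ext_module S M" "ext_module S' M'"
    and \<theta>: "hom_on S \<theta>" "\<theta> ` S \<subseteq> S'" and f: "f \<in> carrier M \<rightarrow> carrier M'"
    and add: "\<And>x y. x \<in> carrier M \<Longrightarrow> y \<in> carrier M \<Longrightarrow> f (x \<oplus>\<^bsub>M\<^esub> y) = f x \<oplus>\<^bsub>M'\<^esub> f y"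
    and smult: "\<And>a x. a \<in> S \<Longrightarrow> x \<in> carrier M \<Longrightarrow> f (a \<odot>\<^bsub>M\<^esub> x) = \<theta> a \<odot>\<^bsub>M'\<^esub> f x"
    and C: "C \<in> carrier (exterior_power (subtring S) M k)"
  shows "ext_map (subtring S') M' k f \<theta> C \<in> carrier (exterior_power (subtring S') M' k)"
proof -
  interpret X: ext_module S M k by fact
  interpret Y: ext_module S' M' k by fact
  obtain x where x: "x \<in> finsupp S (tuples M k)" "C = X.cls x"
    using C unfolding X.exterior_power_eq X.carrier_Q by auto
  have tup: "map f ` tuples M k \<subseteq> tuples M' k" using f by (auto simp: tuples_def Pi_iff subset_iff)
  have gens: "free_map (map f) \<theta> g \<in> Y.rel" if "g \<in> X.ext_gens" for g
  proof -
    note h = hom_onD[OF \<theta>(1) X.S_closed]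
    note one = closed_subringD(2)[OF X.S_closed]
    have fin: "Poly_Mapping.single zs c \<in> finsupp S (tuples M k)" if "zs \<in> tuples M k" "c \<in> S" for zs c
      using that by (rule finsupp_closed(5)[OF X.S_closed])
    have fm: "free_map (map f) \<theta> (u - v) = free_map (map f) \<theta> u - free_map (map f) \<theta> v"
      if "u \<in> finsupp S (tuples M k)" "v \<in> finsupp S (tuples M k)" for u v
    proof -
      have "u - v \<in> finsupp S (tuples M k)" using that by (rule finsupp_closed(3)[OF X.S_closed])
      from free_map_add[OF \<theta>(1) X.S_closed finsuppD(2)[OF this] finsuppD(2)[OF that(2)], of "map f"]
      show ?thesis by (simp add: eq_diff_eq)
    qed
    have mem: "map f xs \<in> tuples M' k" if "xs \<in> tuples M k" for xs using tup that by auto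
    from that consider (1) xs i a b where "xs \<in> tuples M k" "i < k" "a \<in> carrier M" "b \<in> carrier M"
        "g = Poly_Mapping.single (xs[i := a \<oplus>\<^bsub>M\<^esub> b]) 1 - Poly_Mapping.single (xs[i := a]) 1 - Poly_Mapping.single (xs[i := b]) 1"
      | (2) xs i c a where "xs \<in> tuples M k" "i < k" "c \<in> S" "a \<in> carrier M"
        "g = Poly_Mapping.single (xs[i := c \<odot>\<^bsub>M\<^esub> a]) 1 - Poly_Mapping.single (xs[i := a]) c"
      | (3) xs where "xs \<in> tuples M k" "\<not> distinct xs" "g = Poly_Mapping.single xs 1"
      unfolding X.ext_gens_def by auto
    then have "free_map (map f) \<theta> g \<in> Y.ext_gens"
    proof cases
      case 1
      have t: "xs[i := a \<oplus>\<^bsub>M\<^esub> b] \<in> tuples M k" "xs[i := a] \<in> tuples M k" "xs[i := b] \<in> tuples M k"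
        using 1 by (auto intro!: X.tuples_update)
      have "Poly_Mapping.single (xs[i := a \<oplus>\<^bsub>M\<^esub> b]) 1 - Poly_Mapping.single (xs[i := a]) 1 \<in> finsupp S (tuples M k)"
        by (intro finsupp_closed(3)[OF X.S_closed] fin t one)
      then have "free_map (map f) \<theta> g = Poly_Mapping.single ((map f xs)[i := f a \<oplus>\<^bsub>M'\<^esub> f b]) 1 -
          Poly_Mapping.single ((map f xs)[i := f a]) 1 - Poly_Mapping.single ((map f xs)[i := f b]) 1"
        using fm fin t one 1 by (simp add: free_map_single h add map_update)
      then show ?thesis unfolding Y.ext_gens_def using mem[OF 1(1)] 1(2-4) f by blast
    next
      case 2
      have t: "xs[i := c \<odot>\<^bsub>M\<^esub> a] \<in> tuples M k" "xs[i := a] \<in> tuples M k"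
        using 2 by (auto intro!: X.tuples_update)
      have "free_map (map f) \<theta> g = Poly_Mapping.single ((map f xs)[i := \<theta> c \<odot>\<^bsub>M'\<^esub> f a]) 1 -
          Poly_Mapping.single ((map f xs)[i := f a]) (\<theta> c)"
        using fm fin t one 2 by (simp add: free_map_single h smult map_update)
      moreover have "\<theta> c \<in> carrier (subtring S')" using 2 \<theta>(2) by auto
      ultimately show ?thesis unfolding Y.ext_gens_def using mem[OF 2(1)] 2(2-4) f by blast
    next
      case 3
      have "free_map (map f) \<theta> g = Poly_Mapping.single (map f xs) 1" using 3 by (simp add: free_map_single h)
      moreover have "\<not> distinct (map f xs)" using 3 by (simp add: distinct_map)
      ultimately show ?thesis unfolding Y.ext_gens_def using mem[OF 3(1)] by blast
    qed
    then show ?thesis using Y.gens_rel by auto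
  qed
  have "ext_map (subtring S') M' k f \<theta> C = Y.cls (free_map (map f) \<theta> x)"
    unfolding ext_map_def Y.ext_rel_eq x(2)
    by (rule quot_map_free_map[OF X.free_quotient_axioms Y.free_quotient_axioms \<theta> tup gens x(1)])
  then show ?thesis unfolding Y.exterior_power_eq Y.carrier_Q
    using free_map_closed[OF \<theta>(1) X.S_closed \<theta>(2) Y.S_closed tup x(1)] by simp
qed

section \<open>Semisimple rings and their simple factors\<close>

text \<open>Write 1 = f + g with g in a complement J of I. For x in I the element xg = x - xf lies
  in both I and J, so it vanishes.\<close>

lemma left_ideal_generator:
  assumes B: "ring B" and ss: "semisimple_ring B" and I: "left_ideal B I"
  obtains f where "f \<in> I" "\<And>x. x \<in> I \<Longrightarrow> x \<otimes>\<^bsub>B\<^esub> f = x"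
proof -
  interpret ring B by (rule B)
  obtain J where J: "left_ideal B J" "I \<inter> J = {\<zero>\<^bsub>B\<^esub>}" "set_add B I J = carrier B"
    using ss I unfolding semisimple_ring_def by blast
  interpret I: additive_subgroup I B using I unfolding left_ideal_def by simp
  interpret J: additive_subgroup J B using J(1) unfolding left_ideal_def by simp
  have "\<one>\<^bsub>B\<^esub> \<in> set_add B I J" using J(3) by simp
  then obtain f g where fg: "f \<in> I" "g \<in> J" "\<one>\<^bsub>B\<^esub> = f \<oplus>\<^bsub>B\<^esub> g" by (auto simp: set_add_def')
  have c: "f \<in> carrier B" "g \<in> carrier B" using fg I.a_subset J.a_subset by auto
  have "x \<otimes>\<^bsub>B\<^esub> f = x" if x: "x \<in> I" for x
  proof -
    have xc: "x \<in> carrier B" using x I.a_subset by auto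
    have xf: "x \<otimes>\<^bsub>B\<^esub> f \<in> I" and xg: "x \<otimes>\<^bsub>B\<^esub> g \<in> J"
      using I J(1) fg xc unfolding left_ideal_def by auto
    have e: "x = x \<otimes>\<^bsub>B\<^esub> f \<oplus>\<^bsub>B\<^esub> x \<otimes>\<^bsub>B\<^esub> g"
      using fg(3) xc c by (metis r_distr r_one)
    then have "x \<otimes>\<^bsub>B\<^esub> g = x \<ominus>\<^bsub>B\<^esub> x \<otimes>\<^bsub>B\<^esub> f"
      using xc c by (metis add.inv_solve_left' m_closed minus_eq add.m_comm add.inv_closed)
    also have "\<dots> \<in> I" unfolding minus_eq using x xf by simp
    finally have "x \<otimes>\<^bsub>B\<^esub> g = \<zero>\<^bsub>B\<^esub>" using xg J(2) by auto
    then show ?thesis using e xc c by (metis m_closed r_zero)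
  qed
  with fg(1) show ?thesis using that by blast
qed

lemma ideal_left_ideal: "ideal I B \<Longrightarrow> left_ideal B I"
proof -
  assume "ideal I B"
  then interpret ideal I B .
  show ?thesis unfolding left_ideal_def using additive_subgroup_axioms I_l_closed by auto
qed

text \<open>Every two-sided ideal of a semisimple ring is generated by a central idempotent.\<close>

lemma ideal_central_idempotent:
  assumes B: "ring B" and ss: "semisimple_ring B" and I: "ideal I B"
  obtains f where "f \<in> I" "f \<in> center B" "\<And>x. x \<in> I \<Longrightarrow> x \<otimes>\<^bsub>B\<^esub> f = x"
proof -
  interpret ring B by (rule B)
  interpret I: ideal I B by (rule I)
  obtain f where f: "f \<in> I" "\<And>x. x \<in> I \<Longrightarrow> x \<otimes>\<^bsub>B\<^esub> f = x"
    using left_ideal_generator[OF B ss ideal_left_ideal[OF I]] by blast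
  have fc: "f \<in> carrier B" using f(1) I.a_subset by auto
  have "f \<otimes>\<^bsub>B\<^esub> x = x \<otimes>\<^bsub>B\<^esub> f" if x: "x \<in> carrier B" for x
  proof -
    \<comment> \<open>The element w = xf - fxf satisfies fw = 0, and elements of I are fixed by f on
      the right, so the left ideal Bw has square zero. Its idempotent generator is then 0, hence w =
      0 and xf = fxf. On the other side fx lies in I, so fx = fxf.\<close>
    define w where "w = x \<otimes>\<^bsub>B\<^esub> f \<ominus>\<^bsub>B\<^esub> f \<otimes>\<^bsub>B\<^esub> (x \<otimes>\<^bsub>B\<^esub> f)"
    have wc: "w \<in> carrier B" unfolding w_def using x fc by simp
    have xf: "x \<otimes>\<^bsub>B\<^esub> f \<in> I" using I.I_l_closed[OF f(1) x] .
    have wI: "w \<in> I" unfolding w_def minus_eq using xf I.I_l_closed[OF xf fc] by simp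
    have ff: "f \<otimes>\<^bsub>B\<^esub> f = f" using f by blast
    have fw: "f \<otimes>\<^bsub>B\<^esub> w = \<zero>\<^bsub>B\<^esub>"
    proof -
      have "f \<otimes>\<^bsub>B\<^esub> w = f \<otimes>\<^bsub>B\<^esub> (x \<otimes>\<^bsub>B\<^esub> f) \<ominus>\<^bsub>B\<^esub> f \<otimes>\<^bsub>B\<^esub> (f \<otimes>\<^bsub>B\<^esub> (x \<otimes>\<^bsub>B\<^esub> f))"
        unfolding w_def minus_eq using x fc by (simp add: r_distr r_minus)
      also have "f \<otimes>\<^bsub>B\<^esub> (f \<otimes>\<^bsub>B\<^esub> (x \<otimes>\<^bsub>B\<^esub> f)) = f \<otimes>\<^bsub>B\<^esub> (x \<otimes>\<^bsub>B\<^esub> f)"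
        using ff x fc by (metis m_assoc m_closed)
      finally show ?thesis using x fc by (simp add: minus_eq r_neg)
    qed
    let ?L = "(\<lambda>y. y \<otimes>\<^bsub>B\<^esub> w) ` carrier B"
    have L: "left_ideal B ?L"
    proof -
      have "additive_subgroup ?L B"
      proof (rule additive_subgroupI, rule add.subgroupI)
        show "\<ominus>\<^bsub>B\<^esub> a \<in> ?L" if "a \<in> ?L" for a
        proof -
          obtain y where "y \<in> carrier B" "a = y \<otimes>\<^bsub>B\<^esub> w" using \<open>a \<in> ?L\<close> by auto
          then have "\<ominus>\<^bsub>B\<^esub> a = (\<ominus>\<^bsub>B\<^esub> y) \<otimes>\<^bsub>B\<^esub> w" "\<ominus>\<^bsub>B\<^esub> y \<in> carrier B" using wc by (auto simp: l_minus)
          then show ?thesis by auto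
        qed
        show "a \<oplus>\<^bsub>B\<^esub> b \<in> ?L" if "a \<in> ?L" "b \<in> ?L" for a b
        proof -
          obtain y z where "y \<in> carrier B" "a = y \<otimes>\<^bsub>B\<^esub> w" "z \<in> carrier B" "b = z \<otimes>\<^bsub>B\<^esub> w" using \<open>a \<in> ?L\<close> \<open>b \<in> ?L\<close> by auto
          then have "a \<oplus>\<^bsub>B\<^esub> b = (y \<oplus>\<^bsub>B\<^esub> z) \<otimes>\<^bsub>B\<^esub> w" "y \<oplus>\<^bsub>B\<^esub> z \<in> carrier B" using wc by (auto simp: l_distr)
          then show ?thesis by simp
        qed
      qed (use wc in auto)
      moreover have "a \<otimes>\<^bsub>B\<^esub> (y \<otimes>\<^bsub>B\<^esub> w) \<in> ?L" if "a \<in> carrier B" "y \<in> carrier B" for a y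
        using that wc by (auto simp: m_assoc[symmetric])
      ultimately show ?thesis unfolding left_ideal_def by auto
    qed
    have nil: "a \<otimes>\<^bsub>B\<^esub> b = \<zero>\<^bsub>B\<^esub>" if "a \<in> ?L" "b \<in> ?L" for a b
    proof -
      obtain y z where yz: "y \<in> carrier B" "a = y \<otimes>\<^bsub>B\<^esub> w" "z \<in> carrier B" "b = z \<otimes>\<^bsub>B\<^esub> w" using \<open>a \<in> ?L\<close> \<open>b \<in> ?L\<close> by auto
      have "w \<otimes>\<^bsub>B\<^esub> z \<in> I" using I.I_r_closed[OF wI yz(3)] .
      then have "w \<otimes>\<^bsub>B\<^esub> z = w \<otimes>\<^bsub>B\<^esub> z \<otimes>\<^bsub>B\<^esub> f" using f(2) by simp
      then have "w \<otimes>\<^bsub>B\<^esub> z \<otimes>\<^bsub>B\<^esub> w = w \<otimes>\<^bsub>B\<^esub> z \<otimes>\<^bsub>B\<^esub> (f \<otimes>\<^bsub>B\<^esub> w)"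
        using wc yz fc by (metis m_assoc m_closed)
      then have "w \<otimes>\<^bsub>B\<^esub> z \<otimes>\<^bsub>B\<^esub> w = \<zero>\<^bsub>B\<^esub>" using fw wc yz by simp
      then show ?thesis using yz wc by (simp add: m_assoc)
    qed
    obtain g where g: "g \<in> ?L" "\<And>y. y \<in> ?L \<Longrightarrow> y \<otimes>\<^bsub>B\<^esub> g = y"
      using left_ideal_generator[OF B ss L] by blast
    have "w \<in> ?L" using wc l_one[OF wc] by (metis image_eqI one_closed)
    then have "w = \<zero>\<^bsub>B\<^esub>" using g nil by metis
    then have "x \<otimes>\<^bsub>B\<^esub> f = f \<otimes>\<^bsub>B\<^esub> (x \<otimes>\<^bsub>B\<^esub> f)"
      unfolding w_def using x fc by simp
    also have "\<dots> = f \<otimes>\<^bsub>B\<^esub> x \<otimes>\<^bsub>B\<^esub> f" using x fc by (simp add: m_assoc)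
    also have "\<dots> = f \<otimes>\<^bsub>B\<^esub> x" by (rule f(2)) (rule I.I_r_closed[OF f(1) x])
    finally show ?thesis by simp
  qed
  then have "f \<in> center B" unfolding center_def using fc by blast
  with f show ?thesis using that by blast
qed

text \<open>The idempotents giving the decomposition of the center into fields are the simple factors.\<close>

lemma simple_factors_eq:
  fixes B :: "('b, 'c) ring_scheme"
  assumes B: "ring B" and ss: "semisimple_ring B"
    and I: "I \<subseteq> center B" "\<And>e f. e \<in> I \<Longrightarrow> f \<in> I \<Longrightarrow> e \<otimes>\<^bsub>B\<^esub> f = (if e = f then e else \<zero>\<^bsub>B\<^esub>)"
    and fin: "finite I" and sum: "(\<Oplus>\<^bsub>B\<^esub>e\<in>I. e) = \<one>\<^bsub>B\<^esub>"
    and field: "\<And>e x. e \<in> I \<Longrightarrow> x \<in> center B \<Longrightarrow> e \<otimes>\<^bsub>B\<^esub> x \<noteq> \<zero>\<^bsub>B\<^esub> \<Longrightarrow> \<exists>y\<in>center B. (e \<otimes>\<^bsub>B\<^esub> x) \<otimes>\<^bsub>B\<^esub> (e \<otimes>\<^bsub>B\<^esub> y) = e"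
    and nz: "\<zero>\<^bsub>B\<^esub> \<notin> I"
  shows "simple_factors B = I"
proof -
  interpret ring B by (rule B)
  have cen: "x \<in> carrier B" "x \<otimes>\<^bsub>B\<^esub> y = y \<otimes>\<^bsub>B\<^esub> x" if "x \<in> center B" "y \<in> carrier B" for x y
    using that unfolding center_def by auto
  have Ic: "e \<in> carrier B" if "e \<in> I" for e using that I(1) unfolding center_def by auto
  let ?eB = "\<lambda>e. (\<lambda>x. e \<otimes>\<^bsub>B\<^esub> x) ` carrier B"
  \<comment> \<open>In the field attached to e the idempotent ef can only be 0 or the unit
    e.\<close>
  have idem: "e \<otimes>\<^bsub>B\<^esub> f = \<zero>\<^bsub>B\<^esub> \<or> e \<otimes>\<^bsub>B\<^esub> f = e"
    if e: "e \<in> I" and f: "f \<in> center B" "f \<otimes>\<^bsub>B\<^esub> f = f" for e f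
  proof (rule disjCI)
    assume "e \<otimes>\<^bsub>B\<^esub> f \<noteq> e"
    show "e \<otimes>\<^bsub>B\<^esub> f = \<zero>\<^bsub>B\<^esub>"
    proof (rule ccontr)
      assume "e \<otimes>\<^bsub>B\<^esub> f \<noteq> \<zero>\<^bsub>B\<^esub>"
      then obtain y where y: "y \<in> center B" "(e \<otimes>\<^bsub>B\<^esub> f) \<otimes>\<^bsub>B\<^esub> (e \<otimes>\<^bsub>B\<^esub> y) = e" using field[OF e f(1)] by blast
      have c: "e \<in> carrier B" "f \<in> carrier B" "y \<in> carrier B" using Ic[OF e] f(1) y(1) by (auto simp: center_def)
      have "f \<otimes>\<^bsub>B\<^esub> ((e \<otimes>\<^bsub>B\<^esub> f) \<otimes>\<^bsub>B\<^esub> (e \<otimes>\<^bsub>B\<^esub> y)) = (e \<otimes>\<^bsub>B\<^esub> f) \<otimes>\<^bsub>B\<^esub> (e \<otimes>\<^bsub>B\<^esub> y)"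
        using cen(2)[OF f(1), of e] f(2) c by (metis m_assoc m_closed)
      then have "f \<otimes>\<^bsub>B\<^esub> e = e" using y(2) by simp
      then show False using \<open>e \<otimes>\<^bsub>B\<^esub> f \<noteq> e\<close> cen(2)[OF f(1) c(1)] by simp
    qed
  qed
  show ?thesis
  proof (intro equalityI subsetI)
    fix e assume e: "e \<in> I"
    have ec: "e \<in> center B" "e \<in> carrier B" "e \<otimes>\<^bsub>B\<^esub> e = e" using e I Ic by auto
    have "J = {\<zero>\<^bsub>B\<^esub>} \<or> J = ?eB e" if J: "ideal J B" "J \<subseteq> ?eB e" for J
    proof -
      interpret J: ideal J B by (rule J)
      obtain f where f: "f \<in> J" "f \<in> center B" "\<And>x. x \<in> J \<Longrightarrow> x \<otimes>\<^bsub>B\<^esub> f = x"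
        using ideal_central_idempotent[OF B ss J(1)] by blast
      have fc: "f \<in> carrier B" using f(2) by (simp add: center_def)
      have "e \<otimes>\<^bsub>B\<^esub> f = f"
      proof -
        obtain x where "x \<in> carrier B" "f = e \<otimes>\<^bsub>B\<^esub> x" using f(1) J(2) by auto
        then show ?thesis using ec by (metis m_assoc)
      qed
      then consider "f = \<zero>\<^bsub>B\<^esub>" | "f = e" using idem[OF e f(2)] f by metis
      then show ?thesis
      proof cases
        case 1
        have "x = \<zero>\<^bsub>B\<^esub>" if "x \<in> J" for x using f(3)[OF that] 1 that J.a_subset by (metis r_null subsetD)
        then show ?thesis using J.zero_closed by auto
      next
        case 2
        then have "?eB e \<subseteq> J" using J.I_r_closed f(1) by auto
        then show ?thesis using J(2) by auto
      qed
    qed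
    then show "e \<in> simple_factors B" unfolding simple_factors_def using ec e nz by auto
  next
    fix f assume f: "f \<in> simple_factors B"
    note f = f[unfolded simple_factors_def mem_Collect_eq]
    have f': "f \<in> center B" "f \<otimes>\<^bsub>B\<^esub> f = f" "f \<noteq> \<zero>\<^bsub>B\<^esub>" using f by simp_all
    have f'': "f \<in> carrier B" using f'(1) unfolding center_def by blast
    note f' = f' f''
    have simple: "\<And>J. ideal J B \<Longrightarrow> J \<subseteq> ?eB f \<Longrightarrow> J = {\<zero>\<^bsub>B\<^esub>} \<or> J = ?eB f" using f by simp
    \<comment> \<open>Some e does not annihilate f, since the e sum to 1. Then ef = e, so the
      nonzero two-sided ideal eB is contained in fB; as fB is simple they are equal, which gives f =
      e.\<close>
    have "\<exists>e\<in>I. e \<otimes>\<^bsub>B\<^esub> f \<noteq> \<zero>\<^bsub>B\<^esub>"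
    proof (rule ccontr)
      assume "\<not> ?thesis"
      then have z: "e \<otimes>\<^bsub>B\<^esub> f = \<zero>\<^bsub>B\<^esub>" if "e \<in> I" for e using that by blast
      have "f = (\<Oplus>\<^bsub>B\<^esub>e\<in>I. e) \<otimes>\<^bsub>B\<^esub> f" using sum f' by simp
      also have "\<dots> = (\<Oplus>\<^bsub>B\<^esub>e\<in>I. e \<otimes>\<^bsub>B\<^esub> f)" using fin f' Ic by (intro finsum_ldistr) auto
      also have "\<dots> = (\<Oplus>\<^bsub>B\<^esub>e\<in>I. \<zero>\<^bsub>B\<^esub>)" using z by (intro finsum_cong') auto
      finally show False using f'(3) by simp
    qed
    then obtain e where e: "e \<in> I" "e \<otimes>\<^bsub>B\<^esub> f \<noteq> \<zero>\<^bsub>B\<^esub>" by blast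
    then have ef: "e \<otimes>\<^bsub>B\<^esub> f = e" using idem[OF e(1) f'(1,2)] by blast
    have ec: "e \<in> center B" "e \<in> carrier B" "e \<otimes>\<^bsub>B\<^esub> e = e" using e(1) I Ic by auto
    have fe: "f \<otimes>\<^bsub>B\<^esub> e = e" using ef cen(2)[OF f'(1) ec(2)] by simp
    have id: "ideal (?eB e) B"
    proof (rule idealI[OF B])
      show "subgroup (?eB e) (add_monoid B)"
      proof (rule add.subgroupI)
        show "\<ominus>\<^bsub>B\<^esub> a \<in> ?eB e" if "a \<in> ?eB e" for a
        proof -
          obtain y where "y \<in> carrier B" "a = e \<otimes>\<^bsub>B\<^esub> y" using \<open>a \<in> ?eB e\<close> by auto
          then have "\<ominus>\<^bsub>B\<^esub> a = e \<otimes>\<^bsub>B\<^esub> (\<ominus>\<^bsub>B\<^esub> y)" "\<ominus>\<^bsub>B\<^esub> y \<in> carrier B" using ec by (auto simp: r_minus)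
          then show ?thesis by auto
        qed
        show "a \<oplus>\<^bsub>B\<^esub> b \<in> ?eB e" if "a \<in> ?eB e" "b \<in> ?eB e" for a b
        proof -
          obtain y z where "y \<in> carrier B" "a = e \<otimes>\<^bsub>B\<^esub> y" "z \<in> carrier B" "b = e \<otimes>\<^bsub>B\<^esub> z" using \<open>a \<in> ?eB e\<close> \<open>b \<in> ?eB e\<close> by auto
          then have "a \<oplus>\<^bsub>B\<^esub> b = e \<otimes>\<^bsub>B\<^esub> (y \<oplus>\<^bsub>B\<^esub> z)" "y \<oplus>\<^bsub>B\<^esub> z \<in> carrier B" using ec by (auto simp: r_distr)
          then show ?thesis by simp
        qed
      qed (use ec in auto)
      show "x \<otimes>\<^bsub>B\<^esub> a \<in> ?eB e" if a: "a \<in> ?eB e" and x: "x \<in> carrier B" for a x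
      proof -
        obtain y where y: "y \<in> carrier B" "a = e \<otimes>\<^bsub>B\<^esub> y" using a by auto
        then have "x \<otimes>\<^bsub>B\<^esub> a = e \<otimes>\<^bsub>B\<^esub> (x \<otimes>\<^bsub>B\<^esub> y)" using cen(2)[OF ec(1) x] x ec by (metis m_assoc)
        then show ?thesis using x y by auto
      qed
      show "a \<otimes>\<^bsub>B\<^esub> x \<in> ?eB e" if "a \<in> ?eB e" "x \<in> carrier B" for a x
        using that ec by (auto simp: m_assoc)
    qed
    have "?eB e \<subseteq> ?eB f"
    proof
      fix a assume "a \<in> ?eB e"
      then obtain y where "y \<in> carrier B" "a = e \<otimes>\<^bsub>B\<^esub> y" by auto
      then have "a = f \<otimes>\<^bsub>B\<^esub> (e \<otimes>\<^bsub>B\<^esub> y)" "e \<otimes>\<^bsub>B\<^esub> y \<in> carrier B" using fe ec f'(4) by (auto simp: m_assoc[symmetric])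
      then show "a \<in> ?eB f" by blast
    qed
    moreover have "e \<in> ?eB e" using ec by (metis image_eqI)
    moreover have "e \<noteq> \<zero>\<^bsub>B\<^esub>" using e(1) nz by auto
    ultimately have "?eB e = ?eB f" using simple[OF id] by blast
    moreover have "f \<in> ?eB f" using f' by (metis image_eqI)
    ultimately obtain y where "y \<in> carrier B" "f = e \<otimes>\<^bsub>B\<^esub> y" by auto
    then have "e \<otimes>\<^bsub>B\<^esub> f = f" using ec by (metis m_assoc)
    then show "f \<in> I" using ef e(1) by simp
  qed
qed

section \<open>Lattices over the p-adic integers\<close>

lemma padic_field_Zp:
  assumes p: "padic_field p (nrm :: 'q::field_char_0 \<Rightarrow> real)"
  shows "closed_subring (Zp nrm)" "x \<noteq> 0 \<Longrightarrow> nrm y \<le> nrm x \<Longrightarrow> y / x \<in> Zp nrm" "nrm x = 0 \<longleftrightarrow> x = 0"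
proof -
  have mult: "nrm (x * y) = nrm x * nrm y" and ult: "nrm (x + y) \<le> max (nrm x) (nrm y)" and nn: "0 \<le> nrm x"
    and z: "nrm x = 0 \<longleftrightarrow> x = 0" for x y
    using p unfolding padic_field_def by auto
  have 1: "nrm 1 = 1" using mult[of 1 1] z[of 1] by auto
  have "nrm (- 1) * nrm (- 1) = 1" using mult[of "- 1" "- 1"] 1 by simp
  then have m1: "nrm (- 1) = 1" using nn[of "- 1"] by (metis abs_of_nonneg abs_square_eq_1 power2_eq_square)
  have neg: "nrm (- x) = nrm x" for x using mult[of "- 1" x] m1 by simp
  show "closed_subring (Zp nrm)"
    unfolding closed_subring_def Zp_def
    using ult neg 1 mult nn by (auto intro: mult_le_one) (metis diff_conv_add_uminus le_max_iff_disj order.trans max.bounded_iff)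
  show "x \<noteq> 0 \<Longrightarrow> nrm y \<le> nrm x \<Longrightarrow> y / x \<in> Zp nrm"
  proof -
    assume x: "x \<noteq> 0" and le: "nrm y \<le> nrm x"
    have "nrm (y / x) * nrm x = nrm y" using mult[of "y / x" x] x by simp
    moreover have "nrm x > 0" using nn[of x] z[of x] x by linarith
    ultimately have "nrm (y / x) \<le> 1" using le mult_le_cancel_right[of "nrm (y / x)" "nrm x" 1] by simp
    then show "y / x \<in> Zp nrm" by (simp add: Zp_def)
  qed
  show "nrm x = 0 \<longleftrightarrow> x = 0" by (rule z)
qed

lemma restrict_scalars:
  assumes M: "module tring M" and S: "closed_subring S" shows "module (subtring S) M"
proof -
  interpret M: module tring M by (rule M)
  show ?thesis
    by (rule moduleI) (use M.smult_l_distr M.smult_r_distr M.smult_assoc1 M.smult_one in \<open>auto simp: cring_subtring[OF S] M.abelian_group_axioms\<close>)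
qed

lemma submodule_finsum:
  assumes "LinearCombinations.submodule R P M" "finite I" "\<And>i. i \<in> I \<Longrightarrow> f i \<in> P"
  shows "finsum M f I \<in> P"
proof -
  interpret M: module R M using assms(1) by (rule LinearCombinations.submodule.module)
  have P: "P \<subseteq> carrier M" "\<zero>\<^bsub>M\<^esub> \<in> P" "\<And>x y. x \<in> P \<Longrightarrow> y \<in> P \<Longrightarrow> x \<oplus>\<^bsub>M\<^esub> y \<in> P"
    using assms(1) unfolding LinearCombinations.submodule_def by auto
  from assms(2,3) show ?thesis
  proof (induct I rule: finite_induct)
    case (insert i I)
    then have "finsum M f (insert i I) = f i \<oplus>\<^bsub>M\<^esub> finsum M f I"
      using P(1) by (intro M.M.finsum_insert) auto
    then show ?case using insert P(3) by auto
  qed (simp add: P)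
qed

text \<open>A minimal generating set of a finitely generated \<open>\<int>\<^sub>p\<close>-module is linearly independent over \<open>\<rat>\<^sub>p\<close>, because a linear
  relation can be solved for the vector with the coefficient of largest norm.\<close>

lemma lattice_based:
  fixes V :: "('q::field_char_0, 'v) module"
  assumes p: "padic_field p nrm" and V: "vectorspace tring V" and L: "is_lattice nrm V (carrier V) L"
  obtains N e co where "based_module UNIV V N e co" "based_module (Zp nrm) (restr V L) N e co"
proof -
  interpret V: vectorspace tring V by (rule V)
  have Vm: "module tring V" by (rule V.module_axioms)
  note Z = padic_field_Zp(1)[OF p]
  have Vz: "module (subtring (Zp nrm)) V" by (rule restrict_scalars[OF Vm Z])
  interpret Vz: module "subtring (Zp nrm)" V by (rule Vz)
  define gen where "gen G \<longleftrightarrow> finite G \<and> G \<subseteq> carrier V \<and> L = mspan (subtring (Zp nrm)) V G" for G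
  have "\<exists>G. gen G" using L unfolding is_lattice_def gen_def by auto
  \<comment> \<open>A generating set of least cardinality.\<close>
  then have "\<exists>G. gen G \<and> (\<forall>H. gen H \<longrightarrow> card G \<le> card H)" using ex_has_least_nat[of gen _ card] by blast
  then obtain G where G: "gen G" "\<And>H. gen H \<Longrightarrow> card G \<le> card H" by blast
  then have Gc: "finite G" "G \<subseteq> carrier V" "L = mspan (subtring (Zp nrm)) V G" unfolding gen_def by auto
  define N where "N = card G"
  obtain z where z: "bij_betw z {..<N} G" using ex_bij_betw_nat_finite[OF Gc(1)] unfolding N_def by (auto simp: atLeast0LessThan)
  have zc: "z i \<in> carrier V" if "i < N" for i using bij_betwE[OF z] that Gc(2) by auto
  have zG: "z i \<in> G" if "i < N" for i using bij_betwE[OF z] that by auto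
  define lc where "lc a = (\<Oplus>\<^bsub>V\<^esub>i\<in>{..<N}. a i \<odot>\<^bsub>V\<^esub> z i)" for a
  have lcc: "lc a \<in> carrier V" for a unfolding lc_def using zc by (intro V.M.finsum_closed) auto
  have lc_add: "lc a \<oplus>\<^bsub>V\<^esub> lc b = lc (\<lambda>i. a i + b i)" for a b
  proof -
    have "lc a \<oplus>\<^bsub>V\<^esub> lc b = (\<Oplus>\<^bsub>V\<^esub>i\<in>{..<N}. a i \<odot>\<^bsub>V\<^esub> z i \<oplus>\<^bsub>V\<^esub> b i \<odot>\<^bsub>V\<^esub> z i)"
      unfolding lc_def using zc by (intro V.M.finsum_addf[symmetric]) auto
    also have "\<dots> = lc (\<lambda>i. a i + b i)" unfolding lc_def using zc V.smult_l_distr by (intro V.M.finsum_cong') auto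
    finally show ?thesis .
  qed
  have lc_smult: "c \<odot>\<^bsub>V\<^esub> lc a = lc (\<lambda>i. c * a i)" for c a
  proof -
    have "c \<odot>\<^bsub>V\<^esub> lc a = (\<Oplus>\<^bsub>V\<^esub>i\<in>{..<N}. c \<odot>\<^bsub>V\<^esub> (a i \<odot>\<^bsub>V\<^esub> z i))"
      unfolding lc_def using zc by (intro V.finsum_smult_ldistr) auto
    also have "\<dots> = lc (\<lambda>i. c * a i)" unfolding lc_def using zc V.smult_assoc1 by (intro V.M.finsum_cong') auto
    finally show ?thesis .
  qed
  have lc_0: "lc (\<lambda>_. 0) = \<zero>\<^bsub>V\<^esub>"
  proof -
    have "lc (\<lambda>_. 0) = (\<Oplus>\<^bsub>V\<^esub>i\<in>{..<N}. \<zero>\<^bsub>V\<^esub>)"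
      unfolding lc_def using zc V.smult_l_null by (intro V.M.finsum_cong') auto
    then show ?thesis by simp
  qed
  have lc_z: "lc (\<lambda>i. if i = j then 1 else 0) = z j" if j: "j < N" for j
  proof -
    have "lc (\<lambda>i. if i = j then 1 else 0) = (\<Oplus>\<^bsub>V\<^esub>i\<in>{..<N}. if j = i then z i else \<zero>\<^bsub>V\<^esub>)"
      unfolding lc_def using zc V.smult_one V.smult_l_null by (intro V.M.finsum_cong') auto
    also have "\<dots> = z j" using j zc by (intro V.M.finsum_singleton) auto
    finally show ?thesis .
  qed
  have Lsub: "LinearCombinations.submodule (subtring (Zp nrm)) L V"
    unfolding Gc(3) by (rule Vz.span_is_submodule[OF Gc(2)])
  have GL: "G \<subseteq> L" unfolding Gc(3) by (rule Vz.in_own_span[OF Gc(2)])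
  have Lc: "L \<subseteq> carrier V" using Lsub unfolding LinearCombinations.submodule_def by auto
  have Lrep: "\<exists>a. (\<forall>i. a i \<in> Zp nrm) \<and> x = lc a" if "x \<in> L" for x
    using Vz Gc(2) that[unfolded Gc(3)]
  proof (rule mspan_induct)
    show "\<exists>a. (\<forall>i. a i \<in> Zp nrm) \<and> \<zero>\<^bsub>V\<^esub> = lc a" using lc_0 closed_subringD[OF Z] by (intro exI[of _ "\<lambda>_. 0"]) auto
    show "\<exists>a. (\<forall>i. a i \<in> Zp nrm) \<and> g = lc a" if g: "g \<in> G" for g
    proof -
      obtain j where j: "j < N" "g = z j" using z g unfolding bij_betw_def by auto
      have "\<forall>i. (if i = j then 1 else 0) \<in> Zp nrm" using closed_subringD[OF Z] by simp
      then show ?thesis using lc_z[OF j(1)] j(2) by (intro exI[of _ "\<lambda>i. if i = j then 1 else 0"]) simp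
    qed
    show "\<exists>a. (\<forall>i. a i \<in> Zp nrm) \<and> x \<oplus>\<^bsub>V\<^esub> y = lc a"
      if ex: "\<exists>a. (\<forall>i. a i \<in> Zp nrm) \<and> x = lc a" and ey: "\<exists>a. (\<forall>i. a i \<in> Zp nrm) \<and> y = lc a" for x y
    proof -
      obtain a where a: "\<forall>i. a i \<in> Zp nrm" "x = lc a" using ex by blast
      obtain b where b: "\<forall>i. b i \<in> Zp nrm" "y = lc b" using ey by blast
      have "\<forall>i. a i + b i \<in> Zp nrm" using a(1) b(1) closed_subringD(4)[OF Z] by simp
      then show ?thesis unfolding a(2) b(2) lc_add by (intro exI[of _ "\<lambda>i. a i + b i"]) simp
    qed
    show "\<exists>a. (\<forall>i. a i \<in> Zp nrm) \<and> c \<odot>\<^bsub>V\<^esub> x = lc a"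
      if c: "c \<in> carrier (subtring (Zp nrm))" and ex: "\<exists>a. (\<forall>i. a i \<in> Zp nrm) \<and> x = lc a" for c x
    proof -
      obtain a where "\<forall>i. a i \<in> Zp nrm" "x = lc a" using ex by blast
      then show ?thesis using c closed_subringD(6)[OF Z] by (intro exI[of _ "\<lambda>i. c * a i"]) (simp add: lc_smult)
    qed
  qed
  have span: "\<exists>a. x = lc a" if "x \<in> carrier V" for x
  proof -
    have "x \<in> mspan tring V L" using L that unfolding is_lattice_def by simp
    with Vm Lc show ?thesis
    proof (rule mspan_induct)
      show "\<exists>a. \<zero>\<^bsub>V\<^esub> = lc a" by (rule exI, rule lc_0[symmetric])
      show "\<exists>a. x \<oplus>\<^bsub>V\<^esub> y = lc a" if "\<exists>a. x = lc a" "\<exists>a. y = lc a" for x y using that by (elim exE) (simp only: lc_add, intro exI, rule refl)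
      show "\<exists>a. c \<odot>\<^bsub>V\<^esub> x = lc a" if "\<exists>a. x = lc a" for c x using that by (elim exE) (simp only: lc_smult, intro exI, rule refl)
      show "\<exists>a. x = lc a" if "x \<in> L" for x using Lrep[OF that] by (elim exE conjE) (rule exI)
    qed
  qed
  have indep: "a i = 0" if a: "lc a = \<zero>\<^bsub>V\<^esub>" and i: "i < N" for a i
  proof (rule ccontr)
    assume ai: "a i \<noteq> 0"
    \<comment> \<open>Dividing a relation by a coefficient of largest norm leaves p-adic integers,
      so \<open>z m\<close> is an integral combination of the other generators, against
      minimality.\<close>
    obtain m where m: "m < N" "\<And>j. j < N \<Longrightarrow> nrm (a j) \<le> nrm (a m)"
    proof -
      have "finite ((\<lambda>j. nrm (a j)) ` {..<N})" "(\<lambda>j. nrm (a j)) ` {..<N} \<noteq> {}" using i by auto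
      from Max_in[OF this] obtain m where m: "m < N" "Max ((\<lambda>j. nrm (a j)) ` {..<N}) = nrm (a m)" by auto
      have "nrm (a j) \<le> nrm (a m)" if "j < N" for j unfolding m(2)[symmetric] by (rule Max_ge) (use that in auto)
      with m(1) show ?thesis by (rule that)
    qed
    have am: "a m \<noteq> 0"
    proof
      assume "a m = 0"
      then have "nrm (a i) \<le> 0" using m(2)[OF i] padic_field_Zp(3)[OF p, of 0] by simp
      moreover have "0 \<le> nrm (a i)" using p unfolding padic_field_def by blast
      ultimately show False using ai padic_field_Zp(3)[OF p, of "a i"] by simp
    qed
    define b where "b j = - (a j / a m)" for j
    have bZ: "b j \<in> Zp nrm" if "j < N" for j
      unfolding b_def using closed_subringD(3)[OF Z padic_field_Zp(2)[OF p am m(2)[OF that]]] .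
    let ?H = "G - {z m}"
    have Hc: "?H \<subseteq> carrier V" using Gc(2) by auto
    have Hsub: "LinearCombinations.submodule (subtring (Zp nrm)) (mspan (subtring (Zp nrm)) V ?H) V"
      by (rule Vz.span_is_submodule[OF Hc])
    have "lc (\<lambda>j. (if j = m then 1 else 0) + (- inverse (a m)) * a j) = z m"
      unfolding lc_add[symmetric] lc_z[OF m(1)] lc_smult[symmetric] a using zc[OF m(1)] V.smult_r_null by simp
    moreover have "lc (\<lambda>j. (if j = m then 1 else 0) + (- inverse (a m)) * a j) = lc (\<lambda>j. if j = m then 0 else b j)"
      unfolding lc_def using am zc by (intro V.M.finsum_cong') (auto simp: b_def field_simps)
    ultimately have zm: "z m = lc (\<lambda>j. if j = m then 0 else b j)" by simp
    have "(\<Oplus>\<^bsub>V\<^esub>j\<in>{..<N}. (if j = m then 0 else b j) \<odot>\<^bsub>V\<^esub> z j) \<in> mspan (subtring (Zp nrm)) V ?H"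
    proof (rule submodule_finsum[OF Hsub])
      fix j assume "j \<in> {..<N}"
      then have j: "j < N" by simp
      show "(if j = m then 0 else b j) \<odot>\<^bsub>V\<^esub> z j \<in> mspan (subtring (Zp nrm)) V ?H"
      proof (cases "j = m")
        case True
        then show ?thesis using Hsub V.smult_l_null[OF zc[OF j]] unfolding LinearCombinations.submodule_def by simp
      next
        case False
        then have "z j \<in> ?H" using z zG[OF j] m(1) j unfolding bij_betw_def inj_on_def by auto
        then have "z j \<in> mspan (subtring (Zp nrm)) V ?H" using Vz.in_own_span[OF Hc] by auto
        then show ?thesis using False bZ[OF j] Hsub unfolding LinearCombinations.submodule_def by simp
      qed
    qed simp
    then have "z m \<in> mspan (subtring (Zp nrm)) V ?H" using zm unfolding lc_def by simp
    then have "G \<subseteq> mspan (subtring (Zp nrm)) V ?H" using Vz.in_own_span[OF Hc] by auto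
    then have "L \<subseteq> mspan (subtring (Zp nrm)) V ?H" unfolding Gc(3) by (rule Vz.span_is_subset[OF _ Hsub])
    moreover have "mspan (subtring (Zp nrm)) V ?H \<subseteq> L" by (rule Vz.span_is_subset[OF _ Lsub]) (use GL in auto)
    ultimately have "gen ?H" unfolding gen_def using Gc(1) Hc by auto
    then have "card G \<le> card ?H" by (rule G(2))
    moreover have "card ?H < card G" using zG[OF m(1)] Gc(1) by (intro psubset_card_mono) auto
    ultimately show False by simp
  qed
  have lc_inj: "a i = b i" if "lc a = lc b" "i < N" for a b i
  proof -
    have "lc (\<lambda>i. a i + - 1 * b i) = lc a \<oplus>\<^bsub>V\<^esub> (- 1) \<odot>\<^bsub>V\<^esub> lc b" unfolding lc_smult lc_add ..
    also have "\<dots> = lc (\<lambda>i. a i + - 1 * a i)" unfolding that(1)[symmetric] lc_smult lc_add ..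
    also have "\<dots> = \<zero>\<^bsub>V\<^esub>" using lc_0 by simp
    finally show ?thesis using indep[of "\<lambda>i. a i + - 1 * b i" i] that(2) by simp
  qed
  define co where "co i x = (SOME a. x = lc a) i" for i x
  have co_lc: "co i (lc a) = a i" if "i < N" for i a
    unfolding co_def by (rule lc_inj[OF _ that], rule someI2[of "\<lambda>b. lc a = lc b" a]) (rule refl, simp)
  have b1: "based_module UNIV V N z co"
  proof (rule based_module.intro)
    show "module (subtring UNIV) V" using Vm by (simp add: subtring_UNIV)
    fix i assume i: "i < N"
    show "co i (x \<oplus>\<^bsub>V\<^esub> y) = co i x + co i y" if "x \<in> carrier V" "y \<in> carrier V" for x y
      using span[OF that(1)] span[OF that(2)] i by (auto simp: lc_add co_lc)
    show "co i (a \<odot>\<^bsub>V\<^esub> x) = a * co i x" if "x \<in> carrier V" for a x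
      using span[OF that] i by (auto simp: lc_smult co_lc)
    show "co i (z j) = (if i = j then 1 else 0)" if "j < N" for j
      unfolding lc_z[OF that, symmetric] co_lc[OF i] ..
  next
    fix x assume x: "x \<in> carrier V" "\<And>i. i < N \<Longrightarrow> co i x = 0"
    obtain a where a: "x = lc a" using span[OF x(1)] by blast
    have "lc a = lc (\<lambda>_. 0)"
      unfolding lc_def using x(2) zc by (intro V.M.finsum_cong') (auto simp: a co_lc)
    then show "x = \<zero>\<^bsub>V\<^esub>" using a lc_0 by simp
  qed (use zc in auto)
  interpret b1: based_module UNIV V N z co by (rule b1)
  have "based_module (Zp nrm) (restr V L) N z co"
  proof (rule based_module.intro)
    show "module (subtring (Zp nrm)) (restr V L)" by (rule Vz.submodule_is_module[OF Lsub])
    show "co i x \<in> Zp nrm" if "i < N" "x \<in> carrier (restr V L)" for i x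
      using Lrep[of x] that by (auto simp: co_lc)
  qed (use Z zG GL Lc b1.co_add b1.co_smult b1.co_e b1.co_inj in \<open>auto simp: subset_iff\<close>)
  with b1 show ?thesis by (rule that)
qed

lemma hom_finsum:
  assumes M: "abelian_group M" and M': "abelian_group M'" and f: "\<And>x. x \<in> carrier M \<Longrightarrow> f x \<in> carrier M'"
    and add: "\<And>x y. x \<in> carrier M \<Longrightarrow> y \<in> carrier M \<Longrightarrow> f (x \<oplus>\<^bsub>M\<^esub> y) = f x \<oplus>\<^bsub>M'\<^esub> f y"
    and "finite I" "\<And>i. i \<in> I \<Longrightarrow> g i \<in> carrier M"
  shows "f (finsum M g I) = finsum M' (\<lambda>i. f (g i)) I"
proof -
  interpret M: abelian_group M by (rule M)
  interpret M': abelian_group M' by (rule M')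
  have "f \<zero>\<^bsub>M\<^esub> \<oplus>\<^bsub>M'\<^esub> f \<zero>\<^bsub>M\<^esub> = f \<zero>\<^bsub>M\<^esub> \<oplus>\<^bsub>M'\<^esub> \<zero>\<^bsub>M'\<^esub>"
    using add[of "\<zero>\<^bsub>M\<^esub>" "\<zero>\<^bsub>M\<^esub>"] f by simp
  then have z: "f \<zero>\<^bsub>M\<^esub> = \<zero>\<^bsub>M'\<^esub>" using f[OF M.zero_closed] M'.add.l_cancel M'.zero_closed by blast
  from assms(5,6) show ?thesis
  proof (induct I rule: finite_induct)
    case (insert i I)
    then have "finsum M g (insert i I) = g i \<oplus>\<^bsub>M\<^esub> finsum M g I" by (intro M.finsum_insert) auto
    moreover have "finsum M' (\<lambda>i. f (g i)) (insert i I) = f (g i) \<oplus>\<^bsub>M'\<^esub> finsum M' (\<lambda>i. f (g i)) I"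
      using insert f by (intro M'.finsum_insert) auto
    moreover have "f (g i \<oplus>\<^bsub>M\<^esub> finsum M g I) = f (g i) \<oplus>\<^bsub>M'\<^esub> f (finsum M g I)"
      using insert by (intro add M.finsum_closed) auto
    ultimately show ?case using insert by simp
  qed (simp add: z)
qed

lemma (in based_base_change) bc_map_linear:
  assumes f: "linear_on A M M f"
  shows "linear_on S Q Q (bc_map (subtring A) M (subtring S) \<phi> f id)" (is ?lin)
    and "mat N N (\<lambda>(i, j). coS i (bc_map (subtring A) M (subtring S) \<phi> f id (pure (e j)))) = map_mat \<phi> (mat_of f)" (is ?mat)
proof -
  have id: "hom_on S id" by (simp add: hom_on_def)
  let ?g = "bc_map (subtring A) M (subtring S) \<phi> f id"
  have *: "?g (cls x) = cls (free_map f id x)" if "x \<in> finsupp S (carrier M)" for x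
    using that by (intro bc_map_cls[OF base_change_module_axioms base_change_module_axioms id _ _ _ f]) auto
  have fc: "free_map f id x \<in> finsupp S (carrier M)" if "x \<in> finsupp S (carrier M)" for x
    by (rule free_map_closed[OF id S_closed _ S_closed _ that]) (use linear_onD(1)[OF f] in auto)
  have r: "range (Poly_Mapping.lookup x) \<subseteq> S" if "x \<in> finsupp S (carrier M)" for x using finsuppD(2)[OF that] .
  show ?lin
    unfolding linear_on_def
  proof (intro conjI ballI Pi_I)
    fix x assume "x \<in> carrier Q"
    then obtain u where u: "x = cls u" "u \<in> finsupp S (carrier M)" unfolding carrier_Q by auto
    show "?g x \<in> carrier Q" unfolding u(1) *[OF u(2)] carrier_Q using fc[OF u(2)] by blast
  next
    fix x y assume "x \<in> carrier Q"
    then obtain u where u: "x = cls u" "u \<in> finsupp S (carrier M)" unfolding carrier_Q by auto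
    assume "y \<in> carrier Q"
    then obtain v where v: "y = cls v" "v \<in> finsupp S (carrier M)" unfolding carrier_Q by auto
    show "?g (x \<oplus>\<^bsub>Q\<^esub> y) = ?g x \<oplus>\<^bsub>Q\<^esub> ?g y"
      unfolding u(1) v(1) add_Q *[OF u(2)] *[OF v(2)] *[OF finsupp_closed(2)[OF S_closed u(2) v(2)]]
        free_map_add[OF id S_closed r[OF u(2)] r[OF v(2)]] ..
  next
    fix a x assume a: "a \<in> S" and "x \<in> carrier Q"
    then obtain u where u: "x = cls u" "u \<in> finsupp S (carrier M)" unfolding carrier_Q by auto
    have su: "scale a u \<in> finsupp S (carrier M)" using finsupp_closed[OF S_closed] a u(2) by blast
    show "?g (a \<odot>\<^bsub>Q\<^esub> x) = a \<odot>\<^bsub>Q\<^esub> ?g x"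
      unfolding u(1) smult_Q[OF a] *[OF u(2)] *[OF su] free_map_scale[OF id S_closed r[OF u(2)] a] by simp
  qed
  show ?mat
  proof (rule eq_matI)
    fix i j assume "i < dim_row (map_mat \<phi> (mat_of f))" "j < dim_col (map_mat \<phi> (mat_of f))"
    then have ij: "i < N" "j < N" by auto
    have "Poly_Mapping.single (e j) (1 :: 's) \<in> finsupp S (carrier M)"
      using e_closed[OF ij(2)] closed_subringD[OF S_closed] unfolding finsupp_def by (auto simp: lookup_single when_def)
    then have "?g (pure (e j)) = pure (f (e j))" unfolding pure_def by (subst *) (auto simp: free_map_single)
    then show "mat N N (\<lambda>(i, j). coS i (?g (pure (e j)))) $$ (i, j) = map_mat \<phi> (mat_of f) $$ (i, j)"
      using ij by (simp add: coS_pure)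
  qed auto
qed

section \<open>The members of the multichain as lattices stable under the maximal order\<close>

context local_PEL_datum
begin

lemma order_props:
  shows "max_order D \<subseteq> carrier (alg D)" "\<one>\<^bsub>alg D\<^esub> \<in> max_order D"
    "x \<in> max_order D \<Longrightarrow> y \<in> max_order D \<Longrightarrow> x \<oplus>\<^bsub>alg D\<^esub> y \<in> max_order D"
    "a \<in> Zp nrm \<Longrightarrow> x \<in> max_order D \<Longrightarrow> a \<odot>\<^bsub>alg D\<^esub> x \<in> max_order D"
    "mspan tring (alg D) (max_order D) = carrier (alg D)"
    "module tring (alg D)"
proof -
  show m: "module tring (alg D)" using B_vectorspace unfolding vectorspace_def by auto
  interpret Bz: module "subtring (Zp nrm)" "alg D" by (rule restrict_scalars[OF m padic_field_Zp(1)[OF padic]])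
  have o: "subring (max_order D) (alg D)" "is_lattice nrm (alg D) (carrier (alg D)) (max_order D)"
    using order_maximal unfolding is_maximal_order_def is_order_def by auto
  show "max_order D \<subseteq> carrier (alg D)" "\<one>\<^bsub>alg D\<^esub> \<in> max_order D"
    "x \<in> max_order D \<Longrightarrow> y \<in> max_order D \<Longrightarrow> x \<oplus>\<^bsub>alg D\<^esub> y \<in> max_order D"
    using subringE[OF o(1)] by auto
  obtain Z where "Z \<subseteq> carrier (alg D)" "max_order D = mspan (subtring (Zp nrm)) (alg D) Z"
    using o(2) unfolding is_lattice_def by blast
  then have "LinearCombinations.submodule (subtring (Zp nrm)) (max_order D) (alg D)" using Bz.span_is_submodule by simp
  then show "a \<in> Zp nrm \<Longrightarrow> x \<in> max_order D \<Longrightarrow> a \<odot>\<^bsub>alg D\<^esub> x \<in> max_order D"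
    unfolding LinearCombinations.submodule_def by simp
  show "mspan tring (alg D) (max_order D) = carrier (alg D)" using o(2) unfolding is_lattice_def by auto
qed

text \<open>The idempotents that decompose the center into fields are exactly the simple factors;
  hence there are finitely many and they sum to one.\<close>

lemma simple_factors_props:
  shows "finite (simple_factors (alg D))" "simple_factors (alg D) \<subseteq> center (alg D)"
    "(\<Oplus>\<^bsub>alg D\<^esub>e\<in>simple_factors (alg D). e) = \<one>\<^bsub>alg D\<^esub>"
    "e \<in> simple_factors (alg D) \<Longrightarrow> e \<otimes>\<^bsub>alg D\<^esub> e = e"
proof -
  let ?B = "alg D" and ?F = "(alg D)\<lparr>carrier := center (alg D)\<rparr>"
  interpret B: ring ?B by (rule B_ring)
  have cc: "center ?B \<subseteq> carrier ?B" unfolding center_def by auto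
  obtain I where I: "finite I" "I \<subseteq> center ?B"
    "\<And>e f. e \<in> I \<Longrightarrow> f \<in> I \<Longrightarrow> e \<otimes>\<^bsub>?B\<^esub> f = (if e = f then e else \<zero>\<^bsub>?B\<^esub>)"
    "(\<Oplus>\<^bsub>?F\<^esub>e\<in>I. e) = \<one>\<^bsub>?B\<^esub>"
    "\<And>e. e \<in> I \<Longrightarrow> field (?F\<lparr>carrier := (\<lambda>x. e \<otimes>\<^bsub>?B\<^esub> x) ` center ?B, one := e\<rparr>)"
  proof -
    obtain I where I: "finite I \<and> I \<subseteq> carrier ?F \<and>
      (\<forall>e\<in>I. \<forall>f\<in>I. e \<otimes>\<^bsub>?F\<^esub> f = (if e = f then e else \<zero>\<^bsub>?F\<^esub>)) \<and> (\<Oplus>\<^bsub>?F\<^esub>e\<in>I. e) = \<one>\<^bsub>?F\<^esub> \<and>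
      (\<forall>e\<in>I. field (?F\<lparr>carrier := (\<lambda>x. e \<otimes>\<^bsub>?F\<^esub> x) ` carrier ?F, one := e\<rparr>))"
      using F_fields unfolding F_center finite_product_of_fields_def by (rule exE)
    note J = I[THEN conjunct1] I[THEN conjunct2, THEN conjunct1] I[THEN conjunct2, THEN conjunct2, THEN conjunct2, THEN conjunct1]
      I[THEN conjunct2, THEN conjunct2, THEN conjunct1] I[THEN conjunct2, THEN conjunct2, THEN conjunct2, THEN conjunct2]
    show ?thesis
    proof (rule that[of I])
      show "finite I" by (rule J(1))
      show "I \<subseteq> center ?B" using J(2) by simp
      show "(\<Oplus>\<^bsub>?F\<^esub>e\<in>I. e) = \<one>\<^bsub>?B\<^esub>" using J(3) by simp
      show "e \<otimes>\<^bsub>?B\<^esub> f = (if e = f then e else \<zero>\<^bsub>?B\<^esub>)" if "e \<in> I" "f \<in> I" for e f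
        using J(4)[rule_format, OF that] by simp
      show "field (?F\<lparr>carrier := (\<lambda>x. e \<otimes>\<^bsub>?B\<^esub> x) ` center ?B, one := e\<rparr>)" if "e \<in> I" for e
        using J(5)[rule_format, OF that] by simp
    qed
  qed
  \<comment> \<open>The decomposition of one is stated in the record of the center; the sum is
    transferred to \<open>B\<close>.\<close>
  have "abelian_monoid ?F"
    by (rule abelian_monoidI) (auto simp: center_def B.l_distr B.r_distr B.add.m_ac)
  then interpret F: abelian_monoid ?F .
  have "finsum ?F (\<lambda>e. e) J = finsum ?B (\<lambda>e. e) J" if "finite J" "J \<subseteq> center ?B" for J
    using that
  proof (induct J rule: finite_induct)
    case (insert e J)
    then have "finsum ?F (\<lambda>e. e) (insert e J) = e \<oplus>\<^bsub>?F\<^esub> finsum ?F (\<lambda>e. e) J"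
      by (intro F.finsum_insert) auto
    moreover have "finsum ?B (\<lambda>e. e) (insert e J) = e \<oplus>\<^bsub>?B\<^esub> finsum ?B (\<lambda>e. e) J"
      using insert cc by (intro B.finsum_insert) auto
    ultimately show ?case using insert by simp
  qed simp
  from this[OF I(1,2)] I(4) have sum: "(\<Oplus>\<^bsub>?B\<^esub>e\<in>I. e) = \<one>\<^bsub>?B\<^esub>" by simp
  have nz: "\<zero>\<^bsub>?B\<^esub> \<notin> I"
  proof
    assume z: "\<zero>\<^bsub>?B\<^esub> \<in> I"
    interpret f: field "?F\<lparr>carrier := (\<lambda>x. \<zero>\<^bsub>?B\<^esub> \<otimes>\<^bsub>?B\<^esub> x) ` center ?B, one := \<zero>\<^bsub>?B\<^esub>\<rparr>" by (rule I(5)[OF z])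
    show False using f.one_not_zero by simp
  qed
  have inv: "\<exists>y\<in>center ?B. (e \<otimes>\<^bsub>?B\<^esub> x) \<otimes>\<^bsub>?B\<^esub> (e \<otimes>\<^bsub>?B\<^esub> y) = e"
    if e: "e \<in> I" and x: "x \<in> center ?B" "e \<otimes>\<^bsub>?B\<^esub> x \<noteq> \<zero>\<^bsub>?B\<^esub>" for e x
  proof -
    let ?G = "?F\<lparr>carrier := (\<lambda>x. e \<otimes>\<^bsub>?B\<^esub> x) ` center ?B, one := e\<rparr>"
    interpret f: field ?G by (rule I(5)[OF e])
    have "e \<otimes>\<^bsub>?B\<^esub> x \<in> Units ?G" using f.field_Units x by simp
    then show ?thesis unfolding Units_def by auto
  qed
  have eq: "simple_factors ?B = I"
    by (rule simple_factors_eq[OF B_ring B_semisimple I(2,3,1) sum inv nz])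
  show "finite (simple_factors ?B)" "simple_factors ?B \<subseteq> center ?B" "(\<Oplus>\<^bsub>?B\<^esub>e\<in>simple_factors ?B. e) = \<one>\<^bsub>?B\<^esub>"
    "e \<in> simple_factors ?B \<Longrightarrow> e \<otimes>\<^bsub>?B\<^esub> e = e"
    unfolding eq using I(1,2) sum I(3)[of e e] by auto
qed

lemma V_module: "module tring (space D)" using V_vectorspace unfolding vectorspace_def by auto

lemma act_props:
  assumes "b \<in> carrier (alg D)" "v \<in> carrier (space D)"
  shows "act D b v \<in> carrier (space D)"
    "w \<in> carrier (space D) \<Longrightarrow> act D b (v \<oplus>\<^bsub>space D\<^esub> w) = act D b v \<oplus>\<^bsub>space D\<^esub> act D b w"
    "act D b (a \<odot>\<^bsub>space D\<^esub> v) = a \<odot>\<^bsub>space D\<^esub> act D b v"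
  using act_hom[OF assms(1)] assms(2) unfolding module_hom_def by auto

text \<open>A member of the multichain is the sum of lattices \<open>L e\<close> in the factors eV.
  Generators of the \<open>L e\<close> together generate it, and it spans V because every vector is
  the sum of its components ev. An element b of the order preserves \<open>L e\<close> because e is
  central and acts on \<open>L e\<close> as the identity, so that b acts there as eb.\<close>

lemma chain_lattice:
  assumes \<Lambda>: "\<Lambda> \<in> chain D"
  shows "is_lattice nrm (space D) (carrier (space D)) \<Lambda>" "b \<in> max_order D \<Longrightarrow> v \<in> \<Lambda> \<Longrightarrow> act D b v \<in> \<Lambda>"
proof -
  let ?V = "space D" and ?I = "simple_factors (alg D)" and ?Z = "subtring (Zp nrm)"
  note Zp = padic_field_Zp(1)[OF padic]
  interpret V: module tring ?V by (rule V_module)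
  interpret Vz: module ?Z ?V by (rule restrict_scalars[OF V_module Zp])
  interpret B: ring "alg D" by (rule B_ring)
  note I = simple_factors_props
  have Ic: "\<And>e. e \<in> ?I \<Longrightarrow> e \<in> carrier (alg D)" using I(2) unfolding center_def by auto
  obtain C where C: "\<And>e. e \<in> ?I \<Longrightarrow> lattice_chain nrm D e (C e)"
    "chain D = {{(\<Oplus>\<^bsub>?V\<^esub>e\<in>?I. u e) | u. \<forall>e\<in>?I. u e \<in> L e} | L. \<forall>e\<in>?I. L e \<in> C e}"
    using chain_multichain unfolding is_multichain_def by blast
  then obtain L where L: "\<And>e. e \<in> ?I \<Longrightarrow> L e \<in> C e" "\<Lambda> = {(\<Oplus>\<^bsub>?V\<^esub>e\<in>?I. u e) | u. \<forall>e\<in>?I. u e \<in> L e}"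
  proof -
    obtain L where "\<Lambda> = {(\<Oplus>\<^bsub>?V\<^esub>e\<in>?I. u e) | u. \<forall>e\<in>?I. u e \<in> L e} \<and> (\<forall>e\<in>?I. L e \<in> C e)"
      using \<Lambda> unfolding C(2) by (elim CollectE exE)
    then show ?thesis by (intro that[of L]) simp_all
  qed
  have Ll: "is_lattice nrm ?V (act D e ` carrier ?V) (L e)"
    and LO: "\<And>x v. x \<in> max_order D \<Longrightarrow> v \<in> L e \<Longrightarrow> act D (e \<otimes>\<^bsub>alg D\<^esub> x) v \<in> L e" if e: "e \<in> ?I" for e
  proof -
    have "\<forall>\<Lambda>\<in>C e. is_lattice nrm ?V (act D e ` carrier ?V) \<Lambda> \<and>
        (\<forall>x\<in>(\<lambda>x. e \<otimes>\<^bsub>alg D\<^esub> x) ` max_order D. act D x ` \<Lambda> \<subseteq> \<Lambda>)"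
      using C(1)[OF e] unfolding lattice_chain_def Let_def by (elim conjE)
    from bspec[OF this L(1)[OF e]] have *: "is_lattice nrm ?V (act D e ` carrier ?V) (L e)"
      "\<forall>x\<in>(\<lambda>x. e \<otimes>\<^bsub>alg D\<^esub> x) ` max_order D. act D x ` L e \<subseteq> L e" by simp_all
    show "is_lattice nrm ?V (act D e ` carrier ?V) (L e)" by (rule *(1))
    show "act D (e \<otimes>\<^bsub>alg D\<^esub> x) v \<in> L e" if "x \<in> max_order D" "v \<in> L e" for x v
      using bspec[OF *(2) imageI[OF that(1)]] that(2) by auto
  qed
  have "\<forall>e\<in>?I. \<exists>Z. finite Z \<and> Z \<subseteq> act D e ` carrier ?V \<and> L e = mspan ?Z ?V Z" using Ll unfolding is_lattice_def by blast
  from bchoice[OF this] obtain Z where Z0: "\<forall>e\<in>?I. finite (Z e) \<and> Z e \<subseteq> act D e ` carrier ?V \<and> L e = mspan ?Z ?V (Z e)"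
    by (rule exE)
  then have Z: "\<And>e. e \<in> ?I \<Longrightarrow> finite (Z e)" "\<And>e. e \<in> ?I \<Longrightarrow> Z e \<subseteq> act D e ` carrier ?V"
    "\<And>e. e \<in> ?I \<Longrightarrow> L e = mspan ?Z ?V (Z e)" by simp_all
  have Zc: "Z e \<subseteq> carrier ?V" if e: "e \<in> ?I" for e using Z(2)[OF e] act_props(1)[OF Ic[OF e]] by auto
  have Lsub: "LinearCombinations.submodule ?Z (L e) ?V" if e: "e \<in> ?I" for e
    unfolding Z(3)[OF e] by (rule Vz.span_is_submodule[OF Zc[OF e]])
  have Lc: "L e \<subseteq> carrier ?V" "\<zero>\<^bsub>?V\<^esub> \<in> L e" "\<And>x y. x \<in> L e \<Longrightarrow> y \<in> L e \<Longrightarrow> x \<oplus>\<^bsub>?V\<^esub> y \<in> L e"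
    "\<And>a x. a \<in> Zp nrm \<Longrightarrow> x \<in> L e \<Longrightarrow> a \<odot>\<^bsub>?V\<^esub> x \<in> L e" if e: "e \<in> ?I" for e
    using Lsub[OF e] unfolding LinearCombinations.submodule_def by auto
  have LV: "mspan tring ?V (L e) = act D e ` carrier ?V" if e: "e \<in> ?I" for e using Ll[OF e] unfolding is_lattice_def by auto
  \<comment> \<open>\<open>L e\<close> lies in the image of the idempotent e.\<close>
  have Lfix: "act D e v = v" if e: "e \<in> ?I" and v: "v \<in> L e" for e v
  proof -
    have "v \<in> act D e ` carrier ?V" using V.in_own_span[OF Lc(1)[OF e]] v LV[OF e] by auto
    then obtain w where w: "v = act D e w" "w \<in> carrier ?V" by auto
    then show ?thesis using act_mult[OF Ic[OF e] Ic[OF e] w(2)] I(4)[OF e] by simp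
  qed
  have inL: "(\<Oplus>\<^bsub>?V\<^esub>e\<in>?I. if e0 = e then v else \<zero>\<^bsub>?V\<^esub>) = v" if "e0 \<in> ?I" "v \<in> L e0" for e0 v
    using I(1) Lc(1)[OF that(1)] that by (intro V.finsum_singleton[of e0 ?I "\<lambda>_. v"]) auto
  have L\<Lambda>: "L e \<subseteq> \<Lambda>" if e: "e \<in> ?I" for e
  proof
    fix v assume v: "v \<in> L e"
    show "v \<in> \<Lambda>" unfolding L(2)
      by (rule CollectI, rule exI[of _ "\<lambda>e'. if e = e' then v else \<zero>\<^bsub>?V\<^esub>"]) (use inL[OF e v] v Lc(2) in auto)
  qed
  have \<Lambda>c: "\<Lambda> \<subseteq> carrier ?V" unfolding L(2) using Lc(1) by (auto intro!: V.finsum_closed)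
  have Zc': "\<Union>(Z ` ?I) \<subseteq> carrier ?V" using Zc by blast
  have "\<Lambda> \<subseteq> mspan ?Z ?V (\<Union>(Z ` ?I))"
  proof
    fix x assume "x \<in> \<Lambda>"
    then obtain u where u: "x = (\<Oplus>\<^bsub>?V\<^esub>e\<in>?I. u e)" "\<And>e. e \<in> ?I \<Longrightarrow> u e \<in> L e" unfolding L(2) by blast
    have sub: "LinearCombinations.submodule ?Z (mspan ?Z ?V (\<Union>(Z ` ?I))) ?V" by (rule Vz.span_is_submodule[OF Zc'])
    show "x \<in> mspan ?Z ?V (\<Union>(Z ` ?I))" unfolding u(1)
    proof (rule submodule_finsum[OF sub I(1)])
      fix e assume e: "e \<in> ?I"
      have "Z e \<subseteq> mspan ?Z ?V (\<Union>(Z ` ?I))" using Vz.in_own_span[OF Zc'] e by blast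
      then show "u e \<in> mspan ?Z ?V (\<Union>(Z ` ?I))" using Vz.span_is_subset[OF _ sub] Z(3)[OF e] u(2)[OF e] by blast
    qed
  qed
  moreover have "x \<in> \<Lambda>" if "x \<in> mspan ?Z ?V (\<Union>(Z ` ?I))" for x
    using Vz.module_axioms Zc' that
  proof (rule mspan_induct)
    show "\<zero>\<^bsub>?V\<^esub> \<in> \<Lambda>" unfolding L(2)
      by (rule CollectI, rule exI[of _ "\<lambda>_. \<zero>\<^bsub>?V\<^esub>"]) (use Lc(2) in auto)
    show "x \<in> \<Lambda>" if "x \<in> \<Union>(Z ` ?I)" for x
    proof -
      obtain e where e: "e \<in> ?I" "x \<in> Z e" using \<open>x \<in> \<Union>(Z ` ?I)\<close> by blast
      then have "x \<in> L e" using Vz.in_own_span[OF Zc[OF e(1)]] Z(3)[OF e(1)] by blast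
      then show ?thesis using L\<Lambda>[OF e(1)] by blast
    qed
    show "x \<oplus>\<^bsub>?V\<^esub> y \<in> \<Lambda>" if x: "x \<in> \<Lambda>" and y: "y \<in> \<Lambda>" for x y
    proof -
      obtain u where u: "x = (\<Oplus>\<^bsub>?V\<^esub>e\<in>?I. u e)" "\<And>e. e \<in> ?I \<Longrightarrow> u e \<in> L e" using x unfolding L(2) by blast
      obtain w where w: "y = (\<Oplus>\<^bsub>?V\<^esub>e\<in>?I. w e)" "\<And>e. e \<in> ?I \<Longrightarrow> w e \<in> L e" using y unfolding L(2) by blast
      have "x \<oplus>\<^bsub>?V\<^esub> y = (\<Oplus>\<^bsub>?V\<^esub>e\<in>?I. u e \<oplus>\<^bsub>?V\<^esub> w e)"
        unfolding u(1) w(1) using u(2) w(2) Lc(1) by (intro V.finsum_addf[symmetric]) auto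
      then show ?thesis unfolding L(2) using Lc(3) u(2) w(2) by blast
    qed
    show "a \<odot>\<^bsub>?V\<^esub> x \<in> \<Lambda>" if a: "a \<in> carrier ?Z" and x: "x \<in> \<Lambda>" for a x
    proof -
      obtain u where u: "x = (\<Oplus>\<^bsub>?V\<^esub>e\<in>?I. u e)" "\<And>e. e \<in> ?I \<Longrightarrow> u e \<in> L e" using x unfolding L(2) by blast
      have "a \<odot>\<^bsub>?V\<^esub> x = (\<Oplus>\<^bsub>?V\<^esub>e\<in>?I. a \<odot>\<^bsub>?V\<^esub> u e)"
        unfolding u(1) using u(2) Lc(1) a by (intro Vz.finsum_smult_ldistr I(1)) auto
      then show ?thesis unfolding L(2) using Lc(4) u(2) a by auto
    qed
  qed
  ultimately have eq: "\<Lambda> = mspan ?Z ?V (\<Union>(Z ` ?I))" by blast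
  have tsub: "LinearCombinations.submodule tring (mspan tring ?V \<Lambda>) ?V" by (rule V.span_is_submodule[OF \<Lambda>c])
  have "v \<in> mspan tring ?V \<Lambda>" if v: "v \<in> carrier ?V" for v
  proof -
    have "v = act D (\<Oplus>\<^bsub>alg D\<^esub>e\<in>?I. e) v" unfolding I(3) act_one[OF v] ..
    also have "\<dots> = (\<Oplus>\<^bsub>?V\<^esub>e\<in>?I. act D e v)"
      by (rule hom_finsum[OF B.abelian_group_axioms V.M.abelian_group_axioms _ _ I(1)])
        (use act_props(1)[OF _ v] act_add[OF _ _ v] Ic in auto)
    also have "\<dots> \<in> mspan tring ?V \<Lambda>"
    proof (rule submodule_finsum[OF tsub I(1)])
      fix e assume e: "e \<in> ?I"
      have "L e \<subseteq> mspan tring ?V \<Lambda>" using L\<Lambda>[OF e] V.in_own_span[OF \<Lambda>c] by blast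
      then have "mspan tring ?V (L e) \<subseteq> mspan tring ?V \<Lambda>" by (rule V.span_is_subset[OF _ tsub])
      then show "act D e v \<in> mspan tring ?V \<Lambda>" unfolding LV[OF e] using v by blast
    qed
    finally show ?thesis .
  qed
  moreover have "mspan tring ?V \<Lambda> \<subseteq> carrier ?V" using tsub unfolding LinearCombinations.submodule_def by auto
  moreover have "finite (\<Union>(Z ` ?I))" using I(1) Z(1) by blast
  ultimately show "is_lattice nrm ?V (carrier ?V) \<Lambda>" unfolding is_lattice_def using eq Zc' by blast
  assume b: "b \<in> max_order D" and "v \<in> \<Lambda>"
  then obtain u where u: "v = (\<Oplus>\<^bsub>?V\<^esub>e\<in>?I. u e)" "\<And>e. e \<in> ?I \<Longrightarrow> u e \<in> L e" unfolding L(2) by blast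
  have bc: "b \<in> carrier (alg D)" using b order_props(1) by blast
  have "act D b v = (\<Oplus>\<^bsub>?V\<^esub>e\<in>?I. act D b (u e))"
    unfolding u(1) by (intro hom_finsum V.M.abelian_group_axioms I(1)) (use act_props[OF bc] u(2) subsetD[OF Lc(1)] in simp_all)
  moreover have "act D b (u e) \<in> L e" if e: "e \<in> ?I" for e
  proof -
    have uc: "u e \<in> carrier ?V" using u(2)[OF e] Lc(1)[OF e] by blast
    have "act D b (u e) = act D b (act D e (u e))" using Lfix[OF e u(2)[OF e]] by simp
    also have "\<dots> = act D (b \<otimes>\<^bsub>alg D\<^esub> e) (u e)" using act_mult[OF bc Ic[OF e] uc] by simp
    also have "b \<otimes>\<^bsub>alg D\<^esub> e = e \<otimes>\<^bsub>alg D\<^esub> b" using I(2) e bc unfolding center_def by auto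
    finally show ?thesis using LO[OF e b u(2)[OF e]] by simp
  qed
  ultimately show "act D b v \<in> \<Lambda>" unfolding L(2) by blast
qed

end

section \<open>Bases of subspaces, and linear forms on the algebraic closure\<close>

lemma module_submodule_iff:
  assumes "Module.submodule P tring M" and M: "module tring M" shows "LinearCombinations.submodule tring P M"
proof -
  interpret P: Module.submodule P tring M by (rule assms(1))
  interpret M: module tring M by (rule M)
  show ?thesis
    unfolding LinearCombinations.submodule_def using P.subset P.m_closed P.one_closed P.smult_closed M.module_axioms by auto
qed

text \<open>Gaussian elimination on the last coordinate that does not vanish on the subspace.\<close>

lemma subspace_based:
  fixes M :: "('a::field, 'm) module"
  assumes b: "based_module UNIV M N e co"
  shows "LinearCombinations.submodule tring P M \<Longrightarrow> n \<le> N \<Longrightarrow> (\<And>x i. x \<in> P \<Longrightarrow> n \<le> i \<Longrightarrow> i < N \<Longrightarrow> co i x = 0) \<Longrightarrow>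
    \<exists>m z c. based_module UNIV (restr M P) m z c"
proof (induct n arbitrary: P)
  interpret based_module UNIV M N e co by (rule b)
  have Mt: "module tring M" using M by (simp add: subtring_UNIV)
  {
    case 0
    have "based_module UNIV (restr M P) 0 z c" for z c
    proof (rule based_module.intro)
      show "module (subtring UNIV) (restr M P)"
        unfolding subtring_UNIV by (rule LinearCombinations.module.submodule_is_module[OF Mt 0(1)])
      show "x = \<zero>\<^bsub>restr M P\<^esub>" if "x \<in> carrier (restr M P)" for x
        using co_inj[of x] 0(3)[of x] that 0(1) unfolding LinearCombinations.submodule_def by auto
    qed auto
    then show ?case by blast
  next
    case (Suc n)
    note P = Suc(2)
    have Pc: "P \<subseteq> carrier M" "\<zero>\<^bsub>M\<^esub> \<in> P" "\<And>x y. x \<in> P \<Longrightarrow> y \<in> P \<Longrightarrow> x \<oplus>\<^bsub>M\<^esub> y \<in> P" "\<And>a x. x \<in> P \<Longrightarrow> a \<odot>\<^bsub>M\<^esub> x \<in> P"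
      using P unfolding LinearCombinations.submodule_def by auto
    have nN: "n < N" using Suc(3) by simp
    show ?case
    proof (cases "\<forall>x\<in>P. co n x = 0")
      case True
      show ?thesis
      proof (rule Suc(1)[OF P])
        show "co i x = 0" if "x \<in> P" "n \<le> i" "i < N" for x i
          using Suc(4)[OF that(1) _ that(3)] that(2) True that(1) by (cases "i = n") auto
      qed (use nN in simp)
    next
      case False
      then obtain y where y: "y \<in> P" "co n y \<noteq> 0" by blast
      define u where "u = inverse (co n y) \<odot>\<^bsub>M\<^esub> y"
      have u: "u \<in> P" "co n u = 1" "u \<in> carrier M" using Pc(1) Pc(4)[OF y(1)] y nN co_smult[of n _ y] by (auto simp: u_def)
      define P' where "P' = {x\<in>P. co n x = 0}"
      have P': "LinearCombinations.submodule tring P' M"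
        unfolding LinearCombinations.submodule_def P'_def
        using Pc Mt nN co_add co_smult co_zero by (auto simp: subset_iff)
      have "\<exists>m z c. based_module UNIV (restr M P') m z c"
      proof (rule Suc(1)[OF P'])
        show "co i x = 0" if "x \<in> P'" "n \<le> i" "i < N" for x i
          using Suc(4)[of x i] that unfolding P'_def by (cases "i = n") auto
      qed (use nN in simp)
      then obtain m z c where z: "based_module UNIV (restr M P') m z c" by blast
      \<comment> \<open>Subtracting the multiple of u with the same n-th coordinate projects
        \<open>P\<close> onto the subspace \<open>P'\<close> where that coordinate vanishes. A basis
        of \<open>P\<close> is one of \<open>P'\<close> followed by u, at index m.\<close>
      define r where "r x = x \<ominus>\<^bsub>M\<^esub> co n x \<odot>\<^bsub>M\<^esub> u" for x
      have uv: "a \<odot>\<^bsub>M\<^esub> u \<in> P" "a \<odot>\<^bsub>M\<^esub> u \<in> carrier M" for a using Pc(1,4) u(1) by auto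
      have rP: "r x \<in> P'" if x: "x \<in> P" for x
      proof -
        have xc: "x \<in> carrier M" using x Pc(1) by blast
        have "r x = x \<oplus>\<^bsub>M\<^esub> (- co n x) \<odot>\<^bsub>M\<^esub> u"
          unfolding r_def by (rule co_ext) (use xc uv u(3) in \<open>auto simp: co_add co_minus co_smult\<close>)
        then have "r x \<in> P" using Pc(3)[OF x uv(1)] by simp
        moreover have "co n (r x) = 0" unfolding r_def using co_minus[OF nN xc uv(2)] co_smult[OF nN _ u(3)] u(2) by simp
        ultimately show ?thesis unfolding P'_def by simp
      qed
      have r_add: "r (x \<oplus>\<^bsub>M\<^esub> y) = r x \<oplus>\<^bsub>M\<^esub> r y" if "x \<in> P" "y \<in> P" for x y
      proof (rule co_ext)
        have xy: "x \<in> carrier M" "y \<in> carrier M" using that Pc(1) by auto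
        show "r (x \<oplus>\<^bsub>M\<^esub> y) \<in> carrier M" "r x \<oplus>\<^bsub>M\<^esub> r y \<in> carrier M" unfolding r_def using xy uv by auto
        show "co i (r (x \<oplus>\<^bsub>M\<^esub> y)) = co i (r x \<oplus>\<^bsub>M\<^esub> r y)" if "i < N" for i
          unfolding r_def using that xy uv u(3) nN by (simp add: co_add co_minus co_smult algebra_simps)
      qed
      have r_smult: "r (a \<odot>\<^bsub>M\<^esub> x) = a \<odot>\<^bsub>M\<^esub> r x" if "x \<in> P" for a x
      proof (rule co_ext)
        have x: "x \<in> carrier M" using that Pc(1) by auto
        have ac: "a \<odot>\<^bsub>M\<^esub> x \<in> carrier M" "a \<odot>\<^bsub>M\<^esub> (x \<ominus>\<^bsub>M\<^esub> co n x \<odot>\<^bsub>M\<^esub> u) \<in> carrier M" using x uv by auto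
        show "r (a \<odot>\<^bsub>M\<^esub> x) \<in> carrier M" "a \<odot>\<^bsub>M\<^esub> r x \<in> carrier M" unfolding r_def using ac uv by auto
        show "co i (r (a \<odot>\<^bsub>M\<^esub> x)) = co i (a \<odot>\<^bsub>M\<^esub> r x)" if "i < N" for i
          unfolding r_def using that x ac uv u(3) nN by (simp add: co_minus co_smult algebra_simps)
      qed
      interpret z: based_module UNIV "restr M P'" m z c by (rule z)
      define z' where "z' i = (if i = m then u else z i)" for i
      define c' where "c' i x = (if i = m then co n x else c i (r x))" for i x
      have zP: "z i \<in> P'" if "i < m" for i using z.e_closed[OF that] by simp
      have r0: "r x = x" if "x \<in> P'" for x
      proof -
        have "x \<in> carrier M" "co n x = 0" using that Pc(1) unfolding P'_def by auto
        then show ?thesis unfolding r_def using M.smult_l_null[OF u(3)] by (simp add: M.minus_eq)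
      qed
      have ru: "r u = \<zero>\<^bsub>M\<^esub>" unfolding r_def u(2) using M.smult_one[OF u(3)] u(3) by (simp add: M.minus_eq M.M.r_neg)
      have c0: "c i \<zero>\<^bsub>M\<^esub> = 0" if "i < m" for i using z.co_zero[OF that] by simp
      have "based_module UNIV (restr M P) (Suc m) z' c'"
      proof (rule based_module.intro)
        show "module (subtring UNIV) (restr M P)"
          unfolding subtring_UNIV by (rule LinearCombinations.module.submodule_is_module[OF Mt P])
        show "z' i \<in> carrier (restr M P)" if "i < Suc m" for i
          using that u(1) zP[of i] unfolding z'_def P'_def by auto
        show "c' i (x \<oplus>\<^bsub>restr M P\<^esub> y) = c' i x + c' i y"
          if "i < Suc m" "x \<in> carrier (restr M P)" "y \<in> carrier (restr M P)" for i x y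
          using that r_add[of x y] rP[of x] rP[of y] z.co_add[of i "r x" "r y"] nN co_add[of n x y] Pc(1) unfolding c'_def by auto
        show "c' i (a \<odot>\<^bsub>restr M P\<^esub> x) = a * c' i x" if "i < Suc m" "x \<in> carrier (restr M P)" for i a x
          using that r_smult[of x a] rP[of x] z.co_smult[of i a "r x"] nN co_smult[of n a x] Pc(1) unfolding c'_def by auto
        show "c' i (z' j) = (if i = j then 1 else 0)" if "i < Suc m" "j < Suc m" for i j
        proof (cases "j = m")
          case True
          then show ?thesis using that u(2) ru c0[of i] unfolding c'_def z'_def by auto
        next
          case False
          then have "j < m" using that by simp
          then show ?thesis using that(1) zP[of j] r0[OF zP[of j]] z.co_e[of i j] unfolding c'_def z'_def P'_def by auto
        qed
        show "x = \<zero>\<^bsub>restr M P\<^esub>" if x: "x \<in> carrier (restr M P)" "\<And>i. i < Suc m \<Longrightarrow> c' i x = 0" for x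
        proof -
          have "co n x = 0" using x(2)[of m] by (simp add: c'_def)
          then have xP: "x \<in> P'" using x(1) unfolding P'_def by simp
          have "c i x = 0" if "i < m" for i using x(2)[of i] that r0[OF xP] by (simp add: c'_def)
          then show ?thesis using z.co_inj[of x] xP by simp
        qed
      qed auto
      then show ?thesis by blast
    qed
  }
qed

lemma exists_linear_functional:
  fixes x :: "'q::field alg_closure"
  assumes "x \<noteq> 0"
  obtains l :: "'q alg_closure \<Rightarrow> 'q" where "l x \<noteq> 0" "\<And>x y. l (x + y) = l x + l y" "\<And>q x. l (to_ac q * x) = q * l x"
proof -
  interpret h: comm_ring_hom "to_ac :: 'q \<Rightarrow> 'q alg_closure" by (rule to_ac_hom)
  interpret vs: vector_space_pair "\<lambda>q (x :: 'q alg_closure). to_ac q * x" "(*) :: 'q \<Rightarrow> 'q \<Rightarrow> 'q"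
    by unfold_locales (auto simp: h.hom_add h.hom_mult algebra_simps)
  have "\<not> vs.vs1.dependent {x}" using assms by simp
  from vs.linear_independent_extend[OF this, of "\<lambda>_. 1"]
  obtain l where l: "Vector_Spaces.linear (\<lambda>q (x :: 'q alg_closure). to_ac q * x) (*) l" "l x = 1" by auto
  interpret l: Vector_Spaces.linear "\<lambda>q (x :: 'q alg_closure). to_ac q * x" "(*)" l by (rule l(1))
  show ?thesis by (rule that[of l]) (simp_all add: l(2) l.add l.scale)
qed

text \<open>When A has entries in the base field, l passes through products with A and only affects
  the coefficients of the polynomial. In this way a statement over the algebraic closure is reduced
  to one about elements of \<open>B\<close>.\<close>

lemma poly_mat_linear_functional:
  fixes A :: "'q::field mat"
  assumes A: "A \<in> carrier_mat n n"
    and l: "\<And>x y. l (x + y) = l x + l y" "\<And>q x. l (to_ac q * x) = q * l x"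
  shows "map_mat l (poly_mat f (map_mat to_ac A)) = poly_mat (map_poly l f) A"
proof (induct f)
  interpret h: comm_ring_hom "to_ac :: 'q \<Rightarrow> 'q alg_closure" by (rule to_ac_hom)
  have l0: "l 0 = 0" using l(2)[of 0 0] by simp
  {
    case 0
    show ?case using A l0 by (auto simp: poly_mat_0[of _ n])
  next
    case (pCons a f)
    have A': "map_mat to_ac A \<in> carrier_mat n n" using A by simp
    let ?P = "poly_mat f (map_mat to_ac A)"
    have P: "?P \<in> carrier_mat n n" using A' by auto
    have sum: "l (sum g I) = (\<Sum>i\<in>I. l (g i))" for g and I :: "nat set"
      by (induct I rule: infinite_finite_induct) (auto simp: l0 l(1))
    show ?case
    proof (rule eq_matI)
      fix i j assume "i < dim_row (poly_mat (map_poly l (pCons a f)) A)" "j < dim_col (poly_mat (map_poly l (pCons a f)) A)"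
      then have ij: "i < n" "j < n" using A by auto
      have "l (poly_mat (pCons a f) (map_mat to_ac A) $$ (i, j)) = l (a * (if i = j then 1 else 0)) + (\<Sum>k<n. A $$ (i, k) * l (?P $$ (k, j)))"
        unfolding poly_mat_pCons[OF A'] using ij A P
        by (simp add: scalar_prod_def l sum atLeast0LessThan)
      also have "\<dots> = poly_mat (map_poly l (pCons a f)) A $$ (i, j)"
      proof -
        have "l (?P $$ (k, j)) = poly_mat (map_poly l f) A $$ (k, j)" if "k < n" for k
          unfolding pCons(2)[symmetric] using that ij P A by simp
        then show ?thesis
          unfolding map_poly_pCons[where f = l, OF pCons(1)] poly_mat_pCons[OF A] using ij A
          by (simp add: scalar_prod_def l0 atLeast0LessThan)
      qed
      finally show "map_mat l (poly_mat (pCons a f) (map_mat to_ac A)) $$ (i, j) = poly_mat (map_poly l (pCons a f)) A $$ (i, j)"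
        using ij A' by simp
    qed (use A in auto)
  }
qed

section \<open>The action of \<open>B\<close> in coordinates, and the good elements of the
  order\<close>

text \<open>Coordinates for one lattice \<Lambda>. The vectors \<open>e\<close> form a basis of
  \<Lambda> over the p-adic integers and of V over the p-adic field, so b has one and the same
  matrix \<open>rep b\<close> everywhere, with entries p-adic integers when b is in the order. The
  vectors \<open>e1\<close> form the basis of V_1 with respect to which \<open>end_mat\<close> is
  computed.\<close>

locale pel_lattice = local_PEL_datum p nrm D
  for p and nrm :: "'q::field_char_0 \<Rightarrow> real" and D :: "('q, 'b, 'v) pel_datum" +
  fixes \<Lambda> :: "'v set" and N e co and \<mu> m e1 co1
  assumes \<Lambda>: "\<Lambda> \<in> chain D"
    and V_based: "based_module UNIV (space D) N e co"
    and L_based: "based_module (Zp nrm) (restr (space D) \<Lambda>) N e co"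
    and \<mu>: "\<mu> \<in> cochars D"
    and V1_based: "based_module UNIV (V1 D \<mu>) m e1 co1"
    and V1_end_mat: "\<And>f. linear_on UNIV (V1 D \<mu>) (V1 D \<mu>) f \<Longrightarrow>
      end_mat tring (V1 D \<mu>) f = mat m m (\<lambda>(i, j). co1 i (f (e1 j)))"
    and m_eq: "m = length (chosen_basis tring (V1 D \<mu>))"

lemma (in local_PEL_datum) V1_submodule:
  assumes \<mu>: "\<mu> \<in> cochars D"
  shows "Module.submodule (weight_space D \<mu> 1) tring (Vbar D)"
  using cochars_weights[OF \<mu>] unfolding complementary_def by blast

lemma (in local_PEL_datum) pel_lattice_exists:
  assumes \<Lambda>: "\<Lambda> \<in> chain D" and \<mu>: "\<mu> \<in> cochars D"
  obtains N e co m e1 co1 where "pel_lattice p nrm D \<Lambda> N e co \<mu> m e1 co1"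
proof -
  obtain N e co where b: "based_module UNIV (space D) N e co" "based_module (Zp nrm) (restr (space D) \<Lambda>) N e co"
    by (rule lattice_based[OF padic V_vectorspace chain_lattice(1)[OF \<Lambda>]])
  interpret h: comm_ring_hom "to_ac :: 'q \<Rightarrow> 'q alg_closure" by (rule to_ac_hom)
  interpret b: based_module UNIV "space D" N e co by (rule b(1))
  interpret K: based_base_change UNIV "space D" UNIV to_ac N e co
    by unfold_locales (auto simp: hom_on_def h.hom_add h.hom_mult)
  have K: "based_module UNIV (Vbar D) N (\<lambda>i. K.pure (e i)) K.coS"
    using K.based K.base_change_eq by (simp add: subtring_UNIV)
  have Km: "module tring (Vbar D)" using based_module.M[OF K] by (simp add: subtring_UNIV)
  note sub = module_submodule_iff[OF V1_submodule[OF \<mu>] Km]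
  obtain m z c where z: "based_module UNIV (V1 D \<mu>) m z c" using subspace_based[OF K sub order_refl] by force
  have mod: "module tring (V1 D \<mu>)" by (rule LinearCombinations.module.submodule_is_module[OF Km sub])
  obtain e1 co1 where e1: "based_module UNIV (V1 D \<mu>) (length (chosen_basis tring (V1 D \<mu>))) e1 co1"
    "\<And>f. linear_on UNIV (V1 D \<mu>) (V1 D \<mu>) f \<Longrightarrow> end_mat tring (V1 D \<mu>) f = based_module.mat_of (length (chosen_basis tring (V1 D \<mu>))) e1 co1 f"
    using end_mat_eq[OF mod] based_module.free_basis[OF z] unfolding subtring_UNIV by metis
  show ?thesis
    by (rule that[of N e co _ e1 co1], rule pel_lattice.intro[OF local_PEL_datum_axioms], rule pel_lattice_axioms.intro)
      (use \<Lambda> \<mu> b e1 in \<open>auto simp: based_module.mat_of_def[OF e1(1)]\<close>)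
qed

sublocale pel_lattice \<subseteq> V: based_module UNIV "space D" N e co by (rule V_based)
sublocale pel_lattice \<subseteq> L: based_module "Zp nrm" "restr (space D) \<Lambda>" N e co by (rule L_based)
sublocale pel_lattice \<subseteq> U: based_module UNIV "V1 D \<mu>" m e1 co1 by (rule V1_based)
sublocale pel_lattice \<subseteq> ac: comm_ring_hom to_ac by (rule to_ac_hom)
sublocale pel_lattice \<subseteq> K: based_base_change UNIV "space D" UNIV to_ac N e co
  by unfold_locales (auto simp: hom_on_def ac.hom_add ac.hom_mult)

context pel_lattice
begin

lemma Vbar_eq: "Vbar D = K.Q" using K.base_change_eq by (simp add: subtring_UNIV)

end

sublocale pel_lattice \<subseteq> KB: based_module UNIV "Vbar D" N "\<lambda>i. K.pure (e i)" K.coS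
  unfolding Vbar_eq by (rule K.based)

context pel_lattice
begin

definition rep where "rep b = V.mat_of (act D b)"
definition abar where "abar b = map_mat to_ac (rep b)"
definition r1 where "r1 b = end_mat tring (V1 D \<mu>) (actbar D b)"

lemma rep_carrier[simp]: "rep b \<in> carrier_mat N N" "dim_row (rep b) = N" "dim_col (rep b) = N"
  "abar b \<in> carrier_mat N N" "dim_row (abar b) = N" "dim_col (abar b) = N"
  by (auto simp: rep_def abar_def)

lemma rep_times: "rep x * rep y \<in> carrier_mat N N" by (rule mult_carrier_mat[of _ N N]) auto

lemma act_linear: "b \<in> carrier (alg D) \<Longrightarrow> linear_on UNIV (space D) (space D) (act D b)"
  unfolding linear_on_def using act_props by auto

lemma rep_mult:
  assumes "b \<in> carrier (alg D)" "c \<in> carrier (alg D)" shows "rep (b \<otimes>\<^bsub>alg D\<^esub> c) = rep b * rep c"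
proof -
  have "rep (b \<otimes>\<^bsub>alg D\<^esub> c) = V.mat_of (act D b \<circ> act D c)"
    unfolding rep_def by (rule V.mat_of_cong) (simp add: act_mult assms)
  then show ?thesis unfolding rep_def V.mat_of_comp[OF act_linear[OF assms(1)] act_linear[OF assms(2)]] .
qed

lemma rep_add:
  assumes "b \<in> carrier (alg D)" "c \<in> carrier (alg D)" shows "rep (b \<oplus>\<^bsub>alg D\<^esub> c) = rep b + rep c"
  unfolding rep_def by (rule V.mat_of_add[OF act_linear[OF assms(1)] act_linear[OF assms(2)]]) (simp add: act_add assms)

lemma rep_smult:
  assumes "b \<in> carrier (alg D)" shows "rep (a \<odot>\<^bsub>alg D\<^esub> b) = a \<cdot>\<^sub>m rep b"
  unfolding rep_def by (rule V.mat_of_smult[OF act_linear[OF assms]]) (simp_all add: act_smult assms)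

lemma rep_one: "rep \<one>\<^bsub>alg D\<^esub> = 1\<^sub>m N" unfolding rep_def by (rule V.mat_of_id) (rule act_one)

lemma rep_Zp: "b \<in> max_order D \<Longrightarrow> i < N \<Longrightarrow> j < N \<Longrightarrow> rep b $$ (i, j) \<in> Zp nrm"
  unfolding rep_def using L.co_closed[of i "act D b (e j)"] chain_lattice(2)[OF \<Lambda>, of b "e j"] L.e_closed[of j] by simp

text \<open>The left ideal of elements that are orthogonal to everything for the trace form is generated by an idempotent, and all
  powers of that idempotent have trace zero.\<close>

lemma rep_trace_nondegenerate:
  assumes x: "x \<in> carrier (alg D)" "\<And>y. y \<in> carrier (alg D) \<Longrightarrow> mat_trace (rep x * rep y) = 0"
  shows "rep x = 0\<^sub>m N N"
proof -
  let ?B = "alg D"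
  interpret B: ring ?B by (rule B_ring)
  define I where "I = {x \<in> carrier ?B. \<forall>y\<in>carrier ?B. mat_trace (rep x * rep y) = 0}"
  have I0: "\<zero>\<^bsub>?B\<^esub> \<in> I" and Iadd: "x \<oplus>\<^bsub>?B\<^esub> y \<in> I" and Ineg: "\<ominus>\<^bsub>?B\<^esub> x \<in> I" and Imult: "z \<otimes>\<^bsub>?B\<^esub> x \<in> I"
    if "x \<in> I" "y \<in> I" "z \<in> carrier ?B" for x y z
  proof -
    have c: "x \<in> carrier ?B" "y \<in> carrier ?B" and t: "\<And>w. w \<in> carrier ?B \<Longrightarrow> mat_trace (rep x * rep w) = 0"
      "\<And>w. w \<in> carrier ?B \<Longrightarrow> mat_trace (rep y * rep w) = 0" using that unfolding I_def by auto
    have m: "mat_trace (rep (z \<otimes>\<^bsub>?B\<^esub> x) * rep w) = 0" if w: "w \<in> carrier ?B" and z: "z \<in> carrier ?B" for z w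
    proof -
      have "mat_trace (rep (z \<otimes>\<^bsub>?B\<^esub> x) * rep w) = mat_trace (rep z * (rep x * rep w))"
        unfolding rep_mult[OF z c(1)] by (subst assoc_mult_mat[of _ N N _ N _ N]) auto
      also have "\<dots> = mat_trace ((rep x * rep w) * rep z)" by (rule mat_trace_commute[of _ N N]) auto
      also have "(rep x * rep w) * rep z = rep x * rep (w \<otimes>\<^bsub>?B\<^esub> z)"
        unfolding rep_mult[OF w z] by (subst assoc_mult_mat[of _ N N _ N _ N]) auto
      finally show ?thesis using t(1) w z by simp
    qed
    then show "z \<otimes>\<^bsub>?B\<^esub> x \<in> I" unfolding I_def using c that(3) by simp
    show "\<zero>\<^bsub>?B\<^esub> \<in> I" unfolding I_def using m[of _ "\<zero>\<^bsub>?B\<^esub>"] c by simp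
    have "(\<ominus>\<^bsub>?B\<^esub> \<one>\<^bsub>?B\<^esub>) \<otimes>\<^bsub>?B\<^esub> x = \<ominus>\<^bsub>?B\<^esub> x" using c B.l_minus[of "\<one>\<^bsub>?B\<^esub>" x] by simp
    then show "\<ominus>\<^bsub>?B\<^esub> x \<in> I" unfolding I_def using m[of _ "\<ominus>\<^bsub>?B\<^esub> \<one>\<^bsub>?B\<^esub>"] c by simp
    have "mat_trace (rep (x \<oplus>\<^bsub>?B\<^esub> y) * rep w) = 0" if w: "w \<in> carrier ?B" for w
    proof -
      have "rep (x \<oplus>\<^bsub>?B\<^esub> y) * rep w = rep x * rep w + rep y * rep w"
        unfolding rep_add[OF c] by (rule add_mult_distrib_mat[of _ N N _ _ N]) auto
      then show ?thesis using t w mat_trace_add[OF rep_times rep_times] by simp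
    qed
    then show "x \<oplus>\<^bsub>?B\<^esub> y \<in> I" unfolding I_def using c by simp
  qed
  have xI: "x \<in> I" using x unfolding I_def by simp
  have Ic: "I \<subseteq> carrier ?B" unfolding I_def by auto
  have "additive_subgroup I ?B"
  proof (rule additive_subgroup.intro, rule subgroup.intro)
    show "I \<subseteq> carrier (add_monoid ?B)" using Ic by simp
    show "a \<otimes>\<^bsub>add_monoid ?B\<^esub> b \<in> I" if "a \<in> I" "b \<in> I" for a b using Iadd[OF that B.zero_closed] by simp
    show "\<one>\<^bsub>add_monoid ?B\<^esub> \<in> I" using I0[OF xI xI B.zero_closed] by simp
    show "inv\<^bsub>add_monoid ?B\<^esub> a \<in> I" if "a \<in> I" for a using Ineg[OF that that B.zero_closed] by (simp add: a_inv_def)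
  qed
  then have "left_ideal ?B I" unfolding left_ideal_def using Imult by blast
  then obtain f where f: "f \<in> I" "\<And>x. x \<in> I \<Longrightarrow> x \<otimes>\<^bsub>?B\<^esub> f = x" using left_ideal_generator[OF B_ring B_semisimple] by blast
  have fc: "f \<in> carrier ?B" using f(1) Ic by blast
  have ff: "rep f * rep f = rep f" using rep_mult[OF fc fc] f(2)[OF f(1)] by simp
  have af: "abar f * abar f = abar f"
    unfolding abar_def using ac.mat_hom_mult[of "rep f" N N "rep f" N] ff by simp
  \<comment> \<open>Positive powers of the idempotent f equal f, and its trace is that of f times 1,
    which is zero as f is in the radical. So f acts nilpotently as well as idempotently, that is, as
    zero.\<close>
  have pow: "abar f ^\<^sub>m k = abar f" if "k > 0" for k
    using that
  proof (induct k)
    case (Suc k) then show ?case using af by (cases k) auto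
  qed simp
  have tf: "mat_trace (abar f) = 0"
  proof -
    have "mat_trace (rep f * rep \<one>\<^bsub>?B\<^esub>) = 0" using f(1) unfolding I_def by simp
    then have "mat_trace (rep f) = 0" unfolding rep_one using right_mult_one_mat[of "rep f" N N] by simp
    then show ?thesis unfolding abar_def using mat_trace_hom[OF to_ac_hom, of "rep f" N] by simp
  qed
  have "abar f ^\<^sub>m N = 0\<^sub>m N N" by (rule nilpotent_if_traces_zero) (simp_all add: pow tf)
  moreover have "abar f = 0\<^sub>m N N" if "\<not> N > 0"
  proof (rule eq_matI)
    fix i assume "i < dim_row (0\<^sub>m N N :: 'q alg_closure mat)"
    then have "i < N" by (simp only: index_zero_mat)
    then show "abar f $$ (i, j) = 0\<^sub>m N N $$ (i, j)" for j using that by linarith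
  qed (simp_all only: rep_carrier index_zero_mat)
  ultimately have "abar f = 0\<^sub>m N N" using pow[of N] by metis
  then have "rep f = 0\<^sub>m N N"
    unfolding abar_def by (intro eq_matI) (auto dest!: arg_cong[of _ _ "\<lambda>A. A $$ _"] simp: mat_eq_iff)
  moreover have "rep x = rep x * rep f" using rep_mult[OF x(1) fc] f(2)[OF xI] by simp
  ultimately show ?thesis using right_mult_zero_mat[of "rep x" N N N] by simp
qed

lemma poly_mat_rep:
  assumes b: "b \<in> carrier (alg D)"
  shows "\<exists>x\<in>carrier (alg D). rep x = poly_mat f (rep b)"
proof (induct f)
  interpret B: ring "alg D" by (rule B_ring)
  interpret Bm: module tring "alg D" by (rule order_props(6))
  {
    case 0
    have "rep (0 \<odot>\<^bsub>alg D\<^esub> b) = 0\<^sub>m N N" unfolding rep_smult[OF b] by auto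
    then show ?case using poly_mat_0[of "rep b" N] b by (metis Bm.smult_closed UNIV_I rep_carrier(1) tring_simps(1))
  next
    case (pCons a f)
    then obtain x where x: "x \<in> carrier (alg D)" "rep x = poly_mat f (rep b)" by blast
    have "rep (a \<odot>\<^bsub>alg D\<^esub> \<one>\<^bsub>alg D\<^esub> \<oplus>\<^bsub>alg D\<^esub> b \<otimes>\<^bsub>alg D\<^esub> x) = poly_mat (pCons a f) (rep b)"
      using b x by (simp add: rep_add rep_smult rep_mult rep_one poly_mat_pCons[of "rep b" N])
    then show ?case using b x by (intro bexI[of _ "a \<odot>\<^bsub>alg D\<^esub> \<one>\<^bsub>alg D\<^esub> \<oplus>\<^bsub>alg D\<^esub> b \<otimes>\<^bsub>alg D\<^esub> x"]) simp_all
  }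
qed

text \<open>If f(b) had a nonzero entry, a linear form l over the p-adic field could be chosen
  nonzero on it. Applying l entrywise gives the matrix of an element x of \<open>B\<close>, a
  polynomial in b over the p-adic field, that is orthogonal to the order and hence to
  \<open>B\<close>, since the order spans \<open>B\<close>. So x acts as zero, against the choice of
  l.\<close>

lemma abar_trace_nondegenerate:
  assumes b: "b \<in> carrier (alg D)" and t: "\<And>y. y \<in> max_order D \<Longrightarrow> mat_trace (poly_mat f (abar b) * abar y) = 0"
  shows "poly_mat f (abar b) = 0\<^sub>m N N"
proof (rule ccontr)
  let ?P = "poly_mat f (abar b)"
  have P: "?P \<in> carrier_mat N N" by auto
  assume "?P \<noteq> 0\<^sub>m N N"
  then obtain i j where ij: "i < N" "j < N" "?P $$ (i, j) \<noteq> 0" using P by (auto simp: mat_eq_iff)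
  obtain l where l: "l (?P $$ (i, j)) \<noteq> 0" "\<And>x y. l (x + y) = l x + l y" "\<And>q x. l (to_ac q * x) = q * l x"
    using exists_linear_functional[OF ij(3)] by blast
  have l0: "l 0 = 0" using l(3)[of 0 0] by simp
  have sum: "l (sum g I) = (\<Sum>i\<in>I. l (g i))" for g and I :: "nat set"
    by (induct I rule: infinite_finite_induct) (auto simp: l0 l(2))
  obtain x where x: "x \<in> carrier (alg D)" "rep x = poly_mat (map_poly l f) (rep b)" using poly_mat_rep[OF b] by blast
  have lP: "map_mat l ?P = rep x"
    unfolding x(2) abar_def by (rule poly_mat_linear_functional[where n = N, OF _ l(2,3)]) simp
  have O: "mat_trace (rep x * rep y) = 0" if y: "y \<in> max_order D" for y
  proof -
    have "mat_trace (rep x * rep y) = (\<Sum>i<N. \<Sum>k<N. l (?P $$ (i, k)) * rep y $$ (k, i))"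
      unfolding lP[symmetric] using P by (simp add: mat_trace_def scalar_prod_def atLeast0LessThan)
    also have "\<dots> = (\<Sum>i<N. \<Sum>k<N. l (to_ac (rep y $$ (k, i)) * ?P $$ (i, k)))" by (simp add: l(3) mult.commute)
    also have "\<dots> = l (mat_trace (?P * abar y))"
      unfolding abar_def using P by (simp add: mat_trace_def scalar_prod_def atLeast0LessThan sum mult.commute abar_def)
    finally show ?thesis using t[OF y] l0 by simp
  qed
  have "mat_trace (rep x * rep y) = 0" if y: "y \<in> carrier (alg D)" for y
  proof -
    have 0: "rep (0 \<odot>\<^bsub>alg D\<^esub> x) = 0\<^sub>m N N" unfolding rep_smult[OF x(1)] by auto
    interpret Bm: module tring "alg D" by (rule order_props(6))
    have z: "rep \<zero>\<^bsub>alg D\<^esub> = 0\<^sub>m N N" using 0 Bm.smult_l_null[OF x(1)] by simp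
    have "y \<in> mspan tring (alg D) (max_order D)" unfolding order_props(5) by (rule y)
    with order_props(6,1) show ?thesis
    proof (rule mspan_induct)
      show "mat_trace (rep x * rep \<zero>\<^bsub>alg D\<^esub>) = 0"
        unfolding z right_mult_zero_mat[OF rep_carrier(1)] by (simp add: mat_trace_def)
      show "mat_trace (rep x * rep (y \<oplus>\<^bsub>alg D\<^esub> z)) = 0"
        if "y \<in> carrier (alg D)" "z \<in> carrier (alg D)" "mat_trace (rep x * rep y) = 0" "mat_trace (rep x * rep z) = 0" for y z
        unfolding rep_add[OF that(1,2)] mult_add_distrib_mat[OF rep_carrier(1) rep_carrier(1) rep_carrier(1)]
        using mat_trace_add[OF rep_times rep_times] that by simp
      show "mat_trace (rep x * rep (a \<odot>\<^bsub>alg D\<^esub> y)) = 0" if "y \<in> carrier (alg D)" "mat_trace (rep x * rep y) = 0" for a y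
        unfolding rep_smult[OF that(1)] mult_smult_distrib[OF rep_carrier(1) rep_carrier(1)]
        using mat_trace_smult[OF rep_times, of a] that(2) by simp
    qed (rule O)
  qed
  then have "rep x = 0\<^sub>m N N" by (rule rep_trace_nondegenerate[OF x(1)])
  then have "l (?P $$ (i, j)) = 0" using lP ij P by (metis index_map_mat(1) index_zero_mat(1) carrier_matD)
  then show False using l(1) by simp
qed

definition max_card where "max_card = Max ((\<lambda>b. card (spectrum (abar b))) ` max_order D)"
text \<open>Good elements are diagonalizable on \<open>Vbar D\<close>
  (\<open>good_diagonalizable\<close>), and every line through one of them contains many of them
  (\<open>gram_perturb\<close>).\<close>

definition good where "good b \<longleftrightarrow> b \<in> max_order D \<and> card (spectrum (abar b)) = max_card"

lemma card_spectrum: "card (spectrum (abar b)) \<le> N"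
proof -
  have cp: "degree (char_poly (abar b)) = N" "char_poly (abar b) \<noteq> 0"
    using degree_monic_char_poly[of "abar b" N] by auto
  show ?thesis unfolding spectrum_def using card_poly_roots_bound[OF cp(2)] cp(1) by simp
qed

lemma max_card: "b \<in> max_order D \<Longrightarrow> card (spectrum (abar b)) \<le> max_card" "\<exists>b. good b"
proof -
  have fin: "finite ((\<lambda>b. card (spectrum (abar b))) ` max_order D)"
    by (rule finite_subset[of _ "{..N}"]) (use card_spectrum in auto)
  show "b \<in> max_order D \<Longrightarrow> card (spectrum (abar b)) \<le> max_card"
    unfolding max_card_def using fin by (intro Max_ge) auto
  show "\<exists>b. good b" using Max_in[OF fin] order_props(2) unfolding max_card_def good_def by fastforce
qed

lemma order_nat_smult: "b \<in> max_order D \<Longrightarrow> of_nat k \<odot>\<^bsub>alg D\<^esub> b \<in> max_order D"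
  using order_props(4) closed_subring_of_nat[OF padic_field_Zp(1)[OF padic]] by blast

lemma abar_add: "b \<in> carrier (alg D) \<Longrightarrow> c \<in> carrier (alg D) \<Longrightarrow> abar (b \<oplus>\<^bsub>alg D\<^esub> c) = abar b + abar c"
  by (rule eq_matI) (simp_all add: abar_def rep_add ac.hom_add)

lemma abar_smult: "b \<in> carrier (alg D) \<Longrightarrow> abar (a \<odot>\<^bsub>alg D\<^esub> b) = to_ac a \<cdot>\<^sub>m abar b"
  by (rule eq_matI) (simp_all add: abar_def rep_smult ac.hom_mult)

text \<open>The elements b + k y with y in the order and k a natural number lie in the order, so by
  maximality they have no more eigenvalues than b.\<close>

lemma good_diagonalizable:
  assumes b: "good b" shows "poly_mat (min_radical (abar b)) (abar b) = 0\<^sub>m N N"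
proof (rule maximal_spectrum_imp_diagonalizable[of _ N "abar ` max_order D"])
  have bO: "b \<in> max_order D" "b \<in> carrier (alg D)" using b order_props(1) unfolding good_def by auto
  show "card (spectrum (abar b + of_nat k \<cdot>\<^sub>m Y)) \<le> card (spectrum (abar b))" if "Y \<in> abar ` max_order D" for k :: nat and Y
  proof -
    obtain y where y: "y \<in> max_order D" "Y = abar y" using \<open>Y \<in> abar ` max_order D\<close> by auto
    have c: "of_nat k \<odot>\<^bsub>alg D\<^esub> y \<in> max_order D" by (rule order_nat_smult[OF y(1)])
    have "abar b + of_nat k \<cdot>\<^sub>m Y = abar (b \<oplus>\<^bsub>alg D\<^esub> of_nat k \<odot>\<^bsub>alg D\<^esub> y)"
      using y(1) c order_props(1) bO(2) unfolding y(2) by (subst abar_add) (auto simp: abar_smult ac.hom_of_nat)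
    then show ?thesis using max_card(1)[OF order_props(3)[OF bO(1) c]] b unfolding good_def by simp
  qed
  show "poly_mat f (abar b) = 0\<^sub>m N N" if "\<And>Y. Y \<in> abar ` max_order D \<Longrightarrow> mat_trace (poly_mat f (abar b) * Y) = 0" for f
    by (rule abar_trace_nondegenerate[OF bO(2)]) (use that in blast)
qed auto

lemma actbar_linear: "b \<in> carrier (alg D) \<Longrightarrow> linear_on UNIV (Vbar D) (Vbar D) (actbar D b)"
  using K.bc_map_linear(1)[OF act_linear, of b] unfolding Vbar_eq subtring_UNIV .

lemma actbar_mat: "b \<in> carrier (alg D) \<Longrightarrow> KB.mat_of (actbar D b) = abar b"
  using K.bc_map_linear(2)[OF act_linear, of b] unfolding KB.mat_of_def abar_def rep_def subtring_UNIV .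

lemma covec_actbar: "b \<in> carrier (alg D) \<Longrightarrow> x \<in> carrier (Vbar D) \<Longrightarrow> KB.covec (actbar D b x) = abar b *\<^sub>v KB.covec x"
  using KB.covec_linear[OF actbar_linear, of b x] actbar_mat by simp

lemma good_gen_eigenspace:
  assumes b: "good b" and v: "v \<in> gen_eigenspace (Vbar D) (actbar D b) a"
  shows "actbar D b v = a \<odot>\<^bsub>Vbar D\<^esub> v" "v \<in> carrier (Vbar D)"
proof -
  have bc: "b \<in> carrier (alg D)" using b order_props(1) unfolding good_def by auto
  note lin = linear_onD[OF actbar_linear[OF bc]]
  interpret Km: module tring "Vbar D" using KB.M by (simp add: subtring_UNIV)
  let ?g = "\<lambda>y. actbar D b y \<ominus>\<^bsub>Vbar D\<^esub> a \<odot>\<^bsub>Vbar D\<^esub> y"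
  obtain k where v: "v \<in> carrier (Vbar D)" "(?g ^^ k) v = \<zero>\<^bsub>Vbar D\<^esub>" using v unfolding gen_eigenspace_def by blast
  show "v \<in> carrier (Vbar D)" by (rule v(1))
  have gc: "?g x \<in> carrier (Vbar D)" if "x \<in> carrier (Vbar D)" for x using lin(1)[OF that] that by simp
  have it: "(?g ^^ k) v \<in> carrier (Vbar D) \<and> KB.covec ((?g ^^ k) v) = ((\<lambda>w. abar b *\<^sub>v w - a \<cdot>\<^sub>v w) ^^ k) (KB.covec v)" for k
  proof (induct k)
    case (Suc k)
    let ?w = "(?g ^^ k) v"
    have c: "?w \<in> carrier (Vbar D)" by (rule conjunct1[OF Suc])
    have "KB.covec (?g ?w) = abar b *\<^sub>v KB.covec ?w - a \<cdot>\<^sub>v KB.covec ?w"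
      using KB.covec_minus[of "actbar D b ?w" "a \<odot>\<^bsub>Vbar D\<^esub> ?w"] lin(1)[OF c] c covec_actbar[OF bc c] KB.covec_smult[OF _ c, of a] by simp
    then show ?case unfolding funpow.simps o_apply using gc[OF c] unfolding conjunct2[OF Suc] by (rule conjI[rotated])
  qed (simp add: v(1))
  have "poly_mat ([:- a, 1:] ^ k) (abar b) *\<^sub>v KB.covec v = 0\<^sub>v N"
    unfolding poly_mat_eigenvector[OF rep_carrier(4) KB.covec_carrier(1)] using it[of k] v(2) KB.covec_zero by simp
  then have "abar b *\<^sub>v KB.covec v = a \<cdot>\<^sub>v KB.covec v"
    by (rule diagonalizable_gen_eigenvector[OF rep_carrier(4) good_diagonalizable[OF b] KB.covec_carrier(1)])
  then show "actbar D b v = a \<odot>\<^bsub>Vbar D\<^esub> v"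
    using v(1) lin(1)[OF v(1)] covec_actbar[OF bc v(1)] KB.covec_smult[OF _ v(1), of a] by (intro KB.covec_inj) auto
qed

end

section \<open>Elements of the order act on W by their determinant on V_1\<close>

lemma poly_hom: "comm_ring_hom (\<lambda>p. Polynomial.poly p (c :: 'a::comm_ring_1))"
  by unfold_locales simp_all

lemma char_poly_linear_factors_det:
  fixes A :: "'a::idom mat"
  assumes A: "A \<in> carrier_mat m m" and as: "char_poly A = (\<Prod>a\<leftarrow>as. [:- a, 1:])"
  shows "length as = m" "det A = prod_list as"
proof -
  have "degree (\<Prod>a\<leftarrow>as. [:- a, 1:]) = length as"
    by (subst degree_prod_list_eq) (auto simp: comp_def sum_list_triv)
  then show len: "length as = m" using degree_monic_char_poly[OF A] as by simp
  have "Polynomial.coeff (\<Prod>a\<leftarrow>as. [:- a, 1:]) 0 = (- 1) ^ length as * prod_list as"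
    unfolding poly_0_coeff_0[symmetric] by (induct as) (simp_all add: algebra_simps)
  then have "(- 1) ^ m * det A = (- 1) ^ m * prod_list as" using char_poly_coeff_0[OF A] as len by simp
  then show "det A = prod_list as" by simp
qed

text \<open>h is the Gram determinant of 1, T, ..., T^(d-1) along the line, with d the number of
  eigenvalues of \<open>A\<close>. It is nonzero at t = 0, and where it is nonzero there are at
  least d eigenvalues.\<close>

lemma gram_perturb:
  fixes A Y :: "'a::{alg_closed_field,field_char_0} mat"
  assumes A: "A \<in> carrier_mat n n" and Y: "Y \<in> carrier_mat n n"
  obtains h where "h \<noteq> 0" "\<And>t. Polynomial.poly h t \<noteq> 0 \<Longrightarrow> card (spectrum A) \<le> card (spectrum (A + t \<cdot>\<^sub>m Y))"
proof -
  define d where "d = card (spectrum A)"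
  define At where "At = map_mat (\<lambda>x. [:x:]) A + [:0, 1:] \<cdot>\<^sub>m map_mat (\<lambda>x. [:x:]) Y"
  define h where "h = det (mat d d (\<lambda>(i, j). mat_trace (poly_mat (map_poly (\<lambda>x. [:x:]) ([:0, 1:] ^ i * [:0, 1:] ^ j)) At)))"
  have ev: "Polynomial.poly h t = det (mat d d (\<lambda>(i, j). mat_trace (poly_mat ([:0, 1:] ^ i * [:0, 1:] ^ j) (A + t \<cdot>\<^sub>m Y))))" for t
  proof -
    interpret t: comm_ring_hom "\<lambda>p. Polynomial.poly p t" by (rule poly_hom)
    show ?thesis unfolding h_def comm_ring_hom.hom_det[OF poly_hom, symmetric]
      by (rule arg_cong[of _ _ det], rule eq_matI) (simp_all add: At_def poly_mat_perturb_eval[OF A Y])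
  qed
  have "A + 0 \<cdot>\<^sub>m Y = A" using A Y by (intro eq_matI) auto
  then have "Polynomial.poly h 0 \<noteq> 0" unfolding ev using gram_nondegenerate[OF A d_def] by simp
  moreover have "d \<le> card (spectrum (A + t \<cdot>\<^sub>m Y))" if "Polynomial.poly h t \<noteq> 0" for t
  proof (rule ccontr)
    assume "\<not> ?thesis"
    then show False using gram_degenerate[of "A + t \<cdot>\<^sub>m Y" n d "\<lambda>i. [:0, 1:] ^ i" "\<lambda>j. [:0, 1:] ^ j"] A Y that ev by simp
  qed
  ultimately show ?thesis using that[of h] unfolding d_def by fastforce
qed

context pel_lattice
begin

lemma similitude:
  assumes "z \<noteq> 0" "b \<in> carrier (alg D)" "x \<in> carrier (Vbar D)"
  shows "\<mu> z (actbar D b x) = actbar D b (\<mu> z x)"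
  using cochars_similitude[OF \<mu> assms(1)] assms(2,3) unfolding is_similitude_def by blast

text \<open>V_1 is stable under \<open>B\<close> because the values of the cocharacter commute with
  \<open>B\<close>.\<close>

lemma actbar_V1_linear:
  assumes b: "b \<in> carrier (alg D)"
  shows "linear_on UNIV (V1 D \<mu>) (V1 D \<mu>) (actbar D b)"
proof -
  note lin = linear_onD[OF actbar_linear[OF b]]
  have "actbar D b x \<in> weight_space D \<mu> 1" if x: "x \<in> weight_space D \<mu> 1" for x
  proof -
    have xc: "x \<in> carrier (Vbar D)" and xw: "\<And>z. z \<noteq> 0 \<Longrightarrow> \<mu> z x = (z powi 1) \<odot>\<^bsub>Vbar D\<^esub> x" using x unfolding weight_space_def by auto
    show ?thesis unfolding weight_space_def
      using lin(1)[OF xc] similitude[OF _ b xc] xw lin(3)[OF _ xc] by simp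
  qed
  moreover have "weight_space D \<mu> 1 \<subseteq> carrier (Vbar D)" unfolding weight_space_def by auto
  ultimately show ?thesis unfolding linear_on_def using lin by (simp add: Pi_iff subset_iff)
qed

lemma r1_eq: "b \<in> carrier (alg D) \<Longrightarrow> r1 b = U.mat_of (actbar D b)"
  unfolding r1_def U.mat_of_def by (rule V1_end_mat[OF actbar_V1_linear])

lemma r1_carrier[simp]: "b \<in> carrier (alg D) \<Longrightarrow> r1 b \<in> carrier_mat m m" by (simp add: r1_eq)

lemma r1_dim[simp]: "b \<in> carrier (alg D) \<Longrightarrow> dim_row (r1 b) = m" "b \<in> carrier (alg D) \<Longrightarrow> dim_col (r1 b) = m"
  by (simp_all add: r1_eq)

lemma V1_carrier: "carrier (V1 D \<mu>) \<subseteq> carrier (Vbar D)" unfolding weight_space_def by auto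

lemma actbar_eqI:
  assumes "b \<in> carrier (alg D)" "x \<in> carrier (Vbar D)" "y \<in> carrier (Vbar D)" "abar b *\<^sub>v KB.covec x = KB.covec y"
  shows "actbar D b x = y"
  using assms linear_onD(1)[OF actbar_linear] covec_actbar by (intro KB.covec_inj) auto

lemma actbar_add:
  assumes b: "b \<in> carrier (alg D)" and c: "c \<in> carrier (alg D)" and x: "x \<in> carrier (Vbar D)"
  shows "actbar D (b \<oplus>\<^bsub>alg D\<^esub> c) x = actbar D b x \<oplus>\<^bsub>Vbar D\<^esub> actbar D c x"
proof (rule actbar_eqI)
  interpret B: ring "alg D" by (rule B_ring)
  show "b \<oplus>\<^bsub>alg D\<^esub> c \<in> carrier (alg D)" using b c by simp
  have ac: "actbar D b x \<in> carrier (Vbar D)" "actbar D c x \<in> carrier (Vbar D)" using linear_onD(1)[OF actbar_linear] b c x by auto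
  then show "actbar D b x \<oplus>\<^bsub>Vbar D\<^esub> actbar D c x \<in> carrier (Vbar D)" by (rule KB.M.M.a_closed)
  have "KB.covec (actbar D b x \<oplus>\<^bsub>Vbar D\<^esub> actbar D c x) = KB.covec (actbar D b x) + KB.covec (actbar D c x)"
    by (rule eq_vecI) (use ac in \<open>simp_all add: KB.co_add\<close>)
  then show "abar (b \<oplus>\<^bsub>alg D\<^esub> c) *\<^sub>v KB.covec x = KB.covec (actbar D b x \<oplus>\<^bsub>Vbar D\<^esub> actbar D c x)"
    unfolding abar_add[OF b c] covec_actbar[OF b x] covec_actbar[OF c x] by (simp add: add_mult_distrib_mat_vec[of _ N N])
qed (rule x)

lemma actbar_smult:
  assumes b: "b \<in> carrier (alg D)" and x: "x \<in> carrier (Vbar D)"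
  shows "actbar D (a \<odot>\<^bsub>alg D\<^esub> b) x = to_ac a \<odot>\<^bsub>Vbar D\<^esub> actbar D b x"
proof (rule actbar_eqI)
  interpret Bm: module tring "alg D" by (rule order_props(6))
  show "a \<odot>\<^bsub>alg D\<^esub> b \<in> carrier (alg D)" using b by simp
  have ac: "actbar D b x \<in> carrier (Vbar D)" using linear_onD(1)[OF actbar_linear] b x by auto
  then show "to_ac a \<odot>\<^bsub>Vbar D\<^esub> actbar D b x \<in> carrier (Vbar D)" by (intro KB.M.smult_closed) auto
  show "abar (a \<odot>\<^bsub>alg D\<^esub> b) *\<^sub>v KB.covec x = KB.covec (to_ac a \<odot>\<^bsub>Vbar D\<^esub> actbar D b x)"
    unfolding abar_smult[OF b] KB.covec_smult[OF UNIV_I ac] covec_actbar[OF b x] by (rule eq_vecI) (simp_all add: row_smult[of _ _] scalar_prod_def sum_distrib_left mult.assoc)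
qed (rule x)

lemma actbar_mult:
  assumes b: "b \<in> carrier (alg D)" and c: "c \<in> carrier (alg D)" and x: "x \<in> carrier (Vbar D)"
  shows "actbar D (b \<otimes>\<^bsub>alg D\<^esub> c) x = actbar D b (actbar D c x)"
proof (rule actbar_eqI)
  interpret B: ring "alg D" by (rule B_ring)
  show "b \<otimes>\<^bsub>alg D\<^esub> c \<in> carrier (alg D)" using b c by simp
  have cx: "actbar D c x \<in> carrier (Vbar D)" using linear_onD(1)[OF actbar_linear] c x by auto
  then show "actbar D b (actbar D c x) \<in> carrier (Vbar D)" using linear_onD(1)[OF actbar_linear] b by auto
  have "abar (b \<otimes>\<^bsub>alg D\<^esub> c) = abar b * abar c" unfolding abar_def rep_mult[OF b c] by (rule ac.mat_hom_mult[of _ N N _ N]) auto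
  then show "abar (b \<otimes>\<^bsub>alg D\<^esub> c) *\<^sub>v KB.covec x = KB.covec (actbar D b (actbar D c x))"
    unfolding covec_actbar[OF b cx] covec_actbar[OF c x] by (simp add: assoc_mult_mat_vec[of _ N N _ N])
qed (rule x)

lemma r1_add:
  assumes b: "b \<in> carrier (alg D)" and c: "c \<in> carrier (alg D)" shows "r1 (b \<oplus>\<^bsub>alg D\<^esub> c) = r1 b + r1 c"
proof -
  interpret B: ring "alg D" by (rule B_ring)
  show ?thesis
    unfolding r1_eq[OF b] r1_eq[OF c] r1_eq[OF B.a_closed[OF b c]]
    by (rule U.mat_of_add[OF actbar_V1_linear[OF b] actbar_V1_linear[OF c]]) (use actbar_add[OF b c] V1_carrier in auto)
qed

lemma r1_smult:
  assumes b: "b \<in> carrier (alg D)" shows "r1 (a \<odot>\<^bsub>alg D\<^esub> b) = to_ac a \<cdot>\<^sub>m r1 b"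
proof -
  interpret Bm: module tring "alg D" by (rule order_props(6))
  have ab: "a \<odot>\<^bsub>alg D\<^esub> b \<in> carrier (alg D)" using b by simp
  show ?thesis
    unfolding r1_eq[OF b] r1_eq[OF ab]
    by (rule U.mat_of_smult[OF actbar_V1_linear[OF b]]) (use actbar_smult[OF b] V1_carrier in auto)
qed

lemma r1_mult:
  assumes b: "b \<in> carrier (alg D)" and c: "c \<in> carrier (alg D)" shows "r1 (b \<otimes>\<^bsub>alg D\<^esub> c) = r1 b * r1 c"
proof -
  interpret B: ring "alg D" by (rule B_ring)
  have "r1 (b \<otimes>\<^bsub>alg D\<^esub> c) = U.mat_of (actbar D b \<circ> actbar D c)"
    unfolding r1_eq[OF B.m_closed[OF b c]] by (rule U.mat_of_cong) (use actbar_mult[OF b c] V1_carrier in auto)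
  then show ?thesis unfolding r1_eq[OF b] r1_eq[OF c] U.mat_of_comp[OF actbar_V1_linear[OF b] actbar_V1_linear[OF c]] .
qed

definition plK where "plK n f = ext_module.pluecker n (\<lambda>i. K.coS (f i))"

lemma ext_module_K: "ext_module UNIV (Vbar D)"
  by (rule ext_module.intro) (rule closed_subring_UNIV, rule KB.M)

lemma linear_family_K: "f \<in> {0..<n} \<rightarrow> {0..<N} \<Longrightarrow> ext_module.linear_family UNIV (Vbar D) n (\<lambda>i. K.coS (f i))"
  unfolding ext_module.linear_family_def[OF ext_module_K] using KB.co_add KB.co_smult by (auto simp: Pi_iff)

text \<open>The left-hand side is the Pluecker coordinate with index map f of the image of z under
  the exterior power of b. For good b the generators of \<open>W_bar\<close> are wedges of true
  eigenvectors, so the exterior power multiplies them by the product of the eigenvalues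
  \<open>as\<close>, which is the determinant of b on V_1. Both sides are linear in z.\<close>

lemma W_bar_identity_good:
  assumes b: "good b" and z: "z \<in> W_bar D \<mu> n b" and f: "f \<in> {0..<n} \<rightarrow> {0..<N}"
  shows "(\<Sum>g\<in>{0..<n} \<rightarrow>\<^sub>E {0..<N}. (\<Prod>i<n. abar b $$ (f i, g i)) * plK n g z) = det (r1 b) * plK n f z"
    and "z \<in> carrier (exterior_power tring (Vbar D) n)"
proof -
  interpret X: ext_module UNIV "Vbar D" n by (rule ext_module_K)
  have bc: "b \<in> carrier (alg D)" using b order_props(1) unfolding good_def by auto
  have eq: "exterior_power tring (Vbar D) n = X.Q" using X.exterior_power_eq by (simp add: subtring_UNIV)
  have weq: "wedge tring (Vbar D) vs = wedge (subtring UNIV) (Vbar D) vs" for vs by (simp add: subtring_UNIV)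
  have Qm: "module tring X.Q" using X.module_Q by (simp add: subtring_UNIV)
  note lf = linear_family_K
  let ?G = "{0..<n} \<rightarrow>\<^sub>E {0..<N}"
  have gl: "g \<in> {0..<n} \<rightarrow> {0..<N}" if "g \<in> ?G" for g using that by (auto simp: PiE_def)
  define P where "P z \<longleftrightarrow> (\<Sum>g\<in>?G. (\<Prod>i<n. abar b $$ (f i, g i)) * plK n g z) = det (r1 b) * plK n f z" for z
  let ?gens = "{wedge tring (Vbar D) vs | vs as. length vs = n \<and> length as = n \<and>
      char_poly (end_mat tring (V1 D \<mu>) (actbar D b)) = (\<Prod>a\<leftarrow>as. [:- a, 1:]) \<and>
      (\<forall>i<n. vs ! i \<in> gen_eigenspace (Vbar D) (actbar D b) (as ! i))}"
  have tup: "vs \<in> tuples (Vbar D) n" if "length vs = n" "\<forall>i<n. vs ! i \<in> gen_eigenspace (Vbar D) (actbar D b) (as ! i)" for vs as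
    using that unfolding tuples_def gen_eigenspace_def by (force simp: in_set_conv_nth)
  have gens: "?gens \<subseteq> carrier X.Q"
  proof
    fix w assume "w \<in> ?gens"
    then obtain vs as where "w = wedge tring (Vbar D) vs" "length vs = n" "\<forall>i<n. vs ! i \<in> gen_eigenspace (Vbar D) (actbar D b) (as ! i)"
      by blast
    with tup[of vs as] show "w \<in> carrier X.Q" unfolding weq X.carrier_Q by (simp add: X.wedge_eq X.single_finsupp)
  qed
  have zs: "z \<in> mspan tring X.Q ?gens" using z unfolding W_bar_def eq .
  show "z \<in> carrier (exterior_power tring (Vbar D) n)"
    using zs LinearCombinations.module.span_is_submodule[OF Qm gens] unfolding eq LinearCombinations.submodule_def by blast
  have "P z" using Qm gens zs
  proof (rule mspan_induct)
    show "P \<zero>\<^bsub>X.Q\<^esub>" unfolding P_def plK_def using X.pluecker_zero[OF lf[OF gl]] X.pluecker_zero[OF lf[OF f]] by simp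
    show "P (x \<oplus>\<^bsub>X.Q\<^esub> y)" if "x \<in> carrier X.Q" "y \<in> carrier X.Q" "P x" "P y" for x y
    proof -
      have "(\<Sum>g\<in>?G. (\<Prod>i<n. abar b $$ (f i, g i)) * plK n g (x \<oplus>\<^bsub>X.Q\<^esub> y)) =
          (\<Sum>g\<in>?G. (\<Prod>i<n. abar b $$ (f i, g i)) * plK n g x + (\<Prod>i<n. abar b $$ (f i, g i)) * plK n g y)"
        unfolding plK_def using X.pluecker_add[OF lf[OF gl] that(1,2)] by (intro sum.cong) (simp_all add: algebra_simps)
      then show ?thesis using that(3,4) X.pluecker_add[OF lf[OF f] that(1,2)] unfolding P_def plK_def by (simp add: sum.distrib algebra_simps)
    qed
    show "P (a \<odot>\<^bsub>X.Q\<^esub> x)" if "x \<in> carrier X.Q" "P x" for a x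
    proof -
      have "(\<Sum>g\<in>?G. (\<Prod>i<n. abar b $$ (f i, g i)) * plK n g (a \<odot>\<^bsub>X.Q\<^esub> x)) =
          (\<Sum>g\<in>?G. a * ((\<Prod>i<n. abar b $$ (f i, g i)) * plK n g x))"
        unfolding plK_def using X.pluecker_smult[OF lf[OF gl] UNIV_I that(1)] by (intro sum.cong) (simp_all add: algebra_simps)
      then show ?thesis using that(2) X.pluecker_smult[OF lf[OF f] UNIV_I that(1)] unfolding P_def plK_def
        by (simp add: sum_distrib_left[symmetric] algebra_simps)
    qed
    show "P w" if "w \<in> ?gens" for w
    proof -
      obtain vs as where w: "w = wedge tring (Vbar D) vs" "length vs = n" "length as = n"
        "char_poly (r1 b) = (\<Prod>a\<leftarrow>as. [:- a, 1:])" "\<forall>i<n. vs ! i \<in> gen_eigenspace (Vbar D) (actbar D b) (as ! i)"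
        using \<open>w \<in> ?gens\<close> unfolding r1_def by blast
      have vc: "vs ! i \<in> carrier (Vbar D)" "actbar D b (vs ! i) = as ! i \<odot>\<^bsub>Vbar D\<^esub> vs ! i" if "i < n" for i
        using good_gen_eigenspace[OF b] w(5) that by auto
      \<comment> \<open>The columns of \<open>M\<close> are the vectors v_j, and \<open>C\<close>
        consists of the rows f(i) of the matrix of b. The determinant of CM is computed from the
        eigenvalue equations and from the Cauchy-Binet formula.\<close>
      define M where "M = mat N n (\<lambda>(i, j). K.coS i (vs ! j))"
      define C where "C = mat n N (\<lambda>(i, k). abar b $$ (f i, k))"
      have MC: "M \<in> carrier_mat N n" "C \<in> carrier_mat n N" by (auto simp: M_def C_def)
      have pl: "plK n g w = det (mat n n (\<lambda>(i, j). M $$ (g i, j)))" if g: "g \<in> {0..<n} \<rightarrow> {0..<N}" for g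
      proof -
        have "plK n g w = det (mat n n (\<lambda>(j, i). K.coS (g i) (vs ! j)))"
          unfolding plK_def w(1) weq X.pluecker_wedge[OF lf[OF g] tup[OF w(2,5)]] form_det_def ..
        also have "mat n n (\<lambda>(j, i). K.coS (g i) (vs ! j)) = transpose_mat (mat n n (\<lambda>(i, j). M $$ (g i, j)))"
          using g by (intro eq_matI) (auto simp: M_def Pi_iff)
        finally show ?thesis using det_transpose[of "mat n n (\<lambda>(i, j). M $$ (g i, j))" n] by simp
      qed
      have "C * M = mat n n (\<lambda>(i, j). as ! j * M $$ (f i, j))"
      proof (rule eq_matI)
        fix i j assume "i < dim_row (mat n n (\<lambda>(i, j). as ! j * M $$ (f i, j)))" "j < dim_col (mat n n (\<lambda>(i, j). as ! j * M $$ (f i, j)))"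
        then have ij: "i < n" "j < n" by auto
        have fi: "f i < N" using f ij by auto
        have "(C * M) $$ (i, j) = (\<Sum>k<N. abar b $$ (f i, k) * K.coS k (vs ! j))"
          using ij by (simp add: C_def M_def scalar_prod_def atLeast0LessThan)
        also have "\<dots> = K.coS (f i) (actbar D b (vs ! j))"
          using KB.co_linear[OF actbar_linear[OF bc] vc(1)[OF ij(2)] fi] by (simp add: actbar_mat[OF bc])
        also have "\<dots> = as ! j * K.coS (f i) (vs ! j)" unfolding vc(2)[OF ij(2)] by (rule KB.co_smult[OF fi UNIV_I vc(1)[OF ij(2)]])
        finally show "(C * M) $$ (i, j) = mat n n (\<lambda>(i, j). as ! j * M $$ (f i, j)) $$ (i, j)"
          using ij fi by (simp add: M_def)
      qed (use MC in auto)
      also have "mat n n (\<lambda>(i, j). as ! j * M $$ (f i, j)) = mat n n (\<lambda>(i, j). M $$ (f i, j)) * mat n n (\<lambda>(i, j). if i = j then as ! i else 0)"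
        by (rule eq_matI) (auto simp: scalar_prod_def if_distrib[of "\<lambda>x. _ * x"] mult.commute cong: if_cong)
      finally have CM: "C * M = mat n n (\<lambda>(i, j). M $$ (f i, j)) * mat n n (\<lambda>(i, j). if i = j then as ! i else 0)" .
      have dd: "det (mat n n (\<lambda>(i, j). if i = j then as ! i else 0)) = prod_list as"
      proof -
        have "det (mat n n (\<lambda>(i, j). if i = j then as ! i else 0)) = prod_list (diag_mat (mat n n (\<lambda>(i, j). if i = j then as ! i else 0)))"
          by (rule det_upper_triangular[of _ n]) auto
        also have "diag_mat (mat n n (\<lambda>(i, j). if i = j then as ! i else 0)) = as"
          using w(3) by (intro nth_equalityI) (auto simp: diag_mat_def)
        finally show ?thesis .
      qed
      have 1: "det (C * M) = plK n f w * prod_list as"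
        unfolding CM pl[OF f] dd[symmetric] by (rule det_mult[of _ n]) auto
      have 2: "det (C * M) = (\<Sum>g\<in>?G. (\<Prod>i<n. C $$ (i, g i)) * det (mat n n (\<lambda>(i, j). M $$ (g i, j))))"
        by (rule det_mult_rect[OF MC(2,1)])
      have 3: "(\<Sum>g\<in>?G. (\<Prod>i<n. C $$ (i, g i)) * det (mat n n (\<lambda>(i, j). M $$ (g i, j)))) = (\<Sum>g\<in>?G. (\<Prod>i<n. abar b $$ (f i, g i)) * plK n g w)"
      proof (rule sum.cong[OF refl])
        fix g assume g: "g \<in> ?G"
        have "(\<Prod>i<n. C $$ (i, g i)) = (\<Prod>i<n. abar b $$ (f i, g i))"
          using gl[OF g] by (intro prod.cong) (auto simp: C_def Pi_iff)
        then show "(\<Prod>i<n. C $$ (i, g i)) * det (mat n n (\<lambda>(i, j). M $$ (g i, j))) = (\<Prod>i<n. abar b $$ (f i, g i)) * plK n g w"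
          using pl[OF gl[OF g]] by simp
      qed
      have 4: "det (r1 b) = prod_list as" by (rule char_poly_linear_factors_det(2)[OF r1_carrier[OF bc] w(4)])
      show ?thesis unfolding P_def 4 using 1 2 3 by (simp only: mult.commute)
    qed
  qed
  then show "(\<Sum>g\<in>?G. (\<Prod>i<n. abar b $$ (f i, g i)) * plK n g z) = det (r1 b) * plK n f z" unfolding P_def .
qed

text \<open>The good elements are Zariski dense in the line through a good element and \<open>b\<close>.\<close>

lemma W_bar_identity:
  assumes z: "\<And>b. b \<in> max_order D \<Longrightarrow> z \<in> W_bar D \<mu> n b" and b: "b \<in> max_order D" and f: "f \<in> {0..<n} \<rightarrow> {0..<N}"
  shows "(\<Sum>g\<in>{0..<n} \<rightarrow>\<^sub>E {0..<N}. (\<Prod>i<n. abar b $$ (f i, g i)) * plK n g z) = det (r1 b) * plK n f z"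
proof -
  let ?G = "{0..<n} \<rightarrow>\<^sub>E {0..<N}"
  interpret B: ring "alg D" by (rule B_ring)
  interpret Bm: module tring "alg D" by (rule order_props(6))
  obtain b0 where b0: "good b0" using max_card(2) by blast
  have b0O: "b0 \<in> max_order D" "card (spectrum (abar b0)) = max_card" using b0 unfolding good_def by auto
  note Oc = subsetD[OF order_props(1)]
  \<comment> \<open>The line from the good element b0 to b: b0 + t c is b at t = 1 and stays in the
    order for natural t.\<close>
  define c where "c = b \<oplus>\<^bsub>alg D\<^esub> (- 1) \<odot>\<^bsub>alg D\<^esub> b0"
  have cO: "c \<in> max_order D" unfolding c_def
    using closed_subringD[OF padic_field_Zp(1)[OF padic]] by (intro order_props(3)[OF b] order_props(4)[OF _ b0O(1)]) auto
  define bt where "bt t = b0 \<oplus>\<^bsub>alg D\<^esub> of_nat t \<odot>\<^bsub>alg D\<^esub> c" for t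
  have btO: "bt t \<in> max_order D" for t unfolding bt_def by (intro order_props(3)[OF b0O(1)] order_nat_smult[OF cO])
  have At: "abar (bt t) = abar b0 + of_nat t \<cdot>\<^sub>m abar c" for t
    unfolding bt_def using Oc[OF cO] Oc[OF b0O(1)] by (simp add: abar_add abar_smult ac.hom_of_nat)
  have Rt: "r1 (bt t) = r1 b0 + of_nat t \<cdot>\<^sub>m r1 c" for t
    unfolding bt_def using Oc[OF cO] Oc[OF b0O(1)] by (simp add: r1_add r1_smult ac.hom_of_nat)
  have m1: "to_ac (- 1) = (- 1 :: 'q alg_closure)" by (simp add: ac.hom_uminus)
  have A1: "abar b = abar b0 + 1 \<cdot>\<^sub>m abar c"
    unfolding c_def using Oc[OF b] Oc[OF b0O(1)] by (intro eq_matI) (simp_all add: abar_add abar_smult m1)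
  have R1: "r1 b = r1 b0 + 1 \<cdot>\<^sub>m r1 c"
    unfolding c_def using Oc[OF b] Oc[OF b0O(1)] by (intro eq_matI) (simp_all add: r1_add r1_smult m1)
  obtain h where h: "h \<noteq> 0" "\<And>t. Polynomial.poly h t \<noteq> 0 \<Longrightarrow> card (spectrum (abar b0)) \<le> card (spectrum (abar b0 + t \<cdot>\<^sub>m abar c))"
    using gram_perturb[of "abar b0" N "abar c"] by auto
  define lhs where "lhs = (\<Sum>g\<in>?G. (\<Prod>i<n. [:abar b0 $$ (f i, g i), abar c $$ (f i, g i):]) * [:plK n g z:])"
  define rhs where "rhs = det (mat m m (\<lambda>(i, j). [:r1 b0 $$ (i, j), r1 c $$ (i, j):])) * [:plK n f z:]"
  have lhs: "Polynomial.poly lhs t = (\<Sum>g\<in>?G. (\<Prod>i<n. (abar b0 + t \<cdot>\<^sub>m abar c) $$ (f i, g i)) * plK n g z)" for t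
  proof -
    have "abar b0 $$ (f i, g i) + t * abar c $$ (f i, g i) = (abar b0 + t \<cdot>\<^sub>m abar c) $$ (f i, g i)" if "g \<in> ?G" "i < n" for g i
      using f that by (auto simp: PiE_def Pi_iff)
    then show ?thesis unfolding lhs_def poly_sum poly_mult poly_prod by (intro sum.cong arg_cong2[of _ _ _ _ "(*)"] prod.cong) simp_all
  qed
  have rhs: "Polynomial.poly rhs t = det (r1 b0 + t \<cdot>\<^sub>m r1 c) * plK n f z" for t
  proof -
    interpret t: comm_ring_hom "\<lambda>p. Polynomial.poly p t" by (rule poly_hom)
    have "map_mat (\<lambda>p. Polynomial.poly p t) (mat m m (\<lambda>(i, j). [:r1 b0 $$ (i, j), r1 c $$ (i, j):])) = r1 b0 + t \<cdot>\<^sub>m r1 c"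
      using r1_carrier[OF Oc[OF cO]] r1_carrier[OF Oc[OF b0O(1)]] by (intro eq_matI) auto
    then show ?thesis unfolding rhs_def by (simp add: comm_ring_hom.hom_det[OF poly_hom, symmetric])
  qed
  \<comment> \<open>Where h does not vanish, the element of the line is good and the two sides
    agree; the factor h covers the remaining points and is cancelled afterwards.\<close>
  have "Polynomial.poly ((lhs - rhs) * h) (of_nat k) = 0" for k :: nat
  proof (cases "Polynomial.poly h (of_nat k) = 0")
    case False
    have "card (spectrum (abar (bt k))) = max_card"
      using h(2)[OF False] b0O(2) max_card(1)[OF btO[of k]] unfolding At by simp
    then have "good (bt k)" using btO unfolding good_def by simp
    from W_bar_identity_good(1)[OF this z[OF btO] f] show ?thesis using lhs rhs unfolding At Rt by simp
  qed simp
  then have "(lhs - rhs) * h = 0" by (rule poly_eq_0_if_nats)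
  then have "lhs = rhs" using h(1) by simp
  then show ?thesis using lhs[of 1] rhs[of 1] unfolding A1 R1 by simp
qed

end

section \<open>Coordinates under change of the coefficient ring\<close>

lemma bc_map_id_coords:
  assumes X: "based_base_change A M S \<phi> N e co" and Y: "based_base_change A' M' S' \<phi>' N e co"
    and \<theta>: "hom_on S \<theta>" "\<theta> ` S \<subseteq> S'" "\<And>a. a \<in> A \<Longrightarrow> \<theta> (\<phi> a) = \<phi>' a" and A: "A \<subseteq> A'" and f: "linear_on A M M' id"
  defines "g \<equiv> bc_map (subtring A') M' (subtring S') \<phi>' id \<theta>"
  defines "P \<equiv> base_change (subtring A) M (subtring S) \<phi>" and "P' \<equiv> base_change (subtring A') M' (subtring S') \<phi>'"
  shows "x \<in> carrier P \<Longrightarrow> g x \<in> carrier P'"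
    "x \<in> carrier P \<Longrightarrow> y \<in> carrier P \<Longrightarrow> g (x \<oplus>\<^bsub>P\<^esub> y) = g x \<oplus>\<^bsub>P'\<^esub> g y"
    "x \<in> carrier P \<Longrightarrow> a \<in> S \<Longrightarrow> g (a \<odot>\<^bsub>P\<^esub> x) = \<theta> a \<odot>\<^bsub>P'\<^esub> g x"
    "x \<in> carrier P \<Longrightarrow> i < N \<Longrightarrow> based_base_change.coS \<phi>' co i (g x) = \<theta> (based_base_change.coS \<phi> co i x)"
proof -
  interpret X: based_base_change A M S \<phi> N e co by (rule X)
  interpret Y: based_base_change A' M' S' \<phi>' N e co by (rule Y)
  note S = X.S_closed
  have P: "P = X.Q" and P': "P' = Y.Q" unfolding P_def P'_def by (rule X.base_change_eq, rule Y.base_change_eq)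
  have *: "g (X.cls u) = Y.cls (free_map id \<theta> u)" if "u \<in> finsupp S (carrier M)" for u
    unfolding g_def by (rule bc_map_cls[OF X.base_change_module_axioms Y.base_change_module_axioms \<theta> A f that])
  have fc: "free_map id \<theta> u \<in> finsupp S' (carrier M')" if "u \<in> finsupp S (carrier M)" for u
    by (rule free_map_closed[OF \<theta>(1) S \<theta>(2) Y.S_closed _ that]) (use linear_onD(1)[OF f] in auto)
  have r: "range (Poly_Mapping.lookup u) \<subseteq> S" if "u \<in> finsupp S (carrier M)" for u using finsuppD(2)[OF that] .
  show "g x \<in> carrier P'" if x: "x \<in> carrier P" for x
  proof -
    obtain u where u: "x = X.cls u" "u \<in> finsupp S (carrier M)" using x unfolding P X.carrier_Q by auto
    show ?thesis unfolding P' u(1) *[OF u(2)] Y.carrier_Q using fc[OF u(2)] by (rule imageI)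
  qed
  show "g (x \<oplus>\<^bsub>P\<^esub> y) = g x \<oplus>\<^bsub>P'\<^esub> g y" if x: "x \<in> carrier P" and y: "y \<in> carrier P"
  proof -
    obtain u where u: "x = X.cls u" "u \<in> finsupp S (carrier M)" using x unfolding P X.carrier_Q by auto
    obtain v where v: "y = X.cls v" "v \<in> finsupp S (carrier M)" using y unfolding P X.carrier_Q by auto
    show ?thesis
      unfolding P P' u(1) v(1) X.add_Q *[OF u(2)] *[OF v(2)] *[OF finsupp_closed(2)[OF S u(2) v(2)]]
        free_map_add[OF \<theta>(1) S r[OF u(2)] r[OF v(2)]] Y.add_Q ..
  qed
  show "g (a \<odot>\<^bsub>P\<^esub> x) = \<theta> a \<odot>\<^bsub>P'\<^esub> g x" if x: "x \<in> carrier P" and a: "a \<in> S"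
  proof -
    obtain u where u: "x = X.cls u" "u \<in> finsupp S (carrier M)" using x unfolding P X.carrier_Q by auto
    have \<theta>a: "\<theta> a \<in> S'" using a \<theta>(2) by auto
    show ?thesis
      unfolding P P' u(1) X.smult_Q[OF a] *[OF u(2)] *[OF finsupp_closed(4)[OF S a u(2)]]
        free_map_scale[OF \<theta>(1) S r[OF u(2)] a] Y.smult_Q[OF \<theta>a] ..
  qed
  show "based_base_change.coS \<phi>' co i (g x) = \<theta> (based_base_change.coS \<phi> co i x)" if x: "x \<in> carrier P" and i: "i < N"
  proof -
    obtain u where u: "x = X.cls u" "u \<in> finsupp S (carrier M)" using x unfolding P X.carrier_Q by auto
    show ?thesis unfolding u(1) *[OF u(2)] X.coS_cls[OF i] Y.coS_cls[OF i]
    proof (rule functional_free_map[OF \<theta>(1) S r[OF u(2)]])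
      fix k assume "k \<in> Poly_Mapping.keys u"
      then have k: "k \<in> carrier M" using finsuppD(1)[OF u(2)] by blast
      show "\<phi> (co i k) \<in> S \<and> \<phi>' (co i (id k)) = \<theta> (\<phi> (co i k))"
        using X.\<phi>_in[OF X.co_closed[OF i k]] \<theta>(3)[OF X.co_closed[OF i k]] by simp
    qed
  qed
qed

lemma hom_on_map_poly:
  assumes h: "hom_on S \<theta>" "closed_subring S"
  shows "hom_on {p. \<forall>i. Polynomial.coeff p i \<in> S} (map_poly \<theta>)"
proof -
  have 0: "\<theta> 0 = 0" by (rule hom_onD(2)[OF h])
  have "map_poly \<theta> 1 = 1" unfolding one_pCons by (simp add: map_poly_pCons hom_onD(1)[OF h])
  moreover have "map_poly \<theta> (p + q) = map_poly \<theta> p + map_poly \<theta> q" if "\<forall>i. Polynomial.coeff p i \<in> S" "\<forall>i. Polynomial.coeff q i \<in> S" for p q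
    by (rule poly_eqI) (use that hom_onD(4)[OF h] in \<open>simp add: coeff_map_poly[where f = \<theta>, OF 0]\<close>)
  moreover have "map_poly \<theta> (p * q) = map_poly \<theta> p * map_poly \<theta> q" if "\<forall>i. Polynomial.coeff p i \<in> S" "\<forall>i. Polynomial.coeff q i \<in> S" for p q
  proof (rule poly_eqI)
    fix k
    have "\<theta> (\<Sum>i\<le>k. Polynomial.coeff p i * Polynomial.coeff q (k - i)) = (\<Sum>i\<le>k. \<theta> (Polynomial.coeff p i * Polynomial.coeff q (k - i)))"
      using that closed_subringD(6)[OF h(2)] by (intro hom_on_sum[OF h]) auto
    then show "Polynomial.coeff (map_poly \<theta> (p * q)) k = Polynomial.coeff (map_poly \<theta> p * map_poly \<theta> q) k"
      using that by (simp add: coeff_map_poly[where f = \<theta>, OF 0] coeff_mult hom_onD(6)[OF h])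
  qed
  ultimately show ?thesis unfolding hom_on_def by auto
qed

section \<open>The generic determinant on V_1 has coefficients in O_E\<close>

context pel_lattice
begin

abbreviation "E \<equiv> reflex_field D \<mu>"

lemma a_inv_tring: "\<ominus>\<^bsub>tring\<^esub> x = - (x :: 's::comm_ring_1)"
proof -
  interpret t: cring "tring :: 's ring" using cring_subtring[OF closed_subring_UNIV] unfolding subtring_UNIV .
  show ?thesis using t.minus_equality[of "- x" x] by simp
qed

lemma m_inv_tring: "x \<noteq> 0 \<Longrightarrow> inv\<^bsub>tring\<^esub> x = inverse (x :: 's::field)"
proof -
  interpret t: cring "tring :: 's ring" using cring_subtring[OF closed_subring_UNIV] unfolding subtring_UNIV .
  assume "x \<noteq> 0" then show ?thesis using t.comm_inv_char[of x "inverse x"] by simp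
qed

lemma E_closed: "closed_subring E" "x \<in> E \<Longrightarrow> inverse x \<in> E" "to_ac q \<in> E"
  "b \<in> carrier (alg D) \<Longrightarrow> mat_trace (r1 b) \<in> E"
proof -
  let ?H = "range to_ac \<union> (\<lambda>b. end_trace tring (V1 D \<mu>) (actbar D b)) ` carrier (alg D)"
  note E = reflex_field_def[of D \<mu>]
  have add: "x + y \<in> E" if "x \<in> E" "y \<in> E" for x y
    using generate_field.eng_add[OF that[unfolded E]] unfolding E by simp
  have mult: "x * y \<in> E" if "x \<in> E" "y \<in> E" for x y
    using generate_field.eng_mult[OF that[unfolded E]] unfolding E by simp
  have neg: "- x \<in> E" if "x \<in> E" for x
    using generate_field.a_inv[OF that[unfolded E]] unfolding E a_inv_tring .
  have one: "1 \<in> E" using generate_field.one[of tring ?H] unfolding E by simp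
  show "closed_subring E" unfolding closed_subring_def using one mult add[OF _ neg] by simp
  have "0 \<in> E" using add[OF one neg[OF one]] by simp
  moreover have "inverse x \<in> E" if "x \<in> E" "x \<noteq> 0" for x
    using generate_field.m_inv[OF that(1)[unfolded E]] that(2) unfolding E by (simp add: m_inv_tring)
  ultimately show "x \<in> E \<Longrightarrow> inverse x \<in> E" by (cases "x = 0") auto
  show "to_ac q \<in> E" unfolding E by (rule generate_field.incl) simp
  assume "b \<in> carrier (alg D)"
  then have "end_trace tring (V1 D \<mu>) (actbar D b) \<in> E" unfolding E by (intro generate_field.incl) blast
  then show "mat_trace (r1 b) \<in> E" unfolding end_trace_def mat_trace_def r1_def .
qed

lemma OE_eq: "OE nrm D \<mu> = {x \<in> E. integral_over (Zp nrm) x}"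
  unfolding integers_of_def integral_over_def ..

lemma OE_closed: "closed_subring (OE nrm D \<mu>)"
  unfolding OE_eq using E_closed(1) closed_subring_integral[OF padic_field_Zp(1)[OF padic]] unfolding closed_subring_def by auto

lemma to_ac_OE: "q \<in> Zp nrm \<Longrightarrow> to_ac q \<in> OE nrm D \<mu>"
proof -
  assume q: "q \<in> Zp nrm"
  note Z = closed_subringD[OF padic_field_Zp(1)[OF padic]]
  have "Polynomial.coeff [:- q, 1:] i \<in> Zp nrm" for i
    using q Z by (cases i) (auto simp: coeff_pCons split: nat.splits)
  then have "integral_over (Zp nrm) (to_ac q)"
    unfolding integral_over_def by (intro exI[of _ "[:- q, 1:]"]) (simp add: map_poly_pCons ac.hom_uminus)
  then show ?thesis unfolding OE_eq using E_closed(3) by simp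
qed

definition J where "J = mat N m (\<lambda>(i, j). K.coS i (e1 j))"

lemma J_carrier[simp]: "J \<in> carrier_mat N m" "dim_row J = N" "dim_col J = m" by (auto simp: J_def)

lemma e1_Vbar: "j < m \<Longrightarrow> e1 j \<in> carrier (Vbar D)" using U.e_closed V1_carrier by auto

text \<open>\<open>J\<close> is the inclusion of \<open>V\<^sub>1\<close> in coordinates.\<close>

lemma J_coords:
  assumes x: "x \<in> carrier (V1 D \<mu>)" shows "KB.covec x = J *\<^sub>v U.covec x"
proof (rule eq_vecI)
  fix i assume "i < dim_vec (J *\<^sub>v U.covec x)"
  then have i: "i < N" by simp
  have "K.coS i x = (\<Sum>j<m. co1 j x * K.coS i (e1 j))"
    by (rule U.functional_expand[OF _ _ x]) (use KB.co_add[OF i] KB.co_smult[OF i] subsetD[OF V1_carrier] in simp_all)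
  then show "vec_index (KB.covec x) i = vec_index (J *\<^sub>v U.covec x) i"
    using i by (simp add: scalar_prod_def J_def atLeast0LessThan mult.commute)
qed simp

lemma J_intertwines:
  assumes b: "b \<in> carrier (alg D)" shows "abar b * J = J * r1 b"
proof (rule eq_matI)
  fix i j assume "i < dim_row (J * r1 b)" "j < dim_col (J * r1 b)"
  then have ij: "i < N" "j < m" using r1_dim[OF b] by auto
  have c: "actbar D b (e1 j) \<in> carrier (V1 D \<mu>)" by (rule linear_onD(1)[OF actbar_V1_linear[OF b] U.e_closed[OF ij(2)]])
  have "(J * r1 b) $$ (i, j) = vec_index (J *\<^sub>v U.covec (actbar D b (e1 j))) i"
    using ij b by (simp add: r1_eq scalar_prod_def)
  also have "\<dots> = vec_index (abar b *\<^sub>v KB.covec (e1 j)) i"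
    unfolding J_coords[OF c, symmetric] covec_actbar[OF b e1_Vbar[OF ij(2)]] ..
  also have "\<dots> = (abar b * J) $$ (i, j)" using ij by (simp add: scalar_prod_def J_def)
  finally show "(abar b * J) $$ (i, j) = (J * r1 b) $$ (i, j)" by simp
qed (use b in auto)

lemma J_injective:
  assumes v: "v \<in> carrier_vec m" and z: "J *\<^sub>v v = 0\<^sub>v N" shows "v = 0\<^sub>v m"
proof -
  define x where "x = (\<Oplus>\<^bsub>V1 D \<mu>\<^esub>j\<in>{..<m}. vec_index v j \<odot>\<^bsub>V1 D \<mu>\<^esub> e1 j)"
  have xc: "x \<in> carrier (V1 D \<mu>)" unfolding x_def
    by (rule U.M.M.finsum_closed) (use U.M.smult_closed U.e_closed in auto)
  have cx: "U.covec x = v" by (rule eq_vecI) (use v U.co_lincomb in \<open>auto simp: x_def\<close>)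
  have xV: "x \<in> carrier (Vbar D)" using xc V1_carrier by auto
  have "KB.covec x = KB.covec \<zero>\<^bsub>Vbar D\<^esub>" unfolding J_coords[OF xc] cx z KB.covec_zero ..
  then have "x = \<zero>\<^bsub>V1 D \<mu>\<^esub>" using KB.covec_inj[OF xV KB.M.M.zero_closed] by simp
  then show ?thesis using cx U.covec_zero by simp
qed

text \<open>The matrix on V_1 of the combination of the \<open>bs ! l\<close> with coefficients X_l,
  after substituting \<open>T ^ (k ^ l)\<close> for X_l; \<open>amat\<close> is the corresponding
  matrix on V.\<close>

definition fmat where "fmat bs k = mat m m (\<lambda>(i, j). \<Sum>l<length bs. Polynomial.monom (r1 (bs ! l) $$ (i, j)) (k ^ l))"
definition amat where "amat bs k = mat N N (\<lambda>(i, j). \<Sum>l<length bs. Polynomial.monom (rep (bs ! l) $$ (i, j)) (k ^ l))"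

lemma fmat_carrier[simp]: "fmat bs k \<in> carrier_mat m m" "amat bs k \<in> carrier_mat N N"
  by (auto simp: fmat_def amat_def)

text \<open>The specialization of the generic element at T = y. For natural y it lies in the order,
  which is why identities in T are tested at natural numbers.\<close>

definition bval where "bval bs k y = (\<Oplus>\<^bsub>alg D\<^esub>l\<in>{..<length bs}. of_nat (y ^ (k ^ l)) \<odot>\<^bsub>alg D\<^esub> (bs ! l))"

lemma bval_order:
  assumes bs: "set bs \<subseteq> max_order D"
  shows "bval bs k y \<in> max_order D"
    "i < m \<Longrightarrow> j < m \<Longrightarrow> r1 (bval bs k y) $$ (i, j) = Polynomial.poly (fmat bs k $$ (i, j)) (of_nat y)"
    "i < N \<Longrightarrow> j < N \<Longrightarrow> rep (bval bs k y) $$ (i, j) = Polynomial.poly (amat bs k $$ (i, j)) (of_nat y)"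
proof -
  interpret B: ring "alg D" by (rule B_ring)
  interpret Bm: module tring "alg D" by (rule order_props(6))
  note Oc = subsetD[OF order_props(1)]
  define s where "s I = (\<Oplus>\<^bsub>alg D\<^esub>l\<in>I. of_nat (y ^ (k ^ l)) \<odot>\<^bsub>alg D\<^esub> (bs ! l))" for I
  have zO: "\<zero>\<^bsub>alg D\<^esub> \<in> max_order D"
    using order_props(4)[OF closed_subringD(1)[OF padic_field_Zp(1)[OF padic]] order_props(2)] Bm.smult_l_null[of "\<one>\<^bsub>alg D\<^esub>"] by simp
  have r1z: "r1 \<zero>\<^bsub>alg D\<^esub> = 0 \<cdot>\<^sub>m r1 \<one>\<^bsub>alg D\<^esub>" using r1_smult[of "\<one>\<^bsub>alg D\<^esub>" 0] Bm.smult_l_null[of "\<one>\<^bsub>alg D\<^esub>"] by simp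
  have repz: "rep \<zero>\<^bsub>alg D\<^esub> = 0 \<cdot>\<^sub>m rep \<one>\<^bsub>alg D\<^esub>" using rep_smult[of "\<one>\<^bsub>alg D\<^esub>" 0] Bm.smult_l_null[of "\<one>\<^bsub>alg D\<^esub>"] by simp
  have "s I \<in> max_order D \<and> (\<forall>i<m. \<forall>j<m. r1 (s I) $$ (i, j) = (\<Sum>l\<in>I. of_nat (y ^ (k ^ l)) * r1 (bs ! l) $$ (i, j))) \<and>
     (\<forall>i<N. \<forall>j<N. rep (s I) $$ (i, j) = (\<Sum>l\<in>I. of_nat (y ^ (k ^ l)) * rep (bs ! l) $$ (i, j)))"
    if "finite I" "I \<subseteq> {..<length bs}" for I
    using that
  proof (induct I rule: finite_induct)
    case empty
    show ?case using zO by (simp add: s_def r1z repz)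
  next
    case (insert l I)
    have bl: "bs ! l \<in> max_order D" using insert bs by auto
    let ?t = "of_nat (y ^ (k ^ l)) \<odot>\<^bsub>alg D\<^esub> (bs ! l)"
    have t: "?t \<in> max_order D" by (rule order_nat_smult[OF bl])
    have I: "s I \<in> max_order D" using insert by simp
    have eq: "s (insert l I) = ?t \<oplus>\<^bsub>alg D\<^esub> s I"
      unfolding s_def by (rule B.finsum_insert) (use insert bs Oc order_nat_smult in \<open>auto simp: subset_iff\<close>)
    show ?case unfolding eq
      using order_props(3)[OF t I] insert Oc[OF t] Oc[OF I] Oc[OF bl]
      by (simp add: r1_add rep_add r1_smult rep_smult ac.hom_of_nat ac.hom_power)
  qed
  from this[of "{..<length bs}"]
  show "bval bs k y \<in> max_order D"
    "i < m \<Longrightarrow> j < m \<Longrightarrow> r1 (bval bs k y) $$ (i, j) = Polynomial.poly (fmat bs k $$ (i, j)) (of_nat y)"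
    "i < N \<Longrightarrow> j < N \<Longrightarrow> rep (bval bs k y) $$ (i, j) = Polynomial.poly (amat bs k $$ (i, j)) (of_nat y)"
    unfolding bval_def s_def by (simp_all add: fmat_def amat_def poly_sum poly_monom mult.commute)
qed

text \<open>Stated for every y in the algebraic closure, because integrality is tested at roots y
  that are not natural numbers. It makes each eigenvalue of the generic matrix on V_1 an eigenvalue
  of the one on V.\<close>

lemma fmat_intertwines:
  assumes bs: "set bs \<subseteq> max_order D"
  shows "map_mat (\<lambda>p. Polynomial.poly (map_poly to_ac p) y) (amat bs k) * J = J * map_mat (\<lambda>p. Polynomial.poly p y) (fmat bs k)"
proof (rule eq_matI)
  let ?A = "map_mat (\<lambda>p. Polynomial.poly (map_poly to_ac p) y) (amat bs k)" and ?F = "map_mat (\<lambda>p. Polynomial.poly p y) (fmat bs k)"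
  fix i j assume "i < dim_row (J * ?F)" "j < dim_col (J * ?F)"
  then have ij: "i < N" "j < m" by (auto simp: fmat_def)
  have mp: "Polynomial.poly (map_poly to_ac (amat bs k $$ (i, r))) y = (\<Sum>l<length bs. y ^ (k ^ l) * abar (bs ! l) $$ (i, r))" if "r < N" for r
  proof -
    have "map_poly to_ac (\<Sum>l\<in>L. p l) = (\<Sum>l\<in>L. map_poly to_ac (p l))" for L :: "nat set" and p :: "nat \<Rightarrow> 'q Polynomial.poly"
      by (rule poly_eqI) (simp add: coeff_sum coeff_map_poly ac.hom_sum)
    then show ?thesis using ij(1) that by (simp add: amat_def map_poly_monom poly_sum poly_monom abar_def mult.commute)
  qed
  have "(?A * J) $$ (i, j) = (\<Sum>r<N. (\<Sum>l<length bs. y ^ (k ^ l) * abar (bs ! l) $$ (i, r)) * J $$ (r, j))"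
    using ij mp by (simp add: scalar_prod_def atLeast0LessThan carrier_matD[OF fmat_carrier(2)])
  also have "\<dots> = (\<Sum>l<length bs. y ^ (k ^ l) * (abar (bs ! l) * J) $$ (i, j))"
    using ij by (simp add: scalar_prod_def atLeast0LessThan sum_distrib_right sum_distrib_left mult.assoc) (rule sum.swap)
  also have "\<dots> = (\<Sum>l<length bs. y ^ (k ^ l) * (J * r1 (bs ! l)) $$ (i, j))"
    by (intro sum.cong refl, subst J_intertwines) (use bs order_props(1) in \<open>auto simp: subset_iff\<close>)
  also have "\<dots> = (\<Sum>l<length bs. \<Sum>r<m. y ^ (k ^ l) * (J $$ (i, r) * r1 (bs ! l) $$ (r, j)))"
  proof (intro sum.cong refl)
    fix l assume "l \<in> {..<length bs}"
    then have "bs ! l \<in> carrier (alg D)" using bs order_props(1) by (auto simp: subset_iff)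
    then show "y ^ (k ^ l) * (J * r1 (bs ! l)) $$ (i, j) = (\<Sum>r<m. y ^ (k ^ l) * (J $$ (i, r) * r1 (bs ! l) $$ (r, j)))"
      using ij by (simp add: scalar_prod_def atLeast0LessThan sum_distrib_left)
  qed
  also have "\<dots> = (J * ?F) $$ (i, j)"
    using ij by (subst sum.swap) (simp add: scalar_prod_def atLeast0LessThan fmat_def poly_sum poly_monom sum_distrib_left mult_ac)
  finally show "(?A * J) $$ (i, j) = (J * ?F) $$ (i, j)" .
qed (auto simp: fmat_def amat_def)

text \<open>Membership in E: at natural numbers the value is the determinant on V_1 of an element of
  \<open>B\<close>, whose powers have traces in E. Integrality: eigenvalues on the stable subspace
  V_1 are eigenvalues on \<open>Vbar D\<close>, where the generic matrix has p-adic integers as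
  coefficients.\<close>

lemma det_fmat_OE:
  assumes bs: "set bs \<subseteq> max_order D"
  shows "Polynomial.coeff (det (fmat bs k)) i \<in> OE nrm D \<mu>"
proof -
  note Oc = subsetD[OF order_props(1)]
  have "Polynomial.coeff (det (fmat bs k)) i \<in> E"
  proof (rule coeffs_in_subfield_if_values[OF E_closed(1,2) infinite_UNIV_nat])
    fix y :: nat
    let ?b = "bval bs k y"
    have b: "?b \<in> carrier (alg D)" by (rule Oc[OF bval_order(1)[OF bs]])
    have F: "map_mat (\<lambda>p. Polynomial.poly p (of_nat y)) (fmat bs k) = r1 ?b"
      by (rule eq_matI) (use bval_order(2)[OF bs, of _ _ k y] b in \<open>auto simp: carrier_matD[OF fmat_carrier(1)]\<close>)
    \<comment> \<open>Powers of the matrix of an element are matrices of elements of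
      \<open>B\<close>, to which the description of E by traces applies.\<close>
    have ex: "\<exists>c\<in>carrier (alg D). r1 c = r1 ?b ^\<^sub>m Suc j" for j
    proof (induct j)
      case 0 show ?case using b r1_carrier[OF b] by (intro bexI[of _ ?b]) auto
    next
      case (Suc j)
      then obtain c where c: "c \<in> carrier (alg D)" "r1 c = r1 ?b ^\<^sub>m Suc j" by blast
      interpret B: ring "alg D" by (rule B_ring)
      show ?case using r1_mult[OF c(1) b] c b by (intro bexI[of _ "c \<otimes>\<^bsub>alg D\<^esub> ?b"]) simp_all
    qed
    have "det (r1 ?b) \<in> E"
    proof (rule det_in_subfield_if_traces[OF r1_carrier[OF b] E_closed(1,2)])
      fix j :: nat assume "j > 0"
      then obtain i where "j = Suc i" by (cases j) auto
      then show "mat_trace (r1 ?b ^\<^sub>m j) \<in> E" using ex[of i] E_closed(4) by metis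
    qed
    then show "Polynomial.poly (det (fmat bs k)) (of_nat y) \<in> E"
      unfolding comm_ring_hom.hom_det[OF poly_hom, symmetric] F .
  qed
  moreover have "integral_over (Zp nrm) (Polynomial.coeff (det (fmat bs k)) i)"
  proof (rule det_coeffs_integral[OF padic_field_Zp(1)[OF padic] fmat_carrier])
    fix i j l assume ij: "i < N" "j < N"
    have "rep (bs ! q) $$ (i, j) \<in> Zp nrm" if "q < length bs" for q using rep_Zp[OF subsetD[OF bs nth_mem[OF that]] ij] .
    then have "(\<Sum>q<length bs. if k ^ q = l then rep (bs ! q) $$ (i, j) else 0) \<in> Zp nrm"
      using closed_subringD(1)[OF padic_field_Zp(1)[OF padic]] by (intro closed_subring_sum[OF padic_field_Zp(1)[OF padic]]) auto
    then show "Polynomial.coeff (amat bs k $$ (i, j)) l \<in> Zp nrm"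
      using ij by (simp add: amat_def coeff_sum)
  next
    \<comment> \<open>The inclusion \<open>J\<close> is injective, so it takes an eigenvector on V_1
      to one on \<open>Vbar D\<close>.\<close>
    fix y c assume "eigenvalue (map_mat (\<lambda>p. Polynomial.poly p y) (fmat bs k)) c"
    then obtain v where v: "v \<in> carrier_vec m" "v \<noteq> 0\<^sub>v m" "map_mat (\<lambda>p. Polynomial.poly p y) (fmat bs k) *\<^sub>v v = c \<cdot>\<^sub>v v"
      unfolding eigenvalue_def eigenvector_def by (auto simp: carrier_matD[OF fmat_carrier(1)])
    let ?A = "map_mat (\<lambda>p. Polynomial.poly (map_poly to_ac p) y) (amat bs k)" and ?F = "map_mat (\<lambda>p. Polynomial.poly p y) (fmat bs k)"
    have "?A *\<^sub>v (J *\<^sub>v v) = (?A * J) *\<^sub>v v" using v(1) by (intro assoc_mult_mat_vec[symmetric, of _ N N _ m]) auto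
    also have "\<dots> = J *\<^sub>v (?F *\<^sub>v v)" unfolding fmat_intertwines[OF bs] using v(1) by (intro assoc_mult_mat_vec[of _ N m _ m]) auto
    also have "\<dots> = c \<cdot>\<^sub>v (J *\<^sub>v v)" unfolding v(3) using v(1) by (intro mult_mat_vec[of _ N m]) auto
    finally show "eigenvalue ?A c"
      unfolding eigenvalue_def eigenvector_def using J_injective[OF v(1)] v(2)
      mult_mat_vec_carrier[OF J_carrier(1) v(1)]
      by (intro exI[of _ "J *\<^sub>v v"]) (auto simp: carrier_matD[OF fmat_carrier(2)])
  qed
  ultimately show ?thesis unfolding OE_eq by simp
qed

text \<open>Both sides are polynomials in T; at a natural number y they agree by
  \<open>W_bar_identity\<close> for the element \<open>bval bs k y\<close> of the order.\<close>

lemma K_identity: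
  assumes bs: "set bs \<subseteq> max_order D" and z: "\<And>b. b \<in> max_order D \<Longrightarrow> z \<in> W_bar D \<mu> n b" and f: "f \<in> {0..<n} \<rightarrow> {0..<N}"
  shows "(\<Sum>g\<in>{0..<n} \<rightarrow>\<^sub>E {0..<N}. (\<Prod>i<n. map_poly to_ac (amat bs k $$ (f i, g i))) * [:plK n g z:]) = det (fmat bs k) * [:plK n f z:]"
    (is "?l = ?r")
proof -
  have "Polynomial.poly (?l - ?r) (of_nat y) = 0" for y :: nat
  proof -
    let ?b = "bval bs k y"
    note b = bval_order(1)[OF bs, of k y]
    have bc: "?b \<in> carrier (alg D)" using b order_props(1) by blast
    have F: "map_mat (\<lambda>p. Polynomial.poly p (of_nat y)) (fmat bs k) = r1 ?b"
      by (rule eq_matI) (use bval_order(2)[OF bs, of _ _ k y] bc in \<open>auto simp: carrier_matD[OF fmat_carrier(1)]\<close>)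
    have "Polynomial.poly (map_poly to_ac p) (of_nat y) = to_ac (Polynomial.poly p (of_nat y))" for p :: "'q Polynomial.poly"
      using ac.poly_map_poly[of p "of_nat y"] by (simp add: ac.hom_of_nat)
    then have "abar ?b $$ (f i, g i) = Polynomial.poly (map_poly to_ac (amat bs k $$ (f i, g i))) (of_nat y)"
      if "g \<in> {0..<n} \<rightarrow>\<^sub>E {0..<N}" "i < n" for g i
      using bval_order(3)[OF bs, of "f i" "g i" k y] f that by (auto simp: abar_def PiE_def Pi_iff)
    then have "Polynomial.poly ?l (of_nat y) = (\<Sum>g\<in>{0..<n} \<rightarrow>\<^sub>E {0..<N}. (\<Prod>i<n. abar ?b $$ (f i, g i)) * plK n g z)"
      unfolding poly_sum poly_mult poly_prod by (intro sum.cong arg_cong2[of _ _ _ _ "(*)"] prod.cong) simp_all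
    moreover have "Polynomial.poly ?r (of_nat y) = det (r1 ?b) * plK n f z"
      unfolding poly_mult comm_ring_hom.hom_det[OF poly_hom, symmetric] F by simp
    moreover have "(\<Sum>g\<in>{0..<n} \<rightarrow>\<^sub>E {0..<N}. (\<Prod>i<n. abar ?b $$ (f i, g i)) * plK n g z) = det (r1 ?b) * plK n f z"
      by (rule W_bar_identity[OF _ b f]) (rule z)
    ultimately show ?thesis unfolding poly_diff by (simp only: diff_self)
  qed
  then have "?l - ?r = 0" by (rule poly_eq_0_if_nats)
  then show ?thesis by simp
qed

end

section \<open>Transport of the identity to \<open>R\<close>\<close>

context based_base_change
begin

lemma ext_module_Q: "ext_module S Q"
  by (rule ext_module.intro) (rule S_closed, rule module_Q)

lemma linear_family_coS: "f \<in> {0..<n} \<rightarrow> {0..<N} \<Longrightarrow> ext_module.linear_family S Q n (\<lambda>i. coS (f i))"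
  unfolding ext_module.linear_family_def[OF ext_module_Q]
  using based_module.co_add[OF based] based_module.co_smult[OF based] coS_closed by (auto simp: Pi_iff)

end

text \<open>This serves three maps: from the lattice over O_E to V over E, from there to
  \<open>Vbar D\<close>, and from the lattice over O_E to the lattice over \<open>R\<close>.\<close>

lemma pluecker_transfer:
  fixes n :: nat
  assumes X: "based_base_change A M S \<phi> N e co" and Y: "based_base_change A' M' S' \<phi>' N e co"
    and \<theta>: "hom_on S \<theta>" "\<theta> ` S \<subseteq> S'" "\<And>a. a \<in> A \<Longrightarrow> \<theta> (\<phi> a) = \<phi>' a" and A: "A \<subseteq> A'" and l: "linear_on A M M' id"
  defines "P \<equiv> base_change (subtring A) M (subtring S) \<phi>" and "P' \<equiv> base_change (subtring A') M' (subtring S') \<phi>'"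
  defines "g \<equiv> ext_map (subtring S') P' n (bc_map (subtring A') M' (subtring S') \<phi>' id \<theta>) \<theta>"
  assumes C: "C \<in> carrier (exterior_power (subtring S) P n)"
  shows "g C \<in> carrier (exterior_power (subtring S') P' n)"
    "f \<in> {0..<n} \<rightarrow> {0..<N} \<Longrightarrow> ext_module.pluecker n (\<lambda>i. based_base_change.coS \<phi>' co (f i)) (g C) =
      \<theta> (ext_module.pluecker n (\<lambda>i. based_base_change.coS \<phi> co (f i)) C)"
proof -
  interpret X: based_base_change A M S \<phi> N e co by (rule X)
  interpret Y: based_base_change A' M' S' \<phi>' N e co by (rule Y)
  have P: "P = X.Q" and P': "P' = Y.Q" unfolding P_def P'_def by (rule X.base_change_eq, rule Y.base_change_eq)
  note b = bc_map_id_coords[OF X Y \<theta> A l, folded P_def P'_def]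
  show "g C \<in> carrier (exterior_power (subtring S') P' n)"
    unfolding g_def
    by (rule ext_map_closed[OF X.ext_module_Q[folded P] Y.ext_module_Q[folded P'] \<theta>(1,2) _ _ _ C]) (use b(1-3) in auto)
  assume f: "f \<in> {0..<n} \<rightarrow> {0..<N}"
  show "ext_module.pluecker n (\<lambda>i. Y.coS (f i)) (g C) = \<theta> (ext_module.pluecker n (\<lambda>i. X.coS (f i)) C)"
    unfolding g_def
    by (rule pluecker_ext_map[OF X.ext_module_Q[folded P] Y.ext_module_Q[folded P'] \<theta>(1)
          X.linear_family_coS[OF f, folded P] Y.linear_family_coS[OF f, folded P'] _ C]) (use b(4) f in \<open>simp_all add: Pi_iff\<close>)
qed

lemma (in based_module) restrict_carrier_linear:
  assumes "S \<subseteq> A" "L \<subseteq> carrier M"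
  shows "linear_on S (restr M L) M id"
  using assms unfolding linear_on_def by auto

locale pel_model = pel_lattice p nrm D \<Lambda> N e co \<mu> m e1 co1
  for p and nrm :: "'q::field_char_0 \<Rightarrow> real" and D :: "('q, 'b, 'v) pel_datum" and \<Lambda> N e co \<mu> m e1 co1 +
  fixes \<phi> :: "'q alg_closure \<Rightarrow> 'r::comm_ring_1"
  assumes \<phi>: "hom_on (OE nrm D \<mu>) \<phi>"

sublocale pel_model \<subseteq> OO: based_base_change "Zp nrm" "restr (space D) \<Lambda>" "OE nrm D \<mu>" to_ac N e co
  by unfold_locales (simp_all add: hom_on_def ac.hom_add ac.hom_mult OE_closed to_ac_OE image_subset_iff padic_field_Zp(1)[OF padic])
sublocale pel_model \<subseteq> EE: based_base_change UNIV "space D" "reflex_field D \<mu>" to_ac N e co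
  by unfold_locales (simp_all add: hom_on_def ac.hom_add ac.hom_mult E_closed image_subset_iff)
sublocale pel_model \<subseteq> RR: based_base_change "Zp nrm" "restr (space D) \<Lambda>" UNIV "\<phi> \<circ> to_ac" N e co
proof unfold_locales
  show "hom_on (Zp nrm) (\<phi> \<circ> to_ac)"
    using \<phi> to_ac_OE unfolding hom_on_def by (simp add: ac.hom_add ac.hom_mult)
qed (simp_all add: padic_field_Zp(1)[OF padic])

context pel_model
begin

lemma lattice_carrier: "\<Lambda> \<subseteq> carrier (space D)"
proof -
  interpret Vz: module "subtring (Zp nrm)" "space D" by (rule restrict_scalars[OF V_module padic_field_Zp(1)[OF padic]])
  obtain Z where "Z \<subseteq> carrier (space D)" "\<Lambda> = mspan (subtring (Zp nrm)) (space D) Z"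
    using chain_lattice(1)[OF \<Lambda>] unfolding is_lattice_def by blast
  then show ?thesis using Vz.span_is_submodule[of Z] unfolding LinearCombinations.submodule_def by simp
qed

lemma amat_Zp:
  assumes bs: "set bs \<subseteq> max_order D" and ij: "i < N" "j < N"
  shows "Polynomial.coeff (amat bs k $$ (i, j)) l \<in> Zp nrm"
proof -
  have "rep (bs ! q) $$ (i, j) \<in> Zp nrm" if "q < length bs" for q using rep_Zp[OF subsetD[OF bs nth_mem[OF that]] ij] .
  then have "(\<Sum>q<length bs. if k ^ q = l then rep (bs ! q) $$ (i, j) else 0) \<in> Zp nrm"
    using closed_subringD(1)[OF padic_field_Zp(1)[OF padic]] by (intro closed_subring_sum[OF padic_field_Zp(1)[OF padic]]) auto
  then show ?thesis using ij by (simp add: amat_def coeff_sum)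
qed

abbreviation "LR \<equiv> lat nrm D tring (\<phi> \<circ> to_ac) \<Lambda>"

lemma LR_eq: "LR = RR.Q" using RR.base_change_eq by (simp add: subtring_UNIV)

definition plR where "plR n f = ext_module.pluecker n (\<lambda>i. RR.coS (f i))"
definition aR where "aR bs k = map_mat (map_poly (\<phi> \<circ> to_ac)) (amat bs k)"
definition dR where "dR bs k = map_poly \<phi> (det (fmat bs k))"
abbreviation "toR n \<equiv> ext_map tring LR n (bc_map (subtring (Zp nrm)) (restr (space D) \<Lambda>) tring (\<phi> \<circ> to_ac) id \<phi>) \<phi>"

lemma aR_carrier[simp]: "aR bs k \<in> carrier_mat N N" by (simp add: aR_def)

text \<open>The Pluecker coordinates of x lie in O_E and coincide with those of its image in the
  exterior power of \<open>Vbar D\<close>, where \<open>K_identity\<close> applies. By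
  \<open>det_fmat_OE\<close> all terms of that identity have coefficients in O_E, so
  \<open>\<phi>\<close> can be applied coefficient by coefficient.\<close>

lemma W_lat_identity:
  assumes bs: "set bs \<subseteq> max_order D" and x: "x \<in> W_lat nrm D \<mu> n \<Lambda>" and f: "f \<in> {0..<n} \<rightarrow> {0..<N}"
  shows "toR n x \<in> carrier (exterior_power tring LR n)"
    "(\<Sum>g\<in>{0..<n} \<rightarrow>\<^sub>E {0..<N}. (\<Prod>i<n. aR bs k $$ (f i, g i)) * [:plR n g (toR n x):]) = dR bs k * [:plR n f (toR n x):]"
proof -
  let ?E = "subtring (reflex_field D \<mu>)" and ?O = "subtring (OE nrm D \<mu>)" and ?G = "{0..<n} \<rightarrow>\<^sub>E {0..<N}"
  define y where "y = ext_map ?E (space_over D ?E to_ac) n (bc_map tring (space D) ?E to_ac id id) id x"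
  define z where "z = ext_map tring (Vbar D) n (bc_map tring (space D) tring to_ac id id) id y"
  have x: "x \<in> carrier (exterior_power ?O (lat nrm D ?O to_ac \<Lambda>) n)" and yW: "y \<in> W D \<mu> n"
    using x unfolding W_lat_def Let_def y_def by auto
  have yE: "y \<in> W_E D \<mu> n b" if "b \<in> max_order D" for b using yW that unfolding W_def by blast
  have y: "y \<in> carrier (exterior_power ?E (space_over D ?E to_ac) n)"
    using yE[OF order_props(2)] unfolding W_E_def Let_def by blast
  have zW: "z \<in> W_bar D \<mu> n b" if "b \<in> max_order D" for b using yE[OF that] unfolding W_E_def Let_def z_def by blast
  have \<Lambda>c: "\<Lambda> \<subseteq> carrier (space D)" by (rule lattice_carrier)
  have idl: "linear_on (Zp nrm) (restr (space D) \<Lambda>) (space D) id" by (rule V.restrict_carrier_linear) (use \<Lambda>c in auto)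
  have idL: "linear_on (Zp nrm) (restr (space D) \<Lambda>) (restr (space D) \<Lambda>) id" by (simp add: linear_on_def)
  have idV: "linear_on UNIV (space D) (space D) id" by (simp add: linear_on_def)
  \<comment> \<open>The common Pluecker coordinates of x, y and z; those of \<open>toR n x\<close>
    are their images under \<open>\<phi>\<close>.\<close>
  define plO where "plO g = ext_module.pluecker n (\<lambda>i. OO.coS (g i)) x" for g :: "nat \<Rightarrow> nat"
  have id: "hom_on S id" for S :: "'q alg_closure set" by (simp add: hom_on_def)
  have 1: "ext_module.pluecker n (\<lambda>i. EE.coS (g i)) y = plO g" if "g \<in> {0..<n} \<rightarrow> {0..<N}" for g
    using pluecker_transfer(2)[OF OO.based_base_change_axioms EE.based_base_change_axioms id _ _ _ idl x that]
    unfolding y_def plO_def subtring_UNIV by (auto simp: OE_eq)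
  have 2: "plK n g z = plO g" if g: "g \<in> {0..<n} \<rightarrow> {0..<N}" for g
  proof -
    have "plK n g z = id (ext_module.pluecker n (\<lambda>i. EE.coS (g i)) y)"
      unfolding z_def plK_def
      by (rule pluecker_transfer(2)[OF EE.based_base_change_axioms K.based_base_change_axioms id _ _ _ idV _ g, unfolded subtring_UNIV])
        (rule subset_UNIV, rule id_apply, rule subset_UNIV, rule y)
    then show ?thesis unfolding id_apply 1[OF g] .
  qed
  note tR = pluecker_transfer[OF OO.based_base_change_axioms RR.based_base_change_axioms \<phi> _ _ _ idL x, unfolded subtring_UNIV]
  show "toR n x \<in> carrier (exterior_power tring LR n)" by (rule tR(1)) (rule subset_UNIV, rule o_apply[symmetric], rule subset_refl)
  have 3: "plR n g (toR n x) = \<phi> (plO g)" if g: "g \<in> {0..<n} \<rightarrow> {0..<N}" for g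
    unfolding plR_def plO_def by (rule tR(2)[OF _ _ _ g]) (rule subset_UNIV, rule o_apply[symmetric], rule subset_refl)
  have plO: "plO g \<in> OE nrm D \<mu>" if g: "g \<in> {0..<n} \<rightarrow> {0..<N}" for g
    unfolding plO_def by (rule ext_module.pluecker_closed[OF OO.ext_module_Q OO.linear_family_coS[OF g]])
      (use x OO.base_change_eq ext_module.exterior_power_eq[OF OO.ext_module_Q, of n] in simp)
  let ?P = "{p. \<forall>i. Polynomial.coeff p i \<in> OE nrm D \<mu>}"
  note mp = hom_on_map_poly[OF \<phi> OE_closed]
  note Pc = closed_subring_polys[OF OE_closed]
  note OEz = closed_subringD(1)[OF OE_closed]
  have \<phi>0: "\<phi> 0 = 0" by (rule hom_onD(2)[OF \<phi> OE_closed])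
  have mc: "map_poly \<phi> [:a:] = [:\<phi> a:]" for a
    by (rule poly_eqI) (simp add: coeff_map_poly \<phi>0 coeff_pCons split: nat.splits)
  have constP: "[:a:] \<in> ?P" if "a \<in> OE nrm D \<mu>" for a using that OEz by (auto simp: coeff_pCons split: nat.splits)
  have amP: "map_poly to_ac (amat bs k $$ (i, j)) \<in> ?P" if ij: "i < N" "j < N" for i j
  proof -
    have "Polynomial.coeff (map_poly to_ac (amat bs k $$ (i, j))) l \<in> OE nrm D \<mu>" for l
      using amat_Zp[OF bs ij, of k l] to_ac_OE by (simp add: coeff_map_poly)
    then show ?thesis by blast
  qed
  have amR: "map_poly \<phi> (map_poly to_ac (amat bs k $$ (i, j))) = aR bs k $$ (i, j)" if "i < N" "j < N" for i j
    using that by (simp add: aR_def map_poly_map_poly \<phi>0 carrier_matD[OF fmat_carrier(2)])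
  have fG: "f i < N" "g i < N" if "g \<in> ?G" "i < n" for g i using f that by (auto simp: PiE_def Pi_iff)
  have gl: "g \<in> {0..<n} \<rightarrow> {0..<N}" if "g \<in> ?G" for g using that by (auto simp: PiE_def)
  have dP: "det (fmat bs k) \<in> ?P" using det_fmat_OE[OF bs] by blast
  have prP: "(\<Prod>i<n. map_poly to_ac (amat bs k $$ (f i, g i))) \<in> ?P" if "g \<in> ?G" for g
    by (rule closed_subring_prod[OF Pc]) (use amP fG[OF that] in auto)
  have "map_poly \<phi> (\<Sum>g\<in>?G. (\<Prod>i<n. map_poly to_ac (amat bs k $$ (f i, g i))) * [:plO g:]) =
      (\<Sum>g\<in>?G. map_poly \<phi> ((\<Prod>i<n. map_poly to_ac (amat bs k $$ (f i, g i))) * [:plO g:]))"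
    by (rule hom_on_sum[OF mp Pc], rule closed_subringD(6)[OF Pc prP constP[OF plO[OF gl]]])
  also have "\<dots> = (\<Sum>g\<in>?G. (\<Prod>i<n. aR bs k $$ (f i, g i)) * [:plR n g (toR n x):])"
  proof (rule sum.cong[OF refl])
    fix g assume g: "g \<in> ?G"
    have "map_poly \<phi> (\<Prod>i<n. map_poly to_ac (amat bs k $$ (f i, g i))) = (\<Prod>i<n. map_poly \<phi> (map_poly to_ac (amat bs k $$ (f i, g i))))"
      by (rule hom_on_prod[OF mp Pc]) (use amP fG[OF g] in auto)
    also have "\<dots> = (\<Prod>i<n. aR bs k $$ (f i, g i))" by (rule prod.cong[OF refl]) (use amR fG[OF g] in auto)
    finally show "map_poly \<phi> ((\<Prod>i<n. map_poly to_ac (amat bs k $$ (f i, g i))) * [:plO g:]) = (\<Prod>i<n. aR bs k $$ (f i, g i)) * [:plR n g (toR n x):]"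
      unfolding hom_onD(6)[OF mp Pc prP[OF g] constP[OF plO[OF gl[OF g]]]] 3[OF gl[OF g]] mc by simp
  qed
  finally have l: "map_poly \<phi> (\<Sum>g\<in>?G. (\<Prod>i<n. map_poly to_ac (amat bs k $$ (f i, g i))) * [:plO g:]) =
    (\<Sum>g\<in>?G. (\<Prod>i<n. aR bs k $$ (f i, g i)) * [:plR n g (toR n x):])" .
  have r: "map_poly \<phi> (det (fmat bs k) * [:plO f:]) = dR bs k * [:plR n f (toR n x):]"
    unfolding hom_onD(6)[OF mp Pc dP constP[OF plO[OF f]]] 3[OF f] dR_def mc ..
  have "(\<Sum>g\<in>?G. (\<Prod>i<n. map_poly to_ac (amat bs k $$ (f i, g i))) * [:plO g:]) = det (fmat bs k) * [:plO f:]"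
    using K_identity[OF bs zW f, of k] 2[OF f] 2[OF gl] by (simp cong: sum.cong)
  then show "(\<Sum>g\<in>?G. (\<Prod>i<n. aR bs k $$ (f i, g i)) * [:plR n g (toR n x):]) = dR bs k * [:plR n f (toR n x):]"
    unfolding l[symmetric] r[symmetric] by simp
qed

lemma LR_module: "module tring LR" using RR.module_Q unfolding LR_eq subtring_UNIV .

lemma span_identity:
  assumes bs: "set bs \<subseteq> max_order D" and w: "w \<in> mspan tring (exterior_power tring LR n) (toR n ` W_lat nrm D \<mu> n \<Lambda>)"
    and f: "f \<in> {0..<n} \<rightarrow> {0..<N}"
  shows "(\<Sum>g\<in>{0..<n} \<rightarrow>\<^sub>E {0..<N}. (\<Prod>i<n. aR bs k $$ (f i, g i)) * [:plR n g w:]) = dR bs k * [:plR n f w:]"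
proof -
  interpret X: ext_module UNIV RR.Q n by (rule RR.ext_module_Q)
  have eq: "exterior_power tring LR n = X.Q" using X.exterior_power_eq unfolding LR_eq subtring_UNIV .
  have Qm: "module tring X.Q" using X.module_Q by (simp add: subtring_UNIV)
  note lf = RR.linear_family_coS
  let ?G = "{0..<n} \<rightarrow>\<^sub>E {0..<N}"
  have gl: "g \<in> {0..<n} \<rightarrow> {0..<N}" if "g \<in> ?G" for g using that by (auto simp: PiE_def)
  define P where "P w \<longleftrightarrow> (\<Sum>g\<in>?G. (\<Prod>i<n. aR bs k $$ (f i, g i)) * [:plR n g w:]) = dR bs k * [:plR n f w:]" for w
  have sub: "toR n ` W_lat nrm D \<mu> n \<Lambda> \<subseteq> carrier X.Q" using W_lat_identity(1)[OF bs _ f] unfolding eq by blast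
  have "P w" using Qm sub w[unfolded eq]
  proof (rule mspan_induct)
    show "P \<zero>\<^bsub>X.Q\<^esub>" unfolding P_def plR_def using X.pluecker_zero[OF lf[OF gl]] X.pluecker_zero[OF lf[OF f]] by simp
    show "P (x \<oplus>\<^bsub>X.Q\<^esub> y)" if "x \<in> carrier X.Q" "y \<in> carrier X.Q" "P x" "P y" for x y
    proof -
      have add: "[:plR n g (x \<oplus>\<^bsub>X.Q\<^esub> y):] = [:plR n g x:] + [:plR n g y:]" if "g \<in> {0..<n} \<rightarrow> {0..<N}" for g
        unfolding plR_def using X.pluecker_add[OF lf[OF that] \<open>x \<in> carrier X.Q\<close> \<open>y \<in> carrier X.Q\<close>] by simp
      have "(\<Sum>g\<in>?G. (\<Prod>i<n. aR bs k $$ (f i, g i)) * [:plR n g (x \<oplus>\<^bsub>X.Q\<^esub> y):]) =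
          (\<Sum>g\<in>?G. (\<Prod>i<n. aR bs k $$ (f i, g i)) * [:plR n g x:] + (\<Prod>i<n. aR bs k $$ (f i, g i)) * [:plR n g y:])"
        by (rule sum.cong[OF refl]) (simp only: add[OF gl] distrib_left)
      then show ?thesis using that(3,4) unfolding P_def add[OF f] by (simp only: sum.distrib distrib_left)
    qed
    show "P (a \<odot>\<^bsub>X.Q\<^esub> x)" if "x \<in> carrier X.Q" "P x" for a x
    proof -
      have sm: "[:plR n g (a \<odot>\<^bsub>X.Q\<^esub> x):] = [:a:] * [:plR n g x:]" if "g \<in> {0..<n} \<rightarrow> {0..<N}" for g
        unfolding plR_def using X.pluecker_smult[OF lf[OF that] UNIV_I \<open>x \<in> carrier X.Q\<close>] by simp
      have "(\<Sum>g\<in>?G. (\<Prod>i<n. aR bs k $$ (f i, g i)) * [:plR n g (a \<odot>\<^bsub>X.Q\<^esub> x):]) =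
          (\<Sum>g\<in>?G. [:a:] * ((\<Prod>i<n. aR bs k $$ (f i, g i)) * [:plR n g x:]))"
        by (rule sum.cong[OF refl]) (simp only: sm[OF gl] mult_ac)
      then show ?thesis using that(2) unfolding P_def sm[OF f] by (simp only: sum_distrib_left[symmetric] mult_ac)
    qed
    show "P u" if "u \<in> toR n ` W_lat nrm D \<mu> n \<Lambda>" for u
      using that W_lat_identity(2)[OF bs _ f] unfolding P_def by blast
  qed
  then show ?thesis unfolding P_def .
qed

text \<open>Condition (K_n) places the wedge of any n elements of the summand in the span of the
  image of W(\<Lambda>), where \<open>span_identity\<close> applies; its Pluecker coordinates are
  the minors of the matrix of coordinates of the elements.\<close>

lemma R_identity:
  assumes bs: "set bs \<subseteq> max_order D" and F: "LinearCombinations.submodule tring F LR"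
    and Kn: "ext_map tring LR n id id ` carrier (exterior_power tring (restr LR F) n) \<subseteq>
      mspan tring (exterior_power tring LR n) (toR n ` W_lat nrm D \<mu> n \<Lambda>)"
    and xs: "length xs = n" "set xs \<subseteq> F" and f: "f \<in> {0..<n} \<rightarrow> {0..<N}"
  shows "(\<Sum>g\<in>{0..<n} \<rightarrow>\<^sub>E {0..<N}. (\<Prod>i<n. aR bs k $$ (f i, g i)) * [:det (mat n n (\<lambda>(i, j). RR.coS (g i) (xs ! j))):]) =
    dR bs k * [:det (mat n n (\<lambda>(i, j). RR.coS (f i) (xs ! j))):]"
proof -
  have Fm: "module (subtring UNIV) (restr LR F)"
    unfolding subtring_UNIV by (rule LinearCombinations.module.submodule_is_module[OF LR_module F])
  interpret Y: ext_module UNIV "restr LR F" n by (rule ext_module.intro[OF closed_subring_UNIV Fm])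
  have Fc: "F \<subseteq> carrier LR" using F unfolding LinearCombinations.submodule_def by auto
  have t: "xs \<in> tuples (restr LR F) n" using xs unfolding tuples_def by simp
  define w where "w = wedge (subtring UNIV) (restr LR F) xs"
  have "w \<in> carrier (exterior_power (subtring UNIV) (restr LR F) n)"
    unfolding w_def Y.exterior_power_eq Y.wedge_eq[OF xs(1)] Y.carrier_Q by (rule imageI[OF Y.single_finsupp[OF t]])
  note wc = this[unfolded subtring_UNIV]
  define u where "u = ext_map tring LR n id id w"
  have "u \<in> mspan tring (exterior_power tring LR n) (toR n ` W_lat nrm D \<mu> n \<Lambda>)"
    unfolding u_def by (rule subsetD[OF Kn imageI[OF wc]])
  note span = span_identity[OF bs this f, of k]
  have pl: "plR n g u = det (mat n n (\<lambda>(i, j). RR.coS (g i) (xs ! j)))" if g: "g \<in> {0..<n} \<rightarrow> {0..<N}" for g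
  proof -
    note lg = RR.linear_family_coS[OF g, folded LR_eq]
    have lY: "Y.linear_family (\<lambda>i. RR.coS (g i))"
      using lg Fc unfolding Y.linear_family_def ext_module.linear_family_def[OF RR.ext_module_Q[folded LR_eq]] by (auto simp: subset_iff)
    have "plR n g u = id (Y.pluecker (\<lambda>i. RR.coS (g i)) w)"
      unfolding plR_def u_def
      by (rule pluecker_ext_map[OF Y.ext_module_axioms RR.ext_module_Q[folded LR_eq] _ lY lg, unfolded subtring_UNIV])
        (simp add: hom_on_def, simp only: id_apply, rule wc)
    also have "\<dots> = det (mat n n (\<lambda>(j, i). RR.coS (g i) (xs ! j)))"
      unfolding id_apply w_def Y.pluecker_wedge[OF lY t] form_det_def ..
    also have "mat n n (\<lambda>(j, i). RR.coS (g i) (xs ! j)) = transpose_mat (mat n n (\<lambda>(i, j). RR.coS (g i) (xs ! j)))"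
      by (rule eq_matI) auto
    finally show ?thesis using det_transpose[of "mat n n (\<lambda>(i, j). RR.coS (g i) (xs ! j))" n] by simp
  qed
  have "(\<Sum>g\<in>{0..<n} \<rightarrow>\<^sub>E {0..<N}. (\<Prod>i<n. aR bs k $$ (f i, g i)) * [:det (mat n n (\<lambda>(i, j). RR.coS (g i) (xs ! j))):]) =
     (\<Sum>g\<in>{0..<n} \<rightarrow>\<^sub>E {0..<N}. (\<Prod>i<n. aR bs k $$ (f i, g i)) * [:plR n g u:])"
    by (rule sum.cong[OF refl], subst pl) (auto simp: PiE_def)
  then show ?thesis unfolding span pl[OF f] .
qed

end

section \<open>Prime ideals and projections onto a summand\<close>

text \<open>An ideal maximal among the proper ideals containing I, obtained by Zorn's lemma, is
  prime.\<close>

lemma prime_ideal_exists: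
  fixes I :: "'r::comm_ring_1 set"
  assumes I: "0 \<in> I" "\<And>x y. x \<in> I \<Longrightarrow> y \<in> I \<Longrightarrow> x + y \<in> I" "\<And>r x. x \<in> I \<Longrightarrow> r * x \<in> I" "1 \<notin> I"
  obtains P where "primeideal P (tring :: 'r ring)" "I \<subseteq> P"
proof -
  define id where "id J \<longleftrightarrow> 0 \<in> J \<and> (\<forall>x\<in>J. \<forall>y\<in>J. x + y \<in> J) \<and> (\<forall>r. \<forall>x\<in>J. r * x \<in> J) \<and> 1 \<notin> J" for J :: "'r set"
  define A where "A = {J. id J \<and> I \<subseteq> J}"
  have "\<exists>M\<in>A. \<forall>J\<in>A. M \<subseteq> J \<longrightarrow> J = M"
  proof (rule subset_Zorn_nonempty)
    have "I \<in> A" unfolding A_def id_def using I by auto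
    then show "A \<noteq> {}" by blast
    fix C assume C: "C \<noteq> {}" "subset.chain A C"
    have CA: "\<And>J. J \<in> C \<Longrightarrow> id J \<and> I \<subseteq> J" using C(2) unfolding subset.chain_def A_def by blast
    have tot: "\<And>J K. J \<in> C \<Longrightarrow> K \<in> C \<Longrightarrow> J \<subseteq> K \<or> K \<subseteq> J" using C(2) unfolding subset.chain_def by blast
    obtain J0 where J0: "J0 \<in> C" using C(1) by blast
    have "id (\<Union>C)"
      unfolding id_def
    proof (intro conjI ballI allI)
      show "0 \<in> \<Union>C" using CA[OF J0] J0 unfolding id_def by blast
      show "1 \<notin> \<Union>C" using CA unfolding id_def by blast
      show "r * x \<in> \<Union>C" if "x \<in> \<Union>C" for r x using that CA unfolding id_def by blast
      fix x y assume "x \<in> \<Union>C" "y \<in> \<Union>C"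
      then obtain J K where JK: "J \<in> C" "K \<in> C" "x \<in> J" "y \<in> K" by blast
      then obtain L where L: "L \<in> C" "x \<in> L" "y \<in> L" using tot[OF JK(1,2)] by blast
      then have "x + y \<in> L" using CA[OF L(1)] unfolding id_def by blast
      then show "x + y \<in> \<Union>C" using L(1) by blast
    qed
    moreover have "I \<subseteq> \<Union>C" using CA[OF J0] J0 by blast
    ultimately show "\<Union>C \<in> A" unfolding A_def by blast
  qed
  then obtain P where PA: "P \<in> A" and max': "\<forall>J\<in>A. P \<subseteq> J \<longrightarrow> J = P" by (elim bexE)
  have P: "id P" "I \<subseteq> P" using PA unfolding A_def by simp_all
  have max: "J = P" if "id J" "P \<subseteq> J" for J
  proof -
    have "J \<in> A" using that P(2) unfolding A_def by simp
    then show ?thesis using max' that(2) by simp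
  qed
  have P1: "0 \<in> P" "\<And>x y. x \<in> P \<Longrightarrow> y \<in> P \<Longrightarrow> x + y \<in> P" "\<And>r x. x \<in> P \<Longrightarrow> r * x \<in> P" "1 \<notin> P"
    using P(1) unfolding id_def by auto
  have inv: "\<exists>x\<in>P. \<exists>r. x + r * a = 1" if a: "a \<notin> P" for a
  proof (rule ccontr)
    assume n: "\<not> ?thesis"
    let ?J = "{x + r * a | x r. x \<in> P}"
    have "id ?J" unfolding id_def
    proof (intro conjI ballI allI)
      show "0 \<in> ?J" using P1(1) by (intro CollectI exI[of _ 0]) simp
      show "1 \<notin> ?J" using n by force
      show "r * x \<in> ?J" if x: "x \<in> ?J" for r x
      proof -
        obtain y t where y: "x = y + t * a" "y \<in> P" using x by blast
        then show ?thesis using P1(3)[OF y(2), of r] by (intro CollectI exI[of _ "r * y"] exI[of _ "r * t"]) (simp add: algebra_simps)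
      qed
      fix x y assume x: "x \<in> ?J" and y: "y \<in> ?J"
      obtain u t where u: "x = u + t * a" "u \<in> P" using x by blast
      obtain v w where v: "y = v + w * a" "v \<in> P" using y by blast
      show "x + y \<in> ?J" using P1(2)[OF u(2) v(2)] u v by (intro CollectI exI[of _ "u + v"] exI[of _ "t + w"]) (simp add: algebra_simps)
    qed
    moreover have "P \<subseteq> ?J" 
    proof
      fix x assume "x \<in> P" then show "x \<in> ?J" by (intro CollectI exI[of _ x] exI[of _ 0]) simp
    qed
    ultimately have "?J = P" by (rule max)
    moreover have "a \<in> ?J" using P1(1) by (intro CollectI exI[of _ 0] exI[of _ 1]) simp
    ultimately show False using a by blast
  qed
  interpret t: cring "tring :: 'r ring" using cring_subtring[OF closed_subring_UNIV] unfolding subtring_UNIV .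
  have "primeideal P (tring :: 'r ring)"
  proof (rule primeidealI2)
    show "additive_subgroup P (tring :: 'r ring)"
    proof (rule additive_subgroup.intro, rule subgroup.intro)
      show "inv\<^bsub>add_monoid tring\<^esub> x \<in> P" if "x \<in> P" for x
      proof -
        have "\<ominus>\<^bsub>tring\<^esub> x = - x" using t.minus_equality[of "- x" x] by simp
        then show ?thesis using P1(3)[OF that, of "- 1"] by (simp add: a_inv_def)
      qed
    qed (use P1 in auto)
    show "a \<in> P \<or> b \<in> P" if "a \<otimes>\<^bsub>tring\<^esub> b \<in> P" for a b
    proof (rule ccontr)
      assume "\<not> ?thesis"
      then obtain x r y w where x: "x \<in> P" "x + r * a = 1" and y: "y \<in> P" "y + w * b = 1" using inv[of a] inv[of b] by auto
      have "1 = (x + r * a) * (y + w * b)" unfolding x(2) y(2) by simp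
      also have "\<dots> = ((y + w * b) * x + (r * a) * y) + (r * w) * (a * b)" by (simp add: algebra_simps)
      also have "\<dots> \<in> P" by (rule P1(2)[OF P1(2)[OF P1(3)[OF x(1)] P1(3)[OF y(1)]] P1(3)[of "a * b"]]) (use that in simp)
      finally show False using P1(4) by simp
    qed
    show "carrier tring \<noteq> P" using P1(4) by auto
    show "x \<otimes>\<^bsub>tring\<^esub> a \<in> P" if "a \<in> P" for a x using P1(3)[OF that] by simp
    show "a \<otimes>\<^bsub>tring\<^esub> x \<in> P" if "a \<in> P" for a x using P1(3)[OF that, of x] by (simp add: mult.commute)
  qed (rule t.is_cring)
  then show ?thesis using P(2) by (rule that)
qed

lemma prime_ideal_complement:
  assumes P: "primeideal P (tring :: 'r::comm_ring_1 ring)"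
  shows "1 \<notin> P" "a \<notin> P \<Longrightarrow> b \<notin> P \<Longrightarrow> a * b \<notin> P" "finite I \<Longrightarrow> (\<And>i. i \<in> I \<Longrightarrow> s i \<notin> P) \<Longrightarrow> prod s I \<notin> P"
    "a \<notin> P \<Longrightarrow> a ^ k \<notin> P"
proof -
  interpret P: primeideal P "tring :: 'r ring" by (rule P)
  show 1: "1 \<notin> P" using P.I_notcarr P.one_imp_carrier by auto
  show 2: "a * b \<notin> P" if "a \<notin> P" "b \<notin> P" for a b using P.I_prime[of a b] that by auto
  show "finite I \<Longrightarrow> (\<And>i. i \<in> I \<Longrightarrow> s i \<notin> P) \<Longrightarrow> prod s I \<notin> P"
    by (induct I rule: finite_induct) (simp_all add: 1 2)
  show "a \<notin> P \<Longrightarrow> a ^ k \<notin> P" by (induct k) (simp_all add: 1 2)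
qed

lemma proj_along_props:
  assumes M: "module tring M" and c: "complementary tring M P C"
  shows "linear_on UNIV M M (proj_along M P C)" "x \<in> carrier M \<Longrightarrow> proj_along M P C x \<in> P" "y \<in> P \<Longrightarrow> proj_along M P C y = y"
    "LinearCombinations.submodule tring P M"
proof -
  interpret M: module tring M by (rule M)
  let ?p = "proj_along M P C"
  have PC: "LinearCombinations.submodule tring P M" "LinearCombinations.submodule tring C M"
    using c module_submodule_iff[OF _ M] unfolding complementary_def by auto
  show "LinearCombinations.submodule tring P M" by (rule PC(1))
  have P: "P \<subseteq> carrier M" "\<zero>\<^bsub>M\<^esub> \<in> P" "\<And>x y. x \<in> P \<Longrightarrow> y \<in> P \<Longrightarrow> x \<oplus>\<^bsub>M\<^esub> y \<in> P" "\<And>a x. x \<in> P \<Longrightarrow> a \<odot>\<^bsub>M\<^esub> x \<in> P"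
    and C: "C \<subseteq> carrier M" "\<zero>\<^bsub>M\<^esub> \<in> C" "\<And>x y. x \<in> C \<Longrightarrow> y \<in> C \<Longrightarrow> x \<oplus>\<^bsub>M\<^esub> y \<in> C" "\<And>a x. x \<in> C \<Longrightarrow> a \<odot>\<^bsub>M\<^esub> x \<in> C"
    using PC unfolding LinearCombinations.submodule_def by auto
  have ex: "\<exists>y\<in>P. \<exists>z\<in>C. x = y \<oplus>\<^bsub>M\<^esub> z" if "x \<in> carrier M" for x
    using c that unfolding complementary_def by (blast elim: ex1E)
  have un: "y = y'" if "x \<in> carrier M" "y \<in> P" "z \<in> C" "x = y \<oplus>\<^bsub>M\<^esub> z" "y' \<in> P" "z' \<in> C" "x = y' \<oplus>\<^bsub>M\<^esub> z'" for x y z y' z'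
  proof -
    have "\<exists>!(y, z). y \<in> P \<and> z \<in> C \<and> x = y \<oplus>\<^bsub>M\<^esub> z" using c that(1) unfolding complementary_def by blast
    then obtain r where r: "\<forall>r'. (case r' of (y, z) \<Rightarrow> y \<in> P \<and> z \<in> C \<and> x = y \<oplus>\<^bsub>M\<^esub> z) \<longrightarrow> r' = r"
      unfolding Ex1_def by (elim exE conjE)
    have "(y, z) = r" "(y', z') = r" using r that by blast+
    then show ?thesis by blast
  qed
  have val: "?p x = y" if "x \<in> carrier M" "y \<in> P" "z \<in> C" "x = y \<oplus>\<^bsub>M\<^esub> z" for x y z
    unfolding proj_along_def
  proof (rule the_equality)
    show "y \<in> P \<and> (\<exists>z\<in>C. x = y \<oplus>\<^bsub>M\<^esub> z)" using that by blast
    show "y' = y" if "y' \<in> P \<and> (\<exists>z\<in>C. x = y' \<oplus>\<^bsub>M\<^esub> z)" for y'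
      using un[of x y' _ y z] that \<open>x \<in> carrier M\<close> \<open>y \<in> P\<close> \<open>z \<in> C\<close> \<open>x = y \<oplus>\<^bsub>M\<^esub> z\<close> by blast
  qed
  show inP: "?p x \<in> P" if "x \<in> carrier M" for x
  proof -
    obtain y z where "y \<in> P" "z \<in> C" "x = y \<oplus>\<^bsub>M\<^esub> z" using ex[OF \<open>x \<in> carrier M\<close>] by blast
    then show ?thesis using val[OF \<open>x \<in> carrier M\<close>, of y z] by simp
  qed
  show "?p y = y" if "y \<in> P" for y by (rule val[of _ _ "\<zero>\<^bsub>M\<^esub>"]) (use that P(1) C(2) in auto)
  show "linear_on UNIV M M ?p"
    unfolding linear_on_def
  proof (intro conjI ballI Pi_I)
    fix x assume x: "x \<in> carrier M"
    show "?p x \<in> carrier M" using inP[OF x] P(1) by blast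
  next
    fix x y assume x: "x \<in> carrier M" and y: "y \<in> carrier M"
    obtain a b where a: "a \<in> P" "b \<in> C" "x = a \<oplus>\<^bsub>M\<^esub> b" using ex[OF x] by blast
    obtain a' b' where a': "a' \<in> P" "b' \<in> C" "y = a' \<oplus>\<^bsub>M\<^esub> b'" using ex[OF y] by blast
    have car: "a \<in> carrier M" "b \<in> carrier M" "a' \<in> carrier M" "b' \<in> carrier M" using a a' P(1) C(1) by auto
    have "?p (x \<oplus>\<^bsub>M\<^esub> y) = a \<oplus>\<^bsub>M\<^esub> a'"
      by (rule val[of _ _ "b \<oplus>\<^bsub>M\<^esub> b'"]) (use x y a a' car P(3) C(3) in \<open>simp_all add: M.M.add.m_ac\<close>)
    then show "?p (x \<oplus>\<^bsub>M\<^esub> y) = ?p x \<oplus>\<^bsub>M\<^esub> ?p y" using val[OF x a] val[OF y a'] by simp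
  next
    fix r x assume x: "x \<in> carrier M"
    obtain a b where a: "a \<in> P" "b \<in> C" "x = a \<oplus>\<^bsub>M\<^esub> b" using ex[OF x] by blast
    have car: "a \<in> carrier M" "b \<in> carrier M" using a P(1) C(1) by auto
    have "?p (r \<odot>\<^bsub>M\<^esub> x) = r \<odot>\<^bsub>M\<^esub> a"
      by (rule val[of _ _ "r \<odot>\<^bsub>M\<^esub> b"]) (use x a car P(4) C(4) M.smult_r_distr in simp_all)
    then show "?p (r \<odot>\<^bsub>M\<^esub> x) = r \<odot>\<^bsub>M\<^esub> ?p x" using val[OF x a] by simp
  qed
qed

section \<open>Determinants of generic endomorphisms of a direct summand\<close>

abbreviation const_mat :: "'a::comm_ring_1 mat \<Rightarrow> 'a Polynomial.poly mat" where "const_mat \<equiv> map_mat (\<lambda>a. [:a:])"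

definition pencil :: "nat \<Rightarrow> nat \<Rightarrow> (nat \<Rightarrow> 'a::comm_ring_1 mat) \<Rightarrow> nat \<Rightarrow> nat \<Rightarrow> 'a Polynomial.poly mat" where
  "pencil t k G r c = mat r c (\<lambda>(i, j). \<Sum>l<t. Polynomial.monom (G l $$ (i, j)) (k ^ l))"

lemma pencil_carrier[simp]: "pencil t k G r c \<in> carrier_mat r c" by (simp add: pencil_def)

lemma monom_sum_eq: "(\<Sum>i\<in>I. Polynomial.monom (f i) k) = Polynomial.monom (\<Sum>i\<in>I. f i) k"
  by (induct I rule: infinite_finite_induct) (simp_all add: add_monom)

lemma pencil_mult_const:
  assumes "\<And>l. G l \<in> carrier_mat r c" "C \<in> carrier_mat c d"
  shows "pencil t k G r c * const_mat C = pencil t k (\<lambda>l. G l * C) r d"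
proof (rule eq_matI)
  fix i j assume "i < dim_row (pencil t k (\<lambda>l. G l * C) r d)" "j < dim_col (pencil t k (\<lambda>l. G l * C) r d)"
  then have ij: "i < r" "j < d" by (auto simp: pencil_def)
  have "(pencil t k G r c * const_mat C) $$ (i, j) = (\<Sum>a<c. \<Sum>l<t. Polynomial.monom (G l $$ (i, a) * C $$ (a, j)) (k ^ l))"
    using ij assms(2) by (simp add: pencil_def scalar_prod_def atLeast0LessThan smult_sum2 smult_monom mult.commute)
  also have "\<dots> = (\<Sum>l<t. Polynomial.monom (\<Sum>a<c. G l $$ (i, a) * C $$ (a, j)) (k ^ l))"
    by (subst sum.swap) (simp add: monom_sum_eq)
  also have "\<dots> = pencil t k (\<lambda>l. G l * C) r d $$ (i, j)"
    using ij assms(2) carrier_matD[OF assms(1)] by (simp add: pencil_def scalar_prod_def atLeast0LessThan)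
  finally show "(pencil t k G r c * const_mat C) $$ (i, j) = pencil t k (\<lambda>l. G l * C) r d $$ (i, j)" .
qed (use assms in \<open>auto simp: pencil_def\<close>)

lemma const_mult_pencil:
  assumes "\<And>l. G l \<in> carrier_mat r c" "C \<in> carrier_mat d r"
  shows "const_mat C * pencil t k G r c = pencil t k (\<lambda>l. C * G l) d c"
proof (rule eq_matI)
  fix i j assume "i < dim_row (pencil t k (\<lambda>l. C * G l) d c)" "j < dim_col (pencil t k (\<lambda>l. C * G l) d c)"
  then have ij: "i < d" "j < c" by (auto simp: pencil_def)
  have "(const_mat C * pencil t k G r c) $$ (i, j) = (\<Sum>a<r. \<Sum>l<t. Polynomial.monom (C $$ (i, a) * G l $$ (a, j)) (k ^ l))"
    using ij assms(2) by (simp add: pencil_def scalar_prod_def atLeast0LessThan smult_sum2 smult_monom)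
  also have "\<dots> = (\<Sum>l<t. Polynomial.monom (\<Sum>a<r. C $$ (i, a) * G l $$ (a, j)) (k ^ l))"
    by (subst sum.swap) (simp add: monom_sum_eq)
  also have "\<dots> = pencil t k (\<lambda>l. C * G l) d c $$ (i, j)"
    using ij assms(2) carrier_matD[OF assms(1)] by (simp add: pencil_def scalar_prod_def atLeast0LessThan)
  finally show "(const_mat C * pencil t k G r c) $$ (i, j) = pencil t k (\<lambda>l. C * G l) d c $$ (i, j)" .
qed (use assms in \<open>auto simp: pencil_def\<close>)

lemma const_mat_mult:
  assumes "A \<in> carrier_mat r c" "B \<in> carrier_mat c d" shows "const_mat (A * B) = const_mat A * const_mat (B :: 'a::comm_ring_1 mat)"
proof -
  interpret h: comm_ring_hom "\<lambda>a :: 'a. [:a:]" by unfold_locales (auto simp: one_pCons)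
  show ?thesis by (rule h.mat_hom_mult[OF assms])
qed

text \<open>If the exterior power of A multiplies the wedge of the columns of M by d, then so does
  every maximal minor after a further linear map T: expand both determinants by Cauchy-Binet along
  T.\<close>

lemma det_compound:
  fixes A M T :: "'a::comm_ring_1 mat"
  assumes T: "T \<in> carrier_mat n N" and A: "A \<in> carrier_mat N N" and M: "M \<in> carrier_mat N n"
    and eq: "\<And>f. f \<in> {0..<n} \<rightarrow> {0..<N} \<Longrightarrow>
      (\<Sum>g\<in>{0..<n} \<rightarrow>\<^sub>E {0..<N}. (\<Prod>i<n. A $$ (f i, g i)) * det (mat n n (\<lambda>(i, j). M $$ (g i, j)))) = d * det (mat n n (\<lambda>(i, j). M $$ (f i, j)))"
  shows "det (T * (A * M)) = d * det (T * M)"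
proof -
  let ?G = "{0..<n} \<rightarrow>\<^sub>E {0..<N}"
  have 1: "det (mat n n (\<lambda>(i, j). (A * M) $$ (f i, j))) = d * det (mat n n (\<lambda>(i, j). M $$ (f i, j)))" if f: "f \<in> {0..<n} \<rightarrow> {0..<N}" for f
  proof -
    define Af where "Af = mat n N (\<lambda>(i, k). A $$ (f i, k))"
    have Af: "Af \<in> carrier_mat n N" by (simp add: Af_def)
    have "mat n n (\<lambda>(i, j). (A * M) $$ (f i, j)) = Af * M"
      by (rule eq_matI) (use f A M in \<open>auto simp: Af_def scalar_prod_def Pi_iff\<close>)
    then have "det (mat n n (\<lambda>(i, j). (A * M) $$ (f i, j))) = (\<Sum>g\<in>?G. (\<Prod>i<n. Af $$ (i, g i)) * det (mat n n (\<lambda>(i, j). M $$ (g i, j))))"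
      using det_mult_rect[OF Af M] by simp
    also have "\<dots> = (\<Sum>g\<in>?G. (\<Prod>i<n. A $$ (f i, g i)) * det (mat n n (\<lambda>(i, j). M $$ (g i, j))))"
      by (intro sum.cong arg_cong2[of _ _ _ _ "(*)"] prod.cong refl) (auto simp: Af_def PiE_def Pi_iff)
    finally show ?thesis unfolding eq[OF f] .
  qed
  have AM: "A * M \<in> carrier_mat N n" using A M by simp
  have "det (T * (A * M)) = (\<Sum>f\<in>?G. (\<Prod>i<n. T $$ (i, f i)) * (d * det (mat n n (\<lambda>(i, j). M $$ (f i, j)))))"
    unfolding det_mult_rect[OF T AM] by (rule sum.cong[OF refl], subst 1) (auto simp: PiE_def)
  also have "\<dots> = d * det (T * M)" unfolding det_mult_rect[OF T M] by (simp add: sum_distrib_left mult_ac)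
  finally show ?thesis .
qed

text \<open>After inverting \<open>s\<close>, the columns of \<open>U\<close> are a basis of the image of the projection \<open>P\<close>, in which \<open>G\<close> has the matrix
  \<open>C G U\<close>; Sylvester's determinant identity compares the two determinants.\<close>

lemma det_summand:
  fixes P U C :: "'a::comm_ring_1 mat"
  assumes P: "P \<in> carrier_mat q q" and U: "U \<in> carrier_mat q n" and C: "C \<in> carrier_mat n q" and G: "G \<in> carrier_mat q q"
    and UC: "U * C = s \<cdot>\<^sub>m P" and CU: "C * U = s \<cdot>\<^sub>m 1\<^sub>m n"
    and d: "det (const_mat C * (G * const_mat U)) = d * det (const_mat C * const_mat U)"
  shows "[:s ^ (n + q):] * det ((1\<^sub>m q - const_mat P) + G * const_mat P) = [:s ^ (n + q):] * d"
proof -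
  let ?s = "[:s:]" and ?P = "const_mat P" and ?U = "const_mat U" and ?C = "const_mat C"
  have car: "?P \<in> carrier_mat q q" "?U \<in> carrier_mat q n" "?C \<in> carrier_mat n q" using P U C by auto
  \<comment> \<open>Sylvester's identity is applied to (G - 1)U and C. Because UC = sP and CU = s,
    the two sums become s((1 - P) + GP) and CGU.\<close>
  let ?M = "(G - 1\<^sub>m q) * ?U" and ?L = "(1\<^sub>m q - ?P) + G * ?P"
  have M: "?M \<in> carrier_mat q n" using G car by auto
  have L: "?L \<in> carrier_mat q q" using G car by auto
  have sm: "const_mat (s \<cdot>\<^sub>m A) = ?s \<cdot>\<^sub>m const_mat A" for A by (rule eq_matI) auto
  have c1: "const_mat (1\<^sub>m r) = 1\<^sub>m r" for r by (rule eq_matI) (auto simp: one_pCons)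
  have UC': "?U * ?C = ?s \<cdot>\<^sub>m ?P" using const_mat_mult[OF U C] UC sm by simp
  have CU': "?C * ?U = ?s \<cdot>\<^sub>m 1\<^sub>m n" unfolding const_mat_mult[OF C U, symmetric] CU sm c1 ..
  have "?M * ?C = (G - 1\<^sub>m q) * (?U * ?C)" by (rule assoc_mult_mat[of _ q q _ n _ q]) (use G car in auto)
  also have "\<dots> = ?s \<cdot>\<^sub>m ((G - 1\<^sub>m q) * ?P)" unfolding UC' by (rule mult_smult_distrib[of _ q q]) (use G car in auto)
  also have "(G - 1\<^sub>m q) * ?P = G * ?P - ?P" using minus_mult_distrib_mat[of G q q "1\<^sub>m q" ?P q] G car by simp
  finally have MC: "?M * ?C = ?s \<cdot>\<^sub>m (G * ?P - ?P)" .
  have 1: "?s \<cdot>\<^sub>m 1\<^sub>m q + ?M * ?C = ?s \<cdot>\<^sub>m ?L" unfolding MC by (rule eq_matI) (use G car in \<open>auto simp: algebra_simps\<close>)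
  have GU: "G * ?U \<in> carrier_mat q n" using G car by auto
  have "?M = G * ?U - ?U" using minus_mult_distrib_mat[of G q q "1\<^sub>m q" ?U n] G car by simp
  then have "?C * ?M = ?C * (G * ?U) - ?C * ?U" using mult_minus_distrib_mat[OF car(3) GU car(2)] by simp
  then have 2: "?s \<cdot>\<^sub>m 1\<^sub>m n + ?C * ?M = ?C * (G * ?U)" unfolding CU' by (intro eq_matI) (use GU car in auto)
  have "?s ^ n * det (?s \<cdot>\<^sub>m ?L) = ?s ^ q * det (?C * (G * ?U))"
    using det_one_plus_commute_scaled[OF M car(3), of ?s] unfolding 1 2 .
  moreover have "det (?s \<cdot>\<^sub>m ?L) = ?s ^ q * det ?L" using L P by simp
  moreover have "det (?C * ?U) = ?s ^ n" unfolding CU' by (simp add: det_one)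
  ultimately have "?s ^ n * (?s ^ q * det ?L) = ?s ^ q * (d * ?s ^ n)" unfolding d by simp
  moreover have "[:s ^ (n + q):] = ?s ^ n * ?s ^ q" by (simp add: poly_const_pow power_add)
  ultimately show ?thesis by (simp only: mult_ac)
qed

lemma det_pencil_kronecker:
  fixes M :: "('a::comm_ring_1, 'm) module"
  defines "q \<equiv> length (chosen_basis tring M)"
  shows "kronecker k (det_pencil tring M g fs) =
      det (mat q q (\<lambda>(i, j). [:end_mat tring M g $$ (i, j):] + (\<Sum>l<length fs. Polynomial.monom (end_mat tring M (fs ! l) $$ (i, j)) (k ^ l))))"
    "exps_le q (det_pencil tring M g fs)"
proof -
  define A where "A = mat q q (\<lambda>(i, j). Poly_Mapping.single 0 (end_mat tring M g $$ (i, j)) +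
      (\<Sum>l<length fs. Poly_Mapping.single (Poly_Mapping.single l (1 :: nat)) (end_mat tring M (fs ! l) $$ (i, j))))"
  have A: "A \<in> carrier_mat q q" by (simp add: A_def)
  have eq: "det_pencil tring M g fs = det A" unfolding det_pencil_def Let_def A_def q_def ..
  have k0: "kcode k 0 = 0" and k1: "kcode k (Poly_Mapping.single l 1) = k ^ l" for l by (simp_all add: kcode_def)
  show "kronecker k (det_pencil tring M g fs) =
      det (mat q q (\<lambda>(i, j). [:end_mat tring M g $$ (i, j):] + (\<Sum>l<length fs. Polynomial.monom (end_mat tring M (fs ! l) $$ (i, j)) (k ^ l))))"
    unfolding eq comm_ring_hom.hom_det[OF kronecker_hom, symmetric]
    by (rule arg_cong[of _ _ det], rule eq_matI)
      (simp_all add: A_def kronecker_add kronecker_sum kronecker_single k0 k1[unfolded One_nat_def] monom_0)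
  show "exps_le q (det_pencil tring M g fs)" unfolding eq
  proof (rule exps_le_det[OF A])
    fix i j assume "i < q" "j < q"
    then show "exps_le 1 (A $$ (i, j))"
      by (simp add: A_def, intro exps_le_add exps_le_sum) (auto simp: exps_le_def lookup_single when_def split: if_splits)
  qed
qed

context pel_model
begin

abbreviation "beta b \<equiv> lat_map nrm D tring (\<phi> \<circ> to_ac) \<Lambda> (act D b)"

lemma beta_linear:
  assumes b: "b \<in> max_order D"
  shows "linear_on UNIV LR LR (beta b)"
    "i < N \<Longrightarrow> j < N \<Longrightarrow> RR.coS i (beta b (RR.pure (e j))) = \<phi> (to_ac (rep b $$ (i, j)))"
proof -
  have bc: "b \<in> carrier (alg D)" using b order_props(1) by blast
  have lin: "linear_on (Zp nrm) (restr (space D) \<Lambda>) (restr (space D) \<Lambda>) (act D b)"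
    unfolding linear_on_def using chain_lattice(2)[OF \<Lambda> b] act_props[OF bc] lattice_carrier by (simp add: Pi_iff subset_iff)
  show "linear_on UNIV LR LR (beta b)" using RR.bc_map_linear(1)[OF lin] unfolding LR_eq subtring_UNIV .
  show "RR.coS i (beta b (RR.pure (e j))) = \<phi> (to_ac (rep b $$ (i, j)))" if "i < N" "j < N"
    using arg_cong[OF RR.bc_map_linear(2)[OF lin], of "\<lambda>A. A $$ (i, j)"] that
    unfolding subtring_UNIV rep_def by (simp add: L.mat_of_def V.mat_of_def)
qed

lemma aR_pencil:
  assumes bs: "set bs \<subseteq> max_order D"
  shows "aR bs k = pencil (length bs) k (\<lambda>l. map_mat (\<phi> \<circ> to_ac) (rep (bs ! l))) N N" (is "_ = ?P")
proof (rule eq_matI)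
  note Z = padic_field_Zp(1)[OF padic]
  have \<phi>0: "(\<phi> \<circ> to_ac) 0 = 0" by (rule hom_onD(2)[OF RR.\<phi> Z])
  fix i j assume "i < dim_row ?P" "j < dim_col ?P"
  then have ij: "i < N" "j < N" by (auto simp: pencil_def)
  show "aR bs k $$ (i, j) = ?P $$ (i, j)"
  proof (rule poly_eqI)
    fix r
    have "(\<phi> \<circ> to_ac) (\<Sum>l<length bs. if k ^ l = r then rep (bs ! l) $$ (i, j) else 0) =
        (\<Sum>l<length bs. (\<phi> \<circ> to_ac) (if k ^ l = r then rep (bs ! l) $$ (i, j) else 0))"
    proof (rule hom_on_sum[OF RR.\<phi> Z])
      fix l assume "l \<in> {..<length bs}"
      then have "bs ! l \<in> max_order D" using bs by auto
      then show "(if k ^ l = r then rep (bs ! l) $$ (i, j) else 0) \<in> Zp nrm" using rep_Zp ij closed_subringD(1)[OF Z] by simp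
    qed
    also have "\<dots> = (\<Sum>l<length bs. if k ^ l = r then (\<phi> \<circ> to_ac) (rep (bs ! l) $$ (i, j)) else 0)"
      by (rule sum.cong[OF refl]) (simp only: \<phi>0 split: if_split, simp)
    finally show "Polynomial.coeff (aR bs k $$ (i, j)) r = Polynomial.coeff (?P $$ (i, j)) r"
      using ij \<phi>0 by (simp add: aR_def amat_def pencil_def coeff_map_poly coeff_sum cong: if_cong)
  qed
qed (auto simp: pencil_def carrier_matD[OF aR_carrier])

end

lemma span_list_coords:
  assumes b: "based_module UNIV M q ee co" and xs: "set xs \<subseteq> carrier M" and y: "y \<in> mspan tring M (set xs)"
  shows "\<exists>c. \<forall>i<q. co i y = (\<Sum>a<length xs. co i (xs ! a) * c a)"
proof -
  interpret based_module UNIV M q ee co by (rule b)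
  have Mt: "module tring M" using M by (simp add: subtring_UNIV)
  from Mt xs y show ?thesis
  proof (rule mspan_induct)
    show "\<exists>c. \<forall>i<q. co i \<zero>\<^bsub>M\<^esub> = (\<Sum>a<length xs. co i (xs ! a) * c a)"
      by (rule exI[of _ "\<lambda>_. 0"]) (simp add: co_zero)
    show "\<exists>c. \<forall>i<q. co i x = (\<Sum>a<length xs. co i (xs ! a) * c a)" if x: "x \<in> set xs" for x
    proof -
      obtain a where a: "a < length xs" "x = xs ! a" using x by (auto simp: in_set_conv_nth)
      have "(\<Sum>b<length xs. co i (xs ! b) * (if b = a then 1 else 0)) = co i x" for i
        using a by (simp add: if_distrib[of "\<lambda>u. _ * u"] cong: if_cong)
      then show ?thesis by (intro exI[of _ "\<lambda>b. if b = a then 1 else 0"]) simp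
    qed
    show "\<exists>c. \<forall>i<q. co i (x \<oplus>\<^bsub>M\<^esub> y) = (\<Sum>a<length xs. co i (xs ! a) * c a)"
      if "x \<in> carrier M" "y \<in> carrier M" and ex: "\<exists>c. \<forall>i<q. co i x = (\<Sum>a<length xs. co i (xs ! a) * c a)"
        and ey: "\<exists>c. \<forall>i<q. co i y = (\<Sum>a<length xs. co i (xs ! a) * c a)" for x y
    proof -
      obtain c where c: "\<forall>i<q. co i x = (\<Sum>a<length xs. co i (xs ! a) * c a)" using ex by (rule exE)
      obtain d where d: "\<forall>i<q. co i y = (\<Sum>a<length xs. co i (xs ! a) * d a)" using ey by (rule exE)
      show ?thesis by (rule exI[of _ "\<lambda>a. c a + d a"]) (simp add: co_add that(1,2) c d sum.distrib distrib_left)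
    qed
    show "\<exists>c. \<forall>i<q. co i (r \<odot>\<^bsub>M\<^esub> x) = (\<Sum>a<length xs. co i (xs ! a) * c a)"
      if "x \<in> carrier M" and ex: "\<exists>c. \<forall>i<q. co i x = (\<Sum>a<length xs. co i (xs ! a) * c a)" for r x
    proof -
      obtain c where c: "\<forall>i<q. co i x = (\<Sum>a<length xs. co i (xs ! a) * c a)" using ex by (rule exE)
      show ?thesis by (rule exI[of _ "\<lambda>a. r * c a"]) (simp add: co_smult that(1) c sum_distrib_left mult_ac)
    qed
  qed
qed

text \<open>At a prime \<open>\<pp>\<close>, a direct summand of rank \<open>n\<close> has a basis after inverting an element outside \<open>\<pp>\<close>.\<close>

lemma local_basis_matrices:
  fixes M :: "('r::comm_ring_1, 'm) module"
  assumes b: "based_module UNIV M q ee co" and \<pi>: "linear_on UNIV M M \<pi>" "\<And>x. x \<in> carrier M \<Longrightarrow> \<pi> x \<in> F" "\<And>y. y \<in> F \<Longrightarrow> \<pi> y = y"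
    and F: "F \<subseteq> carrier M" and rank: "has_rank M F n" and P: "primeideal P (tring :: 'r ring)"
  obtains xs C s where "length xs = n" "set xs \<subseteq> F" "C \<in> carrier_mat n q" "s \<notin> P"
    "mat q n (\<lambda>(i, a). co i (xs ! a)) * C = s \<cdot>\<^sub>m based_module.mat_of q ee co \<pi>"
    "C * mat q n (\<lambda>(i, a). co i (xs ! a)) = s \<cdot>\<^sub>m 1\<^sub>m n"
proof -
  interpret based_module UNIV M q ee co by (rule b)
  note Pc = prime_ideal_complement[OF P]
  obtain xs where xs: "length xs = n" "set xs \<subseteq> F" "\<And>y. y \<in> F \<Longrightarrow> \<exists>s. s \<notin> P \<and> s \<odot>\<^bsub>M\<^esub> y \<in> mspan tring M (set xs)"
    "\<And>c. (\<Oplus>\<^bsub>M\<^esub>i\<in>{..<n}. c i \<odot>\<^bsub>M\<^esub> (xs ! i)) = \<zero>\<^bsub>M\<^esub> \<Longrightarrow> \<exists>s. s \<notin> P \<and> (\<forall>i<n. s * c i = 0)"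
    using rank P unfolding has_rank_def by blast
  have xc: "set xs \<subseteq> carrier M" using xs(2) F by blast
  have xa: "xs ! a \<in> carrier M" "\<pi> (xs ! a) = xs ! a" if "a < n" for a
    using xc xs(1,2) \<pi>(3) that by (auto simp: subset_iff)
  define U where "U = mat q n (\<lambda>(i, a). co i (xs ! a))"
  let ?Pi = "mat_of \<pi>"
  have U: "U \<in> carrier_mat q n" by (simp add: U_def)
  have "\<exists>s c. s \<notin> P \<and> (\<forall>i<q. s * ?Pi $$ (i, j) = (\<Sum>a<n. co i (xs ! a) * c a))" if j: "j < q" for j
  proof -
    have pj: "\<pi> (ee j) \<in> F" "\<pi> (ee j) \<in> carrier M" using \<pi>(2)[OF e_closed[OF j]] F by auto
    obtain s where s: "s \<notin> P" "s \<odot>\<^bsub>M\<^esub> \<pi> (ee j) \<in> mspan tring M (set xs)" using xs(3)[OF pj(1)] by (elim exE conjE)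
    obtain c where c: "\<forall>i<q. co i (s \<odot>\<^bsub>M\<^esub> \<pi> (ee j)) = (\<Sum>a<length xs. co i (xs ! a) * c a)"
      using span_list_coords[OF b xc s(2)] by (rule exE)
    have "\<forall>i<q. s * ?Pi $$ (i, j) = (\<Sum>a<n. co i (xs ! a) * c a)" using c j pj(2) by (simp add: co_smult xs(1))
    with s(1) show ?thesis by (intro exI conjI)
  qed
  then have "\<forall>j\<in>{..<q}. \<exists>sc. fst sc \<notin> P \<and> (\<forall>i<q. fst sc * ?Pi $$ (i, j) = (\<Sum>a<n. co i (xs ! a) * snd sc a))" by simp
  from bchoice[OF this] obtain sc where sc: "\<forall>j\<in>{..<q}. fst (sc j) \<notin> P \<and> (\<forall>i<q. fst (sc j) * ?Pi $$ (i, j) = (\<Sum>a<n. co i (xs ! a) * snd (sc j) a))"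
    by (rule exE)
  \<comment> \<open>A common denominator: after multiplication by s all images \<pi>(e_j) are
    combinations of the \<open>xs\<close>, with coefficients in the columns of
    \<open>C\<close>.\<close>
  define s where "s = (\<Prod>j<q. fst (sc j))"
  have sP: "s \<notin> P" unfolding s_def by (rule Pc(3)) (use sc in auto)
  define C where "C = mat n q (\<lambda>(a, j). (\<Prod>l\<in>{..<q} - {j}. fst (sc l)) * snd (sc j) a)"
  have C: "C \<in> carrier_mat n q" by (simp add: C_def)
  have UC: "U * C = s \<cdot>\<^sub>m ?Pi"
  proof (rule eq_matI)
    fix i j assume "i < dim_row (s \<cdot>\<^sub>m ?Pi)" "j < dim_col (s \<cdot>\<^sub>m ?Pi)"
    then have ij: "i < q" "j < q" by auto
    let ?r = "\<Prod>l\<in>{..<q} - {j}. fst (sc l)"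
    have "(U * C) $$ (i, j) = ?r * (\<Sum>a<n. co i (xs ! a) * snd (sc j) a)"
      using ij by (simp add: U_def C_def scalar_prod_def atLeast0LessThan sum_distrib_left mult_ac)
    also have "(\<Sum>a<n. co i (xs ! a) * snd (sc j) a) = fst (sc j) * ?Pi $$ (i, j)"
      using conjunct2[OF bspec[OF sc], of j] ij by (simp del: index_mat_of)
    also have "?r * (fst (sc j) * ?Pi $$ (i, j)) = (fst (sc j) * ?r) * ?Pi $$ (i, j)" by (simp only: mult_ac)
    also have "fst (sc j) * ?r = s" unfolding s_def using ij by (simp add: prod.remove[of "{..<q}" j])
    finally show "(U * C) $$ (i, j) = (s \<cdot>\<^sub>m ?Pi) $$ (i, j)" using ij by simp
  qed (simp_all add: U_def C_def)
  have PU: "?Pi * U = U"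
  proof (rule eq_matI)
    fix i a assume "i < dim_row U" "a < dim_col U"
    then have ia: "i < q" "a < n" by (auto simp: U_def)
    show "(?Pi * U) $$ (i, a) = U $$ (i, a)"
      using co_linear[OF \<pi>(1) xa(1)[OF ia(2)] ia(1)] ia xa(2) by (simp add: U_def scalar_prod_def atLeast0LessThan)
  qed (simp_all add: U_def)
  have UCU: "U * (C * U) = s \<cdot>\<^sub>m U"
    using assoc_mult_mat[OF U C U] UC PU mult_smult_assoc_mat[of ?Pi q q U n s] U by simp
  have "\<exists>t. t \<notin> P \<and> (\<forall>b<n. t * ((C * U) $$ (b, a) - (if b = a then s else 0)) = 0)" if a: "a < n" for a
  \<comment> \<open>Since U(CU) = sU, the columns of CU - s are linear relations among the
    \<open>xs\<close>, so each is killed by an element outside the prime. The product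
    \<open>t'\<close> of these elements kills all of them and is absorbed into \<open>C\<close> and
    s.\<close>
  proof (rule xs(4))
    let ?v = "\<lambda>b. (C * U) $$ (b, a) - (if b = a then s else 0)"
    show "(\<Oplus>\<^bsub>M\<^esub>b\<in>{..<n}. ?v b \<odot>\<^bsub>M\<^esub> (xs ! b)) = \<zero>\<^bsub>M\<^esub>"
    proof (rule co_inj)
      have fc: "(\<lambda>b. ?v b \<odot>\<^bsub>M\<^esub> (xs ! b)) \<in> {..<n} \<rightarrow> carrier M" using xa(1) by auto
      then show "(\<Oplus>\<^bsub>M\<^esub>b\<in>{..<n}. ?v b \<odot>\<^bsub>M\<^esub> (xs ! b)) \<in> carrier M" by (rule M.M.finsum_closed)
      fix i assume i: "i < q"
      have "co i (\<Oplus>\<^bsub>M\<^esub>b\<in>{..<n}. ?v b \<odot>\<^bsub>M\<^esub> (xs ! b)) = (\<Sum>b<n. ?v b * co i (xs ! b))"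
        using co_finsum[OF _ i fc] xa(1) co_smult[OF i] by simp
      also have "\<dots> = (\<Sum>b<n. U $$ (i, b) * (C * U) $$ (b, a)) - (\<Sum>b<n. if b = a then s * U $$ (i, b) else 0)"
        unfolding sum_subtractf[symmetric] using i by (intro sum.cong) (auto simp: U_def algebra_simps)
      also have "\<dots> = (U * (C * U)) $$ (i, a) - s * U $$ (i, a)"
      proof -
        have "(U * W) $$ (i, a) = (\<Sum>b<n. U $$ (i, b) * W $$ (b, a))" if "W \<in> carrier_mat n n" for W
          using that i a U by (simp add: scalar_prod_def atLeast0LessThan)
        from this[OF mult_carrier_mat[OF C U]]
        have "(U * (C * U)) $$ (i, a) = (\<Sum>b<n. U $$ (i, b) * (C * U) $$ (b, a))" .
        then show ?thesis using i a U by (simp del: index_mult_mat(1))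
      qed
      also have "\<dots> = 0" unfolding UCU using i a U by simp
      finally show "co i (\<Oplus>\<^bsub>M\<^esub>b\<in>{..<n}. ?v b \<odot>\<^bsub>M\<^esub> (xs ! b)) = 0" .
    qed
  qed
  then have "\<forall>a\<in>{..<n}. \<exists>t. t \<notin> P \<and> (\<forall>b<n. t * ((C * U) $$ (b, a) - (if b = a then s else 0)) = 0)" by simp
  from bchoice[OF this] obtain t where t: "\<forall>a\<in>{..<n}. t a \<notin> P \<and> (\<forall>b<n. t a * ((C * U) $$ (b, a) - (if b = a then s else 0)) = 0)"
    by (rule exE)
  define t' where "t' = (\<Prod>a<n. t a)"
  have t'P: "t' \<notin> P" unfolding t'_def by (rule Pc(3)) (use t in auto)
  have tv: "t' * (C * U) $$ (b, a) = t' * (if b = a then s else 0)" if "a < n" "b < n" for a b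
  proof -
    have "t' = (\<Prod>l\<in>{..<n} - {a}. t l) * t a" unfolding t'_def using that by (simp add: prod.remove[of _ a] mult.commute)
    then have "t' * ((C * U) $$ (b, a) - (if b = a then s else 0)) = 0" using t that by (simp only: mult.assoc) simp
    then show ?thesis unfolding right_diff_distrib by (rule iffD2[OF eq_iff_diff_eq_0])
  qed
  show ?thesis
  proof (rule that[of xs "t' \<cdot>\<^sub>m C" "t' * s"])
    show "t' \<cdot>\<^sub>m C \<in> carrier_mat n q" using C by simp
    show "t' * s \<notin> P" by (rule Pc(2)[OF t'P sP])
    show "mat q n (\<lambda>(i, a). co i (xs ! a)) * (t' \<cdot>\<^sub>m C) = (t' * s) \<cdot>\<^sub>m ?Pi"
      unfolding U_def[symmetric] mult_smult_distrib[OF U C] UC by (rule eq_matI) (simp_all add: mult.assoc)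
    show "(t' \<cdot>\<^sub>m C) * mat q n (\<lambda>(i, a). co i (xs ! a)) = (t' * s) \<cdot>\<^sub>m 1\<^sub>m n"
      unfolding U_def[symmetric] mult_smult_assoc_mat[OF C U]
    proof (rule eq_matI)
      fix b a assume "b < dim_row ((t' * s) \<cdot>\<^sub>m 1\<^sub>m n)" "a < dim_col ((t' * s) \<cdot>\<^sub>m 1\<^sub>m n)"
      then have ba: "b < n" "a < n" by auto
      have CUc: "C * U \<in> carrier_mat n n" using C U by simp
      have "(t' \<cdot>\<^sub>m (C * U)) $$ (b, a) = t' * (C * U) $$ (b, a)" using ba CUc by (intro index_smult_mat(1)) auto
      then show "(t' \<cdot>\<^sub>m (C * U)) $$ (b, a) = ((t' * s) \<cdot>\<^sub>m 1\<^sub>m n) $$ (b, a)" unfolding tv[OF ba(2,1)] using ba by simp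
    qed (use C U in auto)
  qed (rule xs(1), rule xs(2))
qed

lemma (in based_module) linear_minus:
  assumes f: "linear_on A M M f" shows "linear_on A M M (\<lambda>x. x \<ominus>\<^bsub>M\<^esub> f x)"
  unfolding linear_on_def
proof (intro conjI ballI Pi_I)
  note fc = linear_onD[OF f]
  show cl: "x \<ominus>\<^bsub>M\<^esub> f x \<in> carrier M" if "x \<in> carrier M" for x by (rule M.M.minus_closed[OF that fc(1)[OF that]])
  show "(x \<oplus>\<^bsub>M\<^esub> y) \<ominus>\<^bsub>M\<^esub> f (x \<oplus>\<^bsub>M\<^esub> y) = (x \<ominus>\<^bsub>M\<^esub> f x) \<oplus>\<^bsub>M\<^esub> (y \<ominus>\<^bsub>M\<^esub> f y)" if x: "x \<in> carrier M" and y: "y \<in> carrier M" for x y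
  proof (rule co_ext)
    note xy = M.M.a_closed[OF x y]
    show "(x \<oplus>\<^bsub>M\<^esub> y) \<ominus>\<^bsub>M\<^esub> f (x \<oplus>\<^bsub>M\<^esub> y) \<in> carrier M" by (rule cl[OF xy])
    show "(x \<ominus>\<^bsub>M\<^esub> f x) \<oplus>\<^bsub>M\<^esub> (y \<ominus>\<^bsub>M\<^esub> f y) \<in> carrier M" by (rule M.M.a_closed[OF cl[OF x] cl[OF y]])
    show "co i ((x \<oplus>\<^bsub>M\<^esub> y) \<ominus>\<^bsub>M\<^esub> f (x \<oplus>\<^bsub>M\<^esub> y)) = co i ((x \<ominus>\<^bsub>M\<^esub> f x) \<oplus>\<^bsub>M\<^esub> (y \<ominus>\<^bsub>M\<^esub> f y))" if i: "i < N" for i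
    proof -
      have "co i (f (x \<oplus>\<^bsub>M\<^esub> y)) = co i (f x) + co i (f y)"
        unfolding fc(2)[OF x y] by (rule co_add[OF i fc(1)[OF x] fc(1)[OF y]])
      then show ?thesis
        using co_minus[OF i xy fc(1)[OF xy]] co_add[OF i x y] co_add[OF i cl[OF x] cl[OF y]]
          co_minus[OF i x fc(1)[OF x]] co_minus[OF i y fc(1)[OF y]] by simp
    qed
  qed
  show "(a \<odot>\<^bsub>M\<^esub> x) \<ominus>\<^bsub>M\<^esub> f (a \<odot>\<^bsub>M\<^esub> x) = a \<odot>\<^bsub>M\<^esub> (x \<ominus>\<^bsub>M\<^esub> f x)" if a: "a \<in> A" and x: "x \<in> carrier M" for a x
  proof (rule co_ext)
    have sc: "a \<odot>\<^bsub>M\<^esub> y \<in> carrier M" if "y \<in> carrier M" for y by (rule M.smult_closed) (simp_all add: that a)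
    show "(a \<odot>\<^bsub>M\<^esub> x) \<ominus>\<^bsub>M\<^esub> f (a \<odot>\<^bsub>M\<^esub> x) \<in> carrier M" by (rule cl[OF sc[OF x]])
    show "a \<odot>\<^bsub>M\<^esub> (x \<ominus>\<^bsub>M\<^esub> f x) \<in> carrier M" by (rule sc[OF cl[OF x]])
    show "co i ((a \<odot>\<^bsub>M\<^esub> x) \<ominus>\<^bsub>M\<^esub> f (a \<odot>\<^bsub>M\<^esub> x)) = co i (a \<odot>\<^bsub>M\<^esub> (x \<ominus>\<^bsub>M\<^esub> f x))" if i: "i < N" for i
    proof -
      have "co i (f (a \<odot>\<^bsub>M\<^esub> x)) = a * co i (f x)" unfolding fc(3)[OF a x] by (rule co_smult[OF i a fc(1)[OF x]])
      then show ?thesis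
        using co_minus[OF i sc[OF x] fc(1)[OF sc[OF x]]] co_smult[OF i a x] co_smult[OF i a cl[OF x]] co_minus[OF i x fc(1)[OF x]]
        by (simp add: right_diff_distrib)
    qed
  qed
qed

section \<open>Comparison of the two determinants\<close>

context pel_model
begin

text \<open>Equality of polynomials over \<open>R\<close> is checked locally. At a prime the summand
  has a basis up to a denominator s; the generic element multiplies the wedge of this basis by
  \<open>dR bs k\<close> according to \<open>R_identity\<close>, and \<open>det_summand\<close>
  identifies this factor with the determinant on the summand up to a power of s.\<close>

lemma summand_det:
  assumes bs: "set bs \<subseteq> max_order D" and c: "complementary tring LR F C" and rank: "has_rank LR F n"
    and Kn: "ext_map tring LR n id id ` carrier (exterior_power tring (restr LR F) n) \<subseteq>
      mspan tring (exterior_power tring LR n) (toR n ` W_lat nrm D \<mu> n \<Lambda>)"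
  shows "kronecker k (det_pencil tring LR (\<lambda>x. x \<ominus>\<^bsub>LR\<^esub> proj_along LR F C x) (map (\<lambda>f. f \<circ> proj_along LR F C) (map beta bs))) = dR bs k"
proof -
  define q where "q = length (chosen_basis tring LR)"
  define \<pi> where "\<pi> = proj_along LR F C"
  note \<pi> = proj_along_props[OF LR_module c, folded \<pi>_def]
  \<comment> \<open>Two bases are in play: the lattice basis \<open>RB\<close>, in which the
    identity of Pluecker coordinates holds, and the basis \<open>Q\<close> in which the determinant
    on the summand is defined.\<close>
  have RB: "based_module UNIV LR N (\<lambda>i. RR.pure (e i)) RR.coS" unfolding LR_eq by (rule RR.based)
  interpret RB: based_module UNIV LR N "\<lambda>i. RR.pure (e i)" RR.coS by (rule RB)
  obtain eQ coQ where Q: "based_module UNIV LR q eQ coQ"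
    and em: "\<And>f. linear_on UNIV LR LR f \<Longrightarrow> end_mat tring LR f = based_module.mat_of q eQ coQ f"
    using end_mat_eq[OF LR_module RB.free_basis[unfolded subtring_UNIV], folded q_def] by blast
  interpret Q: based_module UNIV LR q eQ coQ by (rule Q)
  have Fc: "F \<subseteq> carrier LR" using \<pi>(4) unfolding LinearCombinations.submodule_def by auto
  note \<pi>c = linear_onD[OF \<pi>(1)]
  have lin0: "linear_on UNIV LR LR (\<lambda>x. x \<ominus>\<^bsub>LR\<^esub> \<pi> x)"
    by (rule Q.linear_minus[OF \<pi>(1)])
  define Pi where "Pi = Q.mat_of \<pi>"
  define G where "G l = Q.mat_of (beta (bs ! l))" for l
  have Pi: "Pi \<in> carrier_mat q q" "dim_row Pi = q" "dim_col Pi = q" and G: "\<And>l. G l \<in> carrier_mat q q" by (auto simp: Pi_def G_def)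
  have bl: "bs ! l \<in> max_order D" if "l < length bs" for l using bs that by auto
  let ?t = "length bs"
  define PG where "PG = pencil ?t k G q q"
  have PGc: "PG \<in> carrier_mat q q" by (simp add: PG_def)
  have E0: "end_mat tring LR (\<lambda>x. x \<ominus>\<^bsub>LR\<^esub> \<pi> x) $$ (i, j) = (if i = j then 1 else 0) - Pi $$ (i, j)" if ij: "i < q" "j < q" for i j
    unfolding em[OF lin0] Q.index_mat_of[OF ij] Q.co_minus[OF ij(1) Q.e_closed[OF ij(2)] \<pi>c(1)[OF Q.e_closed[OF ij(2)]]] Q.co_e[OF ij]
      Pi_def Q.index_mat_of[OF ij] ..
  have B: "end_mat tring LR (beta (bs ! l) \<circ> \<pi>) = G l * Pi" if "l < ?t" for l
    unfolding em[OF linear_on_comp[OF \<pi>(1) beta_linear(1)[OF bl[OF that]]]] G_def Pi_def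
    by (rule Q.mat_of_comp[OF beta_linear(1)[OF bl[OF that]] \<pi>(1)])
  have "kronecker k (det_pencil tring LR (\<lambda>x. x \<ominus>\<^bsub>LR\<^esub> \<pi> x) (map (\<lambda>f. f \<circ> \<pi>) (map beta bs))) =
    det ((1\<^sub>m q - const_mat Pi) + pencil ?t k (\<lambda>l. G l * Pi) q q)"
    unfolding det_pencil_kronecker(1) q_def[symmetric]
  proof (rule arg_cong[of _ _ det], rule eq_matI)
    fix i j assume "i < dim_row ((1\<^sub>m q - const_mat Pi) + pencil ?t k (\<lambda>l. G l * Pi) q q)" "j < dim_col ((1\<^sub>m q - const_mat Pi) + pencil ?t k (\<lambda>l. G l * Pi) q q)"
    then have ij: "i < q" "j < q" by (auto simp: pencil_def)
    have s: "(\<Sum>l<length (map (\<lambda>f. f \<circ> \<pi>) (map beta bs)). Polynomial.monom (end_mat tring LR (map (\<lambda>f. f \<circ> \<pi>) (map beta bs) ! l) $$ (i, j)) (k ^ l)) =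
        (\<Sum>l<?t. Polynomial.monom ((G l * Pi) $$ (i, j)) (k ^ l))"
    proof (rule sum.cong)
      fix l assume "l \<in> {..<?t}"
      then have l: "l < ?t" by simp
      have "map (\<lambda>f. f \<circ> \<pi>) (map beta bs) ! l = beta (bs ! l) \<circ> \<pi>" using l by (simp only: nth_map length_map)
      then show "Polynomial.monom (end_mat tring LR (map (\<lambda>f. f \<circ> \<pi>) (map beta bs) ! l) $$ (i, j)) (k ^ l) = Polynomial.monom ((G l * Pi) $$ (i, j)) (k ^ l)"
        by (simp only: B[OF l])
    qed (simp only: length_map)
    have "[:(if i = j then 1 else 0) - Pi $$ (i, j):] = (1\<^sub>m q - const_mat Pi) $$ (i, j)" using ij Pi by (simp add: one_pCons)
    then show "mat q q (\<lambda>(i, j). [:end_mat tring LR (\<lambda>x. x \<ominus>\<^bsub>LR\<^esub> \<pi> x) $$ (i, j):] +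
        (\<Sum>l<length (map (\<lambda>f. f \<circ> \<pi>) (map beta bs)). Polynomial.monom (end_mat tring LR (map (\<lambda>f. f \<circ> \<pi>) (map beta bs) ! l) $$ (i, j)) (k ^ l))) $$ (i, j) =
      ((1\<^sub>m q - const_mat Pi) + pencil ?t k (\<lambda>l. G l * Pi) q q) $$ (i, j)"
      unfolding index_mat(1)[OF ij] prod.case s E0[OF ij] using ij Pi by (simp add: pencil_def del: index_mult_mat)
  qed (simp_all add: pencil_def)
  also have "pencil ?t k (\<lambda>l. G l * Pi) q q = PG * const_mat Pi" unfolding PG_def by (rule pencil_mult_const[OF G Pi(1), symmetric])
  finally have kron: "kronecker k (det_pencil tring LR (\<lambda>x. x \<ominus>\<^bsub>LR\<^esub> \<pi> x) (map (\<lambda>f. f \<circ> \<pi>) (map beta bs))) =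
    det ((1\<^sub>m q - const_mat Pi) + PG * const_mat Pi)" .
  let ?L = "det ((1\<^sub>m q - const_mat Pi) + PG * const_mat Pi)"
  have "?L = dR bs k"
  proof (rule ccontr)
    assume "?L \<noteq> dR bs k"
    then obtain r where r: "Polynomial.coeff ?L r \<noteq> Polynomial.coeff (dR bs k) r" by (auto simp: poly_eq_iff)
    \<comment> \<open>If a coefficient differed by \<delta>, the annihilator of \<delta> would be a
      proper ideal, hence contained in a prime P. The identity below shows that a power of some s
      outside P annihilates \<delta>.\<close>
    define \<delta> where "\<delta> = Polynomial.coeff ?L r - Polynomial.coeff (dR bs k) r"
    have "\<delta> \<noteq> 0" using r unfolding \<delta>_def by simp
    then obtain P where P: "primeideal P (tring :: 'r ring)" "{a. a * \<delta> = 0} \<subseteq> P"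
      using prime_ideal_exists[of "{a. a * \<delta> = 0}"] by (auto simp: distrib_right mult.assoc)
    obtain xs C' s where x: "length xs = n" "set xs \<subseteq> F" "C' \<in> carrier_mat n q" "s \<notin> P"
      "mat q n (\<lambda>(i, a). coQ i (xs ! a)) * C' = s \<cdot>\<^sub>m Q.mat_of \<pi>"
      "C' * mat q n (\<lambda>(i, a). coQ i (xs ! a)) = s \<cdot>\<^sub>m 1\<^sub>m n"
      by (rule local_basis_matrices[OF Q \<pi>(1,2,3) Fc rank P(1)])
    have xa: "xs ! a \<in> carrier LR" if "a < n" for a using x(1,2) Fc that by (auto simp: subset_iff)
    define U where "U = mat q n (\<lambda>(i, a). coQ i (xs ! a))"
    define Xm where "Xm = mat N n (\<lambda>(i, a). RR.coS i (xs ! a))"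
    \<comment> \<open>The change of coordinates from the lattice basis to the chosen basis.\<close>
    define Qm where "Qm = mat q N (\<lambda>(i, j). coQ i (RR.pure (e j)))"
    define A where "A l = map_mat (\<phi> \<circ> to_ac) (rep (bs ! l))" for l
    have car: "U \<in> carrier_mat q n" "Xm \<in> carrier_mat N n" "Qm \<in> carrier_mat q N" "\<And>l. A l \<in> carrier_mat N N"
      by (simp_all add: U_def Xm_def Qm_def A_def)
    have ex: "coQ i y = (\<Sum>j<N. RR.coS j y * coQ i (RR.pure (e j)))" if "y \<in> carrier LR" "i < q" for i y
      by (rule RB.functional_expand[OF _ _ that(1)]) (simp_all add: Q.co_add[OF that(2)] Q.co_smult[OF that(2)])
    have U: "U = Qm * Xm"
      by (rule eq_matI) (simp_all add: U_def Qm_def Xm_def scalar_prod_def atLeast0LessThan ex[OF xa] mult.commute)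
    have GU: "G l * U = Qm * (A l * Xm)" if l: "l < ?t" for l
    proof (rule eq_matI)
      fix i a assume "i < dim_row (Qm * (A l * Xm))" "a < dim_col (Qm * (A l * Xm))"
      then have ia: "i < q" "a < n" by (auto simp: Qm_def Xm_def)
      note lin = beta_linear(1)[OF bl[OF l]]
      have bx: "beta (bs ! l) (xs ! a) \<in> carrier LR" by (rule linear_onD(1)[OF lin xa[OF ia(2)]])
      have "(G l * U) $$ (i, a) = coQ i (beta (bs ! l) (xs ! a))"
        unfolding Q.co_linear[OF lin xa[OF ia(2)] ia(1)] G_def[symmetric]
        using ia carrier_matD[OF G[of l]] by (simp add: U_def scalar_prod_def atLeast0LessThan)
      also have "\<dots> = (\<Sum>j<N. coQ i (RR.pure (e j)) * (A l * Xm) $$ (j, a))"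
        unfolding ex[OF bx ia(1)]
      proof (rule sum.cong[OF refl])
        fix j assume "j \<in> {..<N}"
        then have j: "j < N" by simp
        have "RR.coS j (beta (bs ! l) (xs ! a)) = (A l * Xm) $$ (j, a)"
          unfolding RB.co_linear[OF lin xa[OF ia(2)] j] using j ia beta_linear(2)[OF bl[OF l] j]
          by (simp add: A_def Xm_def scalar_prod_def atLeast0LessThan)
        then show "RR.coS j (beta (bs ! l) (xs ! a)) * coQ i (RR.pure (e j)) = coQ i (RR.pure (e j)) * (A l * Xm) $$ (j, a)" by (simp only: mult.commute)
      qed
      also have "\<dots> = (Qm * (A l * Xm)) $$ (i, a)"
      proof -
        have "(Qm * W) $$ (i, a) = (\<Sum>j<N. Qm $$ (i, j) * W $$ (j, a))" if "W \<in> carrier_mat N n" for W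
          using that ia car(3) by (simp add: scalar_prod_def atLeast0LessThan)
        from this[OF mult_carrier_mat[OF car(4,2)]]
        have "(Qm * (A l * Xm)) $$ (i, a) = (\<Sum>j<N. Qm $$ (i, j) * (A l * Xm) $$ (j, a))" .
        then show ?thesis using ia(1) by (simp add: Qm_def del: index_mult_mat(1))
      qed
      finally show "(G l * U) $$ (i, a) = (Qm * (A l * Xm)) $$ (i, a)" .
    qed (use carrier_matD[OF G[of l]] in \<open>simp_all add: U_def Qm_def Xm_def\<close>)
    have PGU: "PG * const_mat U = const_mat Qm * (aR bs k * const_mat Xm)"
    proof -
      have "PG * const_mat U = pencil ?t k (\<lambda>l. G l * U) q n" unfolding PG_def by (rule pencil_mult_const[OF G car(1)])
      also have "\<dots> = pencil ?t k (\<lambda>l. Qm * (A l * Xm)) q n"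
        unfolding pencil_def by (rule eq_matI) (simp_all add: GU del: index_mult_mat)
      also have "\<dots> = const_mat Qm * pencil ?t k (\<lambda>l. A l * Xm) N n"
        by (rule const_mult_pencil[OF _ car(3), symmetric]) (rule mult_carrier_mat[OF car(4,2)])
      also have "pencil ?t k (\<lambda>l. A l * Xm) N n = aR bs k * const_mat Xm"
        unfolding aR_pencil[OF bs] A_def[symmetric] by (rule pencil_mult_const[OF car(4,2), symmetric])
      finally show ?thesis .
    qed
    \<comment> \<open>With this \<open>?T\<close>, \<open>det_compound\<close> turns the identity in
      lattice coordinates into the hypothesis on determinants that \<open>det_summand\<close>
      requires in chosen coordinates.\<close>
    let ?T = "const_mat C' * const_mat Qm"
    have T: "?T \<in> carrier_mat n N" using x(3) car(3) by auto
    have cX: "const_mat Xm \<in> carrier_mat N n" using car(2) by simp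
    have dX: "det (mat n n (\<lambda>(i, j). const_mat Xm $$ (f i, j))) = [:det (mat n n (\<lambda>(i, j). RR.coS (f i) (xs ! j))):]" if f: "f \<in> {0..<n} \<rightarrow> {0..<N}" for f
    proof -
      interpret h: comm_ring_hom "\<lambda>a :: 'r. [:a:]" by unfold_locales (auto simp: one_pCons)
      have "mat n n (\<lambda>(i, j). const_mat Xm $$ (f i, j)) = const_mat (mat n n (\<lambda>(i, j). RR.coS (f i) (xs ! j)))"
        by (rule eq_matI) (use f in \<open>auto simp: Xm_def Pi_iff\<close>)
      then show ?thesis by (simp only: comm_ring_hom.hom_det[OF h.comm_ring_hom_axioms])
    qed
    have "det (?T * (aR bs k * const_mat Xm)) = dR bs k * det (?T * const_mat Xm)"
    proof (rule det_compound[OF T aR_carrier cX])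
      fix f assume f: "f \<in> {0..<n} \<rightarrow> {0..<N}"
      have "(\<Sum>g\<in>{0..<n} \<rightarrow>\<^sub>E {0..<N}. (\<Prod>i<n. aR bs k $$ (f i, g i)) * det (mat n n (\<lambda>(i, j). const_mat Xm $$ (g i, j)))) =
        (\<Sum>g\<in>{0..<n} \<rightarrow>\<^sub>E {0..<N}. (\<Prod>i<n. aR bs k $$ (f i, g i)) * [:det (mat n n (\<lambda>(i, j). RR.coS (g i) (xs ! j))):])"
        by (rule sum.cong[OF refl], subst dX) (auto simp: PiE_def)
      then show "(\<Sum>g\<in>{0..<n} \<rightarrow>\<^sub>E {0..<N}. (\<Prod>i<n. aR bs k $$ (f i, g i)) * det (mat n n (\<lambda>(i, j). const_mat Xm $$ (g i, j)))) =
        dR bs k * det (mat n n (\<lambda>(i, j). const_mat Xm $$ (f i, j)))"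
        unfolding R_identity[OF bs \<pi>(4) Kn x(1,2) f] dX[OF f] .
    qed
    moreover have "?T * (aR bs k * const_mat Xm) = const_mat C' * (PG * const_mat U)"
      unfolding PGU by (rule assoc_mult_mat[of _ n q _ N _ n]) (use x(3) car mult_carrier_mat[OF aR_carrier cX] in auto)
    moreover have "?T * const_mat Xm = const_mat C' * const_mat U"
      unfolding U const_mat_mult[OF car(3,2)] by (rule assoc_mult_mat[of _ n q _ N _ n]) (use x(3) car cX in auto)
    ultimately have d: "det (const_mat C' * (PG * const_mat U)) = dR bs k * det (const_mat C' * const_mat U)" by simp
    have "[:s ^ (n + q):] * ?L = [:s ^ (n + q):] * dR bs k"
      by (rule det_summand[OF Pi(1) car(1) x(3) PGc _ _ d]) (use x(5,6) in \<open>simp_all only: U_def Pi_def\<close>)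
    then have "Polynomial.coeff ([:s ^ (n + q):] * ?L) r = Polynomial.coeff ([:s ^ (n + q):] * dR bs k) r" by (simp only:)
    then have "s ^ (n + q) * \<delta> = 0" unfolding \<delta>_def by (simp add: right_diff_distrib)
    then have "s ^ (n + q) \<in> P" using P(2) by blast
    then show False using prime_ideal_complement(4)[OF P(1) x(4)] by blast
  qed
  then show ?thesis using kron unfolding \<pi>_def by simp
qed

lemma free_det_poly_kronecker:
  assumes bs: "set bs \<subseteq> max_order D"
  shows "kronecker k (free_det_poly tring (V1 D \<mu>) (map (actbar D) bs)) = det (fmat bs k)"
    "exps_le m (free_det_poly tring (V1 D \<mu>) (map (actbar D) bs))"
proof -
  have z: "linear_on UNIV (V1 D \<mu>) (V1 D \<mu>) (\<lambda>_. \<zero>\<^bsub>V1 D \<mu>\<^esub>)"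
    unfolding linear_on_def using U.M.M.zero_closed U.M.M.l_zero[OF U.M.M.zero_closed] U.M.smult_r_null by (simp add: Pi_iff)
  have z0: "end_mat tring (V1 D \<mu>) (\<lambda>_. \<zero>\<^bsub>V1 D \<mu>\<^esub>) $$ (i, j) = 0" if "i < m" "j < m" for i j
    unfolding V1_end_mat[OF z] using that U.co_zero[OF that(1)] by simp
  show "kronecker k (free_det_poly tring (V1 D \<mu>) (map (actbar D) bs)) = det (fmat bs k)"
    unfolding free_det_poly_def det_pencil_kronecker(1) m_eq[symmetric]
  proof (rule arg_cong[of _ _ det], rule eq_matI)
    fix i j assume "i < dim_row (fmat bs k)" "j < dim_col (fmat bs k)"
    then have ij: "i < m" "j < m" by (auto simp: fmat_def)
    show "mat m m (\<lambda>(i, j). [:end_mat tring (V1 D \<mu>) (\<lambda>_. \<zero>\<^bsub>V1 D \<mu>\<^esub>) $$ (i, j):] +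
        (\<Sum>l<length (map (actbar D) bs). Polynomial.monom (end_mat tring (V1 D \<mu>) (map (actbar D) bs ! l) $$ (i, j)) (k ^ l))) $$ (i, j) = fmat bs k $$ (i, j)"
      unfolding index_mat(1)[OF ij] prod.case z0[OF ij] fmat_def r1_def by (simp add: id_def[symmetric] del: id_apply)
  qed (simp_all add: fmat_def)
  show "exps_le m (free_det_poly tring (V1 D \<mu>) (map (actbar D) bs))"
    unfolding free_det_poly_def m_eq by (rule det_pencil_kronecker(2))
qed

lemma kottwitz_at:
  assumes bs: "set bs \<subseteq> max_order D" and ds: "direct_summand tring LR F" and rank: "has_rank LR F n"
    and Kn: "ext_map tring LR n id id ` carrier (exterior_power tring (restr LR F) n) \<subseteq>
      mspan tring (exterior_power tring LR n) (toR n ` W_lat nrm D \<mu> n \<Lambda>)"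
  shows "summand_det_poly tring LR F (map beta bs) = Poly_Mapping.map \<phi> (free_det_poly tring (V1 D \<mu>) (map (actbar D) bs))"
proof -
  define C where "C = (SOME C. complementary tring LR F C)"
  have c: "complementary tring LR F C" using ds unfolding direct_summand_def C_def by (rule someI_ex)
  define q where "q = length (chosen_basis tring LR)"
  \<comment> \<open>Above m and q, which bound the degrees in each variable of the determinants on
    V_1 and on the summand.\<close>
  define k where "k = Suc (m + q)"
  let ?p = "det_pencil tring LR (\<lambda>x. x \<ominus>\<^bsub>LR\<^esub> proj_along LR F C x) (map (\<lambda>f. f \<circ> proj_along LR F C) (map beta bs))"
  have \<phi>0: "\<phi> 0 = 0" by (rule hom_onD(2)[OF \<phi> OE_closed])
  have "?p = Poly_Mapping.map \<phi> (free_det_poly tring (V1 D \<mu>) (map (actbar D) bs))"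
  proof (rule map_eq_if_kronecker_eq[where \<phi> = \<phi> and d = m and e = q and N = k])
    show "exps_le m (free_det_poly tring (V1 D \<mu>) (map (actbar D) bs))" by (rule free_det_poly_kronecker(2)[OF bs])
    show "\<phi> 0 = 0" by (rule \<phi>0)
    show "exps_le q ?p" unfolding q_def by (rule det_pencil_kronecker(2))
    show "m < k" "q < k" by (simp_all add: k_def)
    show "Polynomial.coeff (kronecker k ?p) i = \<phi> (Polynomial.coeff (kronecker k (free_det_poly tring (V1 D \<mu>) (map (actbar D) bs))) i)" for i
      unfolding summand_det[OF bs c rank Kn] free_det_poly_kronecker(1)[OF bs] dR_def by (rule coeff_map_poly[where f = \<phi>, OF \<phi>0])
  qed
  then show ?thesis unfolding summand_det_poly_def Let_def C_def .
qed

end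

theorem lemma5p4p2:
  fixes p n :: nat
    and nrm :: "'q::field_char_0 \<Rightarrow> real"
    and D :: "('q, 'b, 'v) pel_datum"
    and \<mu> :: "'q alg_closure \<Rightarrow> ('q, 'v) vbar \<Rightarrow> ('q, 'v) vbar"
    and \<phi> :: "'q alg_closure \<Rightarrow> 'r::comm_ring_1"
    and \<F> :: "'v set \<Rightarrow> ('v \<Rightarrow>\<^sub>0 'r) set set"
  assumes "local_PEL_datum p nrm D"
    and "\<mu> \<in> cochars D"
    and "2 * n = vectorspace.dim tring (space D)"
    and "\<phi> \<in> Ring.ring_hom (subtring (OE nrm D \<mu>)) tring"
    and "lm_submodules nrm D (\<phi> \<circ> to_ac) \<F>"
    and "lm_periodic nrm D (\<phi> \<circ> to_ac) \<F>"
    and "lm_isotropic nrm D (\<phi> \<circ> to_ac) \<F>"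
    and "\<And>\<Lambda>. \<Lambda> \<in> chain D \<Longrightarrow> has_rank (lat nrm D tring (\<phi> \<circ> to_ac) \<Lambda>) (\<F> \<Lambda>) n"
    and "Kn_condition nrm D \<mu> n \<phi> \<F>"
  shows "kottwitz_condition nrm D \<mu> \<phi> \<F>"
  unfolding kottwitz_condition_def
proof (intro ballI allI impI)
  fix \<Lambda> bs
  assume \<Lambda>: "\<Lambda> \<in> chain D" and bs: "free_basis (subtring (Zp nrm)) (restr (alg D) (max_order D)) bs"
  \<comment> \<open>Coordinates are chosen separately for each \<Lambda>, since the basis has to be
    one of the lattice.\<close>
  obtain N e co m e1 co1 where pl: "pel_lattice p nrm D \<Lambda> N e co \<mu> m e1 co1"
    using local_PEL_datum.pel_lattice_exists[OF assms(1) \<Lambda> assms(2)] by blast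
  have hom: "hom_on (OE nrm D \<mu>) \<phi>"
    unfolding hom_on_def using ring_hom_one[OF assms(4)] ring_hom_add[OF assms(4)] ring_hom_mult[OF assms(4)] by simp
  have pm: "pel_model p nrm D \<Lambda> N e co \<mu> m e1 co1 \<phi>"
    by (rule pel_model.intro[OF pl pel_model_axioms.intro[OF hom]])
  have O: "set bs \<subseteq> max_order D" using bs unfolding free_basis_def by simp
  have ds: "direct_summand tring (lat nrm D tring (\<phi> \<circ> to_ac) \<Lambda>) (\<F> \<Lambda>)"
    using assms(5) \<Lambda> unfolding lm_submodules_def by blast
  note Kn = bspec[OF assms(9)[unfolded Kn_condition_def Let_def] \<Lambda>]
  from pel_model.kottwitz_at[OF pm O ds assms(8)[OF \<Lambda>] Kn]
  show "summand_det_poly tring (lat nrm D tring (\<phi> \<circ> to_ac) \<Lambda>) (\<F> \<Lambda>)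
      (map (\<lambda>b. lat_map nrm D tring (\<phi> \<circ> to_ac) \<Lambda> (act D b)) bs) =
    Poly_Mapping.map \<phi> (free_det_poly tring (V1 D \<mu>) (map (actbar D) bs))" .
qed

end
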